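(* Let $C:f=0$ be a nodal curve in $\mathbb{P}^2$ (over $\mathbb{C}$) of degree $d\ge 4$, let $\mathcal N$ denote the set of nodes of $C$ and let $n(C)$ be the number of irreducible components of $C$. Let $T=3(d-2)$, and let $f_s\in S=\mathbb{C}[x,y,z]$ be a homogeneous polynomial of degree $d$ such that the curve $C_s:f_s=0$ in $\mathbb{P}^2$ is smooth. Then, for integers $k$, $$n(f)_k=\begin{cases} m(f_s)_k-|\mathcal N| & \text{for } d-3<k\le T/2,\\ m(f_s)_k-|\mathcal N|+n(C)-1 & \text{for } k=d-3.\end{cases}$$ Moreover, when all the irreducible components of $C$ are rational, one has in addition $n(f)_k=0$ for all $k\le d-3$.
   Context: Let $S=\mathbb{C}[x,y,z]$ with its standard grading and maximal ideal $\mathbf m=(x,y,z)$. For a homogeneous polynomial $g\in S$, let $J_g=(g_x,g_y,g_z)\subset S$ be the ideal generated by its partial derivatives, let $M(g)=S/J_g$ be the graded Milnor algebra, and put $m(g)_k=\dim_{\mathbb{C}} M(g)_k$. For a reduced curve $C:f=0$ of degree $d$ in $\mathbb{P}^2$, let $\hat J_f$ be the saturation of $J_f$ with respect to $\mathbf m$. The Jacobian module is the graded $S$-module $N(f)=\hat J_f/J_f$, and $n(f)_k=\dim_{\mathbb{C}} N(f)_k$. A nodal curve is a reduced (possibly reducible) plane curve all of whose singularities are nodes, i.e. ordinary double points. *)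

theory Defs
  imports
    "HOL-Analysis.Analysis"
    "HOL-Library.Poly_Mapping"
    "HOL-Computational_Algebra.Computational_Algebra"
begin

text \<open>
  The ring \<open>\<complex>[x,y,z]\<close>: the three variables are indexed by the type \<open>3\<close>, monomials are exponent
  vectors, and polynomials are finitely supported coefficient functions with the convolution
  product of \<^theory>\<open>HOL-Library.Poly_Mapping\<close>.
\<close>

type_synonym monom3 = "3 \<Rightarrow>\<^sub>0 nat"
type_synonym poly3 = "monom3 \<Rightarrow>\<^sub>0 complex"

definition poly_at :: "poly3 \<Rightarrow> complex^3 \<Rightarrow> complex" where
  "poly_at p v =
     (\<Sum>m\<in>Poly_Mapping.keys p. Poly_Mapping.lookup p m * (\<Prod>i\<in>UNIV. (v $ i) ^ Poly_Mapping.lookup m i))"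

definition var3 :: "3 \<Rightarrow> poly3" where
  "var3 i = Poly_Mapping.single (Poly_Mapping.single i 1) 1"

definition scal3 :: "complex \<Rightarrow> poly3 \<Rightarrow> poly3" where
  "scal3 c p = Poly_Mapping.single 0 c * p"

text \<open>The exponent subtraction truncates only when the coefficient is zero.\<close>

definition pderiv3 :: "3 \<Rightarrow> poly3 \<Rightarrow> poly3" where
  "pderiv3 i p =
     (\<Sum>m\<in>Poly_Mapping.keys p. Poly_Mapping.single (m - Poly_Mapping.single i 1)
        (of_nat (Poly_Mapping.lookup m i) * Poly_Mapping.lookup p m))"

definition mdeg :: "monom3 \<Rightarrow> nat" where
  "mdeg m = (\<Sum>i\<in>UNIV. Poly_Mapping.lookup m i)"

text \<open>
  The graded piece \<open>S\<^sub>k\<close>, including \<open>0\<close>; it is \<open>{0}\<close> for negative \<open>k\<close>.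
\<close>

definition graded_piece :: "int \<Rightarrow> poly3 set" where
  "graded_piece k = {p. \<forall>m\<in>Poly_Mapping.keys p. int (mdeg m) = k}"

definition ideal_gen :: "poly3 set \<Rightarrow> poly3 set" where
  "ideal_gen A = module.span (*) A"

definition ideal_power :: "poly3 set \<Rightarrow> nat \<Rightarrow> poly3 set" where
  "ideal_power I n = ideal_gen {\<Prod>j<n. a j | a. \<forall>j<n. a j \<in> I}"

definition max_ideal :: "poly3 set" where
  "max_ideal = ideal_gen (range var3)"

definition saturation :: "poly3 set \<Rightarrow> poly3 set" where
  "saturation I = {p. \<exists>n. \<forall>q\<in>ideal_power max_ideal n. p * q \<in> I}"

definition jacobian_ideal :: "poly3 \<Rightarrow> poly3 set" where
  "jacobian_ideal g = ideal_gen (range (\<lambda>i. pderiv3 i g))"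

text \<open>
  For complex subspaces \<open>W \<subseteq> U\<close>, the residue classes of the elements of \<open>B\<close> are pairwise distinct and
  form a basis of the quotient space \<open>U / W\<close>: every class is a unique linear combination of them.
\<close>

definition quotient_basis :: "poly3 set \<Rightarrow> poly3 set \<Rightarrow> poly3 set \<Rightarrow> bool" where
  "quotient_basis U W B \<longleftrightarrow> finite B \<and> B \<subseteq> U \<and>
     (\<forall>p\<in>U. \<exists>!c. (\<forall>b. b \<notin> B \<longrightarrow> c b = 0) \<and> p - (\<Sum>b\<in>B. scal3 (c b) b) \<in> W)"

definition quotient_dim :: "poly3 set \<Rightarrow> poly3 set \<Rightarrow> nat" where
  "quotient_dim U W = (THE n. \<exists>B. quotient_basis U W B \<and> card B = n)"

text \<open>
  As the ideals are homogeneous, the degree \<open>k\<close> pieces of \<open>S / J\<close> and of \<open>J' / J\<close> are the quotients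
  of the degree \<open>k\<close> pieces.
\<close>

definition milnor_dim :: "poly3 \<Rightarrow> int \<Rightarrow> nat" where
  "milnor_dim g k = quotient_dim (graded_piece k) (jacobian_ideal g \<inter> graded_piece k)"

definition jacobian_module_dim :: "poly3 \<Rightarrow> int \<Rightarrow> nat" where
  "jacobian_module_dim f k =
     quotient_dim (saturation (jacobian_ideal f) \<inter> graded_piece k) (jacobian_ideal f \<inter> graded_piece k)"

text \<open>
  Points of the projective plane are the lines through the origin in \<open>\<complex>\<^sup>3\<close>.  The definitions
  below are meant for homogeneous polynomials, where they do not depend on the
  chosen representative of the point.
\<close>

definition zero_locus :: "poly3 \<Rightarrow> (complex^3) set set" where
  "zero_locus g = {vec.span {v} | v. v \<noteq> 0 \<and> poly_at g v = 0}"

definition singular_at :: "poly3 \<Rightarrow> complex^3 \<Rightarrow> bool" where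
  "singular_at f v \<longleftrightarrow> v \<noteq> 0 \<and> poly_at f v = 0 \<and> (\<forall>i. poly_at (pderiv3 i f) v = 0)"

definition smooth_curve :: "poly3 \<Rightarrow> bool" where
  "smooth_curve f \<longleftrightarrow> \<not> (\<exists>v. singular_at f v)"

text \<open>The quadratic term in \<open>w\<close> of the Taylor expansion of \<open>f (v + w)\<close>.\<close>

definition taylor2 :: "poly3 \<Rightarrow> complex^3 \<Rightarrow> complex^3 \<Rightarrow> complex" where
  "taylor2 f v w =
     (1/2) * (\<Sum>i\<in>UNIV. \<Sum>j\<in>UNIV. poly_at (pderiv3 i (pderiv3 j f)) v * (w $ i) * (w $ j))"

text \<open>
  An ordinary double point: multiplicity two with two distinct tangents.  At a singular point of
  the curve the quadratic Taylor term is invariant under translation by \<open>v\<close> (Euler's relation), so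
  it is a form on the tangent space \<open>\<complex>\<^sup>3 / \<complex>v\<close> of the plane, namely the quadratic part of a local
  equation; its zeros are the tangent lines \<open>a \<cdot> w = 0\<close> and \<open>b \<cdot> w = 0\<close>.
\<close>

definition node_at :: "poly3 \<Rightarrow> complex^3 \<Rightarrow> bool" where
  "node_at f v \<longleftrightarrow> singular_at f v \<and>
     (\<exists>a b :: complex^3. a \<noteq> b \<and> vec.independent {a, b} \<and>
        (\<forall>w. taylor2 f v w = (\<Sum>i\<in>UNIV. a $ i * w $ i) * (\<Sum>i\<in>UNIV. b $ i * w $ i)))"

definition nodes :: "poly3 \<Rightarrow> (complex^3) set set" where
  "nodes f = {vec.span {v} | v. node_at f v}"

definition nodal_curve :: "poly3 \<Rightarrow> bool" where
  "nodal_curve f \<longleftrightarrow> squarefree f \<and> (\<forall>v. singular_at f v \<longrightarrow> node_at f v)"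

text \<open>
  Every factor of a nonzero homogeneous polynomial is homogeneous, and associated factors have the same
  zero locus.
\<close>

definition curve_components :: "poly3 \<Rightarrow> (complex^3) set set set" where
  "curve_components f = zero_locus ` {g. irreducible g \<and> g dvd f}"

text \<open>
  An irreducible curve \<open>C\<close> is rational if it is birational to the projective line.
  The map \<open>t \<mapsto> [\<phi>\<^sub>1 t : \<phi>\<^sub>2 t : \<phi>\<^sub>3 t]\<close> from the affine line to \<open>C\<close> and the map \<open>A / B\<close> from \<open>C\<close> to
  the affine line, with \<open>A\<close> and \<open>B\<close> forms of the same degree, are required to be defined and mutually
  inverse off finite sets, that is, on dense open subsets.
\<close>

definition rational_curve :: "(complex^3) set set \<Rightarrow> bool" where
  "rational_curve C \<longleftrightarrow>
     (\<exists>(\<phi> :: 3 \<Rightarrow> complex poly) A B e. A \<in> graded_piece e \<and> B \<in> graded_piece e \<and>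
        (let \<Phi> = (\<lambda>t. \<chi> i. poly (\<phi> i) t) in
           finite {t. \<not> (\<Phi> t \<noteq> 0 \<and> vec.span {\<Phi> t} \<in> C \<and>
                         poly_at B (\<Phi> t) \<noteq> 0 \<and> poly_at A (\<Phi> t) / poly_at B (\<Phi> t) = t)} \<and>
           finite {P \<in> C. \<not> (\<forall>v\<in>P - {0}. poly_at B v \<noteq> 0 \<and>
                                vec.span {\<Phi> (poly_at A v / poly_at B v)} = P)}))"

end

theory Submission
  imports Defs "HOL-Computational_Algebra.Field_as_Ring"
begin

text \<open>
  In degree \<open>k\<close> the saturation of \<open>J\<^sub>f\<close> consists of the forms vanishing at the nodes, since the Hessian has rank two
  at a node, so that \<open>J\<^sub>f\<close> is locally the maximal ideal there. Choose a line transversal to the curve. The two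
  derivatives of \<open>f\<close> along directions of this line form, together with its equation, a complete intersection, and the
  pairing given by the socle functional identifies the failure of the nodes to impose independent conditions on
  forms of degree \<open>k\<close> with the syzygies of the partial derivatives in degree \<open>2d - 5 - k\<close>. In degree at most \<open>d - 2\<close>
  such syzygies are logarithmic forms whose residues along the components are constants; hence there are none
  below degree \<open>d - 2\<close>, and they span a space of dimension \<open>n(C) - 1\<close> in degree \<open>d - 2\<close>. Without syzygies in low
  degrees, \<open>J\<^sub>f\<close> has the same dimension in degree \<open>k\<close> as the Jacobian ideal of a smooth curve.

  If \<open>g\<close> has degree at most \<open>d - 3\<close> and vanishes at the nodes, then the residue of \<open>g / f\<close> along a rational
  component is a holomorphic differential on the projective line, hence zero, so \<open>g\<close> is divisible by \<open>f\<close>.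
\<close>

text \<open>Every count is linear algebra on single graded pieces. Since \<open>l\<close> is a
  nonzerodivisor modulo \<open>gu\<close>, \<open>gv\<close>, setting l = 1 turns S/(gu, gv) into
  the coordinate ring of e^2 points counted with multiplicity, where e = d - 1. All its functions
  come from forms of the socle degree 2e - 2, and the nodes are among the points. The ideal (gu, gv)
  : gw belongs to the points residual to the nodes, so linkage pairs degree k with 2e - 3 - k = 2d -
  5 - k. An element of this colon ideal is the last coefficient of a Jacobian syzygy, which is how
  syzygies enter.

  Residues are shown to be constant by algebra alone: multiplication by a residue maps the forms of
  some large degree through the nodes to themselves modulo f. It therefore satisfies a polynomial
  equation over the complex numbers, and primality of the equation of a component selects one root.

  The smooth curve needs no computation of its own: it is a nodal curve without nodes, and the
  absence of small syzygies fixes the dimension of the Jacobian ideal of both curves in the required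
  degrees.\<close>

no_notation fps_nth (infixl "$" 75)

section \<open>Finite-dimensional subspaces\<close>

locale abstract_vector_space = vector_space scale
  for scale :: "'a::field \<Rightarrow> 'b::ab_group_add \<Rightarrow> 'b"
begin

text \<open>The full polynomial ring is infinite-dimensional and \<open>dim\<close> carries no
  information there, so all counts are relative to subspaces of a finite span.\<close>

definition fin_dim :: "'b set \<Rightarrow> bool" where
  "fin_dim U \<longleftrightarrow> subspace U \<and> (\<exists>B. finite B \<and> U \<subseteq> span B)"

text \<open>Linearity is asked only on \<open>U\<close>: the functional \<open>trace\<close> is
  defined by a choice and is linear only on forms of one fixed degree.\<close>

definition linear_on :: "'b set \<Rightarrow> ('b \<Rightarrow> 'a) \<Rightarrow> bool" where
  "linear_on U \<phi> \<longleftrightarrow> (\<forall>x\<in>U. \<forall>y\<in>U. \<phi> (x + y) = \<phi> x + \<phi> y) \<and> (\<forall>c. \<forall>x\<in>U. \<phi> (scale c x) = c * \<phi> x)"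

lemma fin_dim_subspace: "fin_dim U \<Longrightarrow> subspace U"
  by (simp add: fin_dim_def)

lemma fin_dim_subset: "fin_dim U \<Longrightarrow> subspace W \<Longrightarrow> W \<subseteq> U \<Longrightarrow> fin_dim W"
  unfolding fin_dim_def by blast

lemma fin_dim_span: "finite B \<Longrightarrow> fin_dim (span B)"
  unfolding fin_dim_def by auto

lemma fin_dim_independent:
  assumes "fin_dim U" "independent B" "B \<subseteq> U"
  shows "finite B" "card B \<le> dim U"
proof -
  obtain B0 where B0: "finite B0" "U \<subseteq> span B0" using assms(1) unfolding fin_dim_def by blast
  obtain C where C: "C \<subseteq> U" "independent C" "U \<subseteq> span C" "card C = dim U" using basis_exists by blast
  have "finite C" using independent_span_bound[OF B0(1) C(2)] C(1) B0(2) by blast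
  then show "finite B" "card B \<le> dim U"
    using independent_span_bound[OF \<open>finite C\<close> assms(2)] assms(3) C by auto
qed

lemma fin_dim_extend:
  assumes "fin_dim U" "independent C" "C \<subseteq> U"
  obtains B where "finite B" "C \<subseteq> B" "B \<subseteq> U" "independent B" "span B = U" "card B = dim U"
proof -
  obtain B where B: "C \<subseteq> B" "B \<subseteq> U" "independent B" "U \<subseteq> span B"
    using maximal_independent_subset_extend[OF assms(3,2)] by blast
  have "span B = U" using B span_minimal[OF B(2) fin_dim_subspace[OF assms(1)]] by auto
  moreover have "card B = dim U" using basis_card_eq_dim[OF B(2,4,3)] .
  ultimately show ?thesis using that B fin_dim_independent[OF assms(1) B(3,2)] by blast
qed

lemma fin_dim_basis:
  assumes "fin_dim U"
  obtains B where "finite B" "B \<subseteq> U" "independent B" "span B = U" "card B = dim U"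
  using fin_dim_extend[OF assms independent_empty] by auto

lemma fin_dim_mono:
  assumes "fin_dim U" "subspace W" "W \<subseteq> U"
  shows "dim W \<le> dim U"
proof -
  obtain B where "finite B" "B \<subseteq> W" "independent B" "span B = W" "card B = dim W"
    using fin_dim_basis[OF fin_dim_subset[OF assms]] .
  then show ?thesis using fin_dim_independent(2)[OF assms(1), of B] assms(3) by auto
qed

lemma independent_Un:
  assumes "finite C" "finite E" "independent C" "independent E" "span C \<inter> span E \<subseteq> {0}"
  shows "independent (C \<union> E)" "C \<inter> E = {}"
proof -
  show disj: "C \<inter> E = {}"
  proof (rule ccontr)
    assume "C \<inter> E \<noteq> {}"
    then obtain x where "x \<in> C" "x \<in> E" by blast
    then have "x = 0" using assms(5) span_base by blast
    then show False using \<open>x \<in> C\<close> assms(3) dependent_zero by blast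
  qed
  show "independent (C \<union> E)"
  proof (rule independent_if_scalars_zero)
    show "finite (C \<union> E)" using assms by simp
    fix f x assume s: "(\<Sum>x\<in>C \<union> E. scale (f x) x) = 0" and x: "x \<in> C \<union> E"
    have eq: "(\<Sum>x\<in>C. scale (f x) x) = - (\<Sum>x\<in>E. scale (f x) x)"
      using s disj assms by (simp add: sum.union_disjoint eq_neg_iff_add_eq_0)
    have a: "(\<Sum>x\<in>C. scale (f x) x) \<in> span C"
      by (intro span_sum span_scale span_base)
    have b: "(\<Sum>x\<in>E. scale (f x) x) \<in> span E"
      by (intro span_sum span_scale span_base)
    have c: "(\<Sum>x\<in>C. scale (f x) x) = 0" using a b eq assms(5) span_neg by auto
    then have d: "(\<Sum>x\<in>E. scale (f x) x) = 0" using eq by simp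
    show "f x = 0" 
      using x independentD[OF assms(3,1) subset_refl c] independentD[OF assms(4,2) subset_refl d] by blast
  qed
qed

lemma independent_span_Int:
  assumes "finite B" "independent B" "C \<subseteq> B"
  shows "span C \<inter> span (B - C) \<subseteq> {0}"
proof
  fix x assume x: "x \<in> span C \<inter> span (B - C)"
  have f: "finite C" "finite (B - C)" using assms finite_subset by auto
  obtain u where u: "x = (\<Sum>v\<in>C. scale (u v) v)" using x unfolding span_finite[OF f(1)] by blast
  obtain w where w: "x = (\<Sum>v\<in>B - C. scale (w v) v)" using x unfolding span_finite[OF f(2)] by blast
  let ?h = "\<lambda>v. if v \<in> C then u v else - w v"
  have "(\<Sum>v\<in>B. scale (?h v) v) = (\<Sum>v\<in>C. scale (?h v) v) + (\<Sum>v\<in>B - C. scale (?h v) v)"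
    using sum.subset_diff[OF assms(3,1)] by (subst add.commute)
  also have "(\<Sum>v\<in>C. scale (?h v) v) = x" unfolding u by (intro sum.cong) auto
  also have "(\<Sum>v\<in>B - C. scale (?h v) v) = - x"
    unfolding w sum_negf[symmetric] by (intro sum.cong) (auto simp: scale_minus_left)
  finally have "(\<Sum>v\<in>B. scale (?h v) v) = 0" by simp
  then have "\<forall>v\<in>B. ?h v = 0" using independentD[OF assms(2,1) subset_refl, of ?h] by blast
  then have "\<forall>v\<in>C. u v = 0" using assms(3) by (metis subsetD)
  then show "x \<in> {0}" unfolding u by simp
qed

lemma fin_dim_complement:
  assumes "fin_dim U" "subspace W" "W \<subseteq> U"
  obtains D where "finite D" "D \<subseteq> U" "independent D" "card D + dim W = dim U"
    "span D \<inter> W \<subseteq> {0}" "\<forall>x\<in>U. \<exists>y\<in>W. \<exists>z\<in>span D. x = y + z"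
proof -
  obtain C where C: "finite C" "C \<subseteq> W" "independent C" "span C = W" "card C = dim W"
    using fin_dim_basis[OF fin_dim_subset[OF assms]] .
  obtain B where B: "finite B" "C \<subseteq> B" "B \<subseteq> U" "independent B" "span B = U" "card B = dim U"
    using fin_dim_extend[OF assms(1) C(3)] C(2) assms(3) by (metis subset_trans)
  show thesis
  proof (rule that[of "B - C"])
    show "finite (B - C)" "B - C \<subseteq> U" using B by auto
    show "independent (B - C)" using B independent_mono by blast
    show "card (B - C) + dim W = dim U" using B C by (metis card_Diff_subset card_mono le_add_diff_inverse2)
    show "span (B - C) \<inter> W \<subseteq> {0}" using independent_span_Int[OF B(1,4,2)] C by auto
    show "\<forall>x\<in>U. \<exists>y\<in>W. \<exists>z\<in>span (B - C). x = y + z"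
    proof
      fix x assume "x \<in> U"
      then have "x \<in> span (C \<union> (B - C))" using B by (simp add: Un_absorb1)
      then show "\<exists>y\<in>W. \<exists>z\<in>span (B - C). x = y + z"
        unfolding span_Un using C by auto
    qed
  qed
qed

lemma fin_dim_sum:
  assumes "fin_dim S" "fin_dim T"
  shows "fin_dim {x + y |x y. x \<in> S \<and> y \<in> T}"
    "dim {x + y |x y. x \<in> S \<and> y \<in> T} + dim (S \<inter> T) = dim S + dim T"
proof -
  have sub: "subspace (S \<inter> T)" using assms fin_dim_subspace subspace_inter by blast
  obtain D where D: "finite D" "D \<subseteq> S" "independent D" "card D + dim (S \<inter> T) = dim S"
    "span D \<inter> (S \<inter> T) \<subseteq> {0}" "\<forall>x\<in>S. \<exists>y\<in>S \<inter> T. \<exists>z\<in>span D. x = y + z"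
    using fin_dim_complement[OF assms(1) sub Int_lower1] .
  obtain C where C: "finite C" "C \<subseteq> T" "independent C" "span C = T" "card C = dim T"
    using fin_dim_basis[OF assms(2)] .
  have DS: "span D \<subseteq> S" using D(2) assms(1) fin_dim_subspace span_minimal by blast
  have i: "independent (C \<union> D)" "C \<inter> D = {}"
    using independent_Un[OF C(1) D(1) C(3) D(3)] D(5) DS unfolding C(4) by blast+
  have eq: "span (C \<union> D) = {x + y |x y. x \<in> S \<and> y \<in> T}"
  proof
    show "span (C \<union> D) \<subseteq> {x + y |x y. x \<in> S \<and> y \<in> T}"
      unfolding span_Un using C DS by (auto simp: add.commute) (metis add.commute subsetD)
    show "{x + y |x y. x \<in> S \<and> y \<in> T} \<subseteq> span (C \<union> D)"
    proof clarify
      fix x y assume xy: "x \<in> S" "y \<in> T"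
      obtain a b where "a \<in> T" "b \<in> span D" "x = a + b" using D(6) xy(1) by blast
      then have "x + y = (a + y) + b" "a + y \<in> span C"
        using C(4) xy span_add by (auto simp: algebra_simps)
      then show "x + y \<in> span (C \<union> D)" unfolding span_Un using \<open>b \<in> span D\<close> by blast
    qed
  qed
  show "fin_dim {x + y |x y. x \<in> S \<and> y \<in> T}" unfolding eq[symmetric] using C D fin_dim_span by simp
  show "dim {x + y |x y. x \<in> S \<and> y \<in> T} + dim (S \<inter> T) = dim S + dim T"
    unfolding eq[symmetric] using dim_span_eq_card_independent[OF i(1)] i(2) C D
    by (simp add: card_Un_disjoint)
qed

lemma subspace_kernel_on:
  assumes "subspace U" "linear_on U \<phi>"
  shows "subspace {u\<in>U. \<phi> u = 0}"
proof -
  have "\<phi> (scale 0 0) = 0" using assms subspace_0 unfolding linear_on_def by (metis mult_zero_left)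
  then show ?thesis using assms unfolding linear_on_def subspace_def by auto
qed

lemma dim_kernel_on:
  assumes "fin_dim U" "linear_on U \<phi>"
  shows "dim U \<le> dim {u\<in>U. \<phi> u = 0} + 1"
proof (cases "\<forall>u\<in>U. \<phi> u = 0")
  case True
  then have "{u\<in>U. \<phi> u = 0} = U" by auto
  then show ?thesis by simp
next
  case False
  then obtain u0 where u0: "u0 \<in> U" "\<phi> u0 \<noteq> 0" by blast
  let ?K = "{u\<in>U. \<phi> u = 0}"
  have s: "subspace U" "subspace ?K" using subspace_kernel_on[OF fin_dim_subspace] assms fin_dim_subspace by auto
  obtain B where B: "finite B" "B \<subseteq> ?K" "independent B" "span B = ?K" "card B = dim ?K"
    using fin_dim_basis[OF fin_dim_subset[OF assms(1) s(2)]] by blast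
  have "U \<subseteq> span (insert u0 B)"
  proof
    fix u assume u: "u \<in> U"
    let ?c = "\<phi> u / \<phi> u0"
    have n: "scale (- ?c) u0 \<in> U" using u0 s subspace_scale by blast
    then have "u + scale (- ?c) u0 \<in> U" using u s subspace_add by blast
    moreover have "\<phi> (u + scale (- ?c) u0) = 0"
    proof -
      have "\<phi> (u + scale (- ?c) u0) = \<phi> u + \<phi> (scale (- ?c) u0)"
        using n u assms(2) unfolding linear_on_def by blast
      also have "\<phi> (scale (- ?c) u0) = - ?c * \<phi> u0"
        using u0 assms(2) unfolding linear_on_def by blast
      finally show ?thesis using u0 by simp
    qed
    ultimately have "u - scale ?c u0 \<in> span B" using B by (simp add: scale_minus_left)
    then show "u \<in> span (insert u0 B)" by (auto simp: span_breakdown_eq)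
  qed
  then have "dim U \<le> card (insert u0 B)" using B by (intro dim_le_card) auto
  also have "\<dots> \<le> card B + 1" using card_insert_le_m1 by (simp add: B(1) card_insert_if)
  finally show ?thesis using B by simp
qed

lemma dim_common_kernel:
  assumes "finite I" "fin_dim U" "\<And>i. i \<in> I \<Longrightarrow> linear_on U (\<phi> i)"
  shows "subspace {u\<in>U. \<forall>i\<in>I. \<phi> i u = 0} \<and> dim U \<le> dim {u\<in>U. \<forall>i\<in>I. \<phi> i u = 0} + card I"
  using assms(1,3)
proof (induction I)
  case empty
  then show ?case using assms(2) fin_dim_subspace by simp
next
  case (insert j I)
  let ?V = "{u\<in>U. \<forall>i\<in>I. \<phi> i u = 0}"
  have IH: "subspace ?V" "dim U \<le> dim ?V + card I" using insert by auto
  have V: "fin_dim ?V" using fin_dim_subset[OF assms(2) IH(1)] by blast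
  have l: "linear_on ?V (\<phi> j)" using insert(4)[of j] unfolding linear_on_def by auto
  have e: "{u\<in>U. \<forall>i\<in>insert j I. \<phi> i u = 0} = {u\<in>?V. \<phi> j u = 0}" by auto
  have c: "card (insert j I) = Suc (card I)" using insert(1,2) by simp
  show ?case unfolding e c using dim_kernel_on[OF V l] subspace_kernel_on[OF IH(1) l] IH(2) by linarith
qed

text \<open>A basis \<open>D\<close> of a complement of the right kernel suffices to test membership
  in the left kernel, which is therefore cut out by \<open>card D\<close> linear conditions.\<close>

lemma bilinear_kernel_le:
  assumes "fin_dim U" "fin_dim W" "\<And>w. w \<in> W \<Longrightarrow> linear_on U (\<lambda>u. \<beta> u w)" "\<And>u. u \<in> U \<Longrightarrow> linear_on W (\<beta> u)"
  shows "dim U + dim {w\<in>W. \<forall>u\<in>U. \<beta> u w = 0} \<le> dim W + dim {u\<in>U. \<forall>w\<in>W. \<beta> u w = 0}"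
proof -
  let ?W0 = "{w\<in>W. \<forall>u\<in>U. \<beta> u w = 0}"
  have z: "\<beta> u 0 = 0" if "u \<in> U" for u
    using assms(4)[OF that] assms(2) fin_dim_subspace subspace_0 unfolding linear_on_def by (metis mult_zero_left scale_zero_right)
  have W0: "subspace ?W0" "?W0 \<subseteq> W"
    using assms(4) z fin_dim_subspace[OF assms(2)] unfolding subspace_def linear_on_def by auto
  obtain D where D: "finite D" "D \<subseteq> W" "independent D" "card D + dim ?W0 = dim W"
    "span D \<inter> ?W0 \<subseteq> {0}" "\<forall>x\<in>W. \<exists>y\<in>?W0. \<exists>z\<in>span D. x = y + z"
    using fin_dim_complement[OF assms(2) W0] .
  have "{u\<in>U. \<forall>i\<in>D. \<beta> u i = 0} = {u\<in>U. \<forall>w\<in>W. \<beta> u w = 0}"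
  proof (intro Collect_cong conj_cong refl iffI ballI)
    fix u w assume u: "u \<in> U" and d: "\<forall>i\<in>D. \<beta> u i = 0" and w: "w \<in> W"
    have s: "subspace {w\<in>W. \<beta> u w = 0}" using subspace_kernel_on assms(4)[OF u] assms(2) fin_dim_subspace by blast
    obtain y z where yz: "y \<in> ?W0" "z \<in> span D" "w = y + z" using D(6) w by blast
    have "z \<in> {w\<in>W. \<beta> u w = 0}" using span_minimal[of D, OF _ s] D(2) d yz by blast
    moreover have "y \<in> {w\<in>W. \<beta> u w = 0}" using yz u by auto
    ultimately show "\<beta> u w = 0" using subspace_add[OF s] yz(3) by blast
  qed (use D(2) in auto)
  moreover have "dim U \<le> dim {u\<in>U. \<forall>i\<in>D. \<beta> u i = 0} + card D"
    using dim_common_kernel[OF D(1) assms(1), of "\<lambda>i u. \<beta> u i"] assms(3) D(2) by blast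
  ultimately show ?thesis using D(4) by simp
qed

lemma bilinear_kernel_eq:
  assumes "fin_dim U" "fin_dim W" "\<And>w. w \<in> W \<Longrightarrow> linear_on U (\<lambda>u. \<beta> u w)" "\<And>u. u \<in> U \<Longrightarrow> linear_on W (\<beta> u)"
  shows "dim U + dim {w\<in>W. \<forall>u\<in>U. \<beta> u w = 0} = dim W + dim {u\<in>U. \<forall>w\<in>W. \<beta> u w = 0}"
proof (rule antisym)
  show "dim U + dim {w\<in>W. \<forall>u\<in>U. \<beta> u w = 0} \<le> dim W + dim {u\<in>U. \<forall>w\<in>W. \<beta> u w = 0}"
    by (rule bilinear_kernel_le[OF assms])
  show "dim W + dim {u\<in>U. \<forall>w\<in>W. \<beta> u w = 0} \<le> dim U + dim {w\<in>W. \<forall>u\<in>U. \<beta> u w = 0}"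
    by (rule bilinear_kernel_le[of W U "\<lambda>w u. \<beta> u w", OF assms(2,1,4,3)])
qed

text \<open>Stated for a family, since the iterates to which it is applied may coincide; a
  coincidence is itself a relation, with coefficients 1 and -1.\<close>

lemma linear_dependence:
  assumes "fin_dim U" "\<And>n. n \<le> dim U \<Longrightarrow> c n \<in> U"
  obtains a where "\<exists>n\<le>dim U. a n \<noteq> 0" "(\<Sum>n\<le>dim U. scale (a n) (c n)) = 0"
proof (cases "inj_on c {..dim U}")
  case True
  have "\<not> independent (c ` {..dim U})"
  proof
    assume i: "independent (c ` {..dim U})"
    have "card (c ` {..dim U}) \<le> dim U" using fin_dim_independent(2)[OF assms(1) i] assms(2) by auto
    then show False using card_image[OF True] by simp
  qed
  then obtain u v where u: "(\<Sum>v\<in>c ` {..dim U}. scale (u v) v) = 0" "v \<in> c ` {..dim U}" "u v \<noteq> 0"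
    using dependent_finite[of "c ` {..dim U}"] by auto
  have "(\<Sum>n\<le>dim U. scale (u (c n)) (c n)) = 0" using u(1) True by (simp add: sum.reindex)
  then show ?thesis using that[of "\<lambda>n. u (c n)"] u by auto
next
  case False
  then obtain i j where ij: "i \<le> dim U" "j \<le> dim U" "i \<noteq> j" "c i = c j" unfolding inj_on_def by auto
  let ?a = "\<lambda>n. if n = i then 1 else if n = j then -1 else 0"
  have "(\<Sum>n\<le>dim U. scale (?a n) (c n)) = (\<Sum>n\<in>{i,j}. scale (?a n) (c n))"
    using ij by (intro sum.mono_neutral_right) auto
  also have "\<dots> = 0" using ij by simp
  finally show ?thesis using that[of ?a] ij(1) by (metis (mono_tags, lifting) zero_neq_one)
qed

lemma dim_linear_image:
  assumes "fin_dim U" "module_hom scale scale h" "\<And>x. x \<in> U \<Longrightarrow> h x = 0 \<Longrightarrow> x = 0"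
  shows "fin_dim (h ` U)" "dim (h ` U) = dim U"
proof -
  interpret h: module_hom scale scale h by fact
  obtain B where B: "finite B" "B \<subseteq> U" "independent B" "span B = U" "card B = dim U"
    using fin_dim_basis[OF assms(1)] .
  have eq: "h ` U = span (h ` B)" using B h.span_image by simp
  show "fin_dim (h ` U)" unfolding eq using B fin_dim_span by simp
  have inj: "inj_on h (span B)" using h.inj_on_iff_eq_0[OF subspace_span] B assms(3) by auto
  have "independent (h ` B)" using h.independent_injective_image[OF B(3) inj] .
  moreover have "card (h ` B) = card B" using inj B by (metis card_image inj_on_subset)
  ultimately show "dim (h ` U) = dim U" unfolding eq using B dim_span_eq_card_independent by simp
qed

end

section \<open>Ternary polynomials\<close>

definition const3 :: "complex \<Rightarrow> poly3" where
  "const3 c = Poly_Mapping.single 0 c"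

abbreviation forms :: "nat \<Rightarrow> poly3 set" where
  "forms n \<equiv> graded_piece (int n)"

lemma scal3_const3: "scal3 c p = const3 c * p"
  by (simp add: scal3_def const3_def)

lemma const3_simps [simp]:
  "const3 0 = 0" "const3 1 = 1" "const3 (a + b) = const3 a + const3 b"
  "const3 (a * b) = const3 a * const3 b" "const3 (- a) = - const3 a" "const3 (a - b) = const3 a - const3 b"
  by (simp_all add: const3_def single_add mult_single single_uminus single_diff)

lemma const3_of_nat: "const3 (of_nat n) = of_nat n"
  by (simp add: const3_def)

lemma const3_eq_0_iff [simp]: "const3 c = 0 \<longleftrightarrow> c = 0"
  unfolding const3_def by (metis lookup_single_eq lookup_zero single_zero)

lemma const3_inject [simp]: "const3 a = const3 b \<longleftrightarrow> a = b"
  by (metis const3_eq_0_iff const3_simps(6) eq_iff_diff_eq_0)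

global_interpretation P3: abstract_vector_space scal3
  by unfold_locales (simp_all add: scal3_const3 algebra_simps)

lemma module_hom_scal3I:
  assumes "\<And>p q. h (p + q) = h p + h q" "\<And>c p. h (const3 c * p) = const3 c * h p"
  shows "module_hom scal3 scal3 h"
  using assms by unfold_locales (simp_all add: scal3_const3)

lemma poly3_monomials: "p = (\<Sum>m\<in>Poly_Mapping.keys p. Poly_Mapping.single m (Poly_Mapping.lookup p m))"
proof (rule poly_mapping_eqI)
  fix k
  have "Poly_Mapping.lookup (\<Sum>m\<in>Poly_Mapping.keys p. Poly_Mapping.single m (Poly_Mapping.lookup p m)) k
      = (\<Sum>m\<in>Poly_Mapping.keys p. if m = k then Poly_Mapping.lookup p m else 0)"
    unfolding lookup_sum by (intro sum.cong refl) (simp add: lookup_single)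
  also have "\<dots> = Poly_Mapping.lookup p k"
    by (simp add: sum.delta' in_keys_iff)
  finally show "Poly_Mapping.lookup p k = Poly_Mapping.lookup (\<Sum>m\<in>Poly_Mapping.keys p. Poly_Mapping.single m (Poly_Mapping.lookup p m)) k"
    by simp
qed

lemma poly3_induct_single:
  assumes "P 0" "\<And>m c. P (Poly_Mapping.single m c)" "\<And>p q. P p \<Longrightarrow> P q \<Longrightarrow> P (p + q)"
  shows "P (p :: poly3)"
proof -
  have "P (\<Sum>m\<in>A. Poly_Mapping.single m (Poly_Mapping.lookup p m))" if "finite A" for A
    using that by (induction A) (auto intro: assms)
  from this[OF finite_keys[of p]] show ?thesis using poly3_monomials[of p] by simp
qed

lemma mdeg_single: "mdeg (Poly_Mapping.single i n) = n"
  unfolding mdeg_def by (simp add: lookup_single when_def)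

lemma mdeg_add: "mdeg (m + m') = mdeg m + mdeg m'"
  unfolding mdeg_def by (simp add: lookup_add sum.distrib)

lemma monom3_cases:
  assumes "m \<noteq> (0 :: monom3)"
  obtains i m' where "m = Poly_Mapping.single i 1 + m'"
proof -
  obtain i where i: "Poly_Mapping.lookup m i \<noteq> 0" using assms by (metis lookup_zero poly_mapping_eqI)
  have "m = Poly_Mapping.single i 1 + (m - Poly_Mapping.single i 1)"
    using i by (intro poly_mapping_eqI) (auto simp: lookup_add lookup_minus lookup_single when_def)
  then show ?thesis using that by blast
qed

lemma single_Suc: "Poly_Mapping.single (Poly_Mapping.single i 1 + m) c = var3 i * Poly_Mapping.single m c"
  unfolding var3_def by (simp add: mult_single)

lemma forms_single: "Poly_Mapping.single m c \<in> forms n \<longleftrightarrow> c = 0 \<or> mdeg m = n"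
  unfolding graded_piece_def by simp

lemma forms_0 [simp]: "0 \<in> graded_piece k"
  unfolding graded_piece_def by simp

lemma forms_add: "p \<in> graded_piece k \<Longrightarrow> q \<in> graded_piece k \<Longrightarrow> p + q \<in> graded_piece k"
  unfolding graded_piece_def using keys_add[of p q] by auto

lemma forms_sum: "(\<And>i. i \<in> A \<Longrightarrow> f i \<in> graded_piece k) \<Longrightarrow> sum f A \<in> graded_piece k"
  by (induction A rule: infinite_finite_induct) (auto intro: forms_add)

lemma forms_mult:
  assumes "p \<in> forms n" "q \<in> forms m"
  shows "p * q \<in> forms (n + m)"
  unfolding graded_piece_def
proof clarify
  fix k assume "k \<in> Poly_Mapping.keys (p * q)"
  then obtain a b where "a \<in> Poly_Mapping.keys p" "b \<in> Poly_Mapping.keys q" "k = a + b"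
    using keys_mult[of p q] by blast
  then show "int (mdeg k) = int (n + m)" using assms unfolding graded_piece_def by (simp add: mdeg_add)
qed

lemma forms_const3: "const3 c \<in> forms 0"
  unfolding const3_def using forms_single[of 0 c 0] by (simp add: mdeg_def)

lemma forms_const3_mult: "p \<in> forms n \<Longrightarrow> const3 c * p \<in> forms n"
  using forms_mult[OF forms_const3, of p n c] by simp

lemma forms_uminus: "p \<in> forms n \<Longrightarrow> - p \<in> forms n"
  using forms_const3_mult[of p n "-1"] by simp

lemma forms_diff: "p \<in> forms n \<Longrightarrow> q \<in> forms n \<Longrightarrow> p - q \<in> forms n"
  using forms_add[of p n "- q"] forms_uminus by simp

lemma forms_var3: "var3 i \<in> forms 1"
  unfolding var3_def using forms_single[of "Poly_Mapping.single i 1" 1 1] by (simp add: mdeg_single)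

lemma forms_var3_mult: "p \<in> forms n \<Longrightarrow> var3 i * p \<in> forms (Suc n)"
  using forms_mult[OF forms_var3, of p n i] by simp

lemma forms_one: "1 \<in> forms 0"
  using forms_const3[of 1] by simp

lemma forms_power: "p \<in> forms n \<Longrightarrow> p ^ k \<in> forms (n * k)"
proof (induction k)
  case (Suc k)
  then show ?case using forms_mult[of p n "p ^ k" "n * k"] by simp
qed (use forms_one in simp)

lemma forms_subspace: "P3.subspace (forms n)"
  unfolding P3.subspace_def by (auto simp: forms_add forms_const3_mult scal3_const3)

lemma forms_unique: "p \<in> forms n \<Longrightarrow> p \<in> forms m \<Longrightarrow> p \<noteq> 0 \<Longrightarrow> n = m"
  unfolding graded_piece_def by (metis (mono_tags, lifting) keys_eq_empty equals0I mem_Collect_eq of_nat_eq_iff)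

lemma poly3_induct [case_names const add var]:
  assumes "\<And>c. P (const3 c)" "\<And>p q. P p \<Longrightarrow> P q \<Longrightarrow> P (p + q)" "\<And>i p. P p \<Longrightarrow> P (var3 i * p)"
  shows "P (p :: poly3)"
proof (rule poly3_induct_single)
  show "P 0" using assms(1)[of 0] by simp
  fix m c
  show "P (Poly_Mapping.single m c)"
  proof (induction "mdeg m" arbitrary: m rule: less_induct)
    case less
    show ?case
    proof (cases "m = 0")
      case True then show ?thesis using assms(1)[of c] by (simp add: const3_def)
    next
      case False
      then obtain i m' where m: "m = Poly_Mapping.single i 1 + m'" by (rule monom3_cases)
      have "mdeg m' < mdeg m" unfolding m by (simp add: mdeg_add mdeg_single)
      then have "P (Poly_Mapping.single m' c)" using less by blast
      then show ?thesis unfolding m single_Suc by (rule assms(3))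
    qed
  qed
qed (use assms in auto)

text \<open>The zero polynomial has a case of its own because it belongs to every degree, while
  \<open>const\<close> speaks of degree 0 only.\<close>

lemma forms_induct [consumes 1, case_names const zero add var]:
  assumes "p \<in> forms n"
    and "\<And>c. P 0 (const3 c)" "\<And>n. P n 0"
    and "\<And>n p q. p \<in> forms n \<Longrightarrow> q \<in> forms n \<Longrightarrow> P n p \<Longrightarrow> P n q \<Longrightarrow> P n (p + q)"
    and "\<And>n i p. p \<in> forms n \<Longrightarrow> P n p \<Longrightarrow> P (Suc n) (var3 i * p)"
  shows "P n p"
proof -
  have 1: "P (mdeg m) (Poly_Mapping.single m c)" for m c
  proof (induction "mdeg m" arbitrary: m rule: less_induct)
    case less
    show ?case
    proof (cases "m = 0")
      case True then show ?thesis using assms(2)[of c] by (simp add: const3_def mdeg_def)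
    next
      case False
      then obtain i m' where m: "m = Poly_Mapping.single i 1 + m'" by (rule monom3_cases)
      have d: "mdeg m = Suc (mdeg m')" unfolding m by (simp add: mdeg_add mdeg_single)
      then have "P (mdeg m') (Poly_Mapping.single m' c)" using less by simp
      moreover have "Poly_Mapping.single m' c \<in> forms (mdeg m')" by (simp add: forms_single)
      ultimately show ?thesis using assms(5) unfolding d unfolding m single_Suc by blast
    qed
  qed
  have "(\<Sum>m\<in>A. Poly_Mapping.single m (Poly_Mapping.lookup p m)) \<in> forms n \<and>
        P n (\<Sum>m\<in>A. Poly_Mapping.single m (Poly_Mapping.lookup p m))" if "finite A" "A \<subseteq> Poly_Mapping.keys p" for A
    using that
  proof (induction A)
    case empty show ?case using assms(3) by simp
  next
    case (insert x F)
    have d: "mdeg x = n" using insert(4) assms(1) unfolding graded_piece_def by auto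
    have "P n (Poly_Mapping.single x (Poly_Mapping.lookup p x))" using 1[of x] d by simp
    moreover have "Poly_Mapping.single x (Poly_Mapping.lookup p x) \<in> forms n" using d by (simp add: forms_single)
    ultimately show ?case using insert assms(4) forms_add by simp
  qed
  from this[OF finite_keys[of p] subset_refl] show ?thesis using poly3_monomials[of p] by simp
qed

text \<open>One substitution homomorphism, with \<open>h\<close> embedding the constants, yields
  evaluation at points, the grading, the passage to nested univariate polynomials and the
  restriction to parametrized curves. The ring laws are thus proved once.\<close>

definition psubst :: "(complex \<Rightarrow> 'r::comm_ring_1) \<Rightarrow> (3 \<Rightarrow> 'r) \<Rightarrow> poly3 \<Rightarrow> 'r" where
  "psubst h v p = (\<Sum>m\<in>Poly_Mapping.keys p. h (Poly_Mapping.lookup p m) * (\<Prod>i\<in>UNIV. v i ^ Poly_Mapping.lookup m i))"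

locale coeff_hom =
  fixes h :: "complex \<Rightarrow> 'r::comm_ring_1"
  assumes h0: "h 0 = 0" and h1: "h 1 = 1"
    and h_add: "h (a + b) = h a + h b" and h_mult: "h (a * b) = h a * h b"
begin

lemma psubst_superset:
  assumes "finite A" "Poly_Mapping.keys p \<subseteq> A"
  shows "psubst h v p = (\<Sum>m\<in>A. h (Poly_Mapping.lookup p m) * (\<Prod>i\<in>UNIV. v i ^ Poly_Mapping.lookup m i))"
  unfolding psubst_def using assms by (intro sum.mono_neutral_left) (auto simp: in_keys_iff h0)

lemma psubst_single: "psubst h v (Poly_Mapping.single m c) = h c * (\<Prod>i\<in>UNIV. v i ^ Poly_Mapping.lookup m i)"
  by (subst psubst_superset[of "{m}"]) (auto simp: h0)

lemma psubst_0 [simp]: "psubst h v 0 = 0"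
  by (simp add: psubst_def)

lemma psubst_const [simp]: "psubst h v (const3 c) = h c"
  unfolding const3_def by (simp add: psubst_single)

lemma psubst_1 [simp]: "psubst h v 1 = 1"
  using psubst_const[of v 1] by (simp add: h1)

lemma psubst_var [simp]: "psubst h v (var3 j) = v j"
proof -
  have "(\<Prod>i\<in>UNIV. v i ^ Poly_Mapping.lookup (Poly_Mapping.single j (1::nat)) i) = (\<Prod>i\<in>UNIV. if j = i then v i else 1)"
    by (intro prod.cong) (auto simp: lookup_single when_def)
  then show ?thesis unfolding var3_def by (simp add: psubst_single h1)
qed

lemma psubst_add: "psubst h v (p + q) = psubst h v p + psubst h v q"
proof -
  let ?A = "Poly_Mapping.keys p \<union> Poly_Mapping.keys q"
  have f: "finite ?A" and k: "Poly_Mapping.keys (p + q) \<subseteq> ?A" "Poly_Mapping.keys p \<subseteq> ?A" "Poly_Mapping.keys q \<subseteq> ?A"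
    using keys_add[of p q] by auto
  show ?thesis
    unfolding psubst_superset[OF f k(1)] psubst_superset[OF f k(2)] psubst_superset[OF f k(3)]
    by (simp only: lookup_add h_add distrib_right sum.distrib)
qed

lemma psubst_mult: "psubst h v (p * q) = psubst h v p * psubst h v q"
proof (induction p rule: poly3_induct_single)
  case (2 m c)
  show ?case
    by (induction q rule: poly3_induct_single)
      (simp_all add: mult_single psubst_single h_mult lookup_add power_add prod.distrib psubst_add algebra_simps)
qed (simp_all add: psubst_add algebra_simps)

lemma psubst_uminus: "psubst h v (- p) = - psubst h v p"
  using psubst_add[of v p "- p"] by (simp add: eq_neg_iff_add_eq_0 add.commute)

lemma psubst_diff: "psubst h v (p - q) = psubst h v p - psubst h v q"
  using psubst_add[of v p "- q"] psubst_uminus by simp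

lemma psubst_sum: "psubst h v (sum f A) = (\<Sum>i\<in>A. psubst h v (f i))"
  by (induction A rule: infinite_finite_induct) (simp_all add: psubst_add)

lemma psubst_prod: "psubst h v (prod f A) = (\<Prod>i\<in>A. psubst h v (f i))"
  by (induction A rule: infinite_finite_induct) (simp_all add: psubst_mult)

lemma psubst_power: "psubst h v (p ^ n) = psubst h v p ^ n"
  by (induction n) (simp_all add: psubst_mult)

lemmas psubst_simps = psubst_add psubst_mult psubst_uminus psubst_diff psubst_sum psubst_prod psubst_power

end

global_interpretation at: coeff_hom "\<lambda>c. c"
  by unfold_locales auto

lemma poly_at_psubst: "poly_at p v = psubst (\<lambda>c. c) (\<lambda>i. v $ i) p"
  unfolding poly_at_def psubst_def ..

lemma poly_at_simps:
  "poly_at 0 v = 0" "poly_at 1 v = 1" "poly_at (const3 c) v = c" "poly_at (var3 i) v = v $ i"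
  "poly_at (p + q) v = poly_at p v + poly_at q v" "poly_at (p * q) v = poly_at p v * poly_at q v"
  "poly_at (- p) v = - poly_at p v" "poly_at (p - q) v = poly_at p v - poly_at q v"
  "poly_at (p ^ n) v = poly_at p v ^ n" "poly_at (sum g A) v = (\<Sum>j\<in>A. poly_at (g j) v)"
  "poly_at (prod g A) v = (\<Prod>j\<in>A. poly_at (g j) v)"
  unfolding poly_at_psubst
  by (rule at.psubst_0 at.psubst_1 at.psubst_const at.psubst_var at.psubst_simps)+

lemma poly_at_scale:
  assumes "p \<in> forms n"
  shows "poly_at p (c *s v) = c ^ n * poly_at p v"
  using assms
proof (induction rule: forms_induct)
  case (add n p q)
  then show ?case by (simp only: poly_at_simps distrib_left)
next
  case (var n i p)
  then show ?case by (simp only: poly_at_simps vector_smult_component power_Suc mult_ac)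
qed (simp_all only: poly_at_simps power_0 mult_1_left mult_zero_right)

lemma poly_at_zero_form:
  assumes "p \<in> forms n" "n > 0"
  shows "poly_at p 0 = 0"
  using poly_at_scale[OF assms(1), of 0 0] assms(2) by (simp add: zero_power)

subsection \<open>Partial derivatives\<close>

lemma pderiv3_superset:
  assumes "finite A" "Poly_Mapping.keys p \<subseteq> A"
  shows "pderiv3 i p = (\<Sum>m\<in>A. Poly_Mapping.single (m - Poly_Mapping.single i 1)
        (of_nat (Poly_Mapping.lookup m i) * Poly_Mapping.lookup p m))"
  unfolding pderiv3_def using assms by (intro sum.mono_neutral_left) (auto simp: in_keys_iff)

lemma pderiv3_single: "pderiv3 i (Poly_Mapping.single m c) =
    Poly_Mapping.single (m - Poly_Mapping.single i 1) (of_nat (Poly_Mapping.lookup m i) * c)"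
  by (subst pderiv3_superset[of "{m}"]) auto

lemma pderiv3_0 [simp]: "pderiv3 i 0 = 0"
  by (simp add: pderiv3_def)

lemma pderiv3_const [simp]: "pderiv3 i (const3 c) = 0"
  by (simp add: const3_def pderiv3_single)

lemma pderiv3_1 [simp]: "pderiv3 i 1 = 0"
  using pderiv3_const[of i 1] by simp

lemma pderiv3_var [simp]: "pderiv3 i (var3 j) = (if i = j then 1 else 0)"
  by (auto simp: var3_def pderiv3_single lookup_single when_def)

lemma pderiv3_add: "pderiv3 i (p + q) = pderiv3 i p + pderiv3 i q"
proof -
  let ?A = "Poly_Mapping.keys p \<union> Poly_Mapping.keys q"
  have f: "finite ?A" and k: "Poly_Mapping.keys (p + q) \<subseteq> ?A" "Poly_Mapping.keys p \<subseteq> ?A" "Poly_Mapping.keys q \<subseteq> ?A"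
    using keys_add[of p q] by auto
  show ?thesis
    unfolding pderiv3_superset[OF f k(1)] pderiv3_superset[OF f k(2)] pderiv3_superset[OF f k(3)]
    by (simp only: lookup_add single_add distrib_left sum.distrib)
qed

lemma pderiv3_mult: "pderiv3 i (p * q) = pderiv3 i p * q + p * pderiv3 i q"
proof (induction p rule: poly3_induct_single)
  case (2 m c)
  show ?case
  proof (induction q rule: poly3_induct_single)
    case (2 m' c')
    have a: "m + m' - Poly_Mapping.single i 1 = (m - Poly_Mapping.single i 1) + m'" if "Poly_Mapping.lookup m i \<noteq> 0"
      using that by (intro poly_mapping_eqI) (auto simp: lookup_add lookup_minus lookup_single when_def)
    have b: "m + m' - Poly_Mapping.single i 1 = m + (m' - Poly_Mapping.single i 1)" if "Poly_Mapping.lookup m' i \<noteq> 0"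
      using that by (intro poly_mapping_eqI) (auto simp: lookup_add lookup_minus lookup_single when_def)
    show ?case
      using a b
      by (cases "Poly_Mapping.lookup m i = 0"; cases "Poly_Mapping.lookup m' i = 0")
        (simp_all add: mult_single pderiv3_single lookup_add single_add[symmetric] algebra_simps)
  qed (simp_all add: pderiv3_add algebra_simps)
qed (simp_all add: pderiv3_add algebra_simps)

lemma pderiv3_const_mult [simp]: "pderiv3 i (const3 c * p) = const3 c * pderiv3 i p"
  by (simp add: pderiv3_mult)

lemma pderiv3_uminus: "pderiv3 i (- p) = - pderiv3 i p"
  using pderiv3_const_mult[of i "-1" p] by simp

lemma pderiv3_diff: "pderiv3 i (p - q) = pderiv3 i p - pderiv3 i q"
  using pderiv3_add[of i p "- q"] pderiv3_uminus by simp

lemma pderiv3_sum: "pderiv3 i (sum f A) = (\<Sum>j\<in>A. pderiv3 i (f j))"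
  by (induction A rule: infinite_finite_induct) (simp_all add: pderiv3_add)

lemmas pderiv3_simps = pderiv3_add pderiv3_mult pderiv3_uminus pderiv3_diff pderiv3_sum

lemma pderiv3_forms_zero: "p \<in> forms n \<Longrightarrow> n = 0 \<Longrightarrow> pderiv3 i p = 0"
  by (induction rule: forms_induct) (simp_all add: pderiv3_simps)

lemma pderiv3_forms:
  assumes "p \<in> forms n"
  shows "pderiv3 i p \<in> forms (n - 1)"
  using assms
proof (induction rule: forms_induct)
  case (var n j p)
  have "var3 j * pderiv3 i p \<in> forms n"
    using var forms_var3_mult[of "pderiv3 i p" "n - 1" j] pderiv3_forms_zero[of p n i]
    by (cases n) auto
  moreover have "pderiv3 i (var3 j) * p \<in> forms n" using var by simp
  ultimately show ?case by (simp add: pderiv3_mult forms_add)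
qed (simp_all add: pderiv3_add forms_add)

lemma pderiv3_commute: "pderiv3 i (pderiv3 j p) = pderiv3 j (pderiv3 i p)"
  by (induction p rule: poly3_induct) (simp_all add: pderiv3_simps)

lemma euler_identity:
  assumes "p \<in> forms n"
  shows "(\<Sum>i\<in>UNIV. var3 i * pderiv3 i p) = of_nat n * p"
  using assms
proof (induction rule: forms_induct)
  case (var n i p)
  have "(\<Sum>j\<in>UNIV. var3 j * pderiv3 j (var3 i * p)) = (\<Sum>j\<in>UNIV. (if j = i then var3 j * p else 0) + var3 i * (var3 j * pderiv3 j p))"
    by (intro sum.cong refl) (simp add: pderiv3_mult algebra_simps)
  also have "\<dots> = var3 i * p + var3 i * (of_nat n * p)"
    using var by (simp add: sum.distrib sum_distrib_left[symmetric])
  finally show ?case by (simp add: algebra_simps)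
qed (simp_all add: pderiv3_simps distrib_left sum.distrib)

subsection \<open>Homogeneous components\<close>

global_interpretation cpoly: coeff_hom "\<lambda>c. [:const3 c:]"
  by unfold_locales auto

text \<open>The substitution \<open>x\<^sub>i \<mapsto> x\<^sub>i t\<close> records the grading in the exponent of \<open>t\<close>.\<close>

definition grading :: "poly3 \<Rightarrow> poly3 poly" where
  "grading = psubst (\<lambda>c. [:const3 c:]) (\<lambda>i. [:0, var3 i:])"

definition hcomp :: "nat \<Rightarrow> poly3 \<Rightarrow> poly3" where
  "hcomp n p = coeff (grading p) n"

lemma grading_simps:
  "grading 0 = 0" "grading (const3 c) = [:const3 c:]" "grading (var3 i) = [:0, var3 i:]"
  "grading (p + q) = grading p + grading q" "grading (p * q) = grading p * grading q"
  "grading (p - q) = grading p - grading q"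
  by (simp_all add: grading_def cpoly.psubst_simps)

lemma grading_form: "p \<in> forms n \<Longrightarrow> grading p = monom p n"
  by (induction rule: forms_induct)
    (simp_all add: grading_simps monom_0 add_monom monom_Suc smult_monom)

lemma poly_grading: "poly (grading p) 1 = p"
  by (induction p rule: poly3_induct) (simp_all add: grading_simps)

lemma hcomp_simps:
  "hcomp n 0 = 0" "hcomp n (p + q) = hcomp n p + hcomp n q" "hcomp n (p - q) = hcomp n p - hcomp n q"
  by (simp_all add: hcomp_def grading_simps)

lemma hcomp_form: "p \<in> forms n \<Longrightarrow> hcomp k p = (if k = n then p else 0)"
  by (simp add: hcomp_def grading_form)

lemma hcomp_in_forms: "hcomp n p \<in> forms n"
proof (induction p arbitrary: n rule: poly3_induct)
  case (const c)
  then show ?case using forms_const3[of c] by (simp add: hcomp_form[OF forms_const3])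
next
  case (add p q)
  then show ?case by (simp add: hcomp_simps forms_add)
next
  case (var i p)
  then show ?case
  proof (cases n)
    case 0 then show ?thesis by (simp add: hcomp_def grading_simps)
  next
    case (Suc k)
    then have "hcomp n (var3 i * p) = var3 i * hcomp k p" by (simp add: hcomp_def grading_simps)
    then show ?thesis using var forms_var3_mult Suc by simp
  qed
qed

lemma hcomp_decomposition: "p = (\<Sum>n\<le>degree (grading p). hcomp n p)"
  using poly_grading[of p] unfolding poly_altdef hcomp_def by simp

lemma hcomp_mult_form:
  assumes "q \<in> forms m"
  shows "hcomp n (p * q) = (if n < m then 0 else hcomp (n - m) p * q)"
  unfolding hcomp_def grading_simps grading_form[OF assms]
    mult.commute[of "grading p"] coeff_monom_mult
  by (simp add: mult.commute)

lemma hcomp_eqI: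
  assumes "\<And>n. n \<noteq> k \<Longrightarrow> hcomp n p = 0"
  shows "p \<in> forms k"
proof -
  have "p \<in> graded_piece (int k)"
    by (subst hcomp_decomposition) (metis forms_sum assms hcomp_in_forms forms_0)
  then show ?thesis .
qed

text \<open>Over a domain both the order at 0 and the degree are additive, and the order never
  exceeds the degree. They agree for a monomial, hence for each factor of one.\<close>

lemma mult_eq_monom_idom:
  fixes p q :: "'a::idom poly"
  assumes "p * q = monom c n" "c \<noteq> 0"
  shows "\<exists>a k. p = monom a k"
proof -
  have nz: "p \<noteq> 0" "q \<noteq> 0" using assms by auto
  have "order 0 p + order 0 q = n"
    using order_mult[of p q 0] nz assms order_0_monom[of c n] by auto
  moreover have "degree p + degree q = n"
    using degree_mult_eq[OF nz] assms degree_monom_eq[of c n] by simp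
  moreover have "order 0 p \<le> degree p" "order 0 q \<le> degree q" using nz order_degree by auto
  ultimately have e: "order 0 p = degree p" by linarith
  obtain r where r: "p = [:- 0, 1:] ^ order 0 p * r" using order_1[of 0 p] by (metis dvdE)
  have rn: "r \<noteq> 0" using r nz by auto
  have "degree p = degree ([:0, 1::'a:] ^ order 0 p) + degree r"
    using r rn by (metis degree_mult_eq minus_zero nz(1) mult_zero_left)
  then have "degree r = 0" using e by (simp add: degree_power_eq)
  then obtain a where "r = [:a:]" by (metis degree_eq_zeroE)
  then have "p = monom a (order 0 p)" using r by (simp add: monom_altdef)
  then show ?thesis by blast
qed

text \<open>\<open>grading\<close> sends a form of degree n to a monomial with exponent n, and the
  factors of a monomial are monomials.\<close>

lemma form_factor:
  assumes "p * q \<in> forms n" "p * q \<noteq> 0"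
  obtains k where "p \<in> forms k"
proof -
  have "grading p * grading q = monom (p * q) n"
    using grading_form[OF assms(1)] grading_simps(5) by metis
  then obtain a k where g: "grading p = monom a k" using mult_eq_monom_idom assms(2) by blast
  have "a = p" using poly_grading[of p] g by (simp add: poly_monom)
  then have "p \<in> forms k" using g by (intro hcomp_eqI) (simp add: hcomp_def)
  then show ?thesis using that by blast
qed

section \<open>Unique factorization\<close>

type_synonym nested = "complex poly poly poly"

global_interpretation nst: coeff_hom "\<lambda>c. monom (monom (monom c 0) 0) 0 :: nested"
  by unfold_locales (simp_all add: monom_0 one_pCons)

text \<open>The isomorphism of \<complex>[x,y,z] with \<complex>[x][y][z]; along it unique
  factorization is transported from iterated univariate polynomials.\<close>

definition nest :: "poly3 \<Rightarrow> nested" where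
  "nest = psubst (\<lambda>c. monom (monom (monom c 0) 0) 0)
     (\<lambda>i. if i = 1 then monom (monom (monom 1 1) 0) 0 else if i = 2 then monom (monom 1 1) 0 else monom 1 1)"

lemma nest_simps:
  "nest 0 = 0" "nest 1 = 1" "nest (p + q) = nest p + nest q" "nest (p * q) = nest p * nest q"
  "nest (const3 c) = [:[:[:c:]:]:]" "nest (var3 1) = [:[:[:0, 1:]:]:]" "nest (var3 2) = [:[:0, 1:]:]" "nest (var3 3) = [:0, 1:]"
  unfolding nest_def nst.psubst_0 nst.psubst_1 nst.psubst_add nst.psubst_mult nst.psubst_const nst.psubst_var
  by (simp_all add: monom_0 monom_Suc)

lemma UNIV_three: "(UNIV :: 3 set) = {1, 2, 3}"
  using exhaust_3 by auto

lemma nest_single: "nest (Poly_Mapping.single m c) =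
   monom (monom (monom c (Poly_Mapping.lookup m 1)) (Poly_Mapping.lookup m 2)) (Poly_Mapping.lookup m 3)"
  unfolding nest_def nst.psubst_single UNIV_three by (simp add: monom_power mult_monom)

definition mon3 :: "nat \<Rightarrow> nat \<Rightarrow> nat \<Rightarrow> monom3" where
  "mon3 i j k = Poly_Mapping.single 1 i + Poly_Mapping.single 2 j + Poly_Mapping.single 3 k"

lemma lookup_mon3: "Poly_Mapping.lookup (mon3 i j k) 1 = i" "Poly_Mapping.lookup (mon3 i j k) 2 = j"
  "Poly_Mapping.lookup (mon3 i j k) 3 = k"
  by (simp_all add: mon3_def lookup_add lookup_single)

lemma mon3_eq_iff: "m = mon3 i j k \<longleftrightarrow> Poly_Mapping.lookup m 1 = i \<and> Poly_Mapping.lookup m 2 = j \<and> Poly_Mapping.lookup m 3 = k"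
proof
  assume a: "Poly_Mapping.lookup m 1 = i \<and> Poly_Mapping.lookup m 2 = j \<and> Poly_Mapping.lookup m 3 = k"
  show "m = mon3 i j k"
  proof (rule poly_mapping_eqI)
    fix x :: 3 show "Poly_Mapping.lookup m x = Poly_Mapping.lookup (mon3 i j k) x"
      using exhaust_3[of x] a by (auto simp: lookup_mon3)
  qed
qed (simp add: lookup_mon3)

lemma coeff_nest: "coeff (coeff (coeff (nest p) k) j) i = Poly_Mapping.lookup p (mon3 i j k)"
proof (induction p rule: poly3_induct_single)
  case (2 m c)
  then show ?case by (auto simp: nest_single coeff_monom lookup_single when_def mon3_eq_iff)
qed (simp_all add: nest_simps lookup_add)

lemma nest_eq_0_iff: "nest p = 0 \<longleftrightarrow> p = 0"
proof
  assume a: "nest p = 0"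
  show "p = 0"
  proof (rule poly_mapping_eqI)
    fix m :: monom3
    have "m = mon3 (Poly_Mapping.lookup m 1) (Poly_Mapping.lookup m 2) (Poly_Mapping.lookup m 3)"
      by (simp add: mon3_eq_iff)
    then show "Poly_Mapping.lookup p m = Poly_Mapping.lookup 0 m"
      using coeff_nest[of p] a by (metis coeff_0 lookup_zero)
  qed
qed (simp add: nest_simps)

lemma nest_inject: "nest p = nest q \<longleftrightarrow> p = q"
proof -
  have "nest (p - q) + nest q = nest p" using nest_simps(3)[of "p - q" q] by simp
  then have "nest p = nest q \<longleftrightarrow> nest (p - q) = 0" by auto
  then show ?thesis by (simp add: nest_eq_0_iff)
qed

lemma nest_surj: "\<exists>p. nest p = P"
proof -
  have 1: "\<exists>p. nest p = [:[:R:]:]" for R :: "complex poly"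
  proof (induction R)
    case 0
    then show ?case by (intro exI[of _ 0]) (simp add: nest_simps)
  next
    case (pCons a R)
    then obtain p where "nest p = [:[:R:]:]" by blast
    then show ?case by (intro exI[of _ "const3 a + var3 1 * p"]) (simp add: nest_simps)
  qed
  have 2: "\<exists>p. nest p = [:Q:]" for Q :: "complex poly poly"
  proof (induction Q)
    case 0
    then show ?case by (intro exI[of _ 0]) (simp add: nest_simps)
  next
    case (pCons a Q)
    then obtain p where "nest p = [:Q:]" by blast
    moreover obtain q where "nest q = [:[:a:]:]" using 1 by blast
    ultimately show ?case by (intro exI[of _ "q + var3 2 * p"]) (simp add: nest_simps)
  qed
  show ?thesis
  proof (induction P)
    case 0
    then show ?case by (intro exI[of _ 0]) (simp add: nest_simps)
  next
    case (pCons a P)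
    then obtain p where "nest p = P" by blast
    moreover obtain q where "nest q = [:a:]" using 2 by blast
    ultimately show ?case by (intro exI[of _ "q + var3 3 * p"]) (simp add: nest_simps)
  qed
qed

lemma nest_dvd_iff: "nest p dvd nest q \<longleftrightarrow> p dvd q"
proof
  assume "nest p dvd nest q"
  then obtain R where R: "nest q = nest p * R" by (auto elim: dvdE)
  obtain r where "nest r = R" using nest_surj by blast
  then have "q = p * r" using R nest_inject nest_simps(4) by metis
  then show "p dvd q" by simp
next
  assume "p dvd q"
  then show "nest p dvd nest q" by (metis dvd_def nest_simps(4))
qed

lemma nest_unit_iff: "nest p dvd 1 \<longleftrightarrow> p dvd 1"
  using nest_dvd_iff[of p 1] nest_simps(2) by simp

lemma prime_elem_nest_iff: "prime_elem (nest p) \<longleftrightarrow> prime_elem p"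
proof
  assume a: "prime_elem (nest p)"
  show "prime_elem p"
  proof (rule prime_elemI)
    show "p \<noteq> 0" using a nest_eq_0_iff prime_elem_not_zeroI by blast
    show "\<not> p dvd 1" using a nest_unit_iff prime_elem_not_unit by blast
    fix a b assume "p dvd a * b"
    then show "p dvd a \<or> p dvd b" using a nest_dvd_iff nest_simps(4) by (metis prime_elem_dvd_mult_iff)
  qed
next
  assume a: "prime_elem p"
  show "prime_elem (nest p)"
  proof (rule prime_elemI)
    show "nest p \<noteq> 0" using a nest_eq_0_iff prime_elem_not_zeroI by blast
    show "\<not> nest p dvd 1" using a nest_unit_iff prime_elem_not_unit by blast
    fix A B assume d: "nest p dvd A * B"
    obtain a' b' where "nest a' = A" "nest b' = B" using nest_surj by metis
    then show "nest p dvd A \<or> nest p dvd B" using a d nest_dvd_iff nest_simps(4) by (metis prime_elem_dvd_mult_iff)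
  qed
qed

lemma irreducible_imp_prime_elem_poly3:
  assumes "irreducible (p :: poly3)"
  shows "prime_elem p"
proof -
  have "irreducible (nest p)"
  proof (rule irreducibleI)
    show "nest p \<noteq> 0" using assms nest_eq_0_iff unfolding irreducible_def by blast
    show "\<not> nest p dvd 1" using assms nest_unit_iff irreducible_not_unit by blast
    fix A B assume d: "nest p = A * B"
    obtain a' b' where ab: "nest a' = A" "nest b' = B" using nest_surj by metis
    then have "p = a' * b'" using d nest_inject nest_simps(4) by metis
    then have "a' dvd 1 \<or> b' dvd 1" using assms irreducibleD by blast
    then show "A dvd 1 \<or> B dvd 1" using ab nest_unit_iff by blast
  qed
  then have "prime_elem (nest p)" by (rule irreducible_imp_prime_elem)
  then show ?thesis using prime_elem_nest_iff by blast
qed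

lemma prime_elem_imp_irreducible_idom:
  assumes "prime_elem (p :: 'a::idom)"
  shows "irreducible p"
proof (rule irreducibleI)
  show p0: "p \<noteq> 0" "\<not> p dvd 1" using assms unfolding prime_elem_def by auto
  fix a b assume ab: "p = a * b"
  have *: "y dvd 1" if "p = x * y" "p dvd x" for x y
  proof -
    obtain r where "x = p * r" using \<open>p dvd x\<close> by (auto elim: dvdE)
    then have "p * (r * y) = p * 1" using \<open>p = x * y\<close> by (metis mult.assoc mult_1_right)
    then have "r * y = 1" using mult_left_cancel[OF p0(1)] by blast
    then show ?thesis by (metis dvd_triv_right)
  qed
  have "p dvd a \<or> p dvd b" using assms ab unfolding prime_elem_def by (metis dvd_refl)
  then show "a dvd 1 \<or> b dvd 1" using *[of a b] *[of b a] ab by (auto simp only: mult.commute)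
qed

lemma forms_0_const:
  assumes "p \<in> forms 0"
  obtains c where "p = const3 c"
proof -
  have "n = 0 \<longrightarrow> (\<exists>c. p = const3 c)" if "p \<in> forms n" for n
    using that
  proof (induction rule: forms_induct)
    case (zero n)
    then show ?case using const3_simps(1) by metis
  next
    case (add n p q)
    then show ?case by (metis const3_simps(3))
  qed auto
  then show ?thesis using assms that by blast
qed

text \<open>The factors of 1 are forms whose degrees add up to 0.\<close>

lemma poly3_unit_const:
  assumes "p dvd (1 :: poly3)"
  obtains c where "p = const3 c" "c \<noteq> 0"
proof -
  obtain q where q: "p * q = 1" using assms by (metis dvdE)
  have f1: "p * q \<in> forms 0" using q forms_one by simp
  have nz: "p * q \<noteq> 0" "p \<noteq> 0" "q \<noteq> 0" using q by auto
  obtain k where k: "p \<in> forms k" using form_factor[OF f1 nz(1)] .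
  have f2: "q * p \<in> forms 0" "q * p \<noteq> 0" using f1 nz by (simp_all add: mult.commute)
  obtain j where j: "q \<in> forms j" using form_factor[OF f2] .
  have "k + j = 0" using forms_unique[OF forms_mult[OF k j] f1 nz(1)] .
  then have "p \<in> forms 0" using k by simp
  then obtain c where "p = const3 c" by (rule forms_0_const)
  then show ?thesis using that nz by auto
qed

lemma const3_dvd_1: "c \<noteq> 0 \<Longrightarrow> const3 c dvd 1"
  by (intro dvdI[of _ _ "const3 (1 / c)"]) (simp flip: const3_simps(4))

text \<open>A prime factorization of \<open>nest f\<close> is pulled back through an inverse of
  \<open>nest\<close>. Squarefreeness excludes repeated and associated factors, so the multiset is a
  set; the remaining unit is a constant.\<close>

lemma squarefree_factorization:
  assumes "squarefree (f :: poly3)"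
  obtains PF c where "finite PF" "\<And>\<pi>. \<pi> \<in> PF \<Longrightarrow> irreducible \<pi>" "\<And>\<pi> \<rho>. \<pi> \<in> PF \<Longrightarrow> \<rho> \<in> PF \<Longrightarrow> \<pi> dvd \<rho> \<Longrightarrow> \<pi> = \<rho>"
    "c \<noteq> 0" "f = const3 c * \<Prod>PF"
proof -
  have f0: "f \<noteq> 0" using assms not_squarefree_0 by blast
  obtain A where A: "\<And>x. x \<in># A \<Longrightarrow> prime_elem x" "normalize (prod_mset A) = normalize (nest f)"
    using prime_factorization_exists[of "nest f"] f0 nest_eq_0_iff by blast
  have "surj nest" using nest_surj unfolding surj_def by metis
  then have inv: "nest (inv nest x) = x" for x by (simp add: surj_f_inv_f)
  define B where "B = image_mset (inv nest) A"
  have nB: "nest (prod_mset C) = prod_mset (image_mset nest C)" for C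
    by (induction C) (simp_all add: nest_simps)
  have "image_mset nest B = A" unfolding B_def by (simp add: multiset.map_comp comp_def inv)
  then have a: "normalize (nest (prod_mset B)) = normalize (nest f)" using nB A(2) by simp
  then have d: "prod_mset B dvd f" "f dvd prod_mset B"
    using associatedD1[OF a] associatedD2[OF a] nest_dvd_iff by blast+
  have p: "prime_elem x" if "x \<in># B" for x
  proof -
    obtain y where "y \<in># A" "x = inv nest y" using \<open>x \<in># B\<close> unfolding B_def by auto
    then have "nest x = y" using inv[of y] by (simp only:)
    then have "prime_elem (nest x)" using A(1)[OF \<open>y \<in># A\<close>] by (simp only:)
    then show ?thesis by (simp only: prime_elem_nest_iff)
  qed
  have sq: "False" if "x \<in># B" "y \<in># B - {#x#}" "x dvd y" for x y
  proof -
    obtain D where D: "B = add_mset x D" using multi_member_split[OF \<open>x \<in># B\<close>] by blast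
    have "y \<in># D" using \<open>y \<in># B - {#x#}\<close> unfolding D by (simp only: add_mset_remove_trivial)
    then obtain C where "D = add_mset y C" by (blast dest: multi_member_split)
    then have B2: "B = add_mset x (add_mset y C)" using D by (simp only:)
    have "x * y dvd prod_mset B" unfolding B2 prod_mset.add_mset mult.assoc[symmetric] by (rule dvd_triv_left)
    then have "x * x dvd f"
      using dvd_trans[OF dvd_trans[OF mult_dvd_mono[OF dvd_refl \<open>x dvd y\<close>]] d(1)] by blast
    then have "x dvd 1" using assms unfolding squarefree_def by (simp add: power2_eq_square)
    then show False using p[OF that(1)] prime_elem_not_unit by blast
  qed
  have cnt: "B = mset_set (set_mset B)"
  proof (rule multiset_eqI)
    fix x
    have "count B x \<le> 1"
    proof (rule ccontr)
      assume "\<not> count B x \<le> 1"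
      then have "x \<in># B" "x \<in># B - {#x#}" by (auto simp flip: count_greater_zero_iff)
      then show False using sq[OF _ _ dvd_refl] by blast
    qed
    then have "count B x = (if x \<in># B then 1 else 0)"
      using count_greater_zero_iff[of B x] by (auto simp: count_eq_zero_iff simp del: count_greater_zero_iff)
    then show "count B x = count (mset_set (set_mset B)) x" by (simp add: count_mset_set')
  qed
  have pr: "prod_mset B = \<Prod>(set_mset B)"
    by (subst cnt) (simp add: prod_unfold_prod_mset)
  obtain u where u: "f = prod_mset B * u" using d(1) by (auto elim: dvdE)
  obtain w where w: "prod_mset B = f * w" using d(2) by (auto elim: dvdE)
  have "f * (w * u) = f * 1" using u w by (metis mult.assoc mult.right_neutral)
  then have "w * u = 1" using mult_left_cancel[OF f0] by blast
  then have "u dvd 1" by (metis dvd_triv_right)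
  then obtain c where c: "u = const3 c" "c \<noteq> 0" by (rule poly3_unit_const)
  show thesis
  proof (rule that[of "set_mset B" c])
    show "f = const3 c * \<Prod>(set_mset B)" using u unfolding c(1) pr by (simp only: mult.commute)
    show "irreducible \<pi>" if "\<pi> \<in># B" for \<pi> by (rule prime_elem_imp_irreducible_idom[OF p[OF that]])
    show "\<pi> = \<rho>" if "\<pi> \<in># B" "\<rho> \<in># B" "\<pi> dvd \<rho>" for \<pi> \<rho>
    proof (rule ccontr)
      assume "\<pi> \<noteq> \<rho>"
      then have "\<rho> \<in># B - {#\<pi>#}" using \<open>\<rho> \<in># B\<close> by (simp add: in_diff_count)
      then show False using sq[OF \<open>\<pi> \<in># B\<close> _ \<open>\<pi> dvd \<rho>\<close>] by blast
    qed
  qed (use c in auto)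
qed

lemma prime_elem_dvd_Prod:
  fixes \<pi> :: poly3
  assumes "finite A" "prime_elem \<pi>" "\<pi> dvd prod g A"
  shows "\<exists>a\<in>A. \<pi> dvd g a"
  using assms(1,3)
  by (induction A) (use assms(2) in \<open>auto simp: prime_elem_dvd_mult_iff prime_elem_not_unit\<close>)

lemma Prod_primes_dvd:
  fixes h :: poly3
  assumes "finite A" "\<And>\<pi>. \<pi> \<in> A \<Longrightarrow> prime_elem \<pi>" "\<And>\<pi> \<rho>. \<pi> \<in> A \<Longrightarrow> \<rho> \<in> A \<Longrightarrow> \<pi> dvd \<rho> \<Longrightarrow> \<pi> = \<rho>"
    "\<And>\<pi>. \<pi> \<in> A \<Longrightarrow> \<pi> dvd h"
  shows "\<Prod>A dvd h"
  using assms
proof (induction A)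
  case (insert x F)
  then have "\<Prod>F dvd h" by blast
  then obtain q where q: "h = \<Prod>F * q" by (auto elim: dvdE)
  have "x dvd \<Prod>F * q" using insert(6)[of x] q by simp
  moreover have "\<not> x dvd \<Prod>F"
    using prime_elem_dvd_Prod[of F x "\<lambda>x. x"] insert by auto
  ultimately have "x dvd q" using insert(4)[of x] by (auto simp: prime_elem_dvd_mult_iff)
  then obtain r where "q = x * r" by (auto elim: dvdE)
  then have "h = \<Prod>(insert x F) * r"
    using q prod.insert[OF insert(1,2), of "\<lambda>x. x"] by (simp only: mult_ac)
  then show ?case by simp
qed simp

section \<open>Evaluation and dimension of spaces of forms\<close>

definition point3 :: "complex \<Rightarrow> complex \<Rightarrow> complex \<Rightarrow> complex^3" where
  "point3 a b c = (\<chi> i. if i = 1 then a else if i = 2 then b else c)"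

lemma point3_simps [simp]: "point3 a b c $ 1 = a" "point3 a b c $ 2 = b" "point3 a b c $ 3 = c"
  by (simp_all add: point3_def)

lemma poly_at_nest: "poly_at p (point3 a b c) = poly (poly (poly (nest p) [:[:c:]:]) [:b:]) a"
proof (induction p rule: poly3_induct)
  case (var i p)
  then show ?case using exhaust_3[of i] by (auto simp: poly_at_simps nest_simps)
qed (simp_all add: poly_at_simps nest_simps)

lemma idom_poly_nonzero_value:
  fixes P :: "'a::{idom,ring_char_0} poly"
  assumes "P \<noteq> 0" "inj g"
  shows "\<exists>c::complex. poly P (g c) \<noteq> 0"
proof (rule ccontr)
  assume "\<not> ?thesis"
  then have "range g \<subseteq> {x. poly P x = 0}" by auto
  moreover have "infinite (range g)" using assms(2) infinite_UNIV_char_0 finite_imageD by blast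
  ultimately show False using poly_roots_finite[OF assms(1)] finite_subset by blast
qed

text \<open>The variables are specialized one at a time: a nonzero polynomial over a domain has
  finitely many roots, and there are infinitely many constants.\<close>

lemma poly_at_nonzero:
  assumes "p \<noteq> 0"
  obtains v where "poly_at p v \<noteq> 0"
proof -
  have "nest p \<noteq> 0" using assms nest_eq_0_iff by blast
  then obtain c where "poly (nest p) [:[:c:]:] \<noteq> 0" using idom_poly_nonzero_value[of "nest p" "\<lambda>c. [:[:c:]:]"] by (auto simp: inj_def)
  then obtain b where "poly (poly (nest p) [:[:c:]:]) [:b:] \<noteq> 0" using idom_poly_nonzero_value[of _ "\<lambda>c. [:c:]"] by (auto simp: inj_def)
  then obtain a where "poly (poly (poly (nest p) [:[:c:]:]) [:b:]) a \<noteq> 0" using idom_poly_nonzero_value[of _ "\<lambda>c. c"] by auto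
  then show ?thesis using that poly_at_nest by metis
qed

definition fdeg :: "poly3 \<Rightarrow> nat" where
  "fdeg p = degree (grading p)"

lemma fdeg_form: "p \<in> forms n \<Longrightarrow> p \<noteq> 0 \<Longrightarrow> fdeg p = n"
  by (simp add: fdeg_def grading_form degree_monom_eq)

lemma monomials_count: "2 * card {m. mdeg m = n} = (n + 1) * (n + 2)" "finite {m. mdeg m = n}"
proof -
  let ?A = "SIGMA i:{..n}. {..n - i}"
  let ?g = "\<lambda>(i, j). mon3 i j (n - i - j)"
  have md: "mdeg m = Poly_Mapping.lookup m 1 + Poly_Mapping.lookup m 2 + Poly_Mapping.lookup m 3" for m
    unfolding mdeg_def UNIV_three by simp
  have inj: "inj_on ?g ?A" by (rule inj_onI) (auto simp: mon3_eq_iff lookup_mon3)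
  have im: "?g ` ?A = {m. mdeg m = n}"
  proof
    show "?g ` ?A \<subseteq> {m. mdeg m = n}" by (auto simp: md lookup_mon3)
    show "{m. mdeg m = n} \<subseteq> ?g ` ?A"
    proof
      fix m assume "m \<in> {m. mdeg m = n}"
      then have d: "mdeg m = n" by simp
      then have "m = ?g (Poly_Mapping.lookup m 1, Poly_Mapping.lookup m 2)"
        unfolding md by (auto simp: mon3_eq_iff)
      moreover have "(Poly_Mapping.lookup m 1, Poly_Mapping.lookup m 2) \<in> ?A" using d unfolding md by auto
      ultimately show "m \<in> ?g ` ?A" by blast
    qed
  qed
  have "card {m. mdeg m = n} = card ?A" using card_image[OF inj] im by simp
  also have "\<dots> = (\<Sum>i\<le>n. n - i + 1)" by simp
  also have "\<dots> = (\<Sum>i\<le>n. i + 1)" by (rule sum.reindex_bij_witness[of _ "\<lambda>i. n - i" "\<lambda>i. n - i"]) auto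
  finally have c: "card {m. mdeg m = n} = (\<Sum>i\<le>n. i + 1)" .
  have "2 * (\<Sum>i\<le>n. i + 1) = (n + 1) * (n + 2)" by (induction n) auto
  then show "2 * card {m. mdeg m = n} = (n + 1) * (n + 2)" using c by simp
  show "finite {m. mdeg m = n}" unfolding im[symmetric] by (intro finite_imageI finite_SigmaI) auto
qed

lemma dim_forms: "2 * P3.dim (forms n) = (n + 1) * (n + 2)" "P3.fin_dim (forms n)"
proof -
  let ?B = "(\<lambda>m. Poly_Mapping.single m (1::complex)) ` {m. mdeg m = n}"
  have fin: "finite ?B" using monomials_count(2) by simp
  have sub: "?B \<subseteq> forms n" by (auto simp: forms_single)
  have inj: "inj_on (\<lambda>m. Poly_Mapping.single m (1::complex)) {m. mdeg m = n}"
  proof (rule inj_onI)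
    fix m m' :: monom3 assume "Poly_Mapping.single m (1::complex) = Poly_Mapping.single m' 1"
    then have "Poly_Mapping.keys (Poly_Mapping.single m (1::complex)) = Poly_Mapping.keys (Poly_Mapping.single m' (1::complex))"
      by simp
    then show "m = m'" by simp
  qed
  have sc: "scal3 c (Poly_Mapping.single m 1) = Poly_Mapping.single m c" for c m
    by (simp add: scal3_def mult_single)
  have sp: "forms n \<subseteq> P3.span ?B"
  proof
    fix p assume p: "p \<in> forms n"
    have "(\<Sum>m\<in>Poly_Mapping.keys p. Poly_Mapping.single m (Poly_Mapping.lookup p m)) \<in> P3.span ?B"
    proof (rule P3.span_sum)
      fix m assume "m \<in> Poly_Mapping.keys p"
      then have "mdeg m = n" using p unfolding graded_piece_def by simp
      then have "Poly_Mapping.single m 1 \<in> P3.span ?B" by (intro P3.span_base) auto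
      then show "Poly_Mapping.single m (Poly_Mapping.lookup p m) \<in> P3.span ?B"
        using P3.span_scale[of "Poly_Mapping.single m 1" ?B "Poly_Mapping.lookup p m"] by (simp add: sc)
    qed
    then show "p \<in> P3.span ?B" using poly3_monomials[of p] by simp
  qed
  have ind: "P3.independent ?B"
  proof (rule P3.independent_if_scalars_zero[OF fin])
    fix g x assume s: "(\<Sum>x\<in>?B. scal3 (g x) x) = 0" and x: "x \<in> ?B"
    obtain m where m: "mdeg m = n" "x = Poly_Mapping.single m 1" using x by auto
    let ?h = "\<lambda>m. g (Poly_Mapping.single m 1)"
    have "(\<Sum>m\<in>{m. mdeg m = n}. Poly_Mapping.single m (?h m)) = 0"
      using s by (simp add: sum.reindex[OF inj] sc)
    then have "Poly_Mapping.lookup (\<Sum>m\<in>{m. mdeg m = n}. Poly_Mapping.single m (?h m)) m = 0" by simp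
    then have "(\<Sum>m'\<in>{m. mdeg m = n}. if m' = m then ?h m' else 0) = 0"
      unfolding lookup_sum by (simp add: lookup_single when_def)
    then show "g x = 0" using m monomials_count(2)[of n] by (simp add: sum.delta')
  qed
  show fd: "P3.fin_dim (forms n)" unfolding P3.fin_dim_def using forms_subspace fin sp by blast
  have "P3.dim (forms n) = card ?B" using P3.dim_unique[OF sub sp ind refl] .
  then show "2 * P3.dim (forms n) = (n + 1) * (n + 2)" using card_image[OF inj] monomials_count(1)[of n] by simp
qed

lemma fin_dim_forms_subset: "P3.subspace W \<Longrightarrow> W \<subseteq> forms n \<Longrightarrow> P3.fin_dim W"
  using P3.fin_dim_subset[OF dim_forms(2)] .

text \<open>At p = 0, uniqueness of the coefficients means independence of \<open>B\<close> modulo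
  \<open>W\<close>; existence means that \<open>B\<close> spans \<open>U\<close> modulo
  \<open>W\<close>.\<close>

lemma quotient_basis_card:
  assumes "P3.fin_dim U" "P3.subspace W" "W \<subseteq> U" "quotient_basis U W B"
  shows "card B = P3.dim U - P3.dim W"
proof -
  have B: "finite B" "B \<subseteq> U" and
    ex1: "\<And>p. p \<in> U \<Longrightarrow> \<exists>!c. (\<forall>b. b \<notin> B \<longrightarrow> c b = 0) \<and> p - (\<Sum>b\<in>B. scal3 (c b) b) \<in> W"
    using assms(4) unfolding quotient_basis_def by auto
  have U: "P3.subspace U" using assms(1) P3.fin_dim_subspace by blast
  have z: "\<forall>b\<in>B. c b = 0" if "(\<Sum>b\<in>B. scal3 (c b) b) \<in> W" for c
  proof -
    let ?c = "\<lambda>b. if b \<in> B then c b else 0"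
    have e: "(\<Sum>b\<in>B. scal3 (?c b) b) = (\<Sum>b\<in>B. scal3 (c b) b)" by (intro sum.cong) auto
    let ?P = "\<lambda>c. (\<forall>b. b \<notin> B \<longrightarrow> c b = 0) \<and> 0 - (\<Sum>b\<in>B. scal3 (c b) b) \<in> W"
    have E: "\<exists>!c. ?P c" using ex1[OF P3.subspace_0[OF U]] .
    have 1: "?P ?c" unfolding e using that P3.subspace_neg[OF assms(2)] by simp
    have 2: "?P (\<lambda>_. 0)" using P3.subspace_0[OF assms(2)] by simp
    have "?c = (\<lambda>_. 0)" 
      using the1_equality[where P = ?P and a = ?c, OF E 1] the1_equality[where P = ?P and a = "\<lambda>_. 0", OF E 2]
      by (rule trans[OF sym])
    then have "?c b = 0" for b by (rule fun_cong)
    then show ?thesis by metis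
  qed
  have indB: "P3.independent B"
  proof (rule P3.independent_if_scalars_zero[OF B(1)])
    fix g x assume "(\<Sum>x\<in>B. scal3 (g x) x) = 0" "x \<in> B"
    then show "g x = 0" using z[of g] P3.subspace_0[OF assms(2)] by auto
  qed
  have int0: "P3.span B \<inter> W \<subseteq> {0}"
  proof
    fix x assume x: "x \<in> P3.span B \<inter> W"
    then have "x \<in> range (\<lambda>u. \<Sum>v\<in>B. scal3 (u v) v)" unfolding P3.span_finite[OF B(1)] by blast
    then obtain u where u: "x = (\<Sum>v\<in>B. scal3 (u v) v)" by blast
    then have "\<forall>b\<in>B. u b = 0" using z[of u] x by blast
    then show "x \<in> {0}" using u by simp
  qed
  have spB: "P3.fin_dim (P3.span B)" using P3.fin_dim_span[OF B(1)] .
  have fW: "P3.fin_dim W" using P3.fin_dim_subset[OF assms(1-3)] .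
  have "{x + y |x y. x \<in> P3.span B \<and> y \<in> W} = U"
  proof
    show "{x + y |x y. x \<in> P3.span B \<and> y \<in> W} \<subseteq> U"
      using assms(3) P3.span_minimal[OF B(2) U] P3.subspace_add[OF U] by blast
    show "U \<subseteq> {x + y |x y. x \<in> P3.span B \<and> y \<in> W}"
    proof
      fix p assume "p \<in> U"
      then obtain c where c: "p - (\<Sum>b\<in>B. scal3 (c b) b) \<in> W" using ex1 by blast
      have "(\<Sum>b\<in>B. scal3 (c b) b) \<in> P3.span B" by (intro P3.span_sum P3.span_scale P3.span_base)
      moreover have "p = (\<Sum>b\<in>B. scal3 (c b) b) + (p - (\<Sum>b\<in>B. scal3 (c b) b))" by simp
      ultimately show "p \<in> {x + y |x y. x \<in> P3.span B \<and> y \<in> W}" using c by blast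
    qed
  qed
  moreover have "P3.span B \<inter> W = {0}" using int0 P3.span_zero P3.subspace_0[OF assms(2)] by blast
  moreover have "P3.dim {0} = 0" using P3.dim_span[of "{}"] P3.dim_eq_card_independent[OF P3.independent_empty] P3.span_empty by simp
  ultimately have "P3.dim U = P3.dim (P3.span B) + P3.dim W" using P3.fin_dim_sum(2)[OF spB fW] by simp
  then show ?thesis using P3.dim_span_eq_card_independent[OF indB] by simp
qed

lemma quotient_basis_exists:
  assumes "P3.fin_dim U" "P3.subspace W" "W \<subseteq> U"
  shows "\<exists>B. quotient_basis U W B"
proof -
  obtain D where D: "finite D" "D \<subseteq> U" "P3.independent D" "card D + P3.dim W = P3.dim U"
    "P3.span D \<inter> W \<subseteq> {0}" "\<forall>x\<in>U. \<exists>y\<in>W. \<exists>z\<in>P3.span D. x = y + z"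
    using P3.fin_dim_complement[OF assms] .
  have "quotient_basis U W D"
    unfolding quotient_basis_def
  proof (intro conjI ballI ex_ex1I)
    fix p assume p: "p \<in> U"
    obtain y z where yz: "y \<in> W" "z \<in> P3.span D" "p = y + z" using D(6) p by blast
    have "z \<in> range (\<lambda>u. \<Sum>v\<in>D. scal3 (u v) v)" using yz(2) unfolding P3.span_finite[OF D(1)] .
    then obtain u where u: "z = (\<Sum>v\<in>D. scal3 (u v) v)" by blast
    let ?u = "\<lambda>v. if v \<in> D then u v else 0"
    have e: "(\<Sum>v\<in>D. scal3 (?u v) v) = (\<Sum>v\<in>D. scal3 (u v) v)" by (intro sum.cong) auto
    have "p - (\<Sum>v\<in>D. scal3 (?u v) v) \<in> W" unfolding e using yz u by simp
    then show "\<exists>c. (\<forall>b. b \<notin> D \<longrightarrow> c b = 0) \<and> p - (\<Sum>b\<in>D. scal3 (c b) b) \<in> W"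
      by (intro exI[of _ ?u]) simp
  next
    fix p c c' assume p: "p \<in> U"
      and c: "(\<forall>b. b \<notin> D \<longrightarrow> c b = 0) \<and> p - (\<Sum>b\<in>D. scal3 (c b) b) \<in> W"
      and c': "(\<forall>b. b \<notin> D \<longrightarrow> c' b = 0) \<and> p - (\<Sum>b\<in>D. scal3 (c' b) b) \<in> W"
    have "(p - (\<Sum>b\<in>D. scal3 (c' b) b)) - (p - (\<Sum>b\<in>D. scal3 (c b) b)) \<in> W"
      using c c' P3.subspace_diff[OF assms(2)] by blast
    moreover have "(p - (\<Sum>b\<in>D. scal3 (c' b) b)) - (p - (\<Sum>b\<in>D. scal3 (c b) b)) = (\<Sum>b\<in>D. scal3 (c b - c' b) b)"
      by (simp add: P3.scale_left_diff_distrib sum_subtractf)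
    moreover have "(\<Sum>b\<in>D. scal3 (c b - c' b) b) \<in> P3.span D" by (intro P3.span_sum P3.span_scale P3.span_base)
    ultimately have s: "(\<Sum>b\<in>D. scal3 (c b - c' b) b) = 0" using D(5) by auto
    have "\<forall>b\<in>D. c b - c' b = 0"
      using P3.independentD[OF D(3,1) subset_refl, of "\<lambda>b. c b - c' b"] s by blast
    then show "c = c'" using c c' by (intro ext) (metis eq_iff_diff_eq_0)
  qed (use D in auto)
  then show ?thesis by blast
qed

lemma quotient_dim_eq:
  assumes "P3.fin_dim U" "P3.subspace W" "W \<subseteq> U"
  shows "quotient_dim U W = P3.dim U - P3.dim W"
  unfolding quotient_dim_def
  using quotient_basis_card[OF assms] quotient_basis_exists[OF assms] by (intro the_equality) blast+

section \<open>Points of the plane and restriction to curves\<close>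

lemma vec_span_single: "vec.span {v} = range (\<lambda>k. k *s (v :: complex^3))"
  by (rule vec.span_singleton)

lemma vec_span_eq_iff:
  fixes v w :: "complex^3"
  assumes "v \<noteq> 0"
  shows "vec.span {v} = vec.span {w} \<longleftrightarrow> (\<exists>c. c \<noteq> 0 \<and> v = c *s w)"
proof
  assume "vec.span {v} = vec.span {w}"
  then have "v \<in> range (\<lambda>k. k *s w)" using vec.span_base[of v "{v}"] vec_span_single[of w] by auto
  then obtain c where c: "v = c *s w" by blast
  then have "c \<noteq> 0" using assms by auto
  then show "\<exists>c. c \<noteq> 0 \<and> v = c *s w" using c by blast
next
  assume "\<exists>c. c \<noteq> 0 \<and> v = c *s w"
  then obtain c where c: "c \<noteq> 0" "v = c *s w" by blast
  have 1: "k *s v = (k * c) *s w" "k *s w = (k / c) *s v" for k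
    using c by (simp_all add: vector_smult_assoc)
  show "vec.span {v} = vec.span {w}" unfolding vec_span_single using 1 by (metis (no_types, lifting) image_subset_iff rangeI subset_antisym)
qed

lemma separating_linear_form:
  fixes v w :: "complex^3"
  assumes "v \<noteq> 0" "w \<noteq> 0" "vec.span {v} \<noteq> vec.span {w}"
  obtains L where "L \<in> forms 1" "poly_at L w = 0" "poly_at L v \<noteq> 0"
proof -
  let ?L = "\<lambda>i j. const3 (w $ j) * var3 i - const3 (w $ i) * var3 j"
  have L1: "?L i j \<in> forms 1" for i j by (intro forms_diff forms_const3_mult forms_var3)
  have L2: "poly_at (?L i j) w = 0" for i j by (simp add: poly_at_simps)
  have "\<exists>i j. poly_at (?L i j) v \<noteq> 0"
  proof (rule ccontr)
    assume "\<not> (\<exists>i j. poly_at (?L i j) v \<noteq> 0)"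
    then have a: "w $ j * v $ i = w $ i * v $ j" for i j by (simp add: poly_at_simps)
    obtain j where j: "w $ j \<noteq> 0" using assms(2) by (metis vec_eq_iff zero_index)
    have "v = (v $ j / w $ j) *s w"
      using j a by (simp add: vec_eq_iff field_simps)
    moreover from this have "v $ j / w $ j \<noteq> 0" using assms(1) by auto
    ultimately show False using vec_span_eq_iff[OF assms(1)] assms(3) by blast
  qed
  then show ?thesis using that L1 L2 by blast
qed

lemma nonvanishing_var:
  assumes "v \<noteq> (0 :: complex^3)"
  obtains i where "v $ i \<noteq> 0"
  using assms by (metis vec_eq_iff zero_index)

text \<open>Through each other point there is a line that misses \<open>v\<close>; a power of a
  coordinate not vanishing at \<open>v\<close> brings the product of their equations to degree
  \<open>n\<close>.\<close>

lemma separating_form: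
  fixes A :: "(complex^3) set"
  assumes "finite A" "0 \<notin> A" "inj_on (\<lambda>v. vec.span {v}) A" "v \<in> A" "card A \<le> n + 1"
  obtains p where "p \<in> forms n" "poly_at p v \<noteq> 0" "\<And>w. w \<in> A \<Longrightarrow> w \<noteq> v \<Longrightarrow> poly_at p w = 0"
proof -
  have "\<exists>L. L \<in> forms 1 \<and> poly_at L w = 0 \<and> poly_at L v \<noteq> 0" if w: "w \<in> A - {v}" for w
  proof -
    have "v \<noteq> 0" "w \<noteq> 0" using assms(2,4) w by auto
    moreover have "vec.span {v} \<noteq> vec.span {w}" using assms(3,4) w unfolding inj_on_def by blast
    ultimately show ?thesis using separating_linear_form by metis
  qed
  then obtain L where L: "\<And>w. w \<in> A - {v} \<Longrightarrow> L w \<in> forms 1 \<and> poly_at (L w) w = 0 \<and> poly_at (L w) v \<noteq> 0" by metis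
  have pr: "B \<subseteq> A - {v} \<Longrightarrow> prod L B \<in> forms (card B)" if "finite B" for B
    using that
  proof (induction B)
    case empty then show ?case using forms_one by simp
  next
    case (insert x B)
    then show ?case using forms_mult[of "L x" 1 "prod L B" "card B"] L[of x] by simp
  qed
  obtain i where i: "v $ i \<noteq> 0" using nonvanishing_var assms(2,4) by metis
  let ?p = "prod L (A - {v}) * var3 i ^ (n + 1 - card A)"
  have fin: "finite (A - {v})" using assms(1) by simp
  have deg: "card (A - {v}) + 1 * (n + 1 - card A) = n"
    using assms(1,4,5) by (cases "card A") (auto simp: card_Diff_singleton)
  have "?p \<in> forms n"
    using forms_mult[OF pr[OF fin subset_refl] forms_power[OF forms_var3[of i], of "n + 1 - card A"]] unfolding deg .
  moreover have "poly_at ?p v \<noteq> 0" using L i fin by (simp add: poly_at_simps)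
  moreover have "poly_at ?p w = 0" if "w \<in> A" "w \<noteq> v" for w
  proof -
    have "w \<in> A - {v}" "poly_at (L w) w = 0" using L[of w] that by auto
    then have "poly_at (prod L (A - {v})) w = 0" unfolding poly_at_simps using fin by (metis prod_zero)
    then show ?thesis by (simp add: poly_at_simps)
  qed
  ultimately show ?thesis using that by blast
qed

lemma vanishing_subspace: "P3.subspace {p \<in> forms n. \<forall>v\<in>A. poly_at p v = 0}"
  using forms_subspace[of n] unfolding P3.subspace_def by (auto simp: poly_at_simps scal3_const3)

text \<open>Separating forms are dual to the evaluations up to scalars, so their span is a
  complement of the space of forms vanishing on \<open>A\<close>.\<close>

lemma dim_vanishing:
  assumes "finite A"
    and sep: "\<And>v. v \<in> A \<Longrightarrow> \<exists>p\<in>forms n. poly_at p v \<noteq> 0 \<and> (\<forall>w\<in>A. w \<noteq> v \<longrightarrow> poly_at p w = 0)"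
  shows "P3.dim {p \<in> forms n. \<forall>v\<in>A. poly_at p v = 0} + card A = P3.dim (forms n)"
proof (rule antisym)
  let ?V = "{p \<in> forms n. \<forall>v\<in>A. poly_at p v = 0}"
  have lin: "P3.linear_on (forms n) (\<lambda>p. poly_at p v)" for v
    unfolding P3.linear_on_def by (simp add: poly_at_simps scal3_const3)
  show "P3.dim (forms n) \<le> P3.dim ?V + card A"
    using P3.dim_common_kernel[OF assms(1) dim_forms(2), where \<phi> = "\<lambda>v p. poly_at p v"] lin by blast
  obtain s where s: "\<And>v. v \<in> A \<Longrightarrow> s v \<in> forms n" "\<And>v. v \<in> A \<Longrightarrow> poly_at (s v) v \<noteq> 0"
    "\<And>v w. v \<in> A \<Longrightarrow> w \<in> A \<Longrightarrow> w \<noteq> v \<Longrightarrow> poly_at (s v) w = 0" using sep by metis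
  have inj: "inj_on s A" by (rule inj_onI) (metis s(2,3))
  have z: "g (s v) = 0" if g: "\<forall>w\<in>A. poly_at (\<Sum>x\<in>s ` A. scal3 (g x) x) w = 0" and v: "v \<in> A" for g v
  proof -
    have "poly_at (\<Sum>x\<in>s ` A. scal3 (g x) x) v = (\<Sum>w\<in>A. g (s w) * poly_at (s w) v)"
      by (simp add: sum.reindex[OF inj] poly_at_simps scal3_const3)
    also have "\<dots> = (\<Sum>w\<in>A. if w = v then g (s v) * poly_at (s v) v else 0)"
      using s(3) v by (intro sum.cong) auto
    also have "\<dots> = g (s v) * poly_at (s v) v" using assms(1) v by simp
    finally show ?thesis using g v s(2) by auto
  qed
  have ind: "P3.independent (s ` A)"
  proof (rule P3.independent_if_scalars_zero)
    fix g x assume a: "(\<Sum>x\<in>s ` A. scal3 (g x) x) = 0" "x \<in> s ` A"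
    then show "g x = 0" using z[of g] by (auto simp: poly_at_simps)
  qed (use assms in simp)
  have int: "P3.span (s ` A) \<inter> ?V = {0}"
  proof -
    have "x = 0" if "x \<in> P3.span (s ` A)" "x \<in> ?V" for x
    proof -
      have "x \<in> range (\<lambda>u. \<Sum>v\<in>s ` A. scal3 (u v) v)" using that(1) P3.span_finite[of "s ` A"] assms(1) by blast
      then obtain u where u: "x = (\<Sum>v\<in>s ` A. scal3 (u v) v)" by blast
      have "\<forall>v\<in>A. u (s v) = 0" using z[of u] that(2) unfolding u by blast
      then show ?thesis unfolding u by (intro sum.neutral) auto
    qed
    moreover have "0 \<in> ?V" by (simp add: poly_at_simps)
    ultimately show ?thesis using P3.span_zero by blast
  qed
  have fs: "P3.fin_dim (P3.span (s ` A))" using P3.fin_dim_span assms(1) by blast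
  have fv: "P3.fin_dim ?V" using fin_dim_forms_subset[OF vanishing_subspace] by blast
  have d0: "P3.dim {0} = 0" using P3.dim_span[of "{}"] P3.dim_eq_card_independent[OF P3.independent_empty] P3.span_empty by simp
  let ?W = "{x + y |x y. x \<in> P3.span (s ` A) \<and> y \<in> ?V}"
  have sub: "?W \<subseteq> forms n" using P3.span_minimal[of "s ` A", OF _ forms_subspace[of n]] s(1) forms_add by blast
  have "P3.dim ?W = card A + P3.dim ?V"
    using P3.fin_dim_sum(2)[OF fs fv] P3.dim_span_eq_card_independent[OF ind] card_image[OF inj] unfolding int d0 by simp
  moreover have "P3.dim ?W \<le> P3.dim (forms n)"
    using P3.fin_dim_mono[OF dim_forms(2) P3.fin_dim_subspace[OF P3.fin_dim_sum(1)[OF fs fv]] sub] .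
  ultimately show "P3.dim ?V + card A \<le> P3.dim (forms n)" by simp
qed

lemma form_cofactor:
  assumes "p \<in> forms a" "p \<noteq> 0" "q \<noteq> 0" "p * q \<in> forms m"
  shows "a \<le> m" "q \<in> forms (m - a)"
proof -
  have nz: "q * p \<noteq> 0" "q * p \<in> forms m" using assms by (simp_all add: mult.commute)
  obtain k where k: "q \<in> forms k" using form_factor[OF nz(2,1)] .
  have "a + k = m" using forms_unique[OF forms_mult[OF assms(1) k] assms(4)] assms(2,3) by simp
  then show "a \<le> m" "q \<in> forms (m - a)" using k by auto
qed

lemma module_hom_mult: "module_hom scal3 scal3 (\<lambda>p. g * p)"
  by (rule module_hom_scal3I) (simp_all add: algebra_simps)

lemma dim_mult_forms:
  assumes "g \<noteq> 0" "P3.fin_dim U"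
  shows "P3.fin_dim ((\<lambda>p. g * p) ` U)" "P3.dim ((\<lambda>p. g * p) ` U) = P3.dim U"
  using P3.dim_linear_image[OF assms(2) module_hom_mult[of g]] assms(1) by auto

section \<open>A weak form of Bezout's theorem\<close>

text \<open>Two codimensions in one degree are compared. The ideal of \<pi> and \<open>h\<close> has
  codimension a b, because a common multiple of the two is a multiple of their product. It lies in
  the space of forms through the points, whose codimension is their number.\<close>

lemma prime_form_Int_bound:
  assumes \<pi>: "prime_elem \<pi>" "\<pi> \<in> forms a" and h: "h \<in> forms b" "\<not> \<pi> dvd h"
    and A: "finite A" "0 \<notin> A" "inj_on (\<lambda>v. vec.span {v}) A" "\<And>v. v \<in> A \<Longrightarrow> poly_at \<pi> v = 0 \<and> poly_at h v = 0"
  shows "card A \<le> a * b"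
proof -
  define k where "k = card A"
  \<comment> \<open>In this degree the points impose independent conditions, and the common
    multiples of \<pi> and \<open>h\<close> have cofactors of degree k.\<close>
  define n where "n = a + b + k"
  have nz: "\<pi> \<noteq> 0" "h \<noteq> 0" using \<pi>(1) h(2) by auto
  let ?V = "{p \<in> forms n. \<forall>v\<in>A. poly_at p v = 0}"
  let ?P = "(\<lambda>p. \<pi> * p) ` forms (b + k)" and ?H = "(\<lambda>p. h * p) ` forms (a + k)"
  let ?I = "(\<lambda>p. (\<pi> * h) * p) ` forms k"
  have "\<exists>p\<in>forms n. poly_at p v \<noteq> 0 \<and> (\<forall>w\<in>A. w \<noteq> v \<longrightarrow> poly_at p w = 0)" if "v \<in> A" for v
    using separating_form[OF A(1-3) that, of n] unfolding n_def k_def by (metis add.commute add_le_mono le_add2 le_add_same_cancel1 le_trans zero_le)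
  from dim_vanishing[OF A(1) this] have V: "P3.dim ?V + k = P3.dim (forms n)" unfolding k_def by blast
  have fV: "P3.fin_dim ?V" using fin_dim_forms_subset[OF vanishing_subspace] by blast
  note P = dim_mult_forms[OF nz(1) dim_forms(2), of "b + k"]
  note H = dim_mult_forms[OF nz(2) dim_forms(2), of "a + k"]
  have "\<pi> * h \<noteq> 0" using nz by simp
  note I = dim_mult_forms[OF this dim_forms(2), of k]
  have "?P \<inter> ?H \<subseteq> ?I"
  proof
    fix x assume "x \<in> ?P \<inter> ?H"
    then obtain \<alpha> \<beta> where x: "x = \<pi> * \<alpha>" "x = h * \<beta>" "\<beta> \<in> forms (a + k)" by blast
    then have "\<pi> dvd h * \<beta>" by (metis dvd_triv_left)
    then have "\<pi> dvd \<beta>" using \<pi>(1) h(2) by (auto simp: prime_elem_dvd_mult_iff)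
    then obtain \<gamma> where g: "\<beta> = \<pi> * \<gamma>" by (auto elim: dvdE)
    have "\<gamma> \<in> forms k"
      using form_cofactor(2)[OF \<pi>(2) nz(1), of \<gamma> "a + k"] x(3) g by (cases "\<gamma> = 0") auto
    moreover have "x = (\<pi> * h) * \<gamma>" using x(2) g by (simp only: mult_ac)
    ultimately show "x \<in> ?I" by blast
  qed
  then have "P3.dim (?P \<inter> ?H) \<le> P3.dim ?I"
    using P3.fin_dim_mono[OF I(1)] P3.subspace_inter P3.fin_dim_subspace P(1) H(1) by blast
  moreover have "P3.dim {x + y |x y. x \<in> ?P \<and> y \<in> ?H} \<le> P3.dim ?V"
  proof (rule P3.fin_dim_mono[OF fV P3.fin_dim_subspace[OF P3.fin_dim_sum(1)[OF P(1) H(1)]]])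
    show "{x + y |x y. x \<in> ?P \<and> y \<in> ?H} \<subseteq> ?V"
    proof clarify
      fix \<alpha> \<beta> assume ab: "\<alpha> \<in> forms (b + k)" "\<beta> \<in> forms (a + k)"
      have "a + (b + k) = n" "b + (a + k) = n" unfolding n_def by simp_all
      then have "\<pi> * \<alpha> \<in> forms n" "h * \<beta> \<in> forms n"
        using forms_mult[OF \<pi>(2) ab(1)] forms_mult[OF h(1) ab(2)] by (simp_all only:)
      then show "\<pi> * \<alpha> + h * \<beta> \<in> forms n \<and> (\<forall>v\<in>A. poly_at (\<pi> * \<alpha> + h * \<beta>) v = 0)"
        using A(4) forms_add by (auto simp: poly_at_simps)
    qed
  qed
  ultimately have "P3.dim (forms (b + k)) + P3.dim (forms (a + k)) + k \<le> P3.dim (forms n) + P3.dim (forms k)"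
    using P3.fin_dim_sum(2)[OF P(1) H(1)] P(2) H(2) I(2) V by linarith
  then have "2 * P3.dim (forms (b + k)) + 2 * P3.dim (forms (a + k)) + 2 * k \<le> 2 * P3.dim (forms n) + 2 * P3.dim (forms k)"
    by linarith
  then have "(b + k + 1) * (b + k + 2) + (a + k + 1) * (a + k + 2) + 2 * k \<le> (a + b + k + 1) * (a + b + k + 2) + (k + 1) * (k + 2)"
    unfolding dim_forms(1) n_def .
  then have "2 * k \<le> 2 * (a * b)" by (simp add: algebra_simps)
  then show ?thesis unfolding k_def by simp
qed

lemma prime_form_Int_finite:
  assumes \<pi>: "prime_elem \<pi>" "\<pi> \<in> forms a" and h: "h \<in> forms b" "\<not> \<pi> dvd h"
  shows "finite (zero_locus \<pi> \<inter> zero_locus h)"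
proof -
  let ?Z = "zero_locus \<pi> \<inter> zero_locus h"
  have ex: "\<exists>v. P = vec.span {v} \<and> v \<noteq> 0 \<and> poly_at \<pi> v = 0 \<and> poly_at h v = 0" if P: "P \<in> ?Z" for P
  proof -
    obtain v where v: "P = vec.span {v}" "v \<noteq> 0" "poly_at \<pi> v = 0" using P unfolding zero_locus_def by blast
    obtain w where w: "P = vec.span {w}" "w \<noteq> 0" "poly_at h w = 0" using P unfolding zero_locus_def by blast
    have "vec.span {v} = vec.span {w}" using v(1) w(1) by (rule trans[OF sym])
    then obtain c where "v = c *s w" using vec_span_eq_iff[OF v(2)] by blast
    then have "poly_at h v = 0" using poly_at_scale[OF h(1)] w(3) by simp
    then show ?thesis using v by blast
  qed
  then obtain r where r: "\<And>P. P \<in> ?Z \<Longrightarrow> P = vec.span {r P} \<and> r P \<noteq> 0 \<and> poly_at \<pi> (r P) = 0 \<and> poly_at h (r P) = 0" by metis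
  have "card F \<le> a * b" if F: "F \<subseteq> ?Z" "finite F" for F
  proof -
    have inj: "inj_on r F" by (rule inj_onI) (metis r F(1) subsetD)
    have "card (r ` F) \<le> a * b"
    proof (rule prime_form_Int_bound[OF assms])
      show "finite (r ` F)" using F(2) by simp
      show "0 \<notin> r ` F" using r F(1) by (metis (no_types, lifting) imageE subsetD)
      show "inj_on (\<lambda>v. vec.span {v}) (r ` F)"
      proof (rule inj_onI)
        fix x y assume "x \<in> r ` F" "y \<in> r ` F" and e: "vec.span {x} = vec.span {y}"
        then obtain P Q where PQ: "P \<in> F" "Q \<in> F" "x = r P" "y = r Q" by blast
        then have "P = vec.span {x}" "Q = vec.span {y}" using r F(1) by (metis subsetD)+
        then show "x = y" using e PQ by (simp only:)
      qed
      show "poly_at \<pi> v = 0 \<and> poly_at h v = 0" if "v \<in> r ` F" for v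
        using that r F(1) by (metis (no_types, lifting) imageE subsetD)
    qed
    then show ?thesis using card_image[OF inj] by simp
  qed
  then show ?thesis using finite_if_finite_subsets_card_bdd[of ?Z "a * b"] by blast
qed

section \<open>Restriction to parametrized curves\<close>

global_interpretation crv: coeff_hom "\<lambda>c. [:c:] :: complex poly"
  by unfold_locales (simp_all add: one_pCons)

definition curve_pull :: "(3 \<Rightarrow> complex poly) \<Rightarrow> poly3 \<Rightarrow> complex poly" where
  "curve_pull \<phi> = psubst (\<lambda>c. [:c:]) \<phi>"

lemma curve_pull_simps:
  "curve_pull \<phi> 0 = 0" "curve_pull \<phi> 1 = 1" "curve_pull \<phi> (const3 c) = [:c:]" "curve_pull \<phi> (var3 i) = \<phi> i"
  "curve_pull \<phi> (p + q) = curve_pull \<phi> p + curve_pull \<phi> q" "curve_pull \<phi> (p * q) = curve_pull \<phi> p * curve_pull \<phi> q"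
  "curve_pull \<phi> (- p) = - curve_pull \<phi> p" "curve_pull \<phi> (p - q) = curve_pull \<phi> p - curve_pull \<phi> q"
  "curve_pull \<phi> (sum g A) = (\<Sum>i\<in>A. curve_pull \<phi> (g i))" "curve_pull \<phi> (p ^ n) = curve_pull \<phi> p ^ n"
  unfolding curve_pull_def
  by (rule crv.psubst_0 crv.psubst_1 crv.psubst_const crv.psubst_var crv.psubst_simps)+

lemma poly_curve_pull: "poly (curve_pull \<phi> p) t = poly_at p (\<chi> i. poly (\<phi> i) t)"
  by (induction p rule: poly3_induct) (simp_all add: curve_pull_simps poly_at_simps)

lemma pderiv_curve_pull: "pderiv (curve_pull \<phi> p) = (\<Sum>i\<in>UNIV. curve_pull \<phi> (pderiv3 i p) * pderiv (\<phi> i))"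
proof (induction p rule: poly3_induct)
  case (const c)
  then show ?case by (simp add: curve_pull_simps pderiv_pCons)
next
  case (add p q)
  then show ?case by (simp add: curve_pull_simps pderiv3_add pderiv_add distrib_right sum.distrib)
next
  case (var j p)
  have "(\<Sum>i\<in>UNIV. curve_pull \<phi> (pderiv3 i (var3 j * p)) * pderiv (\<phi> i))
     = (\<Sum>i\<in>UNIV. (if i = j then curve_pull \<phi> p * pderiv (\<phi> i) else 0) + \<phi> j * (curve_pull \<phi> (pderiv3 i p) * pderiv (\<phi> i)))"
    by (intro sum.cong refl) (simp add: pderiv3_mult curve_pull_simps algebra_simps)
  also have "\<dots> = curve_pull \<phi> p * pderiv (\<phi> j) + \<phi> j * pderiv (curve_pull \<phi> p)"
    using var by (simp add: sum.distrib sum_distrib_left[symmetric])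
  finally show ?case by (simp add: curve_pull_simps pderiv_mult algebra_simps)
qed

lemma coeff_mult_top:
  assumes "degree p \<le> n" "degree q \<le> m"
  shows "coeff (p * q) (n + m) = coeff p n * coeff q m"
proof -
  have "coeff (p * q) (n + m) = (\<Sum>i\<le>n + m. if i = n then coeff p n * coeff q m else 0)"
    unfolding coeff_mult
  proof (intro sum.cong refl)
    fix i assume "i \<in> {..n + m}"
    show "coeff p i * coeff q (n + m - i) = (if i = n then coeff p n * coeff q m else 0)"
      using assms by (cases i n rule: linorder_cases) (auto simp: coeff_eq_0)
  qed
  then show ?thesis by simp
qed

text \<open>\<open>n * k\<close> is a formal degree. The coefficient there is the value of
  \<open>p\<close> at the image of the parameter infinity, and it may be zero.\<close>

lemma degree_curve_pull:
  assumes "p \<in> forms k" "\<And>i. degree (\<phi> i) \<le> n"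
  shows "degree (curve_pull \<phi> p) \<le> n * k \<and> coeff (curve_pull \<phi> p) (n * k) = poly_at p (\<chi> i. coeff (\<phi> i) n)"
  using assms(1)
proof (induction rule: forms_induct)
  case (add k p q)
  then show ?case by (simp add: curve_pull_simps poly_at_simps degree_add_le)
next
  case (var k i p)
  have "degree (\<phi> i * curve_pull \<phi> p) \<le> n + n * k"
    using degree_mult_le[of "\<phi> i" "curve_pull \<phi> p"] assms(2)[of i] var by (meson add_mono le_trans)
  moreover have "coeff (\<phi> i * curve_pull \<phi> p) (n + n * k) = coeff (\<phi> i) n * coeff (curve_pull \<phi> p) (n * k)"
    using var assms(2) by (intro coeff_mult_top) auto
  ultimately show ?case using var by (simp add: curve_pull_simps poly_at_simps)
qed (simp_all add: curve_pull_simps poly_at_simps)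

definition line_restr :: "complex^3 \<Rightarrow> complex^3 \<Rightarrow> poly3 \<Rightarrow> complex poly" where
  "line_restr u v = curve_pull (\<lambda>i. [:u $ i, v $ i:])"

lemma line_restr_simps:
  "line_restr u v 0 = 0" "line_restr u v 1 = 1" "line_restr u v (const3 c) = [:c:]" "line_restr u v (var3 i) = [:u $ i, v $ i:]"
  "line_restr u v (p + q) = line_restr u v p + line_restr u v q" "line_restr u v (p * q) = line_restr u v p * line_restr u v q"
  "line_restr u v (- p) = - line_restr u v p" "line_restr u v (p - q) = line_restr u v p - line_restr u v q"
  "line_restr u v (sum g A) = (\<Sum>i\<in>A. line_restr u v (g i))" "line_restr u v (p ^ n) = line_restr u v p ^ n"
  unfolding line_restr_def by (rule curve_pull_simps)+

lemma poly_line_restr: "poly (line_restr u v p) t = poly_at p (u + t *s v)"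
proof -
  have "(\<chi> i. poly [:u $ i, v $ i:] t) = u + t *s v" by (simp add: vec_eq_iff)
  then show ?thesis unfolding line_restr_def poly_curve_pull by simp
qed

lemma degree_line_restr:
  assumes "p \<in> forms k"
  shows "degree (line_restr u v p) \<le> k" "coeff (line_restr u v p) k = poly_at p v"
proof -
  have "(\<chi> i. coeff [:u $ i, v $ i:] 1) = v" by (simp add: vec_eq_iff)
  then show "degree (line_restr u v p) \<le> k" "coeff (line_restr u v p) k = poly_at p v"
    using degree_curve_pull[OF assms, of "\<lambda>i. [:u $ i, v $ i:]" 1] unfolding line_restr_def by (simp_all add: degree_pCons_le)
qed

definition dir_deriv :: "complex^3 \<Rightarrow> poly3 \<Rightarrow> poly3" where
  "dir_deriv v p = (\<Sum>i\<in>UNIV. const3 (v $ i) * pderiv3 i p)"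

lemma dir_deriv_forms: "p \<in> forms n \<Longrightarrow> dir_deriv v p \<in> forms (n - 1)"
  unfolding dir_deriv_def by (intro forms_sum forms_const3_mult pderiv3_forms)

lemma dir_deriv_mult: "dir_deriv v (p * q) = dir_deriv v p * q + p * dir_deriv v q"
  unfolding dir_deriv_def
  by (simp add: pderiv3_mult sum_distrib_left sum_distrib_right sum.distrib[symmetric] algebra_simps)

lemma pderiv_line_restr: "pderiv (line_restr u v p) = line_restr u v (dir_deriv v p)"
  unfolding line_restr_def pderiv_curve_pull dir_deriv_def curve_pull_simps
  by (simp add: pderiv_pCons mult.commute)

lemma euler_at:
  assumes "p \<in> forms n"
  shows "poly_at (dir_deriv v p) v = of_nat n * poly_at p v"
proof -
  have "poly_at (dir_deriv v p) v = poly_at (\<Sum>i\<in>UNIV. var3 i * pderiv3 i p) v"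
    unfolding dir_deriv_def by (simp add: poly_at_simps)
  also have "\<dots> = of_nat n * poly_at p v"
    unfolding euler_identity[OF assms] const3_of_nat[symmetric] by (simp add: poly_at_simps)
  finally show ?thesis .
qed

text \<open>A pencil of lines through \<open>v\<close>: the form \<open>B\<close> takes the value \<open>c A\<close> on the line through \<open>v\<close> and \<open>u c\<close>.\<close>

lemma pencil:
  fixes v :: "complex^3"
  assumes "v \<noteq> 0"
  obtains u w A B s t l where "A \<in> forms 1" "B \<in> forms 1" "\<And>c \<beta>. poly_at A (u c + \<beta> *s v) \<noteq> 0"
    "\<And>c \<beta>. poly_at B (u c + \<beta> *s v) = c * poly_at A (u c + \<beta> *s v)"
    "\<And>c. s c \<in> forms 1" "\<And>c. t c \<in> forms 1" "\<And>c. l c \<in> forms 1" "\<And>c. l c \<noteq> 0"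
    "\<And>c i. var3 i = const3 (u c $ i) * s c + const3 (v $ i) * t c + const3 (w $ i) * l c"
    "\<And>c. line_restr (u c) v (s c) = 1" "\<And>c. line_restr (u c) v (t c) = [:0, 1:]" "\<And>c. line_restr (u c) v (l c) = 0"
proof -
  obtain k where k: "v $ k \<noteq> 0" using nonvanishing_var assms by metis
  obtain i j where ij: "i \<noteq> j" "i \<noteq> k" "j \<noteq> k" "\<And>m. m = i \<or> m = j \<or> m = k"
  proof -
    have "(1::3) \<noteq> 2" "(1::3) \<noteq> 3" "(2::3) \<noteq> 3" by simp_all
    then show ?thesis using that[of 2 3] that[of 1 3] that[of 1 2] exhaust_3 by (metis (full_types))
  qed
  define u :: "complex \<Rightarrow> complex^3" where "u c = (\<chi> m. if m = i then 1 else if m = j then c else 0)" for c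
  define w :: "complex^3" where "w = (\<chi> m. if m = j then 1 else 0)"
  define A where "A = const3 (v $ k) * var3 i - const3 (v $ i) * var3 k"
  define B where "B = const3 (v $ k) * var3 j - const3 (v $ j) * var3 k"
  \<comment> \<open>\<open>s c\<close>, \<open>t c\<close>, \<open>l c\<close> are the linear
    coordinates dual to the basis \<open>u c\<close>, \<open>v\<close>, \<open>w\<close>.\<close>
  define s where "s = (\<lambda>c::complex. const3 (1 / v $ k) * A)"
  define t where "t = (\<lambda>c::complex. const3 (1 / v $ k) * var3 k)"
  define l where "l = (\<lambda>c. const3 (1 / v $ k) * (B - const3 c * A))"
  have uv: "u c $ i = 1" "u c $ j = c" "u c $ k = 0" "w $ i = 0" "w $ j = 1" "w $ k = 0" for c
    using ij by (auto simp: u_def w_def)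
  have inv: "const3 (1 / v $ k) * const3 (v $ k) = 1" using k by (simp flip: const3_simps(4))
  have inv2: "const3 (v $ k) * (const3 (1 / v $ k) * p) = p" for p
    using inv by (metis mult.assoc mult.commute mult.left_neutral)
  show thesis
  proof (rule that[of A B u s t l w])
    show AB: "A \<in> forms 1" "B \<in> forms 1" unfolding A_def B_def by (intro forms_diff forms_const3_mult forms_var3)+
    show "poly_at A (u c + \<beta> *s v) \<noteq> 0" for c \<beta> unfolding A_def using k by (simp add: poly_at_simps uv algebra_simps)
    show "poly_at B (u c + \<beta> *s v) = c * poly_at A (u c + \<beta> *s v)" for c \<beta>
      unfolding A_def B_def by (simp add: poly_at_simps uv algebra_simps)
    show "s c \<in> forms 1" "t c \<in> forms 1" "l c \<in> forms 1" for c
      unfolding s_def t_def l_def by (intro forms_const3_mult forms_var3 forms_diff AB)+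
    show "l c \<noteq> 0" for c
    proof
      assume "l c = 0"
      then have "poly_at (l c) (u (c + 1)) = 0" by (simp only: poly_at_simps)
      then show False using k by (simp add: l_def A_def B_def poly_at_simps uv)
    qed
    show "var3 m = const3 (u c $ m) * s c + const3 (v $ m) * t c + const3 (w $ m) * l c" for c m
    proof -
      have *: "const3 (1 / v $ k) * A = var3 i - const3 (1 / v $ k) * (const3 (v $ i) * var3 k)"
        "const3 (1 / v $ k) * B = var3 j - const3 (1 / v $ k) * (const3 (v $ j) * var3 k)"
        unfolding A_def B_def right_diff_distrib mult.assoc[symmetric] inv by simp_all
      consider "m = i" | "m = j" | "m = k" using ij(4) by blast
      then show ?thesis
      proof cases
        case 1
        show ?thesis unfolding 1 uv s_def t_def * by (simp add: algebra_simps)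
      next
        case 2
        show ?thesis unfolding 2 uv s_def t_def l_def right_diff_distrib mult.left_commute[of _ "const3 c" A] * by (simp add: algebra_simps)
      next
        case 3
        show ?thesis unfolding 3 uv t_def inv2 by simp
      qed
    qed
    have r: "line_restr (u c) v A = [:v $ k:]" "line_restr (u c) v B = [:c * v $ k:]" for c
      unfolding A_def B_def by (simp_all add: line_restr_simps uv algebra_simps)
    show "line_restr (u c) v (s c) = 1" for c using k by (simp add: s_def line_restr_simps r one_pCons)
    show "line_restr (u c) v (t c) = [:0, 1:]" for c using k by (simp add: t_def line_restr_simps uv)
    show "line_restr (u c) v (l c) = 0" for c using k by (simp add: l_def line_restr_simps r)
  qed
qed

text \<open>By the fundamental theorem of algebra every line of a pencil through a point off the
  curve meets the curve; the ratio B / A tells the lines, hence the intersection points,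
  apart.\<close>

lemma zero_locus_infinite:
  assumes "g \<in> forms n" "n > 0" "g \<noteq> 0"
  shows "infinite (zero_locus g)"
proof -
  obtain v where v: "poly_at g v \<noteq> 0" using poly_at_nonzero[OF assms(3)] .
  then have "v \<noteq> 0" using poly_at_zero_form[OF assms(1,2)] by auto
  then obtain u w A B s t l where AB: "A \<in> forms 1" "B \<in> forms 1" "\<And>c \<beta>. poly_at A (u c + \<beta> *s v) \<noteq> 0"
    "\<And>c \<beta>. poly_at B (u c + \<beta> *s v) = c * poly_at A (u c + \<beta> *s v)"
    by (rule pencil) blast
  have "\<exists>\<beta>. poly_at g (u c + \<beta> *s v) = 0" for c
  proof -
    let ?F = "line_restr (u c) v g"
    have "degree ?F = n" using degree_line_restr[OF assms(1), of "u c" v] v by (metis le_antisym le_degree)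
    then have "\<not> constant (poly ?F)" using assms(2) by (simp add: constant_degree)
    then obtain z where "poly ?F z = 0" using fundamental_theorem_of_algebra by blast
    then show ?thesis unfolding poly_line_restr by blast
  qed
  then obtain \<beta> where \<beta>: "\<And>c. poly_at g (u c + \<beta> c *s v) = 0" by metis
  let ?p = "\<lambda>c. u c + \<beta> c *s v"
  have A0: "poly_at A 0 = 0" using poly_at_zero_form[OF AB(1)] by simp
  have nz: "?p c \<noteq> 0" for c using AB(3)[of c "\<beta> c"] A0 by auto
  have inj: "inj (\<lambda>c. vec.span {?p c})"
  proof (rule injI)
    fix c c' assume "vec.span {?p c} = vec.span {?p c'}"
    then obtain k where k: "k \<noteq> 0" "?p c = k *s ?p c'" using vec_span_eq_iff[OF nz] by blast
    have "poly_at A (?p c) = k * poly_at A (?p c')" "poly_at B (?p c) = k * poly_at B (?p c')"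
      unfolding k(2) poly_at_scale[OF AB(1)] poly_at_scale[OF AB(2)] by simp_all
    then have "c * (k * poly_at A (?p c')) = k * (c' * poly_at A (?p c'))" using AB(4) by metis
    then show "c = c'" using k(1) AB(3)[of c' "\<beta> c'"] by simp
  qed
  have "range (\<lambda>c. vec.span {?p c}) \<subseteq> zero_locus g" unfolding zero_locus_def using nz \<beta> by blast
  moreover have "infinite (range (\<lambda>c. vec.span {?p c}))"
    using finite_imageD[OF _ inj] infinite_UNIV_char_0[where 'a = complex] by blast
  ultimately show ?thesis using finite_subset by blast
qed

section \<open>Nodes\<close>

lemma parallel_vectors:
  fixes a b :: "complex^3"
  assumes "a \<noteq> 0" "\<And>i j. a $ i * b $ j = a $ j * b $ i"
  obtains c where "b = c *s a"
proof -
  obtain k where k: "a $ k \<noteq> 0" using nonvanishing_var assms(1) by metis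
  have "b = (b $ k / a $ k) *s a"
    using k assms(2)[of k] by (simp add: vec_eq_iff field_simps)
  then show ?thesis using that by blast
qed

lemma singular_partials: "singular_at f x \<Longrightarrow> poly_at (pderiv3 i f) x = 0"
  unfolding singular_at_def by blast

text \<open>Euler's identity for the partial derivatives, all of which vanish at
  \<open>x\<close>.\<close>

lemma hessian_point:
  assumes "f \<in> forms d" "singular_at f x"
  shows "(\<Sum>j\<in>UNIV. poly_at (pderiv3 i (pderiv3 j f)) x * x $ j) = 0"
proof -
  have "poly_at (dir_deriv x (pderiv3 i f)) x = 0"
    using euler_at[OF pderiv3_forms[OF assms(1)], of x i] singular_partials[OF assms(2)] by simp
  then show ?thesis unfolding dir_deriv_def
    by (simp add: poly_at_simps pderiv3_commute[of i] mult.commute)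
qed

text \<open>The quadratic Taylor term is unchanged by translation along the kernel of the Hessian. A
  product of two independent linear forms is unchanged only by translation along their common zeros,
  which form a line; that line contains \<open>x\<close>.\<close>

lemma node_hessian_kernel:
  assumes "f \<in> forms d" "node_at f x" "\<And>i. (\<Sum>j\<in>UNIV. poly_at (pderiv3 i (pderiv3 j f)) x * y $ j) = 0"
  obtains c where "y = c *s x"
proof -
  have sx: "singular_at f x" using assms(2) unfolding node_at_def by blast
  have x0: "x \<noteq> 0" using sx unfolding singular_at_def by blast
  obtain a b :: "complex^3" where ab: "a \<noteq> b" "vec.independent {a, b}"
    "\<And>z. taylor2 f x z = (\<Sum>i\<in>UNIV. a $ i * z $ i) * (\<Sum>i\<in>UNIV. b $ i * z $ i)"
    using assms(2) unfolding node_at_def by blast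
  let ?H = "\<lambda>i j. poly_at (pderiv3 i (pderiv3 j f)) x"
  have sym: "?H i j = ?H j i" for i j by (simp add: pderiv3_commute[of i j])
  have nonpar: "\<exists>i j. a $ i * b $ j \<noteq> a $ j * b $ i"
  proof (rule ccontr)
    assume c: "\<not> ?thesis"
    have "a \<noteq> 0" using ab(2) vec.dependent_zero[of "{a, b}"] by auto
    then obtain c where "b = c *s a" using parallel_vectors[of a b] c by blast
    then have "b \<in> vec.span {a}" unfolding vec_span_single by blast
    moreover have "{a, b} - {b} = {a}" using ab(1) by auto
    ultimately have "vec.dependent {a, b}" unfolding vec.dependent_def by auto
    then show False using ab(2) by blast
  qed
  have ker: "(\<Sum>i\<in>UNIV. a $ i * z $ i) = 0 \<and> (\<Sum>i\<in>UNIV. b $ i * z $ i) = 0"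
    if z: "\<And>i. (\<Sum>j\<in>UNIV. ?H i j * z $ j) = 0" for z
  proof -
    let ?A = "\<lambda>z::complex^3. \<Sum>i\<in>UNIV. a $ i * z $ i" and ?B = "\<lambda>z::complex^3. \<Sum>i\<in>UNIV. b $ i * z $ i"
    have inv: "?A (y + c *s z) * ?B (y + c *s z) = ?A y * ?B y" for y c
    proof -
      have h: "?H i 1 * z $ 1 + ?H i 2 * z $ 2 + ?H i 3 * z $ 3 = 0" for i using z[of i] unfolding sum_3 .
      have h2: "?H 1 i * z $ 1 + ?H 2 i * z $ 2 + ?H 3 i * z $ 3 = 0" for i using h[of i] sym by metis
      have "taylor2 f x (y + c *s z) = taylor2 f x y"
      proof -
        have "2 * taylor2 f x (y + c *s z) = 2 * taylor2 f x y
          + c * (y $ 1 * (?H 1 1 * z $ 1 + ?H 1 2 * z $ 2 + ?H 1 3 * z $ 3) + y $ 2 * (?H 2 1 * z $ 1 + ?H 2 2 * z $ 2 + ?H 2 3 * z $ 3)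
             + y $ 3 * (?H 3 1 * z $ 1 + ?H 3 2 * z $ 2 + ?H 3 3 * z $ 3))
          + c * (y $ 1 * (?H 1 1 * z $ 1 + ?H 2 1 * z $ 2 + ?H 3 1 * z $ 3) + y $ 2 * (?H 1 2 * z $ 1 + ?H 2 2 * z $ 2 + ?H 3 2 * z $ 3)
             + y $ 3 * (?H 1 3 * z $ 1 + ?H 2 3 * z $ 2 + ?H 3 3 * z $ 3))
          + c * c * (z $ 1 * (?H 1 1 * z $ 1 + ?H 1 2 * z $ 2 + ?H 1 3 * z $ 3) + z $ 2 * (?H 2 1 * z $ 1 + ?H 2 2 * z $ 2 + ?H 2 3 * z $ 3)
             + z $ 3 * (?H 3 1 * z $ 1 + ?H 3 2 * z $ 2 + ?H 3 3 * z $ 3))"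
          unfolding taylor2_def sum_3 by (simp add: algebra_simps)
        then show ?thesis unfolding h h2 by simp
      qed
      then show ?thesis unfolding ab(3) .
    qed
    have lin: "?A (y + c *s z) = ?A y + c * ?A z" "?B (y + c *s z) = ?B y + c * ?B z" for y z c
      unfolding sum_3 by (simp_all add: algebra_simps)
    obtain i j where ij: "a $ i * b $ j \<noteq> a $ j * b $ i" using nonpar by blast
    \<comment> \<open>\<open>y1\<close> and \<open>y2\<close> are zeros of just one of the two
      linear factors. Translating each of them by \<open>z\<close> and by 2 z gives two equations
      that can both hold only if the other factor's partner vanishes at \<open>z\<close>: A at
      \<open>z\<close> for \<open>y1\<close>, B at \<open>z\<close> for \<open>y2\<close>.\<close>
    define y1 :: "complex^3" where "y1 = (\<chi> m. if m = i then - (a $ j) else if m = j then a $ i else 0)"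
    define y2 :: "complex^3" where "y2 = (\<chi> m. if m = i then - (b $ j) else if m = j then b $ i else 0)"
    have ijn: "i \<noteq> j" using ij by auto
    have two: "(\<Sum>m\<in>UNIV. g m * (if m = i then p else if m = j then q else 0)) = g i * p + g j * q" for g :: "3 \<Rightarrow> complex" and p q
    proof -
      have "(\<Sum>m\<in>UNIV. g m * (if m = i then p else if m = j then q else 0)) = (\<Sum>m\<in>UNIV. (if m = i then g i * p else 0) + (if m = j then g j * q else 0))"
        using ijn by (intro sum.cong) auto
      then show ?thesis by (simp add: sum.distrib)
    qed
    have y1: "?A y1 = 0" "?B y1 \<noteq> 0" and y2: "?B y2 = 0" "?A y2 \<noteq> 0"
      unfolding y1_def y2_def vec_lambda_beta two using ij by (auto simp: algebra_simps)
    have "?A z * (?B y1 + ?B z) = 0" "2 * ?A z * (?B y1 + 2 * ?B z) = 0"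
      using inv[of y1 1] inv[of y1 2] unfolding lin y1 by simp_all
    then have A: "?A z = 0" using y1(2) by (auto simp: add_eq_0_iff)
    have "(?A y2 + ?A z) * ?B z = 0" "(?A y2 + 2 * ?A z) * (2 * ?B z) = 0"
      using inv[of y2 1] inv[of y2 2] unfolding lin y2 by simp_all
    then have "?B z = 0" using y2(2) by (auto simp: add_eq_0_iff)
    then show ?thesis using A by blast
  qed
  have ay: "(\<Sum>i\<in>UNIV. a $ i * y $ i) = 0" "(\<Sum>i\<in>UNIV. b $ i * y $ i) = 0" using ker[of y] assms(3) by blast+
  have ax: "(\<Sum>i\<in>UNIV. a $ i * x $ i) = 0" "(\<Sum>i\<in>UNIV. b $ i * x $ i) = 0" using ker[of x] hessian_point[OF assms(1) sx] by blast+
  \<comment> \<open>The cross product of \<open>a\<close> and \<open>b\<close>, which spans the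
    common zeros of the two linear forms.\<close>
  define n :: "complex^3" where "n = point3 (a $ 2 * b $ 3 - a $ 3 * b $ 2) (a $ 3 * b $ 1 - a $ 1 * b $ 3) (a $ 1 * b $ 2 - a $ 2 * b $ 1)"
  have n0: "n \<noteq> 0"
  proof
    assume "n = 0"
    then have "n $ 1 = 0" "n $ 2 = 0" "n $ 3 = 0" by simp_all
    then have e: "a $ 2 * b $ 3 = a $ 3 * b $ 2" "a $ 3 * b $ 1 = a $ 1 * b $ 3" "a $ 1 * b $ 2 = a $ 2 * b $ 1"
      unfolding n_def by simp_all
    have "a $ i * b $ j = a $ j * b $ i" for i j using exhaust_3[of i] exhaust_3[of j] e by auto
    then show False using nonpar by blast
  qed
  have par: "\<exists>c. z = c *s n" if "(\<Sum>i\<in>UNIV. a $ i * z $ i) = 0" "(\<Sum>i\<in>UNIV. b $ i * z $ i) = 0" for z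
  proof -
    have e: "a $ 1 * z $ 1 + a $ 2 * z $ 2 + a $ 3 * z $ 3 = 0" "b $ 1 * z $ 1 + b $ 2 * z $ 2 + b $ 3 * z $ 3 = 0"
      using that unfolding sum_3 by auto
    have "n $ 1 * z $ 2 - n $ 2 * z $ 1 = b $ 3 * (a $ 1 * z $ 1 + a $ 2 * z $ 2 + a $ 3 * z $ 3) - a $ 3 * (b $ 1 * z $ 1 + b $ 2 * z $ 2 + b $ 3 * z $ 3)"
      "n $ 2 * z $ 3 - n $ 3 * z $ 2 = b $ 1 * (a $ 1 * z $ 1 + a $ 2 * z $ 2 + a $ 3 * z $ 3) - a $ 1 * (b $ 1 * z $ 1 + b $ 2 * z $ 2 + b $ 3 * z $ 3)"
      "n $ 3 * z $ 1 - n $ 1 * z $ 3 = b $ 2 * (a $ 1 * z $ 1 + a $ 2 * z $ 2 + a $ 3 * z $ 3) - a $ 2 * (b $ 1 * z $ 1 + b $ 2 * z $ 2 + b $ 3 * z $ 3)"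
      unfolding n_def by (simp_all add: algebra_simps)
    then have f: "n $ 1 * z $ 2 = n $ 2 * z $ 1" "n $ 2 * z $ 3 = n $ 3 * z $ 2" "n $ 3 * z $ 1 = n $ 1 * z $ 3"
      unfolding e by simp_all
    have "n $ i * z $ j = n $ j * z $ i" for i j using exhaust_3[of i] exhaust_3[of j] f by auto
    then show ?thesis using parallel_vectors[OF n0] by metis
  qed
  obtain p q where pq: "y = p *s n" "x = q *s n" using par ay ax by blast
  then have "q \<noteq> 0" using x0 by auto
  then have "y = (p / q) *s x" unfolding pq by (simp add: vector_smult_assoc)
  then show ?thesis using that by blast
qed

section \<open>A transversal line\<close>

lemma form_pos_of_irreducible:
  assumes "irreducible \<pi>" "\<pi> \<in> forms a"
  shows "a > 0"
proof (rule ccontr)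
  assume "\<not> a > 0"
  then have "\<pi> \<in> forms 0" using assms(2) by simp
  then obtain c where c: "\<pi> = const3 c" by (rule forms_0_const)
  have "c \<noteq> 0" using assms(1) c unfolding irreducible_def by auto
  then show False using const3_dvd_1 assms(1) c unfolding irreducible_def by auto
qed

text \<open>Since \<pi> divides \<open>f\<close> only once, it would have to divide its own
  derivative along \<open>v\<close>. That derivative has smaller degree, so it would be zero, and
  Euler's identity at \<open>v\<close> would make \<pi> vanish at \<open>v\<close>.\<close>

lemma prime_factor_not_dvd_dir_deriv:
  assumes "squarefree f" "f \<in> forms d" "poly_at f v \<noteq> 0" "irreducible \<pi>" "\<pi> dvd f"
  shows "\<not> \<pi> dvd dir_deriv v f"
proof
  assume dv: "\<pi> dvd dir_deriv v f"
  obtain h where h: "f = \<pi> * h" using assms(5) by (auto elim: dvdE)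
  have f0: "f \<noteq> 0" using assms(1) not_squarefree_0 by blast
  have pr: "prime_elem \<pi>" using irreducible_imp_prime_elem_poly3[OF assms(4)] .
  have fd: "\<pi> * h \<in> forms d" "\<pi> * h \<noteq> 0" using h assms(2) f0 by simp_all
  obtain a where a: "\<pi> \<in> forms a" using form_factor[OF fd] .
  have "a > 0" using form_pos_of_irreducible[OF assms(4) a] .
  have "\<not> \<pi> dvd h"
  proof
    assume "\<pi> dvd h"
    then have "\<pi> ^ 2 dvd f" unfolding h power2_eq_square by (intro mult_dvd_mono dvd_refl)
    then show False using assms(1,4) unfolding squarefree_def irreducible_def by blast
  qed
  moreover have "\<pi> dvd dir_deriv v \<pi> * h"
    using dv unfolding h dir_deriv_mult by (simp add: dvd_add_left_iff)
  ultimately have "\<pi> dvd dir_deriv v \<pi>" using pr by (auto simp: prime_elem_dvd_mult_iff)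
  then obtain q where q: "dir_deriv v \<pi> = \<pi> * q" by (auto elim: dvdE)
  have "\<pi> * q \<in> forms (a - 1)" using dir_deriv_forms[OF a, of v] q by simp
  moreover have "\<pi> \<noteq> 0" using f0 h by auto
  ultimately have "q = 0" using form_cofactor(1)[OF a, of q "a - 1"] \<open>a > 0\<close> by (cases "q = 0") auto
  then have "of_nat a * poly_at \<pi> v = 0" using euler_at[OF a, of v] q by (simp add: poly_at_simps)
  then show False using assms(3) \<open>a > 0\<close> unfolding h by (simp add: poly_at_simps)
qed

lemma coprime_complex_poly_iff:
  fixes p q :: "complex poly"
  assumes "p \<noteq> 0" "\<And>z. poly p z = 0 \<Longrightarrow> poly q z \<noteq> 0"
  shows "coprime p q"
proof (rule coprimeI)
  fix c assume c: "c dvd p" "c dvd q"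
  have "degree c = 0"
  proof (rule ccontr)
    assume "degree c \<noteq> 0"
    then have "\<not> constant (poly c)" by (simp add: constant_degree)
    then obtain z where "poly c z = 0" using fundamental_theorem_of_algebra by blast
    then have "poly p z = 0" "poly q z = 0" using c by (auto elim!: dvdE)
    then show False using assms(2) by blast
  qed
  moreover have "c \<noteq> 0" using c(1) assms(1) by auto
  ultimately show "is_unit c" by (simp add: is_unit_iff_degree)
qed

text \<open>A line through \<open>v\<close> fails to meet the curve in d distinct points exactly if
  it contains a common zero of \<open>f\<close> and its derivative along \<open>v\<close>. The
  intersection bound leaves finitely many of these, so a general line of the pencil avoids
  them.\<close>

lemma transversal_line:
  assumes "squarefree f" "f \<in> forms d" "d > 0"
  obtains u v w s t l where "s \<in> forms 1" "t \<in> forms 1" "l \<in> forms 1" "l \<noteq> 0"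
    "\<And>i. var3 i = const3 (u $ i) * s + const3 (v $ i) * t + const3 (w $ i) * l"
    "line_restr u v s = 1" "line_restr u v t = [:0, 1:]" "line_restr u v l = 0"
    "degree (line_restr u v f) = d" "coprime (line_restr u v f) (pderiv (line_restr u v f))"
proof -
  have f0: "f \<noteq> 0" using assms(1) not_squarefree_0 by blast
  obtain v where v: "poly_at f v \<noteq> 0" using poly_at_nonzero[OF f0] .
  then have v0: "v \<noteq> 0" using poly_at_zero_form[OF assms(2,3)] by auto
  obtain PF c where PF: "finite PF" "\<And>\<pi>. \<pi> \<in> PF \<Longrightarrow> irreducible \<pi>" "f = const3 c * \<Prod>PF"
    using squarefree_factorization[OF assms(1)] by metis
  let ?g = "dir_deriv v f"
  have g: "?g \<in> forms (d - 1)" using dir_deriv_forms[OF assms(2)] .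
  let ?Z = "\<Union>\<pi>\<in>PF. zero_locus \<pi> \<inter> zero_locus ?g"
  have "finite (zero_locus \<pi> \<inter> zero_locus ?g)" if "\<pi> \<in> PF" for \<pi>
  proof -
    have dv: "\<pi> dvd f" unfolding PF(3) using that PF(1) by (intro dvd_mult dvd_prodI)
    then obtain h where h: "f = \<pi> * h" by (auto elim: dvdE)
    have fd: "\<pi> * h \<in> forms d" "\<pi> * h \<noteq> 0" using h assms(2) f0 by simp_all
    obtain a where a: "\<pi> \<in> forms a" using form_factor[OF fd] .
    show ?thesis using prime_form_Int_finite[OF irreducible_imp_prime_elem_poly3[OF PF(2)[OF that]] a g
       prime_factor_not_dvd_dir_deriv[OF assms(1,2) v PF(2)[OF that] dv]] .
  qed
  then have Zfin: "finite ?Z" using PF(1) by blast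
  obtain u w A B s t l where AB: "A \<in> forms 1" "B \<in> forms 1" "\<And>c \<beta>. poly_at A (u c + \<beta> *s v) \<noteq> 0"
    "\<And>c \<beta>. poly_at B (u c + \<beta> *s v) = c * poly_at A (u c + \<beta> *s v)"
    "\<And>c. s c \<in> forms 1" "\<And>c. t c \<in> forms 1" "\<And>c. l c \<in> forms 1" "\<And>c. l c \<noteq> 0"
    "\<And>c i. var3 i = const3 (u c $ i) * s c + const3 (v $ i) * t c + const3 (w $ i) * l c"
    "\<And>c. line_restr (u c) v (s c) = 1" "\<And>c. line_restr (u c) v (t c) = [:0, 1:]" "\<And>c. line_restr (u c) v (l c) = 0"
    by (rule pencil[OF v0]) blast
  define r where "r P = (SOME x. P = vec.span {x})" for P :: "(complex^3) set"
  \<comment> \<open>B / A is the parameter of the line of the pencil through the given point. A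
    point with A = 0 contributes the default value 0, just one more parameter to avoid.\<close>
  let ?bad = "(\<lambda>P. poly_at B (r P) / poly_at A (r P)) ` ?Z"
  have "finite ?bad" using Zfin by blast
  then obtain c0 where c0: "c0 \<notin> ?bad" using ex_new_if_finite[OF infinite_UNIV_char_0[where 'a = complex]] by blast
  let ?F = "line_restr (u c0) v f"
  have deg: "degree ?F = d" using degree_line_restr[OF assms(2), of "u c0" v] v by (metis le_antisym le_degree)
  then have F0: "?F \<noteq> 0" using assms(3) by auto
  have cop: "coprime ?F (pderiv ?F)"
  proof (rule coprime_complex_poly_iff[OF F0])
    fix z assume z: "poly ?F z = 0"
    let ?x = "u c0 + z *s v"
    show "poly (pderiv ?F) z \<noteq> 0"
    proof
      assume z': "poly (pderiv ?F) z = 0"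
      have fx: "poly_at f ?x = 0" using z unfolding poly_line_restr .
      have gx: "poly_at ?g ?x = 0" using z' unfolding pderiv_line_restr poly_line_restr .
      have A0: "poly_at A 0 = 0" using poly_at_zero_form[OF AB(1)] by simp
      have x0: "?x \<noteq> 0" using AB(3)[of c0 z] A0 by auto
      have "c \<noteq> 0" using f0 PF(3) by auto
      have "(\<Prod>\<pi>\<in>PF. poly_at \<pi> ?x) = 0" using fx \<open>c \<noteq> 0\<close> unfolding PF(3) by (simp add: poly_at_simps)
      then obtain \<pi> where \<pi>: "\<pi> \<in> PF" "poly_at \<pi> ?x = 0" using PF(1) by auto
      let ?P = "vec.span {?x}"
      have PZ: "?P \<in> ?Z" using \<pi> x0 gx unfolding zero_locus_def by blast
      have "?P = vec.span {r ?P}" unfolding r_def by (rule someI) (rule refl)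
      then obtain k where k: "k \<noteq> 0" "?x = k *s r ?P" using vec_span_eq_iff[OF x0] by blast
      have "poly_at A ?x = k * poly_at A (r ?P)" "poly_at B ?x = k * poly_at B (r ?P)"
        using poly_at_scale[OF AB(1), of k "r ?P"] poly_at_scale[OF AB(2), of k "r ?P"] unfolding k(2)[symmetric] by simp_all
      then have "c0 * (k * poly_at A (r ?P)) = k * poly_at B (r ?P)" "poly_at A (r ?P) \<noteq> 0"
        using AB(3,4)[of c0 z] by auto
      then have "c0 = poly_at B (r ?P) / poly_at A (r ?P)" using k(1) by (simp add: field_simps)
      then show False using c0 PZ by blast
    qed
  qed
  show ?thesis
    by (rule that[of "s c0" "t c0" "l c0" "u c0" v w]) (rule AB deg cop)+
qed

section \<open>Graded pieces and binary forms\<close>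

lemma graded_mult:
  assumes "p \<in> graded_piece a" "q \<in> graded_piece b"
  shows "p * q \<in> graded_piece (a + b)"
  unfolding graded_piece_def
proof clarify
  fix k assume "k \<in> Poly_Mapping.keys (p * q)"
  then obtain x y where "x \<in> Poly_Mapping.keys p" "y \<in> Poly_Mapping.keys q" "k = x + y"
    using keys_mult[of p q] by blast
  then show "int (mdeg k) = a + b" using assms unfolding graded_piece_def by (simp add: mdeg_add)
qed

lemma graded_cong: "p \<in> graded_piece a \<Longrightarrow> a = b \<Longrightarrow> p \<in> graded_piece b"
  by simp

lemma graded_nonneg: "p \<in> graded_piece k \<Longrightarrow> p \<noteq> 0 \<Longrightarrow> k \<ge> 0"
  unfolding graded_piece_def by (metis (mono_tags, lifting) keys_eq_empty equals0I mem_Collect_eq of_nat_0_le_iff)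

lemma graded_const3: "p \<in> graded_piece k \<Longrightarrow> const3 c * p \<in> graded_piece k"
  using graded_mult[OF forms_const3, of p k c] by simp

lemma graded_uminus: "p \<in> graded_piece k \<Longrightarrow> - p \<in> graded_piece k"
  using graded_const3[of p k "-1"] by simp

lemma graded_diff: "p \<in> graded_piece k \<Longrightarrow> q \<in> graded_piece k \<Longrightarrow> p - q \<in> graded_piece k"
  using forms_add[of p k "- q"] graded_uminus by simp

text \<open>Homogenization of \<open>F\<close> in degree \<open>j\<close>. It lifts polynomials on a
  line to forms, and it also clears denominators in a polynomial expression of a ratio t /
  s.\<close>

definition binform :: "poly3 \<Rightarrow> poly3 \<Rightarrow> nat \<Rightarrow> complex poly \<Rightarrow> poly3" where
  "binform s t j F = (\<Sum>i\<le>j. const3 (coeff F i) * (s ^ (j - i) * t ^ i))"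

lemma binform_forms:
  assumes "s \<in> forms 1" "t \<in> forms 1"
  shows "binform s t j F \<in> forms j"
  unfolding binform_def
proof (intro forms_sum forms_const3_mult)
  fix i assume "i \<in> {..j}"
  then have "1 * (j - i) + 1 * i = j" by simp
  then show "s ^ (j - i) * t ^ i \<in> forms j"
    using forms_mult[OF forms_power[OF assms(1), of "j - i"] forms_power[OF assms(2), of i]] by (simp only:)
qed

lemma binform_add: "binform s t j (F + G) = binform s t j F + binform s t j G"
  unfolding binform_def by (simp add: distrib_right sum.distrib)

lemma binform_0: "binform s t j 0 = 0"
  unfolding binform_def by simp

lemma binform_smult: "binform s t j (smult a F) = const3 a * binform s t j F"
  unfolding binform_def by (simp add: sum_distrib_left mult.assoc)

lemma binform_Suc_deg:
  assumes "degree F \<le> j"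
  shows "binform s t (Suc j) F = s * binform s t j F"
proof -
  have "coeff F (Suc j) = 0" using assms by (simp add: coeff_eq_0)
  then have "binform s t (Suc j) F = (\<Sum>i\<le>j. const3 (coeff F i) * (s ^ (Suc j - i) * t ^ i))"
    unfolding binform_def by simp
  also have "\<dots> = (\<Sum>i\<le>j. s * (const3 (coeff F i) * (s ^ (j - i) * t ^ i)))"
    by (intro sum.cong refl) (simp add: Suc_diff_le mult_ac)
  finally show ?thesis unfolding binform_def sum_distrib_left .
qed

lemma binform_pCons_0: "binform s t (Suc j) (pCons 0 F) = t * binform s t j F"
proof -
  have "binform s t (Suc j) (pCons 0 F) = (\<Sum>i\<le>j. const3 (coeff F i) * (s ^ (j - i) * t ^ Suc i))"
    unfolding binform_def sum.atMost_Suc_shift by simp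
  also have "\<dots> = (\<Sum>i\<le>j. t * (const3 (coeff F i) * (s ^ (j - i) * t ^ i)))"
    by (intro sum.cong refl) (simp add: mult_ac)
  finally show ?thesis unfolding binform_def sum_distrib_left .
qed

lemma binform_linear_factor:
  assumes "degree F \<le> j"
  shows "binform s t (Suc j) ([:a, b:] * F) = (const3 a * s + const3 b * t) * binform s t j F"
proof -
  have "[:a, b:] * F = smult a F + smult b (pCons 0 F)" by simp
  then show ?thesis
    by (simp only: binform_add binform_smult binform_Suc_deg[OF assms] binform_pCons_0 distrib_right mult.assoc)
qed

text \<open>The power of \<open>s\<close> accounts for the degree missing from \<open>F\<close>. One
  list of roots serves all \<open>s\<close> and \<open>t\<close>, so the factorization can also be
  applied to forms that are not linear.\<close>

lemma binform_factor:
  assumes "F \<noteq> 0" "degree F \<le> m"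
  shows "\<exists>k cs i. k \<noteq> 0 \<and> (\<forall>s t. binform s t m F = const3 k * s ^ i * prod_list (map (\<lambda>c. t - const3 c * s) cs))"
  using assms
proof (induction "degree F" arbitrary: F m)
  case 0
  then obtain k where k: "F = [:k:]" by (metis degree_eq_zeroE)
  have "binform s t m [:k:] = const3 k * s ^ m" for s t
  proof -
    have "binform s t m [:k:] = (\<Sum>i\<le>m. if i = 0 then const3 k * s ^ m else 0)"
      unfolding binform_def by (intro sum.cong) (auto simp: coeff_pCons split: nat.splits)
    then show ?thesis by simp
  qed
  then have "\<forall>s t. binform s t m F = const3 k * s ^ m * prod_list (map (\<lambda>c. t - const3 c * s) [])" using k by simp
  moreover have "k \<noteq> 0" using k 0 by simp
  ultimately show ?case by blast
next
  case (Suc n)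
  then have "\<not> constant (poly F)" by (simp add: constant_degree)
  then obtain c where "poly F c = 0" using fundamental_theorem_of_algebra by blast
  then obtain G where G: "F = [:- c, 1:] * G" by (auto simp: poly_eq_0_iff_dvd elim: dvdE)
  have G0: "G \<noteq> 0" using G Suc(3) by auto
  have dG: "degree F = Suc (degree G)" unfolding G using degree_mult_eq[of "[:- c, 1:]" G] G0 by simp
  obtain m' where m': "m = Suc m'" using Suc(4) dG by (cases m) auto
  have d: "n = degree G" "degree G \<le> m'" using dG Suc(2,4) m' by auto
  obtain k cs i where IH: "k \<noteq> 0" "\<And>s t. binform s t m' G = const3 k * s ^ i * prod_list (map (\<lambda>c. t - const3 c * s) cs)"
    using Suc(1)[OF d(1) G0 d(2)] by blast
  have "binform s t m F = const3 k * s ^ i * prod_list (map (\<lambda>c. t - const3 c * s) (c # cs))" for s t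
    unfolding G m' binform_linear_factor[OF d(2)] IH(2) by (simp add: mult_ac)
  then show ?case using IH(1) by blast
qed

text \<open>In the chart l = 1 this is division by the maximal ideal of the point \<open>x\<close>.
  The integer index makes the quotients vanish when \<open>q\<close> is a constant.\<close>

lemma point_decomposition:
  assumes "q \<in> forms n" "l \<in> forms 1"
  shows "\<exists>A. (\<forall>i. A i \<in> graded_piece (int n - 1)) \<and>
    q - const3 (poly_at q x) * l ^ n = (\<Sum>i\<in>UNIV. A i * (var3 i - const3 (x $ i) * l))"
  using assms(1)
proof (induction rule: forms_induct)
  case (const c)
  then show ?case by (intro exI[of _ "\<lambda>_. 0"]) (simp add: poly_at_simps)
next
  case (zero n)
  then show ?case by (intro exI[of _ "\<lambda>_. 0"]) (simp add: poly_at_simps)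
next
  case (add n p q)
  then obtain A B where A: "\<And>i. A i \<in> graded_piece (int n - 1)" "p - const3 (poly_at p x) * l ^ n = (\<Sum>i\<in>UNIV. A i * (var3 i - const3 (x $ i) * l))"
    and B: "\<And>i. B i \<in> graded_piece (int n - 1)" "q - const3 (poly_at q x) * l ^ n = (\<Sum>i\<in>UNIV. B i * (var3 i - const3 (x $ i) * l))"
    by blast
  have "p + q - const3 (poly_at (p + q) x) * l ^ n = (p - const3 (poly_at p x) * l ^ n) + (q - const3 (poly_at q x) * l ^ n)"
    by (simp add: poly_at_simps algebra_simps)
  also have "\<dots> = (\<Sum>i\<in>UNIV. (A i + B i) * (var3 i - const3 (x $ i) * l))"
    unfolding A B by (simp add: distrib_right sum.distrib)
  finally show ?case using A(1) B(1) forms_add by (intro exI[of _ "\<lambda>i. A i + B i"]) blast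
next
  case (var n k p)
  then obtain A where A: "\<And>i. A i \<in> graded_piece (int n - 1)" "p - const3 (poly_at p x) * l ^ n = (\<Sum>i\<in>UNIV. A i * (var3 i - const3 (x $ i) * l))"
    by blast
  let ?B = "\<lambda>i. (if i = k then p else 0) + const3 (x $ k) * l * A i"
  have "var3 k * p - const3 (poly_at (var3 k * p) x) * l ^ Suc n
      = p * (var3 k - const3 (x $ k) * l) + const3 (x $ k) * l * (p - const3 (poly_at p x) * l ^ n)"
    by (simp add: poly_at_simps algebra_simps)
  also have "\<dots> = (\<Sum>i\<in>UNIV. ?B i * (var3 i - const3 (x $ i) * l))"
  proof -
    have "(\<Sum>i\<in>UNIV. ?B i * (var3 i - const3 (x $ i) * l))
      = (\<Sum>i\<in>UNIV. (if i = k then p * (var3 k - const3 (x $ k) * l) else 0) + const3 (x $ k) * l * (A i * (var3 i - const3 (x $ i) * l)))"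
      by (intro sum.cong) (auto simp: distrib_right mult.assoc)
    then show ?thesis unfolding A(2) by (simp add: sum.distrib sum_distrib_left)
  qed
  finally have 1: "var3 k * p - const3 (poly_at (var3 k * p) x) * l ^ Suc n = (\<Sum>i\<in>UNIV. ?B i * (var3 i - const3 (x $ i) * l))" .
  have 2: "?B i \<in> graded_piece (int (Suc n) - 1)" for i
  proof (rule forms_add)
    show "(if i = k then p else 0) \<in> graded_piece (int (Suc n) - 1)" using var(1) by simp
    show "const3 (x $ k) * l * A i \<in> graded_piece (int (Suc n) - 1)"
      using graded_cong[OF graded_mult[OF graded_const3[OF assms(2)] A(1)], of "int (Suc n) - 1" "x $ k" i] by simp
  qed
  show ?case by (rule exI[of _ ?B]) (use 1 2 in blast)
qed

section \<open>Duality for the residual complete intersection\<close>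

text \<open>
  The line \<open>l = 0\<close> is transversal to the curve, so the restrictions \<open>P\<close>, \<open>Q\<close> of two partial derivatives
  to it are coprime and the quotient by \<open>gu\<close>, \<open>gv\<close>, \<open>l\<close> is an Artinian complete intersection.
  Its socle functional is \<open>tau\<close>, and \<open>trace\<close> is the induced functional modulo \<open>gu\<close>, \<open>gv\<close>, \<open>l - 1\<close>.
\<close>

locale transversal_nodal =
  fixes f :: poly3 and d :: nat and u v w :: "complex^3" and s t l :: poly3
  assumes f: "f \<in> forms d" and d2: "d \<ge> 2"
    and nodal: "\<And>x. singular_at f x \<Longrightarrow> node_at f x"
    and stl: "s \<in> forms 1" "t \<in> forms 1" "l \<in> forms 1" "l \<noteq> 0"
    and coords: "\<And>i. var3 i = const3 (u $ i) * s + const3 (v $ i) * t + const3 (w $ i) * l"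
    and restr_stl: "line_restr u v s = 1" "line_restr u v t = [:0, 1:]" "line_restr u v l = 0"
    and degF: "degree (line_restr u v f) = d"
    and copF: "coprime (line_restr u v f) (pderiv (line_restr u v f))"
begin

abbreviation r :: "poly3 \<Rightarrow> complex poly" where "r \<equiv> line_restr u v"
abbreviation bin :: "nat \<Rightarrow> complex poly \<Rightarrow> poly3" where "bin \<equiv> binform s t"

definition e :: nat where "e = d - 1"
definition gu :: poly3 where "gu = dir_deriv u f"
definition gv :: poly3 where "gv = dir_deriv v f"
definition gw :: poly3 where "gw = dir_deriv w f"
definition P :: "complex poly" where "P = r gu"
definition Q :: "complex poly" where "Q = r gv"

lemma e1: "e \<ge> 1" and d_e: "d = Suc e"
  using d2 unfolding e_def by auto

lemma g_forms: "gu \<in> forms e" "gv \<in> forms e" "gw \<in> forms e"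
  unfolding gu_def gv_def gw_def e_def by (rule dir_deriv_forms[OF f])+

lemma Q_pderiv: "Q = pderiv (r f)"
  unfolding Q_def gv_def pderiv_line_restr ..

lemma degQ: "degree Q = e" and Q0: "Q \<noteq> 0"
proof -
  show "degree Q = e" unfolding Q_pderiv degree_pderiv degF e_def ..
  then show "Q \<noteq> 0" using e1 by auto
qed

lemma degP: "degree P \<le> e"
  unfolding P_def by (rule degree_line_restr[OF g_forms(1)])

lemma partial_g: "pderiv3 i f = pderiv3 i s * gu + pderiv3 i t * gv + pderiv3 i l * gw"
proof -
  have "pderiv3 i s * const3 (u $ k) + pderiv3 i t * const3 (v $ k) + pderiv3 i l * const3 (w $ k) = (if i = k then 1 else 0)" for k
  proof -
    have "pderiv3 i (var3 k) = pderiv3 i (const3 (u $ k) * s + const3 (v $ k) * t + const3 (w $ k) * l)"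
      using coords[of k] by (rule arg_cong)
    then show ?thesis by (simp add: pderiv3_simps mult.commute)
  qed
  note dl = this
  have "pderiv3 i s * gu + pderiv3 i t * gv + pderiv3 i l * gw
    = (\<Sum>k\<in>UNIV. (pderiv3 i s * const3 (u $ k) + pderiv3 i t * const3 (v $ k) + pderiv3 i l * const3 (w $ k)) * pderiv3 k f)"
    unfolding gu_def gv_def gw_def dir_deriv_def
    by (simp add: sum_distrib_left sum.distrib[symmetric] algebra_simps)
  also have "\<dots> = (\<Sum>k\<in>UNIV. if i = k then pderiv3 k f else 0)"
    by (intro sum.cong refl) (unfold dl, simp)
  finally show ?thesis by simp
qed

lemma euler_stl: "s * gu + t * gv + l * gw = of_nat d * f"
proof -
  have "of_nat d * f = (\<Sum>i\<in>UNIV. (const3 (u $ i) * s + const3 (v $ i) * t + const3 (w $ i) * l) * pderiv3 i f)"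
    unfolding euler_identity[OF f, symmetric] using coords by (intro sum.cong refl) (simp only:)
  also have "\<dots> = s * gu + t * gv + l * gw"
    unfolding gu_def gv_def gw_def dir_deriv_def
    by (simp add: sum_distrib_left sum.distrib[symmetric] algebra_simps)
  finally show ?thesis by simp
qed

text \<open>On the line Euler's identity says that P + X Q, with X the parameter, is d times the
  restriction of \<open>f\<close>, while \<open>Q\<close> is the derivative of that restriction. A
  common factor of \<open>P\<close> and \<open>Q\<close> would therefore produce a multiple
  root.\<close>

lemma coprimePQ: "coprime P Q"
proof (rule coprimeI)
  fix c assume c: "c dvd P" "c dvd Q"
  have "r (s * gu + t * gv + l * gw) = r (const3 (of_nat d) * f)"
    unfolding euler_stl const3_of_nat ..
  then have "P + [:0, 1:] * Q = smult (of_nat d) (r f)"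
    unfolding line_restr_simps restr_stl P_def Q_def by simp
  moreover have "c dvd P + [:0, 1:] * Q" using c by (intro dvd_add dvd_mult)
  ultimately have "c dvd smult (of_nat d) (r f)" by simp
  then have "c dvd r f" using d2 by (simp add: dvd_smult_iff)
  then show "is_unit c" using copF c(2) unfolding Q_pderiv by (metis coprime_common_divisor)
qed

lemma r_bin: "degree F \<le> j \<Longrightarrow> r (bin j F) = F"
  unfolding binform_def line_restr_simps restr_stl
  using poly_as_sum_of_monoms'[of F j] by (simp add: monom_altdef)

lemma bin_forms: "bin j F \<in> forms j"
  using binform_forms stl by blast

text \<open>\<open>bin j\<close> is a section of the restriction to the line l = 0, and the kernel
  of the restriction consists of multiples of \<open>l\<close>.\<close>

lemma lift:
  assumes "p \<in> forms j"
  shows "\<exists>q\<in>graded_piece (int j - 1). p = bin j (r p) + l * q"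
  using assms
proof (induction rule: forms_induct)
  case (const c)
  then show ?case by (intro bexI[of _ 0]) (simp_all add: binform_def line_restr_simps)
next
  case (zero n)
  then show ?case by (intro bexI[of _ 0]) (simp_all add: binform_0 line_restr_simps)
next
  case (add n p q)
  then obtain p' q' where "p' \<in> graded_piece (int n - 1)" "q' \<in> graded_piece (int n - 1)"
    and e: "p = bin n (r p) + l * p'" "q = bin n (r q) + l * q'" by blast
  moreover have "p + q = bin n (r (p + q)) + l * (p' + q')"
  proof -
    have "p + q = (bin n (r p) + l * p') + (bin n (r q) + l * q')" using e by (rule arg_cong2[where f = "(+)"])
    also have "\<dots> = bin n (r (p + q)) + l * (p' + q')" by (simp only: line_restr_simps binform_add distrib_left add_ac)
    finally show ?thesis .
  qed
  ultimately show ?case using forms_add by blast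
next
  case (var n i p)
  then obtain q where q: "q \<in> graded_piece (int n - 1)" "p = bin n (r p) + l * q" by blast
  let ?m = "const3 (u $ i) * s + const3 (v $ i) * t"
  have b: "bin (Suc n) (r (var3 i * p)) = ?m * bin n (r p)"
    unfolding line_restr_simps by (rule binform_linear_factor[OF degree_line_restr(1)[OF var(1)]])
  have "var3 i * p = ?m * p + l * (const3 (w $ i) * p)"
    unfolding coords[of i] by (simp add: algebra_simps)
  also have "?m * p = ?m * (bin n (r p) + l * q)" using q(2) by (rule arg_cong)
  also have "\<dots> = ?m * bin n (r p) + l * (?m * q)" by (simp add: algebra_simps)
  finally have "var3 i * p = bin (Suc n) (r (var3 i * p)) + l * (?m * q + const3 (w $ i) * p)"
    unfolding b by (simp only: distrib_left add.assoc)
  moreover have "?m * q + const3 (w $ i) * p \<in> graded_piece (int (Suc n) - 1)"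
  proof (rule forms_add)
    have "?m \<in> forms 1" using stl by (intro forms_add forms_const3_mult)
    then show "?m * q \<in> graded_piece (int (Suc n) - 1)" using graded_cong[OF graded_mult[OF _ q(1)]] by fastforce
    show "const3 (w $ i) * p \<in> graded_piece (int (Suc n) - 1)" using forms_const3_mult[OF var(1)] by simp
  qed
  ultimately show ?case by blast
qed

lemma r_kernel:
  assumes "p \<in> forms j" "r p = 0"
  obtains q where "q \<in> graded_piece (int j - 1)" "p = l * q"
  using lift[OF assms(1)] assms(2) by (auto simp: binform_0)

text \<open>Multiplication by \<open>gu\<close> or \<open>gv\<close> costs degree e. The zero
  polynomial is a separate case since its \<open>degree\<close> is 0 while \<open>j\<close> may be
  smaller than \<open>e\<close>.\<close>

lemma coeff_lift:
  assumes "F = 0 \<or> degree F + e \<le> j"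
  obtains K where "K \<in> graded_piece (int j - int e)" "r K = F"
proof (cases "F = 0")
  case True
  then show ?thesis using that[of 0] by (simp add: line_restr_simps)
next
  case False
  then have "degree F \<le> j - e" "int (j - e) = int j - int e" using assms by auto
  then show ?thesis using that[of "bin (j - e) F"] r_bin bin_forms[of "j - e" F] by simp
qed

section \<open>The ideal of \<open>gu\<close> and \<open>gv\<close>, with \<open>l\<close> as a
  nonzerodivisor\<close>

definition Qs :: "int \<Rightarrow> poly3 set" where
  "Qs k = {\<alpha> * gu + \<beta> * gv | \<alpha> \<beta>. \<alpha> \<in> graded_piece (k - int e) \<and> \<beta> \<in> graded_piece (k - int e)}"

lemma QsI: "\<alpha> \<in> graded_piece (k - int e) \<Longrightarrow> \<beta> \<in> graded_piece (k - int e) \<Longrightarrow> \<alpha> * gu + \<beta> * gv \<in> Qs k"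
  unfolding Qs_def by blast

lemma Qs_forms: "q \<in> Qs k \<Longrightarrow> q \<in> graded_piece k"
  unfolding Qs_def using graded_cong[OF graded_mult[OF _ g_forms(1)]] graded_cong[OF graded_mult[OF _ g_forms(2)]]
  by (auto intro!: forms_add)

lemma Qs_0: "0 \<in> Qs k"
  using QsI[of 0 k 0] by simp

lemma Qs_add: "p \<in> Qs k \<Longrightarrow> q \<in> Qs k \<Longrightarrow> p + q \<in> Qs k"
proof -
  assume "p \<in> Qs k" "q \<in> Qs k"
  then obtain a b a' b' where ab: "a \<in> graded_piece (k - int e)" "b \<in> graded_piece (k - int e)" "a' \<in> graded_piece (k - int e)" "b' \<in> graded_piece (k - int e)"
    "p = a * gu + b * gv" "q = a' * gu + b' * gv" unfolding Qs_def by blast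
  have "p + q = (a + a') * gu + (b + b') * gv" unfolding ab by (simp only: distrib_right add_ac)
  then show ?thesis using QsI[OF forms_add[OF ab(1,3)] forms_add[OF ab(2,4)]] by simp
qed

lemma Qs_mult: "q \<in> Qs k \<Longrightarrow> p \<in> graded_piece m \<Longrightarrow> p * q \<in> Qs (m + k)"
proof -
  assume q: "q \<in> Qs k" and p: "p \<in> graded_piece m"
  obtain a b where ab: "a \<in> graded_piece (k - int e)" "b \<in> graded_piece (k - int e)" "q = a * gu + b * gv" using q unfolding Qs_def by blast
  have "p * q = (p * a) * gu + (p * b) * gv" unfolding ab by (simp only: distrib_left mult.assoc)
  moreover have "p * a \<in> graded_piece (m + k - int e)" "p * b \<in> graded_piece (m + k - int e)"
    using graded_mult[OF p ab(1)] graded_mult[OF p ab(2)] by (simp_all add: algebra_simps)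
  ultimately show ?thesis using QsI by simp
qed

lemma Qs_const: "q \<in> Qs k \<Longrightarrow> const3 c * q \<in> Qs k"
  using Qs_mult[OF _ forms_const3, of q k c] by simp

lemma Qs_diff: "p \<in> Qs k \<Longrightarrow> q \<in> Qs k \<Longrightarrow> p - q \<in> Qs k"
  using Qs_add[of p k "const3 (-1) * q"] Qs_const[of q k "-1"] by simp

lemma Qs_subspace: "P3.subspace (Qs k)"
  unfolding P3.subspace_def using Qs_0 Qs_add Qs_const by (simp add: scal3_const3)

text \<open>Restricted to the line, a relation between the coprime \<open>P\<close> and
  \<open>Q\<close> is a multiple \<kappa> of the Koszul relation. Subtracting a lift of it makes
  both coefficients divisible by \<open>l\<close>. As \<open>Q\<close> has exact degree e, the
  degree of \<kappa> is small enough for such a lift.\<close>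

lemma Qs_l_regular:
  assumes "p \<in> forms j" "l * p \<in> Qs (int j + 1)"
  shows "p \<in> Qs (int j)"
proof -
  obtain \<alpha> \<beta> where ab: "\<alpha> \<in> graded_piece (int j + 1 - int e)" "\<beta> \<in> graded_piece (int j + 1 - int e)" "l * p = \<alpha> * gu + \<beta> * gv"
    using assms(2) unfolding Qs_def by blast
  show ?thesis
  proof (cases "int j + 1 - int e < 0")
    case True
    then have "\<alpha> = 0" "\<beta> = 0" using ab(1,2) graded_nonneg by (metis not_less)+
    then have "p = 0" using ab(3) stl(4) by simp
    then show ?thesis using Qs_0 by simp
  next
    case False
    define m where "m = nat (int j + 1 - int e)"
    have m: "int m = int j + 1 - int e" using False unfolding m_def by simp
    have ab': "\<alpha> \<in> forms m" "\<beta> \<in> forms m" using ab m by simp_all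
    have eq: "r \<alpha> * P + r \<beta> * Q = 0"
      using arg_cong[OF ab(3), of r] unfolding line_restr_simps restr_stl P_def Q_def by simp
    then have "r \<alpha> * P = Q * (- r \<beta>)" by (simp add: add_eq_0_iff mult.commute)
    then have "Q dvd r \<alpha> * P" by (metis dvd_triv_left)
    then have "Q dvd r \<alpha>" using coprimePQ by (simp add: coprime_dvd_mult_left_iff coprime_commute)
    then obtain \<kappa> where k: "r \<alpha> = Q * \<kappa>" by (auto elim: dvdE)
    have "Q * (\<kappa> * P + r \<beta>) = 0" using eq unfolding k by (simp add: algebra_simps)
    then have "\<kappa> * P + r \<beta> = 0" using Q0 by simp
    then have k2: "r \<beta> = - (\<kappa> * P)" by (simp add: add_eq_0_iff)
    have "\<kappa> = 0 \<or> degree \<kappa> + e \<le> m"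
      using degree_line_restr(1)[OF ab'(1), of u v] degree_mult_eq[OF Q0, of \<kappa>] degQ unfolding k by (cases "\<kappa> = 0") auto
    then obtain K where K: "K \<in> graded_piece (int m - int e)" "r K = \<kappa>" using coeff_lift by blast
    have Kg: "K * gv \<in> forms m" "K * gu \<in> forms m"
      using graded_cong[OF graded_mult[OF K(1) g_forms(2)]] graded_cong[OF graded_mult[OF K(1) g_forms(1)]] by auto
    have "r (\<alpha> - K * gv) = 0" "r (\<beta> + K * gu) = 0"
      unfolding line_restr_simps K k k2 P_def Q_def by (simp_all add: mult.commute)
    then obtain \<alpha>' \<beta>' where c: "\<alpha>' \<in> graded_piece (int m - 1)" "\<alpha> - K * gv = l * \<alpha>'" "\<beta>' \<in> graded_piece (int m - 1)" "\<beta> + K * gu = l * \<beta>'"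
      using r_kernel[OF forms_diff[OF ab'(1) Kg(1)]] r_kernel[OF forms_add[OF ab'(2) Kg(2)]] by metis
    have "l * p = (\<alpha> - K * gv) * gu + (\<beta> + K * gu) * gv" unfolding ab(3) by (simp add: algebra_simps)
    also have "\<dots> = l * (\<alpha>' * gu + \<beta>' * gv)" unfolding c(2,4) by (simp only: distrib_left mult.assoc)
    finally have "p = \<alpha>' * gu + \<beta>' * gv" using mult_left_cancel[OF stl(4)] by blast
    moreover have "int m - 1 = int j - int e" using m by simp
    ultimately show ?thesis using QsI[of \<alpha>' "int j" \<beta>'] c by simp
  qed
qed

lemma Qs_l_power_regular:
  assumes "p \<in> forms j" "l ^ n * p \<in> Qs (int (j + n))"
  shows "p \<in> Qs (int j)"
  using assms
proof (induction n arbitrary: p j)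
  case (Suc n)
  have "l ^ n * (l * p) \<in> Qs (int (Suc j + n))" using Suc(3) by (simp add: mult_ac add_ac)
  moreover have "l * p \<in> forms (Suc j)" using forms_mult[OF stl(3) Suc(2)] by simp
  ultimately have "l * p \<in> Qs (int j + 1)" using Suc(1)[of "l * p" "Suc j"] by (simp add: add_ac)
  then show ?case using Qs_l_regular Suc(2) by blast
qed simp

text \<open>On the line \<open>Q\<close>, of exact degree e, would divide a coefficient of smaller
  degree. So both coefficients are multiples of \<open>l\<close>, and after division by
  \<open>l\<close> the argument repeats in smaller degree.\<close>

lemma syzygy_small:
  assumes "\<alpha> \<in> forms m" "\<beta> \<in> forms m" "m < e" "\<alpha> * gu + \<beta> * gv = 0"
  shows "\<alpha> = 0 \<and> \<beta> = 0"
  using assms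
proof (induction m arbitrary: \<alpha> \<beta> rule: less_induct)
  case (less m)
  have eq: "r \<alpha> * P + r \<beta> * Q = 0"
    using arg_cong[OF less(5), of r] unfolding line_restr_simps P_def Q_def by simp
  then have "r \<alpha> * P = Q * (- r \<beta>)" by (simp add: add_eq_0_iff mult.commute)
  then have "Q dvd r \<alpha> * P" by (metis dvd_triv_left)
  then have "Q dvd r \<alpha>" using coprimePQ by (simp add: coprime_dvd_mult_left_iff coprime_commute)
  then have a: "r \<alpha> = 0" using degree_line_restr(1)[OF less(2), of u v] less(4) degQ dvd_imp_degree_le[of Q "r \<alpha>"] by (cases "r \<alpha> = 0") auto
  then have b: "r \<beta> = 0" using eq Q0 by simp
  obtain \<alpha>' \<beta>' where c: "\<alpha>' \<in> graded_piece (int m - 1)" "\<alpha> = l * \<alpha>'" "\<beta>' \<in> graded_piece (int m - 1)" "\<beta> = l * \<beta>'"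
    using r_kernel[OF less(2) a] r_kernel[OF less(3) b] by metis
  have "l * (\<alpha>' * gu + \<beta>' * gv) = 0" using less(5) unfolding c(2,4) by (simp only: distrib_left mult.assoc)
  then have z: "\<alpha>' * gu + \<beta>' * gv = 0" using stl(4) by simp
  show ?case
  proof (cases m)
    case 0
    then have "\<alpha>' = 0" "\<beta>' = 0" using c graded_nonneg by fastforce+
    then show ?thesis using c by simp
  next
    case (Suc k)
    then have "\<alpha>' = 0 \<and> \<beta>' = 0" using less(1)[of k \<alpha>' \<beta>'] c z less(4) by simp
    then show ?thesis using c by simp
  qed
qed

text \<open>Only the degree of \<open>b0\<close> has to be controlled: that of \<open>a0\<close>
  follows because \<open>Q\<close> has exact degree e, whereas \<open>P\<close> may drop
  degree.\<close>

lemma restr_decomposition: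
  assumes "p \<in> forms j" "r p = b0 * P + a0 * Q" "b0 = 0 \<or> degree b0 + e \<le> j"
  obtains q c where "q \<in> Qs (int j)" "c \<in> graded_piece (int j - 1)" "p = q + l * c"
proof -
  have dj: "degree (r p) \<le> j" using degree_line_restr(1)[OF assms(1)] .
  have "degree (b0 * P) \<le> j" using assms(3) degP degree_mult_le[of b0 P] by (cases "b0 = 0") auto
  then have "degree (a0 * Q) \<le> j"
    using degree_diff_le[OF dj] assms(2) by (metis add_diff_cancel_left')
  then have a: "a0 = 0 \<or> degree a0 + e \<le> j" using degree_mult_eq[of a0 Q] Q0 degQ by (cases "a0 = 0") auto
  obtain B where B: "B \<in> graded_piece (int j - int e)" "r B = b0" using coeff_lift[OF assms(3)] .
  obtain A where A: "A \<in> graded_piece (int j - int e)" "r A = a0" using coeff_lift[OF a] .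
  have q: "B * gu + A * gv \<in> Qs (int j)" using QsI[OF B(1) A(1)] .
  have "p - (B * gu + A * gv) \<in> forms j" using graded_diff[OF assms(1) Qs_forms[OF q]] .
  moreover have "r (p - (B * gu + A * gv)) = 0"
    unfolding line_restr_simps A B assms(2) P_def Q_def by simp
  ultimately obtain c where "c \<in> graded_piece (int j - 1)" "p - (B * gu + A * gv) = l * c" by (rule r_kernel)
  then show ?thesis using that[OF q, of c] by (simp add: algebra_simps)
qed

section \<open>The socle functional and the trace pairing\<close>

definition P' :: "complex poly" where "P' = fst (bezout_coefficients P Q)"

lemma P'_inverse: "(P * P') mod Q = 1 mod Q"
proof -
  have "P' * P + snd (bezout_coefficients P Q) * Q = 1"
    using bezout_coefficients_fst_snd[of P Q] coprimePQ unfolding P'_def by (simp add: coprime_iff_gcd_eq_1)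
  then have "(P * P' + snd (bezout_coefficients P Q) * Q) mod Q = 1 mod Q" by (simp add: mult.commute)
  then show ?thesis by simp
qed

lemma mod_P'_decomposition: "\<exists>a0. F = (F * P' mod Q) * P + a0 * Q"
proof -
  have "((F * P' mod Q) * P) mod Q = (F * (P * P')) mod Q" by (metis mod_mult_left_eq mult.assoc mult.commute)
  also have "\<dots> = (F * ((P * P') mod Q)) mod Q" by (simp only: mod_mult_right_eq)
  also have "\<dots> = F mod Q" unfolding P'_inverse by (simp add: mod_mult_right_eq)
  finally have "F mod Q = ((F * P' mod Q) * P) mod Q" ..
  then have "Q dvd F - (F * P' mod Q) * P" by (simp add: mod_eq_dvd_iff)
  then obtain a where "F - (F * P' mod Q) * P = Q * a" by (auto elim: dvdE)
  then have "F = (F * P' mod Q) * P + a * Q" by (simp add: algebra_simps)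
  then show ?thesis by blast
qed

lemma degree_mod_Q: "F mod Q = 0 \<or> degree (F mod Q) < e"
  using degree_mod_less[OF Q0, of F] degQ by simp

text \<open>Up to the leading coefficient of \<open>Q\<close>, the sum of the residues of F / (P Q)
  at the zeros of \<open>Q\<close>. For a remainder R modulo \<open>Q\<close> the coefficient of
  degree e - 1 gives this sum for R / Q, and \<open>P'\<close> inverts \<open>P\<close> at these
  zeros.\<close>

definition tau :: "complex poly \<Rightarrow> complex" where
  "tau F = coeff ((F * P') mod Q) (e - 1)"

lemma tau_simps: "tau (F + G) = tau F + tau G" "tau (smult c F) = c * tau F" "tau 0 = 0"
  unfolding tau_def by (simp_all add: distrib_right poly_mod_add_left mod_smult_left)

text \<open>The socle degree e + e + 1 - 3 of the complete intersection of \<open>gu\<close>,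
  \<open>gv\<close>, \<open>l\<close>. It differs from the number 3(d - 2) of the theorem, which is
  the socle degree of the Milnor algebra of a smooth curve.\<close>

definition T :: nat where "T = 2 * e - 2"

text \<open>Modulo \<open>Q\<close> the factor \<open>P'\<close> cancels \<open>P\<close>, and what
  remains is the restriction of the coefficient of \<open>gu\<close>, of degree at most e -
  2.\<close>

lemma tau_Qs:
  assumes "q \<in> Qs (int T)"
  shows "tau (r q) = 0"
proof -
  obtain \<alpha> \<beta> where ab: "\<alpha> \<in> graded_piece (int T - int e)" "\<beta> \<in> graded_piece (int T - int e)" "q = \<alpha> * gu + \<beta> * gv"
    using assms unfolding Qs_def by blast
  have deg: "r \<alpha> = 0 \<or> degree (r \<alpha>) + 1 < e"
  proof (cases "\<alpha> = 0")
    case False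
    then have "int T - int e \<ge> 0" using graded_nonneg ab(1) by blast
    then have k: "e \<ge> 2" "\<alpha> \<in> forms (e - 2)" using ab(1) e1 unfolding T_def by (auto intro: graded_cong)
    then have "degree (r \<alpha>) \<le> e - 2" using degree_line_restr(1) by blast
    moreover have "e - 2 + 1 < e" using k by simp
    ultimately show ?thesis by linarith
  qed (simp add: line_restr_simps)
  have "r q * P' = r \<alpha> * (P * P') + r \<beta> * P' * Q"
    unfolding ab line_restr_simps P_def Q_def by (simp add: algebra_simps)
  then have "(r q * P') mod Q = (r \<alpha> * (P * P')) mod Q" by simp
  also have "\<dots> = (r \<alpha> * ((P * P') mod Q)) mod Q" by (simp only: mod_mult_right_eq)
  also have "\<dots> = r \<alpha> mod Q" unfolding P'_inverse by (simp add: mod_mult_right_eq)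
  also have "\<dots> = r \<alpha>" using deg degQ e1 by (intro mod_poly_less) auto
  finally have "tau (r q) = coeff (r \<alpha>) (e - 1)" unfolding tau_def by simp
  also have "\<dots> = 0" using deg by (auto intro: coeff_eq_0)
  finally show ?thesis .
qed

text \<open>From degree T + 1 = 2e - 1 on, the quotient by \<open>gu\<close>, \<open>gv\<close>,
  \<open>l\<close> is zero: a remainder modulo \<open>Q\<close> has degree at most e - 1, which
  leaves room for the factor \<open>gu\<close>.\<close>

lemma reduce_degree:
  assumes "p \<in> forms j" "j \<ge> T"
  shows "\<exists>c. c \<in> forms T \<and> p - l ^ (j - T) * c \<in> Qs (int j)"
  using assms(2,1)
proof (induction j arbitrary: p rule: dec_induct)
  case base
  then show ?case by (intro exI[of _ p]) (simp add: Qs_0)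
next
  case (step j)
  obtain a0 where a0: "r p = (r p * P' mod Q) * P + a0 * Q" using mod_P'_decomposition by blast
  have "(r p * P') mod Q = 0 \<or> degree ((r p * P') mod Q) + e \<le> Suc j"
    using degree_mod_Q[of "r p * P'"] step(1) e1 unfolding T_def by auto
  then obtain q c where q: "q \<in> Qs (int (Suc j))" "c \<in> graded_piece (int (Suc j) - 1)" "p = q + l * c"
    using restr_decomposition[OF step(4) a0] by metis
  then have "c \<in> forms j" by simp
  then obtain c' where c': "c' \<in> forms T" "c - l ^ (j - T) * c' \<in> Qs (int j)" using step(3) by blast
  have "p - l ^ (Suc j - T) * c' = q + l * (c - l ^ (j - T) * c')"
    using step(1) unfolding q(3) by (simp add: Suc_diff_le algebra_simps)
  moreover have "l * (c - l ^ (j - T) * c') \<in> Qs (int (Suc j))" using Qs_mult[OF c'(2) stl(3)] by simp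
  ultimately have "p - l ^ (Suc j - T) * c' \<in> Qs (int (Suc j))" using q(1) Qs_add by metis
  then show ?case using c'(1) by blast
qed

text \<open>The choice does not matter because \<open>l\<close> is a nonzerodivisor and
  \<open>tau\<close> kills the ideal in degree T. The degree is an argument since multiplication by
  \<open>l\<close> is to count as multiplication by 1, see \<open>trace_l_power\<close>.\<close>

definition trace :: "nat \<Rightarrow> poly3 \<Rightarrow> complex" where
  "trace j p = tau (r (SOME c. c \<in> forms T \<and> p - l ^ (j - T) * c \<in> Qs (int j)))"

lemma trace_eqI:
  assumes "p \<in> forms j" "j \<ge> T" "c \<in> forms T" "p - l ^ (j - T) * c \<in> Qs (int j)"
  shows "trace j p = tau (r c)"
proof -
  let ?c = "SOME c. c \<in> forms T \<and> p - l ^ (j - T) * c \<in> Qs (int j)"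
  have c: "?c \<in> forms T" "p - l ^ (j - T) * ?c \<in> Qs (int j)" using someI_ex[OF reduce_degree[OF assms(1,2)]] by blast+
  have "(p - l ^ (j - T) * c) - (p - l ^ (j - T) * ?c) \<in> Qs (int j)" using Qs_diff[OF assms(4) c(2)] .
  moreover have "(p - l ^ (j - T) * c) - (p - l ^ (j - T) * ?c) = l ^ (j - T) * (?c - c)" by (simp add: algebra_simps)
  ultimately have "l ^ (j - T) * (?c - c) \<in> Qs (int (T + (j - T)))" using assms(2) by simp
  then have "?c - c \<in> Qs (int T)" using Qs_l_power_regular forms_diff[OF c(1) assms(3)] by blast
  then have "tau (r (?c - c)) = 0" by (rule tau_Qs)
  moreover have "tau (r ?c) = tau (r ((?c - c) + c))" by simp
  ultimately show ?thesis unfolding trace_def line_restr_simps tau_simps by (simp add: line_restr_simps)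
qed

lemma trace_add:
  assumes "p \<in> forms j" "q \<in> forms j" "j \<ge> T"
  shows "trace j (p + q) = trace j p + trace j q"
proof -
  obtain c c' where c: "c \<in> forms T" "p - l ^ (j - T) * c \<in> Qs (int j)" "c' \<in> forms T" "q - l ^ (j - T) * c' \<in> Qs (int j)"
    using reduce_degree assms by metis
  have "p + q - l ^ (j - T) * (c + c') = (p - l ^ (j - T) * c) + (q - l ^ (j - T) * c')" by (simp add: algebra_simps)
  then have "p + q - l ^ (j - T) * (c + c') \<in> Qs (int j)" using Qs_add[OF c(2,4)] by (simp only:)
  from trace_eqI[OF forms_add[OF assms(1,2)] assms(3) forms_add[OF c(1,3)] this]
    trace_eqI[OF assms(1,3) c(1,2)] trace_eqI[OF assms(2,3) c(3,4)]
  show ?thesis by (simp add: line_restr_simps tau_simps)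
qed

lemma trace_scale:
  assumes "p \<in> forms j" "j \<ge> T"
  shows "trace j (const3 a * p) = a * trace j p"
proof -
  obtain c where c: "c \<in> forms T" "p - l ^ (j - T) * c \<in> Qs (int j)" using reduce_degree assms by metis
  have "const3 a * p - l ^ (j - T) * (const3 a * c) = const3 a * (p - l ^ (j - T) * c)" by (simp add: algebra_simps)
  then have "const3 a * p - l ^ (j - T) * (const3 a * c) \<in> Qs (int j)" using Qs_const[OF c(2)] by (simp only:)
  from trace_eqI[OF forms_const3_mult[OF assms(1)] assms(2) forms_const3_mult[OF c(1)] this] trace_eqI[OF assms c]
  show ?thesis by (simp add: line_restr_simps tau_simps)
qed

lemma trace_Qs:
  assumes "q \<in> Qs (int j)" "j \<ge> T"
  shows "trace j q = 0"
  using trace_eqI[OF Qs_forms[OF assms(1)] assms(2) forms_0] assms(1) by (simp add: line_restr_simps tau_simps)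

lemma trace_l_power:
  assumes "p \<in> forms j" "j \<ge> T"
  shows "trace (j + m) (l ^ m * p) = trace j p"
proof -
  obtain c where c: "c \<in> forms T" "p - l ^ (j - T) * c \<in> Qs (int j)" using reduce_degree assms by metis
  have lm: "l ^ m \<in> forms m" using forms_power[OF stl(3), of m] by simp
  have "l ^ m * p - l ^ (j + m - T) * c = l ^ m * (p - l ^ (j - T) * c)"
    using assms(2) by (simp add: right_diff_distrib power_add[symmetric] mult.assoc[symmetric] add.commute)
  then have "l ^ m * p - l ^ (j + m - T) * c \<in> Qs (int (j + m))" using Qs_mult[OF c(2) lm] by (simp add: add.commute)
  moreover have "l ^ m * p \<in> forms (j + m)" using forms_mult[OF lm assms(1)] by (simp add: add.commute)
  ultimately have "trace (j + m) (l ^ m * p) = tau (r c)" using trace_eqI[of "l ^ m * p" "j + m" c] assms(2) c(1) by simp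
  then show ?thesis using trace_eqI[OF assms c] by simp
qed

text \<open>Below the socle degree a positive power of \<open>l\<close> is left over in degree T,
  and restriction to the line kills it.\<close>

lemma trace_low:
  assumes "p \<in> forms i" "i \<le> T"
  shows "trace (T + m) (l ^ (m + (T - i)) * p) = (if i = T then tau (r p) else 0)"
proof -
  have lT: "l ^ (T - i) \<in> forms (T - i)" using forms_power[OF stl(3), of "T - i"] by simp
  have c: "l ^ (T - i) * p \<in> forms T" using forms_mult[OF lT assms(1)] assms(2) by simp
  have "l ^ (m + (T - i)) * p = l ^ m * (l ^ (T - i) * p)" by (simp only: power_add mult.assoc)
  then have "trace (T + m) (l ^ (m + (T - i)) * p) = trace T (l ^ (T - i) * p)" using trace_l_power[OF c le_refl, of m] by (simp only:)
  also have "\<dots> = tau (r (l ^ (T - i) * p))" using trace_eqI[OF c le_refl c] Qs_0 by simp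
  also have "\<dots> = (if i = T then tau (r p) else 0)"
    using assms(2) by (auto simp: line_restr_simps restr_stl tau_simps zero_power)
  finally show ?thesis .
qed

text \<open>A suitable power of the parameter moves the leading coefficient of the remainder to
  position e - 1, where \<open>tau\<close> reads it off.\<close>

lemma tau_vanishing_degree:
  assumes "\<And>m. m \<le> i \<Longrightarrow> tau (F * [:0, 1:] ^ m) = 0" "i \<le> T"
  shows "(F * P') mod Q = 0 \<or> degree ((F * P') mod Q) + e \<le> T - i"
proof (rule ccontr)
  let ?b = "(F * P') mod Q"
  assume a: "\<not> ?thesis"
  have dl: "degree ?b < e" using degree_mod_Q[of "F * P'"] a by auto
  define m where "m = e - 1 - degree ?b"
  have m: "degree ?b + m = e - 1" using dl unfolding m_def by simp
  have mi: "m \<le> i" using a m assms(2) e1 unfolding T_def by auto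
  have b0: "?b \<noteq> 0" using a by simp
  have x0: "[:0, 1::complex:] ^ m \<noteq> 0" "degree ([:0, 1::complex:] ^ m) = m" by (simp_all add: degree_power_eq)
  have dm: "degree (?b * [:0, 1:] ^ m) = e - 1"
    unfolding degree_mult_eq[OF b0 x0(1)] x0(2) by (rule m)
  have "F * [:0, 1:] ^ m * P' = F * P' * [:0, 1:] ^ m" by (simp only: mult_ac)
  then have "(F * [:0, 1:] ^ m * P') mod Q = (?b * [:0, 1:] ^ m) mod Q" by (simp only: mod_mult_left_eq)
  also have "\<dots> = ?b * [:0, 1:] ^ m" using dm degQ e1 by (intro mod_poly_less) auto
  finally have "tau (F * [:0, 1:] ^ m) = lead_coeff (?b * [:0, 1:] ^ m)" unfolding tau_def dm by simp
  then have "lead_coeff (?b * [:0, 1:] ^ m) = 0" using assms(1)[OF mi] by (simp only:)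
  then show False using b0 x0(1) by (simp only: leading_coeff_0_iff mult_eq_0_iff) blast
qed

text \<open>Once p agrees with \<open>l ^ i * h\<close> modulo the ideal, pairing it with
  \<open>l ^ (T - i)\<close> times a monomial of degree i in \<open>s\<close>, \<open>t\<close>
  gives \<open>tau\<close> of the restriction of \<open>h\<close> times that monomial. If these
  values vanish, one more factor \<open>l\<close> can be split off.\<close>

lemma trace_descent:
  assumes "p \<in> forms T" "k \<le> T" "\<And>b. b \<in> forms k \<Longrightarrow> trace (2 * T) (p * (l ^ (T - k) * b)) = 0" "i \<le> Suc k"
  shows "\<exists>h\<in>graded_piece (int T - int i). p - l ^ i * h \<in> Qs (int T)"
  using assms(4)
proof (induction i)
  case 0
  then show ?case using assms(1) Qs_0 by (intro bexI[of _ p]) simp_all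
next
  case (Suc i)
  then have ik: "i \<le> k" "i \<le> T" using assms(2) by auto
  obtain h where h: "h \<in> graded_piece (int T - int i)" "p - l ^ i * h \<in> Qs (int T)" using Suc by auto
  define j where "j = T - i"
  have ij: "int j = int T - int i" "i + j = T" using ik unfolding j_def by auto
  have hj: "h \<in> forms j" using h(1) unfolding ij(1)[symmetric] .
  have "tau (r h * [:0, 1:] ^ m) = 0" if m: "m \<le> i" for m
  proof -
    have "1 * (i - m) + 1 * m = i" using m by simp
    then have bi: "s ^ (i - m) * t ^ m \<in> forms i"
      using forms_mult[OF forms_power[OF stl(1), of "i - m"] forms_power[OF stl(2), of m]] by (simp only:)
    let ?b = "s ^ (i - m) * t ^ m"
    have lk: "l ^ (k - i) * ?b \<in> forms k" using forms_mult[OF forms_power[OF stl(3), of "k - i"] bi] ik by simp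
    have lT: "l ^ (T - i) * ?b \<in> forms T" using forms_mult[OF forms_power[OF stl(3), of "T - i"] bi] ik by simp
    have e1: "l ^ (T - k) * (l ^ (k - i) * ?b) = l ^ (T - i) * ?b"
      using ik assms(2) by (simp add: mult.assoc[symmetric] power_add[symmetric])
    have 0: "trace (2 * T) (p * (l ^ (T - i) * ?b)) = 0" using assms(3)[OF lk] unfolding e1 .
    have "j + i = T" using ij(2) by simp
    then have hb: "h * ?b \<in> forms T" using forms_mult[OF hj bi] by (simp only:)
    have TT: "int T + int T = int (2 * T)" "T + T = 2 * T" by simp_all
    have q: "(l ^ (T - i) * ?b) * (p - l ^ i * h) \<in> Qs (int (2 * T))" using Qs_mult[OF h(2) lT] unfolding TT .
    have e2: "p * (l ^ (T - i) * ?b) = (l ^ (T - i) * ?b) * (p - l ^ i * h) + l ^ T * (h * ?b)"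
    proof -
      have "l ^ T = l ^ (T - i) * l ^ i" unfolding power_add[symmetric] using ik by simp
      then show ?thesis by (simp only: right_diff_distrib mult_ac diff_add_cancel)
    qed
    have "l ^ T * (h * ?b) \<in> forms (2 * T)"
      using forms_mult[OF forms_power[OF stl(3), of T] hb] unfolding mult_1_left TT(2) .
    then have "trace (2 * T) (p * (l ^ (T - i) * ?b)) = trace (2 * T) (l ^ T * (h * ?b))"
      unfolding e2 using trace_add[OF Qs_forms[OF q], of "l ^ T * (h * ?b)"] trace_Qs[OF q] by simp
    moreover have "trace (2 * T) (l ^ T * (h * ?b)) = tau (r (h * ?b))"
      using trace_low[OF hb le_refl, of T] unfolding TT(2) by simp
    ultimately have "tau (r (h * ?b)) = 0" using 0 by (simp only:)
    then show ?thesis by (simp add: line_restr_simps restr_stl)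
  qed
  then have dg: "(r h * P') mod Q = 0 \<or> degree ((r h * P') mod Q) + e \<le> j"
    using tau_vanishing_degree[of i "r h"] ik(2) unfolding j_def by blast
  obtain a0 where a0: "r h = (r h * P' mod Q) * P + a0 * Q" using mod_P'_decomposition by blast
  obtain q c where q: "q \<in> Qs (int j)" "c \<in> graded_piece (int j - 1)" "h = q + l * c"
    using restr_decomposition[OF hj a0 dg] .
  have "l ^ i \<in> forms i" using forms_power[OF stl(3), of i] by simp
  then have "l ^ i * q \<in> Qs (int T)" using Qs_mult[OF q(1)] ij by fastforce
  then have "(p - l ^ i * h) + l ^ i * q \<in> Qs (int T)" using Qs_add[OF h(2)] by blast
  moreover have "(p - l ^ i * h) + l ^ i * q = p - l ^ Suc i * c" unfolding q(3) by (simp add: algebra_simps)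
  moreover have "c \<in> graded_piece (int T - int (Suc i))" using q(2) ij by (auto intro: graded_cong)
  ultimately show ?case by auto
qed

text \<open>For k = T the descent ends with a cofactor of degree -1.\<close>

lemma trace_nondegenerate:
  assumes "p \<in> forms T" "\<And>b. b \<in> forms T \<Longrightarrow> trace (2 * T) (p * b) = 0"
  shows "p \<in> Qs (int T)"
proof -
  obtain h where h: "h \<in> graded_piece (int T - int (Suc T))" "p - l ^ Suc T * h \<in> Qs (int T)"
    using trace_descent[OF assms(1), of T "Suc T"] assms(2) by auto
  have "h = 0" using graded_nonneg[OF h(1)] by auto
  then show ?thesis using h(2) by simp
qed

end

section \<open>The saturation of the Jacobian ideal\<close>

text \<open>An interpretation of \<^locale>\<open>module\<close> would add \<open>scale_scale\<close>, here an associativity law that loops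
  with \<open>mult.assoc\<close>, to the simplifier.\<close>

lemma module_poly3: "module ((*) :: poly3 \<Rightarrow> poly3 \<Rightarrow> poly3)"
  by unfold_locales (simp_all add: algebra_simps)

lemmas ideal_span_minimal = module.span_minimal[OF module_poly3]
  and ideal_subspaceI = module.subspaceI[OF module_poly3]
  and ideal_span_sum = module.span_sum[OF module_poly3]
  and ideal_span_scale = module.span_scale[OF module_poly3]
  and ideal_span_base = module.span_base[OF module_poly3]

lemma jacobian_ideal_iff: "p \<in> jacobian_ideal g \<longleftrightarrow> (\<exists>h. p = (\<Sum>i\<in>UNIV. h i * pderiv3 i g))"
proof
  let ?S = "{p. \<exists>h. p = (\<Sum>i\<in>UNIV. h i * pderiv3 i g)}"
  have sub: "module.subspace (*) ?S"
  proof (rule ideal_subspaceI)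
    show "0 \<in> ?S" by (intro CollectI exI[of _ "\<lambda>_. 0"]) simp
  next
    fix x y assume "x \<in> ?S" "y \<in> ?S"
    then obtain a b where ab: "x = (\<Sum>i\<in>UNIV. a i * pderiv3 i g)" "y = (\<Sum>i\<in>UNIV. b i * pderiv3 i g)" by blast
    have "x + y = (\<Sum>i\<in>UNIV. (a i + b i) * pderiv3 i g)" unfolding ab by (simp only: distrib_right sum.distrib)
    then show "x + y \<in> ?S" by (intro CollectI exI[of _ "\<lambda>i. a i + b i"])
  next
    fix c x assume "x \<in> ?S"
    then obtain a where a: "x = (\<Sum>i\<in>UNIV. a i * pderiv3 i g)" by blast
    have "c * x = (\<Sum>i\<in>UNIV. (c * a i) * pderiv3 i g)" unfolding a by (simp only: sum_distrib_left mult.assoc)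
    then show "c * x \<in> ?S" by (intro CollectI exI[of _ "\<lambda>i. c * a i"])
  qed
  have "range (\<lambda>i. pderiv3 i g) \<subseteq> ?S"
  proof
    fix x assume "x \<in> range (\<lambda>i. pderiv3 i g)"
    then obtain k where k: "x = pderiv3 k g" by blast
    have "x = (\<Sum>i\<in>UNIV. (if i = k then 1 else 0) * pderiv3 i g)"
    proof -
      have "(\<Sum>i\<in>UNIV. (if i = k then 1 else 0) * pderiv3 i g) = (\<Sum>i\<in>UNIV. if i = k then pderiv3 i g else 0)"
        by (intro sum.cong) auto
      then show ?thesis unfolding k by simp
    qed
    then show "x \<in> ?S" by (intro CollectI exI[of _ "\<lambda>i. if i = k then 1 else 0"])
  qed
  then have "module.span (*) (range (\<lambda>i. pderiv3 i g)) \<subseteq> ?S" using ideal_span_minimal sub by blast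
  then show "p \<in> jacobian_ideal g \<Longrightarrow> \<exists>h. p = (\<Sum>i\<in>UNIV. h i * pderiv3 i g)"
    unfolding jacobian_ideal_def ideal_gen_def by blast
  show "\<exists>h. p = (\<Sum>i\<in>UNIV. h i * pderiv3 i g) \<Longrightarrow> p \<in> jacobian_ideal g"
    unfolding jacobian_ideal_def ideal_gen_def
  proof (elim exE, hypsubst)
    fix h show "(\<Sum>i\<in>UNIV. h i * pderiv3 i g) \<in> module.span (*) (range (\<lambda>i. pderiv3 i g))"
      by (rule ideal_span_sum, rule ideal_span_scale, rule ideal_span_base, rule rangeI)
  qed
qed

lemma det_nonzero_of_kernel:
  fixes M :: "complex^3^3"
  assumes "\<And>y. M *v y = 0 \<Longrightarrow> y = 0"
  shows "det M \<noteq> 0"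
  using assms matrix_left_invertible_ker[of M] invertible_left_inverse[of M] invertible_det_nz[of M] by blast

text \<open>The order of vanishing at the origin is at least n. Products with elements of a power of
  the maximal ideal are later tested on monomials, of which only the degree matters.\<close>

definition low_order :: "nat \<Rightarrow> poly3 set" where
  "low_order n = {q. \<forall>m\<in>Poly_Mapping.keys q. n \<le> mdeg m}"

lemma low_order_mult: "p \<in> low_order n \<Longrightarrow> q \<in> low_order k \<Longrightarrow> p * q \<in> low_order (n + k)"
  unfolding low_order_def using keys_mult[of p q] by (fastforce simp: mdeg_add intro: add_mono)

lemma low_order_0: "p \<in> low_order 0"
  unfolding low_order_def by simp

lemma low_order_submodule: "module.subspace (*) (low_order n)"
proof (rule ideal_subspaceI)
  show "0 \<in> low_order n" unfolding low_order_def by simp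
  show "x + y \<in> low_order n" if "x \<in> low_order n" "y \<in> low_order n" for x y
    using that keys_add[of x y] unfolding low_order_def by blast
  show "c * x \<in> low_order n" if "x \<in> low_order n" for c x
    using low_order_mult[OF low_order_0 that] by simp
qed

lemma max_ideal_low_order: "max_ideal \<subseteq> low_order 1"
  unfolding max_ideal_def ideal_gen_def
  by (rule ideal_span_minimal[OF _ low_order_submodule]) (auto simp: low_order_def var3_def mdeg_single)

lemma ideal_power_low_order: "ideal_power max_ideal n \<subseteq> low_order n"
  unfolding ideal_power_def ideal_gen_def
proof (rule ideal_span_minimal[OF _ low_order_submodule], clarify)
  fix a :: "nat \<Rightarrow> poly3" assume a: "\<forall>j<n. a j \<in> max_ideal"
  have "k \<le> n \<Longrightarrow> (\<Prod>j<k. a j) \<in> low_order k" for k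
  proof (induction k)
    case (Suc k)
    then have "a k \<in> low_order 1" using a max_ideal_low_order by auto
    then show ?case using low_order_mult[of "\<Prod>j<k. a j" k "a k" 1] Suc by simp
  qed (simp add: low_order_0)
  then show "(\<Prod>j<n. a j) \<in> low_order n" by simp
qed

lemma forms_1_in_max_ideal:
  assumes "l \<in> forms 1"
  shows "l \<in> max_ideal"
proof -
  have "l = (\<Sum>i\<in>UNIV. pderiv3 i l * var3 i)" using euler_identity[OF assms] by (simp add: mult.commute)
  then show ?thesis unfolding max_ideal_def ideal_gen_def
    by (metis (no_types, lifting) ideal_span_sum ideal_span_scale ideal_span_base rangeI)
qed

lemma power_in_ideal_power:
  assumes "l \<in> I"
  shows "l ^ n \<in> ideal_power I n"
proof -
  have "l ^ n = (\<Prod>j<n. l)" by simp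
  then have "l ^ n \<in> {\<Prod>j<n. a j | a. \<forall>j<n. a j \<in> I}" using assms by blast
  then show ?thesis unfolding ideal_power_def ideal_gen_def by (rule ideal_span_base)
qed

context transversal_nodal
begin

text \<open>Normalizing by l = 1 picks one representative of each singular point and makes powers of
  \<open>l\<close> invisible in evaluations.\<close>

definition Npts :: "(complex^3) set" where "Npts = {x. singular_at f x \<and> poly_at l x = 1}"
definition J :: "poly3 set" where "J = {\<alpha> * gu + \<beta> * gv + \<gamma> * gw | \<alpha> \<beta> \<gamma>. True}"
text \<open>Saturation with respect to \<open>l\<close> only. As no singular point lies on l = 0, it
  contains the same forms as the full saturation.\<close>

definition Sat :: "poly3 set" where "Sat = {p. \<exists>n. l ^ n * p \<in> J}"

lemma JI: "\<alpha> * gu + \<beta> * gv + \<gamma> * gw \<in> J"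
  unfolding J_def by blast

lemma J_add: "p \<in> J \<Longrightarrow> q \<in> J \<Longrightarrow> p + q \<in> J"
proof -
  assume "p \<in> J" "q \<in> J"
  then obtain a b c a' b' c' where pq: "p = a * gu + b * gv + c * gw" "q = a' * gu + b' * gv + c' * gw" unfolding J_def by blast
  have "p + q = (a + a') * gu + (b + b') * gv + (c + c') * gw" unfolding pq by (simp only: distrib_right add_ac)
  then show ?thesis by (simp only: JI)
qed

lemma J_mult: "p \<in> J \<Longrightarrow> q * p \<in> J"
proof -
  assume "p \<in> J"
  then obtain a b c where p: "p = a * gu + b * gv + c * gw" unfolding J_def by blast
  have "q * p = (q * a) * gu + (q * b) * gv + (q * c) * gw" unfolding p by (simp only: distrib_left mult.assoc)
  then show ?thesis by (simp only: JI)
qed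

lemma J_0: "0 \<in> J"
  using JI[of 0 0 0] by simp

lemma J_sum: "(\<And>i. i \<in> A \<Longrightarrow> g i \<in> J) \<Longrightarrow> sum g A \<in> J"
  by (induction A rule: infinite_finite_induct) (auto intro: J_add J_0)

lemma partial_in_J: "pderiv3 i f \<in> J"
  unfolding partial_g by (rule JI)

lemma J_jacobian_ideal: "J = jacobian_ideal f"
proof
  show "jacobian_ideal f \<subseteq> J"
    using partial_in_J by (auto simp: jacobian_ideal_iff intro!: J_sum J_mult)
  show "J \<subseteq> jacobian_ideal f"
  proof
    fix p assume "p \<in> J"
    then obtain a b c where p: "p = a * gu + b * gv + c * gw" unfolding J_def by blast
    have dd: "a * dir_deriv y f = (\<Sum>i\<in>UNIV. (a * const3 (y $ i)) * pderiv3 i f)" for a y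
      unfolding dir_deriv_def by (simp only: sum_distrib_left mult.assoc)
    have "p = (\<Sum>i\<in>UNIV. (a * const3 (u $ i) + b * const3 (v $ i) + c * const3 (w $ i)) * pderiv3 i f)"
      unfolding p gu_def gv_def gw_def dd by (simp only: distrib_right sum.distrib)
    then show "p \<in> jacobian_ideal f" unfolding jacobian_ideal_iff
      by (rule exI[of _ "\<lambda>i. a * const3 (u $ i) + b * const3 (v $ i) + c * const3 (w $ i)"])
  qed
qed

lemma Qs_J: "q \<in> Qs k \<Longrightarrow> q \<in> J"
  unfolding Qs_def using JI[of _ _ 0] by auto

lemma J_graded:
  assumes "p \<in> J" "p \<in> forms n"
  obtains \<alpha> \<beta> \<gamma> where "\<alpha> \<in> graded_piece (int n - int e)" "\<beta> \<in> graded_piece (int n - int e)"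
    "\<gamma> \<in> graded_piece (int n - int e)" "p = \<alpha> * gu + \<beta> * gv + \<gamma> * gw"
proof -
  obtain a b c where p: "p = a * gu + b * gv + c * gw" using assms(1) unfolding J_def by blast
  let ?h = "\<lambda>a. if n < e then 0 else hcomp (n - e) a"
  have h: "?h a \<in> graded_piece (int n - int e)" for a
    using hcomp_in_forms[of "n - e" a] by (auto simp: of_nat_diff)
  have m: "hcomp n (a * g) = ?h a * g" if "g \<in> forms e" for a g
    using hcomp_mult_form[OF that, of n a] by simp
  have "p = hcomp n p" using hcomp_form[OF assms(2), of n] by simp
  also have "\<dots> = ?h a * gu + ?h b * gv + ?h c * gw"
    unfolding p hcomp_simps m[OF g_forms(1)] m[OF g_forms(2)] m[OF g_forms(3)] ..
  finally show ?thesis using that[OF h h h] by blast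
qed

lemma Sat_add: "p \<in> Sat \<Longrightarrow> q \<in> Sat \<Longrightarrow> p + q \<in> Sat"
proof -
  assume "p \<in> Sat" "q \<in> Sat"
  then obtain n m where nm: "l ^ n * p \<in> J" "l ^ m * q \<in> J" unfolding Sat_def by blast
  have "l ^ (n + m) * (p + q) = l ^ m * (l ^ n * p) + l ^ n * (l ^ m * q)" by (simp only: power_add distrib_left distrib_right mult_ac)
  then have "l ^ (n + m) * (p + q) \<in> J" using J_add[OF J_mult[OF nm(1)] J_mult[OF nm(2)]] by (simp only:)
  then show ?thesis unfolding Sat_def by blast
qed

lemma Sat_mult: "p \<in> Sat \<Longrightarrow> q * p \<in> Sat"
proof -
  assume "p \<in> Sat"
  then obtain n where "l ^ n * p \<in> J" unfolding Sat_def by blast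
  then have "q * (l ^ n * p) \<in> J" by (rule J_mult)
  then have "l ^ n * (q * p) \<in> J" by (simp only: mult.left_commute)
  then show ?thesis unfolding Sat_def by blast
qed

lemma Sat_diff: "p \<in> Sat \<Longrightarrow> q \<in> Sat \<Longrightarrow> p - q \<in> Sat"
  using Sat_add[of p "(- 1) * q"] Sat_mult[of q "- 1"] by simp

lemma J_Sat: "p \<in> J \<Longrightarrow> p \<in> Sat"
  unfolding Sat_def by (intro CollectI exI[of _ 0]) simp

lemma Sat_sum: "(\<And>i. i \<in> A \<Longrightarrow> g i \<in> Sat) \<Longrightarrow> sum g A \<in> Sat"
  by (induction A rule: infinite_finite_induct) (auto intro: Sat_add J_Sat J_0)

lemma Sat_l_power: "l ^ n * p \<in> Sat \<Longrightarrow> p \<in> Sat"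
proof -
  assume "l ^ n * p \<in> Sat"
  then obtain m where "l ^ m * (l ^ n * p) \<in> J" unfolding Sat_def by blast
  then have "l ^ (m + n) * p \<in> J" by (simp only: power_add mult.assoc)
  then show ?thesis unfolding Sat_def by blast
qed

lemma Sat_const: "const3 c * p \<in> Sat \<Longrightarrow> c \<noteq> 0 \<Longrightarrow> p \<in> Sat"
proof -
  assume a: "const3 c * p \<in> Sat" "c \<noteq> 0"
  have "const3 (1 / c) * (const3 c * p) = const3 (1 / c * c) * p" by (simp only: const3_simps mult.assoc)
  also have "1 / c * c = 1" using a(2) by simp
  finally have "const3 (1 / c) * (const3 c * p) = p" by (simp only: const3_simps mult_1_left)
  then show ?thesis using Sat_mult[OF a(1), of "const3 (1 / c)"] by (simp only:)
qed

text \<open>Modulo \<open>Sat\<close>, multiplication by x / l acts on a space of dimension at most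
  that of \<open>forms T\<close>, so a polynomial in x / l annihilates \<open>b\<close>. Dropping
  its linear factors one at a time until the product leaves \<open>Sat\<close> exhibits an
  eigenvector.\<close>

lemma eigen_step:
  assumes b: "b \<in> forms j" "b \<notin> Sat" and x: "x \<in> forms 1"
  shows "\<exists>c y m. y \<in> forms m \<and> y * b \<notin> Sat \<and> (x - const3 c * l) * (y * b) \<in> Sat"
proof -
  \<comment> \<open>The factor \<open>l ^ T\<close> raises the degree to where
    \<open>reduce_degree\<close> applies; membership in \<open>Sat\<close> ignores it.\<close>
  define b' where "b' = l ^ T * b"
  define M where "M = P3.dim (forms T)"
  define N where "N = M + (T + j)"
  have b': "b' \<in> forms (T + j)" unfolding b'_def using forms_mult[OF forms_power[OF stl(3), of T] b(1)] by simp
  let ?p = "\<lambda>n. (l ^ (M - n) * x ^ n) * b'"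
  have p: "?p n \<in> forms N" if "n \<le> M" for n
  proof -
    have "1 * (M - n) + 1 * n = M" using that by simp
    then have "l ^ (M - n) * x ^ n \<in> forms M"
      using forms_mult[OF forms_power[OF stl(3), of "M - n"] forms_power[OF x, of n]] by (simp only:)
    then show ?thesis using forms_mult[OF _ b'] unfolding N_def by blast
  qed
  have "\<exists>c. n \<le> M \<longrightarrow> c \<in> forms T \<and> ?p n - l ^ (N - T) * c \<in> Qs (int N)" for n
    using reduce_degree[OF p, of n] unfolding N_def by (cases "n \<le> M") auto
  then obtain c where c: "\<And>n. n \<le> M \<Longrightarrow> c n \<in> forms T" "\<And>n. n \<le> M \<Longrightarrow> ?p n - l ^ (N - T) * c n \<in> Qs (int N)" by metis
  obtain a where a: "\<exists>n\<le>M. a n \<noteq> 0" "(\<Sum>n\<le>M. scal3 (a n) (c n)) = 0"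
    using P3.linear_dependence[OF dim_forms(2), of T c] c(1) unfolding M_def by blast
  define F where "F = (\<Sum>n\<le>M. monom (a n) n)"
  have cF: "coeff F n = (if n \<le> M then a n else 0)" for n unfolding F_def by (simp add: coeff_sum)
  obtain n0 where n0: "n0 \<le> M" "a n0 \<noteq> 0" using a(1) by blast
  have "coeff F n0 \<noteq> 0" unfolding cF using n0 by simp
  then have F0: "F \<noteq> 0" by (metis coeff_0)
  have "\<forall>i>M. coeff F i = 0" unfolding cF by simp
  then have dF: "degree F \<le> M" by (rule degree_le)
  note F = F0 dF
  have "binform l x M F * b' = (\<Sum>n\<le>M. const3 (a n) * ?p n)"
    unfolding binform_def sum_distrib_right by (rule sum.cong[OF refl]) (simp only: cF atMost_iff if_True mult.assoc)
  also have "\<dots> = (\<Sum>n\<le>M. const3 (a n) * (?p n - l ^ (N - T) * c n)) + l ^ (N - T) * (\<Sum>n\<le>M. const3 (a n) * c n)"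
  proof -
    have eq: "k * p = k * (p - E * y) + E * (k * y)" for k p E y :: poly3 by (simp add: algebra_simps)
    show ?thesis unfolding sum_distrib_left sum.distrib[symmetric] by (rule sum.cong[OF refl]) (rule eq)
  qed
  finally have "binform l x M F * b' = (\<Sum>n\<le>M. const3 (a n) * (?p n - l ^ (N - T) * c n)) + l ^ (N - T) * (\<Sum>n\<le>M. const3 (a n) * c n)" .
  moreover have "(\<Sum>n\<le>M. const3 (a n) * c n) = 0" using a(2) unfolding scal3_const3 .
  ultimately have "binform l x M F * b' = (\<Sum>n\<le>M. const3 (a n) * (?p n - l ^ (N - T) * c n))"
    by (simp only: mult_zero_right add_0_right)
  moreover have "(\<Sum>n\<le>M. const3 (a n) * (?p n - l ^ (N - T) * c n)) \<in> Sat"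
    by (rule Sat_sum, rule Sat_mult, rule J_Sat, rule Qs_J, rule c(2)) simp
  ultimately have 1: "binform l x M F * b' \<in> Sat" by (simp only:)
  obtain k cs i where k: "k \<noteq> 0" "binform l x M F = const3 k * l ^ i * prod_list (map (\<lambda>c. x - const3 c * l) cs)"
    using binform_factor[OF F] by blast
  have "const3 k * (l ^ (i + T) * (prod_list (map (\<lambda>c. x - const3 c * l) cs) * b)) \<in> Sat"
    using 1 unfolding k(2) b'_def by (simp only: power_add mult_ac)
  then have "prod_list (map (\<lambda>c. x - const3 c * l) cs) * b \<in> Sat"
    using Sat_const[OF _ k(1)] Sat_l_power by blast
  then show ?thesis
  proof (induction cs)
    case Nil
    then show ?case using b(2) by simp
  next
    case (Cons c cs)
    let ?y = "prod_list (map (\<lambda>c. x - const3 c * l) cs)"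
    show ?case
    proof (cases "?y * b \<in> Sat")
      case False
      have "?y \<in> forms (length cs)"
      proof (induction cs)
        case Nil
        then show ?case using forms_one by simp
      next
        case (Cons c cs)
        have "x - const3 c * l \<in> forms 1" using x stl by (intro forms_diff forms_const3_mult)
        then show ?case using forms_mult[OF _ Cons] by fastforce
      qed
      moreover have "(x - const3 c * l) * (?y * b) \<in> Sat" using Cons(2) by (simp add: mult.assoc)
      ultimately show ?thesis using False by blast
    qed (use Cons(1) in blast)
  qed
qed

text \<open>Multiplications commute, so an eigenvalue equation for one variable survives the
  multiplications made for the next ones.\<close>

lemma joint_eigenvector:
  assumes b: "b \<in> forms j" "b \<notin> Sat"
  obtains y m x where "y \<in> forms m" "y * b \<notin> Sat" "\<And>i. (var3 i - const3 (x $ i) * l) * (y * b) \<in> Sat"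
proof -
  obtain c1 y1 m1 where 1: "y1 \<in> forms m1" "y1 * b \<notin> Sat" "(var3 1 - const3 c1 * l) * (y1 * b) \<in> Sat"
    using eigen_step[OF b forms_var3] by blast
  have f1: "y1 * b \<in> forms (m1 + j)" using forms_mult[OF 1(1) b(1)] .
  obtain c2 y2 m2 where 2: "y2 \<in> forms m2" "y2 * (y1 * b) \<notin> Sat" "(var3 2 - const3 c2 * l) * (y2 * (y1 * b)) \<in> Sat"
    using eigen_step[OF f1 1(2) forms_var3] by blast
  have f2: "y2 * (y1 * b) \<in> forms (m2 + (m1 + j))" using forms_mult[OF 2(1) f1] .
  obtain c3 y3 m3 where 3: "y3 \<in> forms m3" "y3 * (y2 * (y1 * b)) \<notin> Sat" "(var3 3 - const3 c3 * l) * (y3 * (y2 * (y1 * b))) \<in> Sat"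
    using eigen_step[OF f2 2(2) forms_var3] by blast
  let ?y = "y3 * (y2 * y1)"
  have yb: "?y * b = y3 * (y2 * (y1 * b))" by (simp only: mult.assoc)
  have m1: "(var3 1 - const3 c1 * l) * (?y * b) \<in> Sat"
    using Sat_mult[OF 1(3), of "y3 * y2"] by (simp only: mult_ac)
  have m2: "(var3 2 - const3 c2 * l) * (?y * b) \<in> Sat"
    using Sat_mult[OF 2(3), of y3] by (simp only: mult_ac)
  have m3: "(var3 3 - const3 c3 * l) * (?y * b) \<in> Sat" using 3(3) unfolding yb .
  show ?thesis
  proof (rule that[of ?y _ "point3 c1 c2 c3"])
    show "?y \<in> forms (m3 + (m2 + m1))" using forms_mult[OF 3(1) forms_mult[OF 2(1) 1(1)]] .
    show "?y * b \<notin> Sat" using 3(2) unfolding yb .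
    show "(var3 i - const3 (point3 c1 c2 c3 $ i) * l) * (?y * b) \<in> Sat" for i
      using exhaust_3[of i] m1 m2 m3 by auto
  qed
qed

lemma singularI:
  assumes "x \<noteq> 0" "poly_at gu x = 0" "poly_at gv x = 0" "poly_at gw x = 0"
  shows "singular_at f x"
proof -
  have p: "poly_at (pderiv3 i f) x = 0" for i unfolding partial_g using assms by (simp add: poly_at_simps)
  have "of_nat d * poly_at f x = 0" using euler_at[OF f, of x] p by (simp add: dir_deriv_def poly_at_simps)
  then show ?thesis unfolding singular_at_def using assms(1) p d2 by simp
qed

lemma singular_g:
  assumes "singular_at f x"
  shows "poly_at gu x = 0" "poly_at gv x = 0" "poly_at gw x = 0"
  using singular_partials[OF assms] by (simp_all add: gu_def gv_def gw_def dir_deriv_def poly_at_simps)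

text \<open>A form \<open>q\<close> acts on the eigenvector as its value at \<open>x\<close> times a
  power of \<open>l\<close>, so forms that carry \<open>g\<close> into \<open>Sat\<close> vanish at
  \<open>x\<close>; this applies to \<open>gu\<close>, \<open>gv\<close>, \<open>gw\<close>. Since
  \<open>J\<close> is the maximal ideal locally at a node, g(x) = 0 would put W g into
  \<open>J\<close> for some form \<open>W\<close> not vanishing at \<open>x\<close>.\<close>

lemma eigenvector_vanishing:
  assumes g: "g \<in> forms n" "g \<notin> Sat" and x: "\<And>i. (var3 i - const3 (x $ i) * l) * g \<in> Sat"
  shows "x \<in> Npts" "poly_at g x \<noteq> 0"
proof -
  have ev: "(q - const3 (poly_at q x) * l ^ m) * g \<in> Sat" if q: "q \<in> forms m" for q m
  proof -
    obtain A where A: "q - const3 (poly_at q x) * l ^ m = (\<Sum>i\<in>UNIV. A i * (var3 i - const3 (x $ i) * l))"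
      using point_decomposition[OF q stl(3)] by blast
    have "(\<Sum>i\<in>UNIV. A i * ((var3 i - const3 (x $ i) * l) * g)) \<in> Sat" by (rule Sat_sum, rule Sat_mult, rule x)
    then show ?thesis unfolding A sum_distrib_right by (simp only: mult.assoc)
  qed
  have zero: "poly_at q x = 0" if "q \<in> forms m" "q * g \<in> Sat" for q m
  proof (rule ccontr)
    assume nz: "poly_at q x \<noteq> 0"
    have "q * g - (q - const3 (poly_at q x) * l ^ m) * g \<in> Sat" using Sat_diff[OF that(2) ev[OF that(1)]] .
    then have "const3 (poly_at q x) * (l ^ m * g) \<in> Sat" by (simp add: algebra_simps)
    then show False using Sat_const[OF _ nz] Sat_l_power g(2) by blast
  qed
  have "const3 (1 - poly_at l x) * (l ^ 1 * g) \<in> Sat" using ev[OF stl(3)] by (simp add: algebra_simps)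
  note lg = this
  have lx: "poly_at l x = 1"
  proof (rule ccontr)
    assume "poly_at l x \<noteq> 1"
    then have "1 - poly_at l x \<noteq> 0" by simp
    then have "g \<in> Sat" by (rule Sat_l_power[OF Sat_const[OF lg]])
    then show False using g(2) by blast
  qed
  then have x0: "x \<noteq> 0" using poly_at_zero_form[OF stl(3)] by auto
  have Jg: "h * g \<in> Sat" if "h \<in> J" for h using Sat_mult[OF J_Sat[OF that], of g] by (simp only: mult.commute)
  have gJ: "gu \<in> J" "gv \<in> J" "gw \<in> J" using JI[of 1 0 0] JI[of 0 1 0] JI[of 0 0 1] by simp_all
  have sx: "singular_at f x"
    using singularI[OF x0] zero[OF g_forms(1) Jg[OF gJ(1)]] zero[OF g_forms(2) Jg[OF gJ(2)]] zero[OF g_forms(3) Jg[OF gJ(3)]] by blast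
  then show xN: "x \<in> Npts" unfolding Npts_def using lx by simp
  let ?xi = "\<lambda>i. var3 i - const3 (x $ i) * l"
  let ?F = "\<lambda>j. pderiv3 j f"
  let ?H = "\<lambda>i j. poly_at (pderiv3 i (pderiv3 j f)) x"
  have Ff: "?F j \<in> forms e" for j using pderiv3_forms[OF f] unfolding e_def .
  have ex: "\<exists>A. (\<forall>i. A i \<in> graded_piece (int e - 1)) \<and> ?F j = (\<Sum>i\<in>UNIV. A i * ?xi i)" for j
    using point_decomposition[OF Ff stl(3), of j x] singular_partials[OF sx, of j] by simp
  define A where "A j = (SOME A. (\<forall>i. A i \<in> graded_piece (int e - 1)) \<and> ?F j = (\<Sum>i\<in>UNIV. A i * ?xi i))" for j
  have A_spec: "(\<forall>i. A j i \<in> graded_piece (int e - 1)) \<and> ?F j = (\<Sum>i\<in>UNIV. A j i * ?xi i)" for j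
    unfolding A_def by (rule someI_ex[OF ex])
  have A: "A j i \<in> graded_piece (int e - 1)" "?F j = (\<Sum>i\<in>UNIV. A j i * ?xi i)" for j i
    using A_spec[of j] by blast+
  define lc where "lc i = poly_at (pderiv3 i l) x" for i
  have lc: "pderiv3 i l = const3 (lc i)" for i
  proof -
    have "pderiv3 i l \<in> forms 0" using pderiv3_forms[OF stl(3), of i] by simp
    then obtain c where "pderiv3 i l = const3 c" by (rule forms_0_const)
    then show ?thesis unfolding lc_def by (simp add: poly_at_simps)
  qed
  have l_eq: "l = (\<Sum>i\<in>UNIV. const3 (lc i) * var3 i)"
    using euler_identity[OF stl(3)] unfolding lc by (simp add: mult.commute)
  have lcx: "(\<Sum>i\<in>UNIV. lc i * x $ i) = 1" using lx by (subst (asm) l_eq) (simp add: poly_at_simps)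
  have l_xi: "(\<Sum>i\<in>UNIV. const3 (lc i) * ?xi i) = 0"
  proof -
    have "(\<Sum>i\<in>UNIV. const3 (lc i) * ?xi i) = (\<Sum>i\<in>UNIV. const3 (lc i) * var3 i) - const3 (\<Sum>i\<in>UNIV. lc i * x $ i) * l"
      by (simp add: right_diff_distrib sum_subtractf sum_3 algebra_simps)
    then show ?thesis unfolding lcx l_eq[symmetric] by simp
  qed
  have Hess: "?H k j = poly_at (A j k) x - (\<Sum>i\<in>UNIV. poly_at (A j i) x * x $ i) * lc k" for k j
  proof -
    have xi0: "poly_at (?xi i) x = 0" for i using lx by (simp add: poly_at_simps)
    have pxi: "poly_at (pderiv3 k (?xi i)) x = (if k = i then 1 else 0) - x $ i * lc k" for i
      by (simp add: pderiv3_simps lc poly_at_simps)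
    have "?H k j = (\<Sum>i\<in>UNIV. poly_at (A j i) x * ((if k = i then 1 else 0) - x $ i * lc k))"
      unfolding A(2) pderiv3_sum pderiv3_mult poly_at_simps(5,6,10) pxi xi0 by simp
    also have "\<dots> = (\<Sum>i\<in>UNIV. (if k = i then poly_at (A j i) x else 0) - poly_at (A j i) x * x $ i * lc k)"
      by (intro sum.cong refl) (simp add: algebra_simps)
    finally show ?thesis by (simp add: sum_subtractf sum_distrib_right)
  qed
  obtain k where k: "x $ k \<noteq> 0" using nonvanishing_var[OF x0] .
  \<comment> \<open>Any vector c whose product with \<open>x\<close> is nonzero would do; a unit
    vector at a nonzero coordinate of \<open>x\<close> is one.\<close>
  define c where "c j = (if j = k then 1 else 0 :: complex)" for j :: 3
  define \<kappa> where "\<kappa> j = (\<Sum>i\<in>UNIV. poly_at (A j i) x * x $ i)" for j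
  \<comment> \<open>The three forms \<open>?xi i\<close> satisfy one linear relation,
    \<open>l_xi\<close>. Adding multiples of it to the coefficients leaves \<open>?F j\<close>
    unchanged, and it turns the matrix at \<open>x\<close> into the Hessian, of rank two, plus a
    rank one term that makes it invertible.\<close>
  define B where "B j i = A j i + const3 ((c j - \<kappa> j) * lc i) * l ^ (e - 1)" for j i
  have BF: "?F j = (\<Sum>i\<in>UNIV. B j i * ?xi i)" for j
  proof -
    have "(\<Sum>i\<in>UNIV. B j i * ?xi i) = ?F j + const3 (c j - \<kappa> j) * l ^ (e - 1) * (\<Sum>i\<in>UNIV. const3 (lc i) * ?xi i)"
      unfolding A(2) B_def sum_3 by (simp add: algebra_simps)
    then show ?thesis unfolding l_xi by simp
  qed
  have Bx: "poly_at (B j i) x = ?H i j + c j * lc i" for i j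
    unfolding Hess \<kappa>_def[symmetric] B_def by (simp add: poly_at_simps lx algebra_simps)
  define M :: "complex^3^3" where "M = (\<chi> j i. poly_at (B j i) x)"
  have detM: "det M \<noteq> 0"
  proof (rule det_nonzero_of_kernel)
    fix y assume "M *v y = 0"
    then have My: "(\<Sum>i\<in>UNIV. poly_at (B j i) x * y $ i) = 0" for j
      by (simp add: M_def matrix_vector_mult_def vec_eq_iff)
    have My': "(\<Sum>i\<in>UNIV. ?H i j * y $ i) + c j * (\<Sum>i\<in>UNIV. lc i * y $ i) = 0" for j
      using My[of j] unfolding Bx by (simp add: distrib_right sum.distrib sum_distrib_left mult.assoc)
    have Hx: "(\<Sum>j\<in>UNIV. ?H i j * x $ j) = 0" for i using hessian_point[OF f sx] .
    have "(\<Sum>j\<in>UNIV. x $ j * ((\<Sum>i\<in>UNIV. ?H i j * y $ i) + c j * (\<Sum>i\<in>UNIV. lc i * y $ i))) = 0"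
      using My' by simp
    moreover have "(\<Sum>j\<in>UNIV. x $ j * ((\<Sum>i\<in>UNIV. ?H i j * y $ i) + c j * (\<Sum>i\<in>UNIV. lc i * y $ i)))
      = (\<Sum>i\<in>UNIV. (\<Sum>j\<in>UNIV. ?H i j * x $ j) * y $ i) + (\<Sum>j\<in>UNIV. x $ j * c j) * (\<Sum>i\<in>UNIV. lc i * y $ i)"
      unfolding sum_3 by (simp add: algebra_simps)
    moreover have "(\<Sum>j\<in>UNIV. x $ j * c j) = x $ k"
    proof -
      have "(\<Sum>j\<in>UNIV. x $ j * c j) = (\<Sum>j\<in>UNIV. if j = k then x $ k else 0)" unfolding c_def by (intro sum.cong) auto
      then show ?thesis by simp
    qed
    ultimately have ly: "(\<Sum>i\<in>UNIV. lc i * y $ i) = 0" using k unfolding Hx by simp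
    have "(\<Sum>j\<in>UNIV. ?H i j * y $ j) = 0" for i
      using My'[of i] ly by (simp add: pderiv3_commute[of i])
    then obtain a where a: "y = a *s x" using node_hessian_kernel[OF f nodal[OF sx]] by blast
    have "a * (\<Sum>i\<in>UNIV. lc i * x $ i) = 0" using ly unfolding a by (simp add: sum_distrib_left mult_ac)
    then show "y = 0" unfolding lcx a by simp
  qed
  \<comment> \<open>The determinant of the matrix \<open>B\<close>. The identities
    \<open>W1\<close>, \<open>W2\<close>, \<open>W3\<close> are Cramer's rule.\<close>
  define W where "W = B 1 1 * (B 2 2 * B 3 3 - B 2 3 * B 3 2) - B 1 2 * (B 2 1 * B 3 3 - B 2 3 * B 3 1) + B 1 3 * (B 2 1 * B 3 2 - B 2 2 * B 3 1)"
  have Wx: "poly_at W x \<noteq> 0"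
  proof -
    have "poly_at W x = det M" unfolding W_def det_3 M_def by (simp add: poly_at_simps algebra_simps)
    then show ?thesis using detM by simp
  qed
  have W1: "W * ?xi 1 = (B 2 2 * B 3 3 - B 2 3 * B 3 2) * ?F 1 + (B 1 3 * B 3 2 - B 1 2 * B 3 3) * ?F 2 + (B 1 2 * B 2 3 - B 1 3 * B 2 2) * ?F 3"
    unfolding W_def BF sum_3 by algebra
  have W2: "W * ?xi 2 = (B 2 3 * B 3 1 - B 2 1 * B 3 3) * ?F 1 + (B 1 1 * B 3 3 - B 1 3 * B 3 1) * ?F 2 + (B 1 3 * B 2 1 - B 1 1 * B 2 3) * ?F 3"
    unfolding W_def BF sum_3 by algebra
  have W3: "W * ?xi 3 = (B 2 1 * B 3 2 - B 2 2 * B 3 1) * ?F 1 + (B 1 2 * B 3 1 - B 1 1 * B 3 2) * ?F 2 + (B 1 1 * B 2 2 - B 1 2 * B 2 1) * ?F 3"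
    unfolding W_def BF sum_3 by algebra
  have Wxi: "W * ?xi i \<in> J" for i
  proof -
    have "W * ?xi 1 \<in> J" unfolding W1 by (intro J_add J_mult partial_in_J)
    moreover have "W * ?xi 2 \<in> J" unfolding W2 by (intro J_add J_mult partial_in_J)
    moreover have "W * ?xi 3 \<in> J" unfolding W3 by (intro J_add J_mult partial_in_J)
    ultimately show ?thesis using exhaust_3[of i] by blast
  qed
  have Bf: "B j i \<in> forms (e - 1)" for j i
  proof -
    have a: "A j i \<in> forms (e - 1)" by (rule graded_cong[OF A(1)]) (use e1 in simp)
    have b: "l ^ (e - 1) \<in> forms (e - 1)" using forms_power[OF stl(3), of "e - 1"] by (simp only: mult_1_left)
    show ?thesis unfolding B_def by (intro forms_add forms_const3_mult a b)
  qed
  define D where "D = (e - 1) + ((e - 1) + (e - 1))"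
  have Wf: "W \<in> forms D" unfolding W_def D_def by (intro forms_add forms_diff forms_mult Bf)
  show "poly_at g x \<noteq> 0"
  proof
    assume gx: "poly_at g x = 0"
    obtain C where C: "g = (\<Sum>i\<in>UNIV. C i * ?xi i)"
      using point_decomposition[OF g(1) stl(3), of x] gx by auto
    have "W * g = (\<Sum>i\<in>UNIV. C i * (W * ?xi i))"
      by (subst C) (simp add: sum_distrib_left mult_ac)
    moreover have "(\<Sum>i\<in>UNIV. C i * (W * ?xi i)) \<in> J" by (rule J_sum, rule J_mult, rule Wxi)
    ultimately have "W * g \<in> Sat" by (simp only: J_Sat)
    then show False using zero[OF Wf] Wx by blast
  qed
qed

lemma vanishing_Sat:
  assumes "b \<in> forms j" "\<And>x. x \<in> Npts \<Longrightarrow> poly_at b x = 0"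
  shows "b \<in> Sat"
proof (rule ccontr)
  assume "b \<notin> Sat"
  then obtain y m x where y: "y \<in> forms m" "y * b \<notin> Sat" "\<And>i. (var3 i - const3 (x $ i) * l) * (y * b) \<in> Sat"
    using joint_eigenvector[OF assms(1)] by blast
  have "x \<in> Npts" "poly_at (y * b) x \<noteq> 0"
    using eigenvector_vanishing[OF forms_mult[OF y(1) assms(1)] y(2,3)] by blast+
  then show False using assms(2) by (simp add: poly_at_simps)
qed

definition Ivan :: "nat \<Rightarrow> poly3 set" where
  "Ivan n = {p \<in> forms n. \<forall>x\<in>Npts. poly_at p x = 0}"

lemma Ivan_subspace: "P3.subspace (Ivan n)" "P3.fin_dim (Ivan n)"
  unfolding Ivan_def using vanishing_subspace fin_dim_forms_subset[OF vanishing_subspace] by blast+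

lemma J_vanish: "p \<in> J \<Longrightarrow> x \<in> Npts \<Longrightarrow> poly_at p x = 0"
  unfolding J_def Npts_def using singular_g by (auto simp: poly_at_simps)

lemma reduce_at:
  assumes "p - l ^ k * c \<in> J" "x \<in> Npts"
  shows "poly_at c x = poly_at p x"
  using J_vanish[OF assms] assms(2) unfolding Npts_def by (simp add: poly_at_simps)

text \<open>A basis of \<open>Ivan T\<close> gives one exponent of \<open>l\<close> for the whole
  space, and a form of higher degree is, modulo \<open>gu\<close> and \<open>gv\<close>, a power of
  \<open>l\<close> times an element of that space.\<close>

lemma Ivan_eventually_J:
  obtains n0 where "\<And>j p. j \<ge> n0 \<Longrightarrow> p \<in> Ivan j \<Longrightarrow> p \<in> J"
proof -
  obtain B where B: "finite B" "B \<subseteq> Ivan T" "P3.span B = Ivan T"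
    using P3.fin_dim_basis[OF Ivan_subspace(2)] by metis
  have "\<exists>n. l ^ n * b \<in> J" if "b \<in> B" for b
    using vanishing_Sat[of b T] B(2) that unfolding Ivan_def Sat_def by blast
  then obtain n where n: "\<And>b. b \<in> B \<Longrightarrow> l ^ n b * b \<in> J" by metis
  define m where "m = (\<Sum>b\<in>B. n b)"
  let ?V = "{c. l ^ m * c \<in> J}"
  have "B \<subseteq> ?V"
  proof
    fix b assume b: "b \<in> B"
    have "n b \<le> m" unfolding m_def using b B(1) by (intro member_le_sum) auto
    then have "l ^ m * b = l ^ (m - n b) * (l ^ n b * b)" unfolding mult.assoc[symmetric] power_add[symmetric] by simp
    then have "l ^ m * b \<in> J" using J_mult[OF n[OF b], of "l ^ (m - n b)"] by (simp only:)
    then show "b \<in> ?V" by blast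
  qed
  moreover have "P3.subspace ?V"
    unfolding P3.subspace_def scal3_const3
  proof (intro conjI allI ballI)
    show "0 \<in> ?V" using J_0 by simp
    show "x + y \<in> ?V" if "x \<in> ?V" "y \<in> ?V" for x y using J_add that by (simp add: distrib_left)
    show "const3 c * x \<in> ?V" if "x \<in> ?V" for c x
      using J_mult[of "l ^ m * x" "const3 c"] that unfolding mem_Collect_eq mult.left_commute[of "l ^ m" "const3 c"] by blast
  qed
  ultimately have V: "Ivan T \<subseteq> ?V" using P3.span_minimal B(3) by metis
  show ?thesis
  proof (rule that[of "T + m"])
    fix j p assume j: "T + m \<le> j" and p: "p \<in> Ivan j"
    obtain c where c: "c \<in> forms T" "p - l ^ (j - T) * c \<in> Qs (int j)"
      using reduce_degree[of p j] p j unfolding Ivan_def by auto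
    have "c \<in> Ivan T" using reduce_at[OF Qs_J[OF c(2)]] c(1) p unfolding Ivan_def by simp
    then have "l ^ m * c \<in> J" using V by blast
    then have "l ^ (j - T - m) * (l ^ m * c) \<in> J" by (rule J_mult)
    moreover have "l ^ (j - T - m) * (l ^ m * c) = l ^ (j - T) * c"
      using j unfolding mult.assoc[symmetric] power_add[symmetric] by simp
    ultimately have "l ^ (j - T) * c \<in> J" by (simp only:)
    then have "(p - l ^ (j - T) * c) + l ^ (j - T) * c \<in> J" by (rule J_add[OF Qs_J[OF c(2)]])
    then show "p \<in> J" by (simp only: diff_add_cancel)
  qed
qed

theorem saturation_forms: "saturation (jacobian_ideal f) \<inter> forms k = Ivan k"
proof
  show "saturation (jacobian_ideal f) \<inter> forms k \<subseteq> Ivan k"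
  proof
    fix p assume p: "p \<in> saturation (jacobian_ideal f) \<inter> forms k"
    then obtain n where "\<forall>q\<in>ideal_power max_ideal n. p * q \<in> J" unfolding saturation_def J_jacobian_ideal by blast
    then have "p * l ^ n \<in> J" using power_in_ideal_power[OF forms_1_in_max_ideal[OF stl(3)]] by blast
    then have "poly_at (p * l ^ n) x = 0" if "x \<in> Npts" for x using J_vanish that by blast
    then have "poly_at p x = 0" if "x \<in> Npts" for x using that unfolding Npts_def by (simp add: poly_at_simps)
    then show "p \<in> Ivan k" using p unfolding Ivan_def by blast
  qed
  show "Ivan k \<subseteq> saturation (jacobian_ideal f) \<inter> forms k"
  proof
    fix p assume p: "p \<in> Ivan k"
    obtain n where n: "\<And>j p. j \<ge> n \<Longrightarrow> p \<in> Ivan j \<Longrightarrow> p \<in> J" using Ivan_eventually_J by blast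
    have "p * q \<in> J" if q: "q \<in> ideal_power max_ideal n" for q
    proof -
      have ql: "q \<in> low_order n" using ideal_power_low_order q by blast
      have "p * Poly_Mapping.single m (Poly_Mapping.lookup q m) \<in> J" if "m \<in> Poly_Mapping.keys q" for m
      proof (rule n)
        show "n \<le> k + mdeg m" using ql that unfolding low_order_def by auto
        show "p * Poly_Mapping.single m (Poly_Mapping.lookup q m) \<in> Ivan (k + mdeg m)"
          using p forms_mult[of p k "Poly_Mapping.single m (Poly_Mapping.lookup q m)" "mdeg m"]
          unfolding Ivan_def by (simp add: forms_single poly_at_simps)
      qed
      then have "(\<Sum>m\<in>Poly_Mapping.keys q. p * Poly_Mapping.single m (Poly_Mapping.lookup q m)) \<in> J" by (rule J_sum)
      then show ?thesis unfolding sum_distrib_left[symmetric] poly3_monomials[of q, symmetric] .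
    qed
    then show "p \<in> saturation (jacobian_ideal f) \<inter> forms k"
      using p unfolding saturation_def J_jacobian_ideal Ivan_def by blast
  qed
qed

section \<open>Independence of conditions and duality\<close>

text \<open>A singular point on the line l = 0 would be a common zero of \<open>P\<close> and
  \<open>Q\<close>. The point \<open>v\<close>, which has parameter infinity, is excluded by the
  exact degree of \<open>Q\<close>.\<close>

lemma l_nonzero_at_singular:
  assumes "singular_at f x"
  shows "poly_at l x \<noteq> 0"
proof
  assume lx: "poly_at l x = 0"
  have x0: "x \<noteq> 0" using assms unfolding singular_at_def by blast
  have "x $ i = u $ i * poly_at s x + v $ i * poly_at t x" for i
    using arg_cong[OF coords[of i], of "\<lambda>p. poly_at p x"] lx by (simp add: poly_at_simps)
  then have xeq: "x = poly_at s x *s u + poly_at t x *s v" by (simp add: vec_eq_iff mult.commute)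
  show False
  proof (cases "poly_at s x = 0")
    case True
    then have x2: "x = poly_at t x *s v" using xeq by simp
    then have "poly_at t x \<noteq> 0" using x0 by auto
    moreover have "poly_at t x ^ e * poly_at gv v = 0"
      using poly_at_scale[OF g_forms(2), of "poly_at t x" v] singular_g(2)[OF assms] x2 by simp
    ultimately have "coeff Q e = 0" using degree_line_restr(2)[OF g_forms(2), of u v] unfolding Q_def by simp
    then show False using degQ Q0 by (metis leading_coeff_0_iff)
  next
    case False
    define z where "z = poly_at t x / poly_at s x"
    have x2: "x = poly_at s x *s (u + z *s v)"
      by (subst xeq) (use False in \<open>simp add: z_def vec_eq_iff field_simps\<close>)
    have "poly P z = 0" "poly Q z = 0"
      unfolding P_def Q_def poly_line_restr
      using poly_at_scale[OF g_forms(1), of "poly_at s x" "u + z *s v"] poly_at_scale[OF g_forms(2), of "poly_at s x" "u + z *s v"]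
        singular_g[OF assms] x2 False by simp_all
    then have "is_unit [:- z, 1:]" using coprimePQ by (metis coprime_common_divisor poly_eq_0_iff_dvd)
    then show False by (simp add: is_unit_pCons_iff)
  qed
qed

lemma Npts_inj: "inj_on (\<lambda>x. vec.span {x}) Npts"
proof (rule inj_onI)
  fix x y assume x: "x \<in> Npts" and y: "y \<in> Npts" and eq: "vec.span {x} = vec.span {y}"
  have "x \<noteq> 0" using x unfolding Npts_def singular_at_def by blast
  then obtain c where c: "x = c *s y" using eq vec_span_eq_iff by blast
  have "poly_at l x = c * poly_at l y" unfolding c using poly_at_scale[OF stl(3), of c y] by simp
  then have "c = 1" using x y unfolding Npts_def by simp
  then show "x = y" using c by simp
qed

text \<open>Points are easy to separate in large degree, and the reduction to degree T modulo
  \<open>gu\<close>, \<open>gv\<close> keeps the values on \<open>Npts\<close>. The number of points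
  is therefore bounded by the dimension of \<open>forms T\<close>.\<close>

lemma Npts_separated:
  assumes "finite A" "A \<subseteq> Npts" "x \<in> A"
  shows "\<exists>p\<in>forms T. poly_at p x \<noteq> 0 \<and> (\<forall>y\<in>A. y \<noteq> x \<longrightarrow> poly_at p y = 0)"
proof -
  have "0 \<notin> A" using assms(2) unfolding Npts_def singular_at_def by blast
  then obtain p where p: "p \<in> forms (T + card A)" "poly_at p x \<noteq> 0" "\<And>y. y \<in> A \<Longrightarrow> y \<noteq> x \<Longrightarrow> poly_at p y = 0"
    using separating_form[OF assms(1) _ inj_on_subset[OF Npts_inj assms(2)] assms(3), of "T + card A"] by auto
  obtain c where c: "c \<in> forms T" "p - l ^ (T + card A - T) * c \<in> Qs (int (T + card A))"
    using reduce_degree[OF p(1)] by auto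
  have "poly_at c y = poly_at p y" if "y \<in> A" for y using reduce_at[OF Qs_J[OF c(2)]] that assms(2) by blast
  then show ?thesis using p c(1) assms(3) by (intro bexI[of _ c]) auto
qed

lemma Npts_finite: "finite Npts"
proof -
  have "card A \<le> P3.dim (forms T)" if "A \<subseteq> Npts" "finite A" for A
    using dim_vanishing[OF that(2) Npts_separated[OF that(2,1)]] by linarith
  then show ?thesis using finite_if_finite_subsets_card_bdd[of Npts] by blast
qed

lemma dim_Ivan_T: "P3.dim (Ivan T) + card Npts = P3.dim (forms T)"
  unfolding Ivan_def using dim_vanishing[OF Npts_finite Npts_separated[OF Npts_finite subset_refl]] .

lemma card_nodes: "card (nodes f) = card Npts"
proof -
  have "nodes f = (\<lambda>x. vec.span {x}) ` Npts"
  proof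
    show "(\<lambda>x. vec.span {x}) ` Npts \<subseteq> nodes f" unfolding nodes_def Npts_def using nodal by blast
    show "nodes f \<subseteq> (\<lambda>x. vec.span {x}) ` Npts"
    proof
      fix X assume "X \<in> nodes f"
      then obtain x where x: "X = vec.span {x}" "node_at f x" unfolding nodes_def by blast
      then have s: "singular_at f x" unfolding node_at_def by blast
      define c where "c = 1 / poly_at l x"
      have c: "c \<noteq> 0" using l_nonzero_at_singular[OF s] unfolding c_def by simp
      have "poly_at l (c *s x) = 1" using poly_at_scale[OF stl(3), of c x] l_nonzero_at_singular[OF s] unfolding c_def by simp
      moreover have "singular_at f (c *s x)"
        using s c poly_at_scale[OF f] poly_at_scale[OF pderiv3_forms[OF f]] unfolding singular_at_def by simp
      ultimately have "c *s x \<in> Npts" unfolding Npts_def by blast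
      moreover have "X = vec.span {c *s x}"
      proof -
        have "c *s x \<noteq> 0" using s c unfolding singular_at_def by simp
        then show ?thesis unfolding x(1) using vec_span_eq_iff[of "c *s x" x] c by blast
      qed
      ultimately show "X \<in> (\<lambda>x. vec.span {x}) ` Npts" by blast
    qed
  qed
  then show ?thesis using card_image[OF Npts_inj] by simp
qed

text \<open>The colon ideal (gu, gv) : gw in degree m, that is, the forms through the points
  residual to the nodes; equivalently, the possible coefficients of \<open>gw\<close> in a relation
  between the three derivatives.\<close>

definition Hs :: "nat \<Rightarrow> poly3 set" where
  "Hs m = {h \<in> forms m. h * gw \<in> Qs (int (m + e))}"

lemma Hs_subspace: "P3.subspace (Hs m)" "P3.fin_dim (Hs m)"
proof -
  show s: "P3.subspace (Hs m)"
    unfolding P3.subspace_def scal3_const3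
  proof (intro conjI allI ballI)
    show "0 \<in> Hs m" unfolding Hs_def using Qs_0 by simp
    show "x + y \<in> Hs m" if "x \<in> Hs m" "y \<in> Hs m" for x y
      using that forms_add Qs_add unfolding Hs_def by (simp add: distrib_right)
    show "const3 c * x \<in> Hs m" if "x \<in> Hs m" for c x
      using that forms_const3_mult Qs_const unfolding Hs_def by (simp add: mult.assoc)
  qed
  show "P3.fin_dim (Hs m)" using fin_dim_forms_subset[OF s] unfolding Hs_def by blast
qed

lemma dim_zero_set: "P3.dim {0} = 0"
  using P3.dim_span[of "{}"] P3.dim_eq_card_independent[OF P3.independent_empty] P3.span_empty by simp

text \<open>
  In \<open>forms T\<close> with the pairing \<open>trace\<close>, the orthogonal complement of the space generated by
  \<open>forms k\<close> and the forms vanishing at the nodes is \<open>Hs (T - 1 - k)\<close>, modulo \<open>Qs T\<close>.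
\<close>

lemma conditions_duality:
  assumes k: "Suc (k + m) = T" "e \<le> k + 2"
  shows "P3.dim (forms k) + P3.dim (Hs m) = P3.dim (Ivan k) + card Npts"
proof -
  have Tm: "T - k = Suc m" "T = k + Suc m" "k < T" using k(1) by auto
  \<comment> \<open>For m < e the ideal of \<open>gu\<close>, \<open>gv\<close> is zero in degree m,
    so that \<open>Hs m\<close> itself, and not a quotient of it, is counted.\<close>
  have me: "m < e" using k unfolding T_def by auto
  have TT: "T + T = 2 * T" by simp
  let ?L = "\<lambda>p. l ^ (T - k) * p" and ?K = "\<lambda>p. l ^ Suc k * p"
  have lf: "l ^ n \<in> forms n" for n using forms_power[OF stl(3), of n] by simp
  have l0: "l ^ n \<noteq> 0" for n using stl(4) by simp
  note A = dim_mult_forms[OF l0 dim_forms(2), of "T - k" k]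
  let ?A = "?L ` forms k"
  define U where "U = {x + y |x y. x \<in> ?A \<and> y \<in> Ivan T}"
  have AT: "?A \<subseteq> forms T" using forms_mult[OF lf[of "T - k"], of _ k] k(1) by auto
  have int: "?A \<inter> Ivan T = ?L ` Ivan k"
  proof
    show "?A \<inter> Ivan T \<subseteq> ?L ` Ivan k"
      unfolding Ivan_def Npts_def by (auto simp: poly_at_simps)
    show "?L ` Ivan k \<subseteq> ?A \<inter> Ivan T"
      using AT unfolding Ivan_def by (auto simp: poly_at_simps)
  qed
  have dU: "P3.dim U + P3.dim (Ivan k) = P3.dim (forms k) + P3.dim (Ivan T)"
    using P3.fin_dim_sum(2)[OF A(1) Ivan_subspace(2)[of T]] A(2) dim_mult_forms(2)[OF l0 Ivan_subspace(2)[of k], of "T - k"]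
    unfolding int U_def by simp
  have fU: "P3.fin_dim U" unfolding U_def using P3.fin_dim_sum(1)[OF A(1) Ivan_subspace(2)] .
  have UT: "U \<subseteq> forms T" unfolding U_def using AT forms_add unfolding Ivan_def by blast
  have mT: "p * q \<in> forms (2 * T)" if "p \<in> forms T" "q \<in> forms T" for p q
    using forms_mult[OF that] unfolding TT .
  have T2: "T \<le> 2 * T" by simp
  let ?\<beta> = "\<lambda>p q. trace (2 * T) (p * q)"
  have lin1: "P3.linear_on U (\<lambda>p. ?\<beta> p q)" if "q \<in> forms T" for q
    unfolding P3.linear_on_def scal3_const3
  proof (intro conjI allI ballI)
    show "?\<beta> (x + y) q = ?\<beta> x q + ?\<beta> y q" if "x \<in> U" "y \<in> U" for x y
      unfolding distrib_right using trace_add[OF mT mT T2] that UT \<open>q \<in> forms T\<close> by blast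
    show "?\<beta> (const3 c * x) q = c * ?\<beta> x q" if "x \<in> U" for c x
      unfolding mult.assoc using trace_scale[OF mT T2] that UT \<open>q \<in> forms T\<close> by blast
  qed
  have lin2: "P3.linear_on (forms T) (?\<beta> p)" if "p \<in> U" for p
    unfolding P3.linear_on_def scal3_const3
  proof (intro conjI allI ballI)
    show "?\<beta> p (x + y) = ?\<beta> p x + ?\<beta> p y" if "x \<in> forms T" "y \<in> forms T" for x y
      unfolding distrib_left using trace_add[OF mT mT T2] that UT \<open>p \<in> U\<close> by blast
    show "?\<beta> p (const3 c * x) = c * ?\<beta> p x" if "x \<in> forms T" for c x
      unfolding mult.left_commute[of p] using trace_scale[OF mT T2] that UT \<open>p \<in> U\<close> by blast
  qed
  have QI: "Qs (int T) \<subseteq> Ivan T" unfolding Ivan_def using Qs_forms J_vanish Qs_J by blast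
  have QU: "Qs (int T) \<subseteq> U"
  proof
    fix q assume "q \<in> Qs (int T)"
    then have "q \<in> Ivan T" using QI by blast
    moreover have "0 \<in> ?A" by (rule image_eqI[of _ _ 0]) simp_all
    ultimately have "0 + q \<in> U" unfolding U_def by blast
    then show "q \<in> U" by simp
  qed
  have tQ: "?\<beta> q p = 0" "?\<beta> p q = 0" if "q \<in> Qs (int T)" "p \<in> forms T" for p q
  proof -
    have "int T + int T = int (2 * T)" by simp
    then have "p * q \<in> Qs (int (2 * T))" using Qs_mult[OF that] by (simp only:)
    then show "?\<beta> p q = 0" using trace_Qs[OF _ T2] by blast
    then show "?\<beta> q p = 0" by (simp only: mult.commute)
  qed
  have ker1: "{p\<in>U. \<forall>q\<in>forms T. ?\<beta> p q = 0} = Qs (int T)"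
    using trace_nondegenerate UT QU tQ(1) by blast
  let ?KH = "?K ` Hs m"
  have KT: "?K h \<in> forms T" if "h \<in> forms m" for h
  proof -
    have "Suc k + m = T" using k(1) by simp
    then show ?thesis using forms_mult[OF lf[of "Suc k"] that] by (simp only:)
  qed
  have ker2: "{q\<in>forms T. \<forall>p\<in>U. ?\<beta> p q = 0} = {x + y |x y. x \<in> ?KH \<and> y \<in> Qs (int T)}"
  proof
    show "{q\<in>forms T. \<forall>p\<in>U. ?\<beta> p q = 0} \<subseteq> {x + y |x y. x \<in> ?KH \<and> y \<in> Qs (int T)}"
    proof
      fix q assume q: "q \<in> {q\<in>forms T. \<forall>p\<in>U. ?\<beta> p q = 0}"
      then have qT: "q \<in> forms T" and q0: "\<And>p. p \<in> U \<Longrightarrow> ?\<beta> q p = 0" by (auto simp only: mult.commute)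
      have z: "trace (2 * T) (q * (l ^ (T - k) * b)) = 0" if "b \<in> forms k" for b
      proof -
        have "0 \<in> Ivan T" using P3.subspace_0[OF Ivan_subspace(1)] .
        then have "l ^ (T - k) * b + 0 \<in> U" unfolding U_def using that by blast
        then have "l ^ (T - k) * b \<in> U" by (simp only: add_0_right)
        then show ?thesis by (rule q0)
      qed
      have IU: "b \<in> U" if "b \<in> Ivan T" for b
      proof -
        have "0 \<in> ?A" by (rule image_eqI[of _ _ 0]) simp_all
        then have "0 + b \<in> U" using that unfolding U_def by blast
        then show ?thesis by simp
      qed
      \<comment> \<open>Orthogonality to the multiples of \<open>l ^ (T - k)\<close> makes
        \<open>q\<close> divisible by \<open>l ^ Suc k\<close> modulo the ideal. Orthogonality to
        \<open>Ivan T\<close> will show that the cofactor lies in \<open>Hs m\<close>.\<close>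
      obtain h where h: "h \<in> graded_piece (int T - int (Suc k))" "q - l ^ Suc k * h \<in> Qs (int T)"
        using trace_descent[OF qT _ z le_refl] Tm(3) by auto
      have hm: "h \<in> forms m" using h(1) by (rule graded_cong) (use Tm(2) in simp)
      let ?p = "?K h * gw"
      have pf: "?p \<in> forms (T + e)" using forms_mult[OF KT[OF hm] g_forms(3)] .
      \<comment> \<open>\<open>c\<close> represents h gw in degree T, and by nondegeneracy it is
        enough that it is orthogonal to every \<open>b\<close>. For this gw is moved over to
        \<open>b\<close>: the reduction \<open>b'\<close> of gw b vanishes at the nodes, so
        \<open>q\<close> is orthogonal to it.\<close>
      obtain c where c: "c \<in> forms T" "?p - l ^ (T + e - T) * c \<in> Qs (int (T + e))" using reduce_degree[OF pf] by auto
      have ce: "l ^ (T + e - T) = l ^ e" by simp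
      have "c \<in> Qs (int T)"
      proof (rule trace_nondegenerate[OF c(1)])
        fix b assume b: "b \<in> forms T"
        have gb: "gw * b \<in> forms (T + e)" using forms_mult[OF g_forms(3) b] by (simp only: add.commute)
        obtain b' where b': "b' \<in> forms T" "gw * b - l ^ (T + e - T) * b' \<in> Qs (int (T + e))" using reduce_degree[OF gb] by auto
        have "b' \<in> Ivan T"
          using reduce_at[OF Qs_J[OF b'(2)]] b'(1) singular_g(3) unfolding Ivan_def Npts_def by (simp add: poly_at_simps)
        then have 0: "?\<beta> q b' = 0" using q0 IU by blast
        have i1: "int T + int (T + e) = int (2 * T + e)" by simp
        have q1: "b * (?p - l ^ e * c) \<in> Qs (int (2 * T + e))" using Qs_mult[OF c(2)[unfolded ce] b] unfolding i1 .
        have q2: "?K h * (gw * b - l ^ e * b') \<in> Qs (int (2 * T + e))" using Qs_mult[OF b'(2)[unfolded ce] KT[OF hm]] unfolding i1 .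
        have "E * (c * b) = E * (X * b') + (X * (gw * b - E * b') - b * (X * gw - E * c))" for E X :: poly3
          by (simp add: algebra_simps)
        note eq = this[of "l ^ e" "?K h"]
        have TE: "T \<le> 2 * T + e" by simp
        have lkb: "l ^ e * (?K h * b') \<in> forms (2 * T + e)"
          using forms_mult[OF lf[of e] mT[OF KT[OF hm] b'(1)]] by (simp only: add.commute)
        note qd = Qs_diff[OF q2 q1]
        have "trace (2 * T) (c * b) = trace (2 * T + e) (l ^ e * (c * b))"
          using trace_l_power[OF mT[OF c(1) b] T2, of e] by (simp only:)
        also have "\<dots> = trace (2 * T + e) (l ^ e * (?K h * b'))"
          unfolding eq trace_add[OF lkb Qs_forms[OF qd] TE] trace_Qs[OF qd TE] by simp
        also have "\<dots> = ?\<beta> (?K h) b'"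
          using trace_l_power[OF mT[OF KT[OF hm] b'(1)] T2, of e] by (simp only:)
        also have "\<dots> = 0"
        proof -
          have "q * b' = X * b' + (q - X) * b'" for X by (simp add: algebra_simps)
          note eq' = this[of "?K h"]
          have "?\<beta> q b' = ?\<beta> (?K h) b' + ?\<beta> (q - ?K h) b'"
            using trace_add[OF mT[OF KT[OF hm] b'(1)] mT[OF Qs_forms[OF h(2)] b'(1)] T2] unfolding eq'[symmetric] .
          then show ?thesis using 0 tQ(1)[OF h(2) b'(1)] by simp
        qed
        finally show "trace (2 * T) (c * b) = 0" .
      qed
      then have "l ^ e * c \<in> Qs (int e + int T)" using Qs_mult[OF _ lf[of e]] by blast
      moreover have "int e + int T = int (T + e)" by simp
      ultimately have "l ^ e * c \<in> Qs (int (T + e))" by (simp only:)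
      then have "(?p - l ^ e * c) + l ^ e * c \<in> Qs (int (T + e))" by (rule Qs_add[OF c(2)[unfolded ce]])
      then have "l ^ Suc k * (h * gw) \<in> Qs (int (T + e))" by (simp only: diff_add_cancel mult.assoc)
      moreover have "T + e = (m + e) + Suc k" using k(1) by simp
      ultimately have "h * gw \<in> Qs (int (m + e))"
        using Qs_l_power_regular[OF forms_mult[OF hm g_forms(3)], of "Suc k"] by (simp only:)
      then have "h \<in> Hs m" unfolding Hs_def using hm by blast
      moreover have "q = ?K h + (q - ?K h)" by simp
      ultimately show "q \<in> {x + y |x y. x \<in> ?KH \<and> y \<in> Qs (int T)}" using h(2) by blast
    qed
    show "{x + y |x y. x \<in> ?KH \<and> y \<in> Qs (int T)} \<subseteq> {q\<in>forms T. \<forall>p\<in>U. ?\<beta> p q = 0}"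
    proof clarify
      fix h y assume h: "h \<in> Hs m" and y: "y \<in> Qs (int T)"
      have hm: "h \<in> forms m" and hg: "h * gw \<in> Qs (int (m + e))" using h unfolding Hs_def by auto
      have hy: "?K h + y \<in> forms T" using forms_add[OF KT[OF hm] Qs_forms[OF y]] .
      moreover have "?\<beta> p (?K h + y) = 0" if "p \<in> U" for p
      proof -
        obtain b z where bz: "b \<in> forms k" "z \<in> Ivan T" "p = ?L b + z" using \<open>p \<in> U\<close> unfolding U_def by blast
        have zT: "z \<in> forms T" using bz(2) unfolding Ivan_def by blast
        have LT: "?L b \<in> forms T" using AT bz(1) by blast
        have "?L b * ?K h = l ^ (T + (T - (k + m))) * (b * h)"
        proof -
          have "(T - k) + Suc k = T + (T - (k + m))" using k(1) by simp
          then have "l ^ (T - k) * l ^ Suc k = l ^ (T + (T - (k + m)))" unfolding power_add[symmetric] by (simp only:)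
          then show ?thesis by (simp only: mult_ac)
        qed
        \<comment> \<open>The product \<open>b * h\<close> has degree k + m = T - 1, one below the
          socle degree.\<close>
        moreover have "trace (T + T) (l ^ (T + (T - (k + m))) * (b * h)) = 0"
          using trace_low[OF forms_mult[OF bz(1) hm], of T] k(1) by simp
        ultimately have 1: "?\<beta> (?L b) (?K h) = 0" unfolding TT by (simp only:)
        \<comment> \<open>Some \<open>l ^ n * z\<close> is a combination of \<open>gu\<close>,
          \<open>gv\<close>, \<open>gw\<close>, and multiplication by \<open>h\<close> carries its
          \<open>gw\<close> term into the ideal of \<open>gu\<close>, \<open>gv\<close>. The power
          of \<open>l\<close> can then be cancelled.\<close>
        have "z \<in> Sat" using vanishing_Sat[OF zT] bz(2) unfolding Ivan_def by blast
        then obtain n where n: "l ^ n * z \<in> J" unfolding Sat_def by blast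
        have nz: "l ^ n * z \<in> forms (n + T)" using forms_mult[OF lf zT] .
        obtain \<alpha> \<beta> \<gamma> where g: "\<alpha> \<in> graded_piece (int (n + T) - int e)" "\<beta> \<in> graded_piece (int (n + T) - int e)"
          "\<gamma> \<in> graded_piece (int (n + T) - int e)" "l ^ n * z = \<alpha> * gu + \<beta> * gv + \<gamma> * gw" using J_graded[OF n nz] .
        have q1: "h * (\<alpha> * gu + \<beta> * gv) \<in> Qs (int m + int (n + T))" using Qs_mult[OF QsI[OF g(1,2)] hm] .
        have q2: "\<gamma> * (h * gw) \<in> Qs (int m + int (n + T))"
          using Qs_mult[OF hg g(3)] by (simp add: algebra_simps)
        have "l ^ n * (z * h) = h * (\<alpha> * gu + \<beta> * gv) + \<gamma> * (h * gw)"
        proof -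
          have "l ^ n * (z * h) = h * (l ^ n * z)" by (simp only: mult_ac)
          then show ?thesis unfolding g(4) by (simp add: algebra_simps)
        qed
        then have "l ^ n * (z * h) \<in> Qs (int m + int (n + T))" using Qs_add[OF q1 q2] by (simp only:)
        moreover have "int m + int (n + T) = int ((T + m) + n)" by simp
        ultimately have zh: "z * h \<in> Qs (int (T + m))"
          using Qs_l_power_regular[OF forms_mult[OF zT hm], of n] by (simp only:)
        have "l ^ Suc k * (z * h) \<in> Qs (int (Suc k) + int (T + m))" using Qs_mult[OF zh lf] .
        moreover have "int (Suc k) + int (T + m) = int (2 * T)" using k(1) by simp
        moreover have "l ^ Suc k * (z * h) = z * ?K h" by (simp only: mult_ac)
        ultimately have "z * ?K h \<in> Qs (int (2 * T))" by (simp only:)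
        then have 2: "?\<beta> z (?K h) = 0" using trace_Qs[OF _ T2] by blast
        have pT: "p \<in> forms T" using UT \<open>p \<in> U\<close> by blast
        have "?\<beta> p (?K h + y) = ?\<beta> p (?K h) + ?\<beta> p y"
          unfolding distrib_left using trace_add[OF mT[OF pT KT[OF hm]] mT[OF pT Qs_forms[OF y]] T2] .
        also have "?\<beta> p (?K h) = ?\<beta> (?L b) (?K h) + ?\<beta> z (?K h)"
          unfolding bz(3) distrib_right using trace_add[OF mT[OF LT KT[OF hm]] mT[OF zT KT[OF hm]] T2] .
        finally show ?thesis using 1 2 tQ(2)[OF y pT] by simp
      qed
      ultimately show "?K h + y \<in> forms T \<and> (\<forall>p\<in>U. ?\<beta> p (?K h + y) = 0)" by blast
    qed
  qed
  have fQ: "P3.fin_dim (Qs (int T))" using fin_dim_forms_subset[OF Qs_subspace] Qs_forms by blast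
  note KH = dim_mult_forms[OF l0 Hs_subspace(2), of "Suc k" m]
  have "?KH \<inter> Qs (int T) = {0}"
  proof -
    have "h = 0" if h: "h \<in> Hs m" "?K h \<in> Qs (int T)" for h
    proof -
      have hm: "h \<in> forms m" using h(1) unfolding Hs_def by blast
      have "m + Suc k = T" using k(1) by simp
      then have "h \<in> Qs (int m)" using Qs_l_power_regular[OF hm, of "Suc k"] h(2) by (simp only:)
      then obtain \<alpha> \<beta> where ab: "\<alpha> \<in> graded_piece (int m - int e)" "\<beta> \<in> graded_piece (int m - int e)" "h = \<alpha> * gu + \<beta> * gv"
        unfolding Qs_def by blast
      have "\<alpha> = 0" "\<beta> = 0" using graded_nonneg[OF ab(1)] graded_nonneg[OF ab(2)] me by auto
      then show ?thesis using ab(3) by simp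
    qed
    moreover have "0 \<in> ?KH" using P3.subspace_0[OF Hs_subspace(1)] by (intro image_eqI[of _ _ 0]) simp_all
    ultimately show ?thesis using Qs_0 by auto
  qed
  then have "P3.dim {x + y |x y. x \<in> ?KH \<and> y \<in> Qs (int T)} = P3.dim (Hs m) + P3.dim (Qs (int T))"
    using P3.fin_dim_sum(2)[OF KH(1) fQ] KH(2) dim_zero_set by simp
  moreover have "P3.dim U + P3.dim {q\<in>forms T. \<forall>p\<in>U. ?\<beta> p q = 0} = P3.dim (forms T) + P3.dim {p\<in>U. \<forall>q\<in>forms T. ?\<beta> p q = 0}"
    using P3.bilinear_kernel_eq[OF fU dim_forms(2) lin1 lin2] .
  ultimately have "P3.dim U + P3.dim (Hs m) = P3.dim (forms T)" unfolding ker1 ker2 by simp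
  then show ?thesis using dU dim_Ivan_T by linarith
qed

end

section \<open>Syzygies of the Jacobian ideal\<close>

lemma irreducible_zero:
  assumes "irreducible \<pi>" "\<pi> \<in> forms a"
  shows "infinite (zero_locus \<pi>)"
proof -
  have "\<pi> \<noteq> 0" using assms(1) unfolding irreducible_def by blast
  then show ?thesis using zero_locus_infinite[OF assms(2) form_pos_of_irreducible[OF assms]] by blast
qed

lemma irreducible_not_dvd_var:
  assumes "irreducible \<pi>" "\<pi> \<in> forms a"
  obtains i where "\<not> \<pi> dvd var3 i"
proof -
  obtain X where "X \<in> zero_locus \<pi>" using irreducible_zero[OF assms] by (metis ex_in_conv finite.emptyI)
  then obtain x where x: "x \<noteq> 0" "poly_at \<pi> x = 0" unfolding zero_locus_def by blast
  obtain i where i: "x $ i \<noteq> 0" using nonvanishing_var[OF x(1)] .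
  have "\<not> \<pi> dvd var3 i"
  proof
    assume "\<pi> dvd var3 i"
    then obtain q where "var3 i = \<pi> * q" by (auto elim: dvdE)
    then have "poly_at (var3 i) x = poly_at \<pi> x * poly_at q x" by (simp only: poly_at_simps)
    then show False using x(2) i by (simp add: poly_at_simps)
  qed
  then show ?thesis using that by blast
qed

lemma dim_family:
  assumes "finite I" "P3.subspace V" "\<And>i. i \<in> I \<Longrightarrow> h i \<in> V"
    and ind: "\<And>b i. (\<Sum>i\<in>I. const3 (b i) * h i) = 0 \<Longrightarrow> i \<in> I \<Longrightarrow> b i = 0"
    and span: "\<And>x. x \<in> V \<Longrightarrow> \<exists>b. x = (\<Sum>i\<in>I. const3 (b i) * h i)"
  shows "P3.dim V = card I"
proof -
  have inj: "inj_on h I"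
  proof (rule inj_onI, rule ccontr)
    fix i j assume ij: "i \<in> I" "j \<in> I" "h i = h j" "i \<noteq> j"
    let ?b = "\<lambda>k. (if k = i then 1 else 0) - (if k = j then 1 else 0) :: complex"
    have "(\<Sum>k\<in>I. const3 (?b k) * h k) = (\<Sum>k\<in>I. (if k = i then h i else 0) - (if k = j then h j else 0))"
      by (rule sum.cong) (auto simp: left_diff_distrib)
    also have "\<dots> = 0" using ij assms(1) by (simp add: sum_subtractf)
    finally have "?b i = 0" using ind[of ?b i] ij(1) by blast
    then show False using ij(4) by simp
  qed
  have "P3.independent (h ` I)"
  proof (rule P3.independent_if_scalars_zero)
    show "finite (h ` I)" using assms(1) by simp
    fix g x assume g: "(\<Sum>x\<in>h ` I. scal3 (g x) x) = 0" and x: "x \<in> h ` I"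
    obtain i where i: "i \<in> I" "x = h i" using x by blast
    have "(\<Sum>i\<in>I. const3 (g (h i)) * h i) = 0" using g by (simp add: sum.reindex[OF inj] scal3_const3)
    then show "g x = 0" using ind[of "\<lambda>i. g (h i)" i] i by blast
  qed
  moreover have "h ` I \<subseteq> V" using assms(3) by blast
  moreover have "V \<subseteq> P3.span (h ` I)"
  proof
    fix x assume "x \<in> V"
    then obtain b where b: "x = (\<Sum>i\<in>I. const3 (b i) * h i)" using span by blast
    have "const3 (b i) * h i \<in> P3.span (h ` I)" if "i \<in> I" for i
      using P3.span_scale[OF P3.span_base[of "h i" "h ` I"], of "b i"] that by (simp add: scal3_const3)
    then show "x \<in> P3.span (h ` I)" unfolding b by (intro P3.span_sum)
  qed
  ultimately have "P3.dim V = card (h ` I)" using P3.dim_unique by metis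
  then show ?thesis using card_image[OF inj] by simp
qed

lemma solve_syzygy:
  fixes x y z :: "'a::comm_ring_1"
  assumes "x * g + y * h + z = 0"
  shows "z = (- x) * g + (- y) * h"
proof -
  have "z = (x * g + y * h + z) + ((- x) * g + (- y) * h)" by (simp add: algebra_simps)
  then show ?thesis unfolding assms by simp
qed

text \<open>\<open>PF_dvd\<close> makes distinct members of \<open>PF\<close> nonassociated, so that
  they correspond one to one to the components.\<close>

locale nodal_transversal_curve = transversal_nodal +
  fixes PF :: "poly3 set" and c0 :: complex
  assumes sqf: "squarefree f" and PF_finite: "finite PF"
    and PF_irr: "\<And>\<pi>. \<pi> \<in> PF \<Longrightarrow> irreducible \<pi>"
    and PF_dvd: "\<And>\<pi> \<rho>. \<pi> \<in> PF \<Longrightarrow> \<rho> \<in> PF \<Longrightarrow> \<pi> dvd \<rho> \<Longrightarrow> \<pi> = \<rho>"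
    and c0: "c0 \<noteq> 0" and f_eq: "f = const3 c0 * \<Prod>PF"
begin

abbreviation F :: "3 \<Rightarrow> poly3" where "F i \<equiv> pderiv3 i f"

lemma f0: "f \<noteq> 0"
  using sqf not_squarefree_0 by blast

lemma PF_prime: "\<pi> \<in> PF \<Longrightarrow> prime_elem \<pi>"
  by (rule irreducible_imp_prime_elem_poly3[OF PF_irr])

lemma PF_dvd_f: "\<pi> \<in> PF \<Longrightarrow> \<pi> dvd f"
  unfolding f_eq by (intro dvd_mult dvd_prodI[OF PF_finite])

lemma PF_form:
  assumes "\<pi> \<in> PF"
  shows "\<pi> \<in> forms (fdeg \<pi>)" "fdeg \<pi> > 0"
proof -
  obtain h where h: "f = \<pi> * h" using PF_dvd_f[OF assms] by (auto elim: dvdE)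
  have fd: "\<pi> * h \<in> forms d" "\<pi> * h \<noteq> 0" using h f f0 by simp_all
  obtain a where a: "\<pi> \<in> forms a" using form_factor[OF fd] .
  have "\<pi> \<noteq> 0" using fd(2) by auto
  then have "fdeg \<pi> = a" using fdeg_form[OF a] by blast
  then show "\<pi> \<in> forms (fdeg \<pi>)" "fdeg \<pi> > 0" using a form_pos_of_irreducible[OF PF_irr[OF assms] a] by simp_all
qed

lemma f_dvdI:
  assumes "\<And>\<pi>. \<pi> \<in> PF \<Longrightarrow> \<pi> dvd h"
  shows "f dvd h"
proof -
  have "\<Prod>PF dvd h" using Prod_primes_dvd[OF PF_finite PF_prime PF_dvd assms] by blast
  then obtain q where q: "h = \<Prod>PF * q" by (auto elim: dvdE)
  have c: "const3 c0 * const3 (1 / c0) = 1" using c0 by (simp flip: const3_simps(4))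
  have "f * (const3 (1 / c0) * q) = (const3 c0 * const3 (1 / c0)) * (\<Prod>PF * q)" unfolding f_eq by (simp only: mult_ac)
  also have "\<dots> = h" unfolding c q by simp
  finally show ?thesis by (rule dvdI[OF sym])
qed

lemma small_form_zero:
  assumes "h \<in> forms k" "k < d" "f dvd h"
  shows "h = 0"
proof (rule ccontr)
  assume "h \<noteq> 0"
  obtain q where q: "h = f * q" using assms(3) by (auto elim: dvdE)
  then have "q \<noteq> 0" using \<open>h \<noteq> 0\<close> by auto
  then show False using form_cofactor(1)[OF f f0, of q k] q assms(1,2) by simp
qed

lemma PF_not_dvd_gv:
  assumes "\<pi> \<in> PF"
  shows "\<not> \<pi> dvd gv"
proof -
  have "poly_at f v \<noteq> 0"
    using degree_line_restr(2)[OF f, of u v] degF d2 by (metis leading_coeff_0_iff degree_0 not_numeral_le_zero)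
  then show ?thesis
    unfolding gv_def using prime_factor_not_dvd_dir_deriv[OF sqf f _ PF_irr[OF assms] PF_dvd_f[OF assms]] by blast
qed

text \<open>The derivations with coefficients of degree m that annihilate \<open>f\<close>.\<close>

definition AR :: "nat \<Rightarrow> (3 \<Rightarrow> poly3) set" where
  "AR m = {a. (\<forall>i. a i \<in> forms m) \<and> (\<Sum>i\<in>UNIV. a i * F i) = 0}"

text \<open>The cross product of the position vector with \<open>a\<close>: the coefficients of the
  1-form obtained by contracting the volume form with the Euler field and the derivation
  \<open>a\<close>.\<close>

definition eta :: "(3 \<Rightarrow> poly3) \<Rightarrow> 3 \<Rightarrow> poly3" where
  "eta a i = (if i = 1 then var3 2 * a 3 - var3 3 * a 2 else if i = 2 then var3 3 * a 1 - var3 1 * a 3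
     else var3 1 * a 2 - var3 2 * a 1)"

lemma eta_simps: "eta a 1 = var3 2 * a 3 - var3 3 * a 2" "eta a 2 = var3 3 * a 1 - var3 1 * a 3"
  "eta a 3 = var3 1 * a 2 - var3 2 * a 1"
  by (simp_all add: eta_def)

lemma eta_forms:
  assumes "a \<in> AR m"
  shows "eta a i \<in> forms (Suc m)"
proof -
  have "a i \<in> forms m" for i using assms unfolding AR_def by blast
  then have "var3 k * a j - var3 j' * a k' \<in> forms (Suc m)" for k j j' k' by (intro forms_diff forms_var3_mult)
  then show ?thesis unfolding eta_def by presburger
qed

lemma euler_three: "var3 1 * F 1 + var3 2 * F 2 + var3 3 * F 3 = of_nat d * f"
  using euler_identity[OF f] unfolding sum_3 .

lemma syzygy_three: "a \<in> AR m \<Longrightarrow> a 1 * F 1 + a 2 * F 2 + a 3 * F 3 = 0"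
  unfolding AR_def sum_3 by blast

text \<open>The double cross product of the gradient with x and \<open>a\<close> is x times
  (gradient dot a) minus \<open>a\<close> times (gradient dot x). The first term vanishes because
  \<open>a\<close> is a syzygy, the second is given by Euler's identity.\<close>

lemma cross_eta:
  assumes "a \<in> AR m"
  shows "F 1 * eta a 2 - F 2 * eta a 1 = - (of_nat d * f * a 3)"
    "F 2 * eta a 3 - F 3 * eta a 2 = - (of_nat d * f * a 1)"
    "F 3 * eta a 1 - F 1 * eta a 3 = - (of_nat d * f * a 2)"
proof -
  have "F 1 * eta a 2 - F 2 * eta a 1 = var3 3 * (a 1 * F 1 + a 2 * F 2 + a 3 * F 3) - a 3 * (var3 1 * F 1 + var3 2 * F 2 + var3 3 * F 3)"
    unfolding eta_simps by (simp add: algebra_simps)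
  then show "F 1 * eta a 2 - F 2 * eta a 1 = - (of_nat d * f * a 3)"
    unfolding syzygy_three[OF assms] euler_three by (simp add: mult.commute)
  have "F 2 * eta a 3 - F 3 * eta a 2 = var3 1 * (a 1 * F 1 + a 2 * F 2 + a 3 * F 3) - a 1 * (var3 1 * F 1 + var3 2 * F 2 + var3 3 * F 3)"
    unfolding eta_simps by (simp add: algebra_simps)
  then show "F 2 * eta a 3 - F 3 * eta a 2 = - (of_nat d * f * a 1)"
    unfolding syzygy_three[OF assms] euler_three by (simp add: mult.commute)
  have "F 3 * eta a 1 - F 1 * eta a 3 = var3 2 * (a 1 * F 1 + a 2 * F 2 + a 3 * F 3) - a 2 * (var3 1 * F 1 + var3 2 * F 2 + var3 3 * F 3)"
    unfolding eta_simps by (simp add: algebra_simps)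
  then show "F 3 * eta a 1 - F 1 * eta a 3 = - (of_nat d * f * a 2)"
    unfolding syzygy_three[OF assms] euler_three by (simp add: mult.commute)
qed

lemma f_dvd_cross:
  assumes "a \<in> AR m"
  shows "f dvd F i * eta a j - F j * eta a i"
proof -
  have d: "f dvd - (of_nat d * f * z)" for z by simp
  have 1: "f dvd F 1 * eta a 2 - F 2 * eta a 1" "f dvd F 2 * eta a 3 - F 3 * eta a 2" "f dvd F 3 * eta a 1 - F 1 * eta a 3"
    unfolding cross_eta[OF assms] using d by blast+
  then have 2: "f dvd F 2 * eta a 1 - F 1 * eta a 2" "f dvd F 3 * eta a 2 - F 2 * eta a 3" "f dvd F 1 * eta a 3 - F 3 * eta a 1"
    by (metis dvd_minus_iff minus_diff_eq)+
  show ?thesis using exhaust_3[of i] exhaust_3[of j] 1 2 by auto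
qed

lemma AR_zero_of_eta:
  assumes "a \<in> AR m" "\<And>i. eta a i = 0"
  shows "a i = 0"
proof -
  have "of_nat d * f * a 1 = 0" "of_nat d * f * a 2 = 0" "of_nat d * f * a 3 = 0"
    using cross_eta[OF assms(1)] unfolding assms(2) by simp_all
  moreover have "(of_nat d :: poly3) \<noteq> 0" using d2 by simp
  ultimately have "a 1 = 0" "a 2 = 0" "a 3 = 0" using f0 by auto
  then show ?thesis using exhaust_3[of i] by auto
qed

definition etad :: "(3 \<Rightarrow> poly3) \<Rightarrow> complex^3 \<Rightarrow> poly3" where
  "etad a y = (\<Sum>i\<in>UNIV. const3 (y $ i) * eta a i)"

lemma etad_forms: "a \<in> AR m \<Longrightarrow> etad a y \<in> forms (Suc m)"
  unfolding etad_def by (intro forms_sum forms_const3_mult eta_forms)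

lemma f_dvd_cross_dir:
  assumes "a \<in> AR m"
  shows "f dvd gv * eta a i - F i * etad a v" "f dvd gv * etad a y - dir_deriv y f * etad a v"
proof -
  have 1: "f dvd gv * eta a i - F i * etad a v" for i
  proof -
    have "gv * eta a i - F i * etad a v = (\<Sum>j\<in>UNIV. const3 (v $ j) * (F j * eta a i - F i * eta a j))"
      unfolding gv_def dir_deriv_def etad_def sum_3 by (simp add: algebra_simps)
    then show ?thesis using f_dvd_cross[OF assms] by (simp add: dvd_sum)
  qed
  then show "f dvd gv * eta a i - F i * etad a v" .
  have "gv * etad a y - dir_deriv y f * etad a v = (\<Sum>j\<in>UNIV. const3 (y $ j) * (gv * eta a j - F j * etad a v))"
    unfolding dir_deriv_def etad_def[of a y] sum_3 by (simp add: algebra_simps)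
  then show "f dvd gv * etad a y - dir_deriv y f * etad a v" using 1 by (simp add: dvd_sum)
qed

text \<open>Differentiating the syzygy at a node puts the value of \<open>a\<close> into the kernel
  of the Hessian. It is therefore parallel to \<open>x\<close>, and the cross product
  vanishes.\<close>

lemma eta_vanish:
  assumes "a \<in> AR m" "x \<in> Npts"
  shows "poly_at (eta a i) x = 0"
proof -
  have sx: "singular_at f x" using assms(2) unfolding Npts_def by blast
  define y :: "complex^3" where "y = (\<chi> j. poly_at (a j) x)"
  have "(\<Sum>j\<in>UNIV. poly_at (pderiv3 i (pderiv3 j f)) x * y $ j) = 0" for i
  proof -
    have "pderiv3 i (\<Sum>j\<in>UNIV. a j * F j) = 0" using assms(1) unfolding AR_def by simp
    then have "poly_at (\<Sum>j\<in>UNIV. pderiv3 i (a j) * F j + a j * pderiv3 i (F j)) x = 0"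
      unfolding pderiv3_sum pderiv3_mult by (simp only: poly_at_simps)
    then have "(\<Sum>j\<in>UNIV. poly_at (a j) x * poly_at (pderiv3 i (F j)) x) = 0"
      unfolding poly_at_simps singular_partials[OF sx] by simp
    then show ?thesis unfolding y_def by (simp add: mult.commute)
  qed
  then obtain c where "y = c *s x" using node_hessian_kernel[OF f nodal[OF sx]] by blast
  then have "poly_at (a j) x = c * x $ j" for j unfolding y_def by (simp add: vec_eq_iff)
  then show ?thesis using exhaust_3[of i] by (auto simp: eta_simps poly_at_simps)
qed

lemma etad_vanish: "a \<in> AR m \<Longrightarrow> x \<in> Npts \<Longrightarrow> poly_at (etad a y) x = 0"
  unfolding etad_def by (simp add: poly_at_simps eta_vanish)

text \<open>
  Along a component the logarithmic form \<open>eta a / f\<close> has a residue, the rational function \<open>etad a v / gv\<close>.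
  It acts on the finite-dimensional spaces \<open>Ivan k\<close>, hence is algebraic over the constants and so constant.
\<close>

lemma residue_constant:
  assumes a: "a \<in> AR m" "Suc m = e" and \<pi>: "\<pi> \<in> PF"
  obtains c where "\<And>i. \<pi> dvd eta a i - const3 c * F i"
proof -
  let ?ev = "etad a v"
  obtain n0 where n0: "\<And>j p. j \<ge> n0 \<Longrightarrow> p \<in> Ivan j \<Longrightarrow> p \<in> J" using Ivan_eventually_J by blast
  \<comment> \<open>Large enough for \<open>Ivan k\<close> to lie in \<open>J\<close>, and for the
    multiple \<open>b0\<close> of \<open>gv\<close>, the start of the iteration, to have this
    degree.\<close>
  define k where "k = n0 + e"
  have ek: "etad a y \<in> forms e" for y using etad_forms[OF a(1)] a(2) by simp
  have step: "\<exists>b'. b' \<in> Ivan k \<and> f dvd gv * b' - ?ev * b" if b: "b \<in> Ivan k" for b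
  proof -
    have "b \<in> J" using n0[of k b] b unfolding k_def by simp
    moreover have "b \<in> forms k" using b unfolding Ivan_def by blast
    ultimately obtain \<alpha> \<beta> \<gamma> where g: "\<alpha> \<in> graded_piece (int k - int e)" "\<beta> \<in> graded_piece (int k - int e)"
      "\<gamma> \<in> graded_piece (int k - int e)" "b = \<alpha> * gu + \<beta> * gv + \<gamma> * gw" by (rule J_graded)
    \<comment> \<open>Modulo \<open>f\<close>, the ratio of \<open>etad a y\<close> to the
      derivative of \<open>f\<close> along y does not depend on the direction y. Replacing each
      derivative in an expression of \<open>b\<close> by its partner thus multiplies
      \<open>b\<close> by this ratio.\<close>
    let ?b = "\<alpha> * etad a u + \<beta> * etad a v + \<gamma> * etad a w"
    have deg: "z * etad a y \<in> forms k" if "z \<in> graded_piece (int k - int e)" for z y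
      by (rule graded_cong[OF graded_mult[OF that ek]]) simp
    have "?b \<in> forms k" by (intro forms_add deg g(1-3))
    then have "?b \<in> Ivan k" unfolding Ivan_def using etad_vanish[OF a(1)] by (simp add: poly_at_simps)
    moreover have "gv * ?b - ?ev * b = \<alpha> * (gv * etad a u - gu * ?ev) + \<beta> * (gv * etad a v - gv * ?ev) + \<gamma> * (gv * etad a w - gw * ?ev)"
      unfolding g(4) by (simp add: algebra_simps)
    moreover have "f dvd \<alpha> * (gv * etad a u - gu * ?ev) + \<beta> * (gv * etad a v - gv * ?ev) + \<gamma> * (gv * etad a w - gw * ?ev)"
      using f_dvd_cross_dir(2)[OF a(1), of u] f_dvd_cross_dir(2)[OF a(1), of v] f_dvd_cross_dir(2)[OF a(1), of w]
      unfolding gu_def[symmetric] gv_def[symmetric] gw_def[symmetric] by (intro dvd_add dvd_mult)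
    ultimately show ?thesis by (intro exI[of _ ?b]) simp
  qed
  define st where "st b = (SOME b'. b' \<in> Ivan k \<and> f dvd gv * b' - ?ev * b)" for b
  have st: "st b \<in> Ivan k \<and> f dvd gv * st b - ?ev * b" if "b \<in> Ivan k" for b
    unfolding st_def by (rule someI_ex[OF step[OF that]])
  obtain i0 where i0: "\<not> \<pi> dvd var3 i0" using irreducible_not_dvd_var[OF PF_irr[OF \<pi>] PF_form(1)[OF \<pi>]] .
  define b0 where "b0 = var3 i0 ^ n0 * gv"
  have "b0 \<in> forms k" unfolding b0_def k_def using forms_mult[OF forms_power[OF forms_var3[of i0], of n0] g_forms(2)] by simp
  moreover have "b0 \<in> J" unfolding b0_def using J_mult[OF JI[of 0 1 0]] by simp
  ultimately have b0I: "b0 \<in> Ivan k" unfolding Ivan_def using J_vanish by blast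
  have b0d: "\<not> \<pi> dvd b0"
  proof
    assume "\<pi> dvd b0"
    then have "\<pi> dvd var3 i0 ^ n0 \<or> \<pi> dvd gv" unfolding b0_def using prime_elem_dvd_mult_iff[OF PF_prime[OF \<pi>]] by blast
    then show False using PF_not_dvd_gv[OF \<pi>] prime_elem_dvd_power[OF PF_prime[OF \<pi>]] i0 by blast
  qed
  define s' where "s' n = (st ^^ n) b0" for n
  have sI: "s' n \<in> Ivan k" for n
    by (induction n) (use b0I st in \<open>simp_all add: s'_def\<close>)
  have sf: "f dvd gv ^ n * s' n - ?ev ^ n * b0" for n
  proof (induction n)
    case 0
    then show ?case by (simp add: s'_def)
  next
    case (Suc n)
    have "s' (Suc n) = st (s' n)" unfolding s'_def by simp
    then have 1: "f dvd gv * s' (Suc n) - ?ev * s' n" using st[OF sI[of n]] by simp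
    have "gv ^ Suc n * s' (Suc n) - ?ev ^ Suc n * b0 = gv ^ n * (gv * s' (Suc n) - ?ev * s' n) + ?ev * (gv ^ n * s' n - ?ev ^ n * b0)"
      by (simp add: algebra_simps)
    moreover have "f dvd gv ^ n * (gv * s' (Suc n) - ?ev * s' n) + ?ev * (gv ^ n * s' n - ?ev ^ n * b0)"
      using 1 Suc by (intro dvd_add dvd_mult)
    ultimately show ?case by (simp only:)
  qed
  \<comment> \<open>A dependence among M + 1 iterates says that a polynomial in the ratio etad a v /
    gv kills \<open>b0\<close> modulo \<open>f\<close>; \<open>binform\<close> clears the
    denominators. As \<pi> does not divide \<open>b0\<close>, it divides one of the linear
    factors.\<close>
  define M where "M = P3.dim (Ivan k)"
  obtain lam where l: "\<exists>n\<le>M. lam n \<noteq> 0" "(\<Sum>n\<le>M. scal3 (lam n) (s' n)) = 0"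
    using P3.linear_dependence[OF Ivan_subspace(2), of k s'] sI unfolding M_def by blast
  define A where "A = (\<Sum>n\<le>M. monom (lam n) n)"
  have cA: "coeff A n = (if n \<le> M then lam n else 0)" for n unfolding A_def by (simp add: coeff_sum)
  obtain n1 where n1: "n1 \<le> M" "lam n1 \<noteq> 0" using l(1) by blast
  have "coeff A n1 \<noteq> 0" unfolding cA using n1 by simp
  then have A0: "A \<noteq> 0" by (metis coeff_0)
  have "\<forall>i>M. coeff A i = 0" unfolding cA by simp
  then have dA: "degree A \<le> M" by (rule degree_le)
  have zero: "(\<Sum>n\<le>M. const3 (lam n) * s' n) = 0" using l(2) unfolding scal3_const3 .
  have "- (binform gv ?ev M A * b0) = (\<Sum>n\<le>M. const3 (lam n) * gv ^ (M - n) * (gv ^ n * s' n - ?ev ^ n * b0)) - gv ^ M * (\<Sum>n\<le>M. const3 (lam n) * s' n)"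
  proof -
    have e: "- (c * (G * E) * b) = c * G * (H * x - E * b) - G * H * (c * x)" for c G E b H x :: poly3
      by (simp add: algebra_simps)
    have p: "gv ^ M = gv ^ (M - n) * gv ^ n" if "n \<in> {..M}" for n
      unfolding power_add[symmetric] using that by simp
    have "- (const3 (coeff A n) * (gv ^ (M - n) * ?ev ^ n) * b0)
      = const3 (lam n) * gv ^ (M - n) * (gv ^ n * s' n - ?ev ^ n * b0) - gv ^ M * (const3 (lam n) * s' n)" if n: "n \<in> {..M}" for n
    proof -
      have c: "coeff A n = lam n" unfolding cA using n by simp
      show ?thesis unfolding c p[OF n] by (rule e)
    qed
    note q = this
    show ?thesis
      unfolding binform_def sum_distrib_right sum_distrib_left sum_negf[symmetric] sum_subtractf[symmetric]
      by (rule sum.cong[OF refl]) (rule q)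
  qed
  moreover have "f dvd (\<Sum>n\<le>M. const3 (lam n) * gv ^ (M - n) * (gv ^ n * s' n - ?ev ^ n * b0))"
    by (intro dvd_sum dvd_mult sf)
  ultimately have "f dvd - (binform gv ?ev M A * b0)" unfolding zero mult_zero_right diff_0_right by (simp only:)
  then have "f dvd binform gv ?ev M A * b0" by (simp only: dvd_minus_iff)
  then have "\<pi> dvd binform gv ?ev M A * b0" using PF_dvd_f[OF \<pi>] dvd_trans by blast
  then have pb: "\<pi> dvd binform gv ?ev M A" using b0d prime_elem_dvd_mult_iff[OF PF_prime[OF \<pi>]] by blast
  obtain kk cs i where kk: "kk \<noteq> 0" "binform gv ?ev M A = const3 kk * gv ^ i * prod_list (map (\<lambda>c. ?ev - const3 c * gv) cs)"
    using binform_factor[OF A0 dA] by blast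
  have nk: "\<not> \<pi> dvd const3 kk"
    using const3_dvd_1[OF kk(1)] PF_irr[OF \<pi>] unfolding irreducible_def by (metis dvd_trans)
  have ng: "\<not> \<pi> dvd gv ^ i" using PF_not_dvd_gv[OF \<pi>] prime_elem_dvd_power[OF PF_prime[OF \<pi>]] by blast
  have "\<pi> dvd prod_list (map (\<lambda>c. ?ev - const3 c * gv) cs)"
    using pb nk ng unfolding kk(2) prime_elem_dvd_mult_iff[OF PF_prime[OF \<pi>]] by blast
  then have "\<exists>c. \<pi> dvd ?ev - const3 c * gv"
  proof (induction cs)
    case Nil
    then show ?case using PF_irr[OF \<pi>] unfolding irreducible_def by simp
  next
    case (Cons c cs)
    then have "\<pi> dvd ?ev - const3 c * gv \<or> \<pi> dvd prod_list (map (\<lambda>c. ?ev - const3 c * gv) cs)"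
      using prime_elem_dvd_mult_iff[OF PF_prime[OF \<pi>]] by simp
    then show ?case using Cons(1) by blast
  qed
  then obtain c where c: "\<pi> dvd ?ev - const3 c * gv" by blast
  have "\<pi> dvd eta a i - const3 c * F i" for i
  proof -
    have "gv * (eta a i - const3 c * F i) = (gv * eta a i - F i * ?ev) + F i * (?ev - const3 c * gv)"
      by (simp add: algebra_simps)
    moreover have "\<pi> dvd (gv * eta a i - F i * ?ev) + F i * (?ev - const3 c * gv)"
      using dvd_trans[OF PF_dvd_f[OF \<pi>] f_dvd_cross_dir(1)[OF a(1), of i]] c by (intro dvd_add dvd_mult)
    ultimately have "\<pi> dvd gv * (eta a i - const3 c * F i)" by (simp only:)
    then show ?thesis using PF_not_dvd_gv[OF \<pi>] prime_elem_dvd_mult_iff[OF PF_prime[OF \<pi>]] by blast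
  qed
  then show ?thesis using that by blast
qed

text \<open>One combination of the partial derivatives, namely \<open>gv\<close>, is prime to
  \<pi>.\<close>

lemma PF_not_dvd_const_gv:
  assumes "\<pi> \<in> PF" "\<And>i. \<pi> dvd q * F i"
  shows "\<pi> dvd q"
proof -
  have "q * gv = (\<Sum>i\<in>UNIV. const3 (v $ i) * (q * F i))"
    unfolding gv_def dir_deriv_def sum_3 by (simp add: algebra_simps)
  moreover have "\<pi> dvd (\<Sum>i\<in>UNIV. const3 (v $ i) * (q * F i))" by (intro dvd_sum dvd_mult assms(2))
  ultimately have "\<pi> dvd q * gv" by (simp only:)
  then show ?thesis using PF_not_dvd_gv[OF assms(1)] prime_elem_dvd_mult_iff[OF PF_prime[OF assms(1)]] by blast
qed

lemma AR_var_mult: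
  assumes "a \<in> AR m"
  shows "(\<lambda>j. var3 i * a j) \<in> AR (Suc m)" "eta (\<lambda>j. var3 i * a j) k = var3 i * eta a k"
proof -
  have "(\<Sum>j\<in>UNIV. var3 i * a j * F j) = var3 i * (\<Sum>j\<in>UNIV. a j * F j)"
    by (simp only: sum_distrib_left mult.assoc)
  then show "(\<lambda>j. var3 i * a j) \<in> AR (Suc m)"
    using assms forms_var3_mult unfolding AR_def by simp
  show "eta (\<lambda>j. var3 i * a j) k = var3 i * eta a k"
    unfolding eta_def by (simp add: algebra_simps)
qed

text \<open>Multiplied by a variable, the syzygy reaches the degree of
  \<open>residue_constant\<close>; let c_i be the constant obtained for x_i. Comparing two variables
  shows that x_i c_j - x_j c_i vanishes on the component. Were some c_i nonzero, the component would
  be a single point. So all c_i are zero, \<pi> divides \<open>eta a\<close>, and this form has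
  degree too small to be divisible by \<open>f\<close>.\<close>

lemma no_small_syzygies_aux:
  assumes a: "a \<in> AR m" "m + 2 = e"
  shows "a i = 0"
proof (rule AR_zero_of_eta[OF a(1)])
  fix k
  have "\<pi> dvd eta a k" if \<pi>: "\<pi> \<in> PF" for \<pi>
  proof -
    have me: "Suc (Suc m) = e" using a(2) by simp
    have "\<exists>c. \<forall>k. \<pi> dvd var3 i * eta a k - const3 c * F k" for i
      using residue_constant[OF AR_var_mult(1)[OF a(1), of i] me \<pi>] unfolding AR_var_mult(2)[OF a(1)] by blast
    then obtain c where c: "\<And>i k. \<pi> dvd var3 i * eta a k - const3 (c i) * F k" by metis
    have cx: "\<pi> dvd var3 i * const3 (c j) - var3 j * const3 (c i)" for i j
    proof (rule PF_not_dvd_const_gv[OF \<pi>])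
      fix k
      have "(var3 i * const3 (c j) - var3 j * const3 (c i)) * F k
        = var3 j * (var3 i * eta a k - const3 (c i) * F k) - var3 i * (var3 j * eta a k - const3 (c j) * F k)"
        by (simp add: algebra_simps)
      moreover have "\<pi> dvd var3 j * (var3 i * eta a k - const3 (c i) * F k) - var3 i * (var3 j * eta a k - const3 (c j) * F k)"
        by (rule dvd_diff; rule dvd_mult; rule c)
      ultimately show "\<pi> dvd (var3 i * const3 (c j) - var3 j * const3 (c i)) * F k" by (simp only:)
    qed
    have c0: "c i = 0" for i
    proof (rule ccontr)
      assume ci: "c i \<noteq> 0"
      define y :: "complex^3" where "y = (\<chi> i. c i)"
      have y0: "y \<noteq> 0" using ci by (auto simp: y_def vec_eq_iff)
      have "zero_locus \<pi> \<subseteq> {vec.span {y}}"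
      proof
        fix X assume "X \<in> zero_locus \<pi>"
        then obtain x where x: "X = vec.span {x}" "x \<noteq> 0" "poly_at \<pi> x = 0" unfolding zero_locus_def by blast
        have "y $ i * x $ j = y $ j * x $ i" for i j
        proof -
          obtain q where "var3 i * const3 (c j) - var3 j * const3 (c i) = \<pi> * q" using cx[of i j] unfolding dvd_def by blast
          then have "poly_at (var3 i * const3 (c j) - var3 j * const3 (c i)) x = poly_at \<pi> x * poly_at q x" by (simp only: poly_at_simps)
          then show ?thesis using x(3) by (simp add: poly_at_simps y_def mult.commute)
        qed
        then obtain b where b: "x = b *s y" using parallel_vectors[OF y0] by metis
        then have "b \<noteq> 0" using x(2) by auto
        then have "vec.span {x} = vec.span {y}" using vec_span_eq_iff[OF x(2)] b by blast
        then show "X \<in> {vec.span {y}}" using x(1) by simp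
      qed
      then show False using irreducible_zero[OF PF_irr[OF \<pi>] PF_form(1)[OF \<pi>]] finite_subset by blast
    qed
    obtain i where i: "\<not> \<pi> dvd var3 i" using irreducible_not_dvd_var[OF PF_irr[OF \<pi>] PF_form(1)[OF \<pi>]] .
    have "\<pi> dvd var3 i * eta a k" using c[of i k] unfolding c0 by simp
    then show ?thesis using i prime_elem_dvd_mult_iff[OF PF_prime[OF \<pi>]] by blast
  qed
  then have "f dvd eta a k" by (rule f_dvdI)
  then show "eta a k = 0" using small_form_zero[OF eta_forms[OF a(1)]] a(2) d_e by simp
qed

text \<open>A power of a variable raises a syzygy of smaller degree to degree e - 2.\<close>

theorem no_small_syzygies:
  assumes "a \<in> AR m" "m + 2 \<le> e"
  shows "a i = 0"
proof -
  have "\<exists>b. b \<in> AR (m + n) \<and> (\<forall>i. b i = var3 1 ^ n * a i)" for n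
  proof (induction n)
    case 0
    then show ?case using assms(1) by (intro exI[of _ a]) simp
  next
    case (Suc n)
    then obtain b where b: "b \<in> AR (m + n)" "\<And>i. b i = var3 1 ^ n * a i" by blast
    have "(\<lambda>j. var3 1 * b j) \<in> AR (m + Suc n)" using AR_var_mult(1)[OF b(1), of 1] by simp
    then show ?case using b(2) by (intro exI[of _ "\<lambda>j. var3 1 * b j"]) (simp add: mult.assoc)
  qed
  then obtain b where b: "b \<in> AR (m + (e - 2 - m))" "\<And>i. b i = var3 1 ^ (e - 2 - m) * a i" by blast
  have "b i = 0" using no_small_syzygies_aux[OF b(1)] assms(2) by simp
  moreover have "var3 1 \<noteq> (0 :: poly3)"
  proof
    assume "var3 1 = (0 :: poly3)"
    then have "pderiv3 1 (var3 1) = pderiv3 1 0" by simp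
    then show False by simp
  qed
  ultimately show ?thesis using b(2) by simp
qed

section \<open>Syzygies in the coordinates of the transversal line, and the colon ideal\<close>

lemma l_value: "poly_at l y = (\<Sum>i\<in>UNIV. poly_at (pderiv3 i l) 0 * y $ i)" "pderiv3 i l = const3 (poly_at (pderiv3 i l) 0)"
proof -
  have c: "pderiv3 i l = const3 (poly_at (pderiv3 i l) 0)" for i
  proof -
    have "pderiv3 i l \<in> forms 0" using pderiv3_forms[OF stl(3), of i] by simp
    then obtain z where z: "pderiv3 i l = const3 z" by (rule forms_0_const)
    then show ?thesis by (simp add: poly_at_simps)
  qed
  then show "pderiv3 i l = const3 (poly_at (pderiv3 i l) 0)" .
  have "poly_at l y = poly_at (\<Sum>i\<in>UNIV. var3 i * pderiv3 i l) y" unfolding euler_identity[OF stl(3)] by simp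
  also have "\<dots> = (\<Sum>i\<in>UNIV. y $ i * poly_at (pderiv3 i l) 0)"
    by (subst c) (simp only: poly_at_simps)
  finally show "poly_at l y = (\<Sum>i\<in>UNIV. poly_at (pderiv3 i l) 0 * y $ i)" by (simp add: mult.commute)
qed

text \<open>\<open>u\<close>, \<open>v\<close>, \<open>w\<close> is the basis dual to
  \<open>s\<close>, \<open>t\<close>, \<open>l\<close>. For \<open>l\<close> this follows from its
  vanishing on the line together with \<open>coords\<close>.\<close>

lemma l_uvw: "poly_at l u = 0" "poly_at l v = 0" "poly_at l w = 1"
proof -
  have "poly (r l) 0 = 0" using restr_stl(3) by simp
  then show lu: "poly_at l u = 0" unfolding poly_line_restr by simp
  show lv: "poly_at l v = 0" using degree_line_restr(2)[OF stl(3), of u v] restr_stl(3) by simp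
  have add: "poly_at l (a *s x + b *s y) = a * poly_at l x + b * poly_at l y" for a b x y
    unfolding l_value(1) sum_3 by (simp add: algebra_simps)
  have co: "x = poly_at s x *s u + poly_at t x *s v + poly_at l x *s w" for x
  proof -
    have "x $ i = poly_at (const3 (u $ i) * s + const3 (v $ i) * t + const3 (w $ i) * l) x" for i
      using arg_cong[OF coords[of i], of "\<lambda>p. poly_at p x"] by (simp add: poly_at_simps)
    then show ?thesis by (simp add: vec_eq_iff poly_at_simps mult.commute)
  qed
  obtain x where x: "poly_at l x \<noteq> 0" using poly_at_nonzero[OF stl(4)] .
  have "poly_at l x = poly_at l (1 *s (poly_at s x *s u + poly_at t x *s v) + poly_at l x *s w)" using co[of x] by simp
  also have "\<dots> = poly_at l x * poly_at l w" unfolding add lu lv by simp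
  finally show "poly_at l w = 1" using x by simp
qed

text \<open>The coefficient of \<open>gw\<close> when a syzygy is rewritten in terms of
  \<open>gu\<close>, \<open>gv\<close>, \<open>gw\<close>. For m < e it identifies
  \<open>AR m\<close> with \<open>Hs m\<close>.\<close>

definition lcomp :: "(3 \<Rightarrow> poly3) \<Rightarrow> poly3" where
  "lcomp a = (\<Sum>i\<in>UNIV. pderiv3 i l * a i)"

lemma syzygy_expansion: "(\<Sum>i\<in>UNIV. a i * F i) = (\<Sum>i\<in>UNIV. pderiv3 i s * a i) * gu + (\<Sum>i\<in>UNIV. pderiv3 i t * a i) * gv + lcomp a * gw"
  unfolding lcomp_def partial_g sum_3 by (simp add: algebra_simps)

lemma linear_comp_forms:
  assumes "s' \<in> forms 1" "\<forall>i. a i \<in> forms m"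
  shows "(\<Sum>i\<in>UNIV. pderiv3 i s' * a i) \<in> forms m"
proof (rule forms_sum)
  fix i
  have "pderiv3 i s' \<in> forms 0" using pderiv3_forms[OF assms(1), of i] by simp
  then have "pderiv3 i s' * a i \<in> forms (0 + m)" using assms(2) by (intro forms_mult) simp_all
  then show "pderiv3 i s' * a i \<in> forms m" by simp
qed

lemma AR_coords: "a i = const3 (u $ i) * (\<Sum>k\<in>UNIV. pderiv3 k s * a k) + const3 (v $ i) * (\<Sum>k\<in>UNIV. pderiv3 k t * a k) + const3 (w $ i) * lcomp a"
proof -
  have "pderiv3 k (var3 i) = pderiv3 k s * const3 (u $ i) + pderiv3 k t * const3 (v $ i) + pderiv3 k l * const3 (w $ i)" for k
    using arg_cong[OF coords[of i], of "pderiv3 k"] by (simp add: pderiv3_simps mult.commute)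
  note dl = this
  have "a i = (\<Sum>k\<in>UNIV. pderiv3 k (var3 i) * a k)"
  proof -
    have "(\<Sum>k\<in>UNIV. pderiv3 k (var3 i) * a k) = (\<Sum>k\<in>UNIV. if k = i then a k else 0)" by (rule sum.cong) auto
    then show ?thesis by simp
  qed
  also have "\<dots> = const3 (u $ i) * (\<Sum>k\<in>UNIV. pderiv3 k s * a k) + const3 (v $ i) * (\<Sum>k\<in>UNIV. pderiv3 k t * a k) + const3 (w $ i) * lcomp a"
    unfolding dl lcomp_def sum_3 by (simp add: algebra_simps)
  finally show ?thesis .
qed

lemma lcomp_Hs:
  assumes "a \<in> AR m"
  shows "lcomp a \<in> Hs m"
proof -
  let ?A = "\<Sum>i\<in>UNIV. pderiv3 i s * a i" and ?B = "\<Sum>i\<in>UNIV. pderiv3 i t * a i"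
  have a: "\<forall>i. a i \<in> forms m" and s0: "(\<Sum>i\<in>UNIV. a i * F i) = 0" using assms unfolding AR_def by blast+
  have ff: "?A \<in> forms m" "?B \<in> forms m" "lcomp a \<in> forms m"
    using linear_comp_forms[OF stl(1) a] linear_comp_forms[OF stl(2) a] linear_comp_forms[OF stl(3) a] unfolding lcomp_def by blast+
  have "?A * gu + ?B * gv + lcomp a * gw = 0" using s0 unfolding syzygy_expansion .
  then have "lcomp a * gw = (- ?A) * gu + (- ?B) * gv" by (rule solve_syzygy)
  moreover have "(- ?A) * gu + (- ?B) * gv \<in> Qs (int (m + e))"
    using ff by (intro QsI) (simp_all add: forms_uminus)
  ultimately show ?thesis unfolding Hs_def using ff(3) by simp
qed

lemma lcomp_zero:
  assumes "a \<in> AR m" "m < e" "lcomp a = 0"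
  shows "a i = 0"
proof -
  let ?A = "\<Sum>i\<in>UNIV. pderiv3 i s * a i" and ?B = "\<Sum>i\<in>UNIV. pderiv3 i t * a i"
  have a: "\<forall>i. a i \<in> forms m" and s0: "(\<Sum>i\<in>UNIV. a i * F i) = 0" using assms(1) unfolding AR_def by blast+
  have "?A * gu + ?B * gv = 0" using s0 unfolding syzygy_expansion assms(3) by simp
  then have z: "?A = 0 \<and> ?B = 0"
    using syzygy_small[OF linear_comp_forms[OF stl(1) a] linear_comp_forms[OF stl(2) a] assms(2)] by blast
  show ?thesis using AR_coords[of a i] unfolding assms(3) z[THEN conjunct1] z[THEN conjunct2] by simp
qed

text \<open>The relation h gw = \<alpha> gu + \<beta> gv is the syzygy with coefficient vector h w -
  \<alpha> u - \<beta> v.\<close>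

lemma Hs_lcomp:
  assumes "h \<in> Hs m"
  obtains a where "a \<in> AR m" "lcomp a = h"
proof -
  have h: "h \<in> forms m" "h * gw \<in> Qs (int (m + e))" using assms unfolding Hs_def by blast+
  obtain \<alpha> \<beta> where ab: "\<alpha> \<in> graded_piece (int (m + e) - int e)" "\<beta> \<in> graded_piece (int (m + e) - int e)" "h * gw = \<alpha> * gu + \<beta> * gv"
    using h(2) unfolding Qs_def by blast
  define a where "a i = const3 (w $ i) * h - (const3 (u $ i) * \<alpha> + const3 (v $ i) * \<beta>)" for i
  have "a i \<in> forms m" for i unfolding a_def using h(1) ab(1,2) by (intro forms_diff forms_add forms_const3_mult) simp_all
  moreover have "(\<Sum>i\<in>UNIV. a i * F i) = h * gw - (\<alpha> * gu + \<beta> * gv)"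
    unfolding a_def gu_def gv_def gw_def dir_deriv_def sum_3 by (simp add: algebra_simps)
  ultimately have "a \<in> AR m" unfolding AR_def ab(3)[symmetric] by simp
  moreover have "lcomp a = const3 (poly_at l w) * h - (const3 (poly_at l u) * \<alpha> + const3 (poly_at l v) * \<beta>)"
  proof -
    have g: "(\<Sum>i\<in>UNIV. const3 (q i) * (const3 (w $ i) * h - (const3 (u $ i) * \<alpha> + const3 (v $ i) * \<beta>)))
      = const3 (\<Sum>i\<in>UNIV. q i * w $ i) * h - (const3 (\<Sum>i\<in>UNIV. q i * u $ i) * \<alpha> + const3 (\<Sum>i\<in>UNIV. q i * v $ i) * \<beta>)" for q
      unfolding sum_3 by (simp add: algebra_simps)
    have "lcomp a = (\<Sum>i\<in>UNIV. const3 (poly_at (pderiv3 i l) 0) * (const3 (w $ i) * h - (const3 (u $ i) * \<alpha> + const3 (v $ i) * \<beta>)))"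
      unfolding lcomp_def a_def by (rule sum.cong[OF refl]) (subst l_value(2), rule refl)
    then show ?thesis unfolding g l_value(1)[symmetric] .
  qed
  ultimately show ?thesis using that[of a] unfolding l_uvw by simp
qed

lemma dim_Hs_small: "m + 2 \<le> e \<Longrightarrow> P3.dim (Hs m) = 0"
proof -
  assume m: "m + 2 \<le> e"
  have "Hs m = {0}"
  proof -
    have "h = 0" if h: "h \<in> Hs m" for h
    proof -
      obtain a where a: "a \<in> AR m" "lcomp a = h" using Hs_lcomp[OF h] .
      then show ?thesis using no_small_syzygies[OF a(1) m] unfolding lcomp_def by simp
    qed
    then show ?thesis using P3.subspace_0[OF Hs_subspace(1)[of m]] by blast
  qed
  then show ?thesis using dim_zero_set by simp
qed

subsection \<open>Syzygies of degree \<open>d - 2\<close> and the components\<close>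

definition cof :: "poly3 \<Rightarrow> poly3" where
  "cof \<pi> = const3 c0 * \<Prod>(PF - {\<pi>})"

text \<open>The sum of the logarithmic differentials of the prime factors with weights \<gamma>,
  multiplied by \<open>f\<close> to clear denominators.\<close>

definition logform :: "(poly3 \<Rightarrow> complex) \<Rightarrow> 3 \<Rightarrow> poly3" where
  "logform \<gamma> i = (\<Sum>\<pi>\<in>PF. const3 (\<gamma> \<pi>) * (cof \<pi> * pderiv3 i \<pi>))"

lemma cof_mult: "\<pi> \<in> PF \<Longrightarrow> \<pi> * cof \<pi> = f"
  unfolding cof_def f_eq using prod.remove[OF PF_finite, of \<pi> "\<lambda>x. x"] by (simp add: mult.left_commute)

lemma dvd_cof: "\<pi> \<in> PF \<Longrightarrow> \<rho> \<in> PF \<Longrightarrow> \<pi> \<noteq> \<rho> \<Longrightarrow> \<pi> dvd cof \<rho>"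
  unfolding cof_def using PF_finite by (intro dvd_mult dvd_prodI) auto

lemma cof_forms:
  assumes "\<pi> \<in> PF"
  shows "fdeg \<pi> \<le> d" "cof \<pi> \<in> forms (d - fdeg \<pi>)"
proof -
  have "\<pi> * cof \<pi> \<in> forms d" "\<pi> \<noteq> 0" "cof \<pi> \<noteq> 0" using cof_mult[OF assms] f f0 by auto
  then show "fdeg \<pi> \<le> d" "cof \<pi> \<in> forms (d - fdeg \<pi>)" using form_cofactor[OF PF_form(1)[OF assms]] by blast+
qed

lemma logform_forms: "logform \<gamma> i \<in> forms e"
  unfolding logform_def
proof (intro forms_sum forms_const3_mult)
  fix \<pi> assume p: "\<pi> \<in> PF"
  have "d - fdeg \<pi> + (fdeg \<pi> - 1) = e" using cof_forms(1)[OF p] PF_form(2)[OF p] unfolding e_def by simp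
  then show "cof \<pi> * pderiv3 i \<pi> \<in> forms e"
    using forms_mult[OF cof_forms(2)[OF p] pderiv3_forms[OF PF_form(1)[OF p], of i]] by (simp only:)
qed

text \<open>The residue along \<pi> is the weight of \<pi>: all other summands contain the factor
  \<pi>.\<close>

lemma logform_cong:
  assumes "\<pi> \<in> PF"
  shows "\<pi> dvd logform \<gamma> i - const3 (\<gamma> \<pi>) * F i"
proof -
  have Fi: "F i = pderiv3 i \<pi> * cof \<pi> + \<pi> * pderiv3 i (cof \<pi>)"
    using arg_cong[OF cof_mult[OF assms], of "pderiv3 i"] unfolding pderiv3_mult by simp
  let ?R = "\<Sum>\<rho>\<in>PF - {\<pi>}. const3 (\<gamma> \<rho>) * (cof \<rho> * pderiv3 i \<rho>)"
  have "logform \<gamma> i = const3 (\<gamma> \<pi>) * (cof \<pi> * pderiv3 i \<pi>) + ?R"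
    unfolding logform_def by (rule sum.remove[OF PF_finite assms])
  then have "logform \<gamma> i - const3 (\<gamma> \<pi>) * F i = ?R - \<pi> * (const3 (\<gamma> \<pi>) * pderiv3 i (cof \<pi>))"
    unfolding Fi by (simp add: algebra_simps)
  moreover have "\<pi> dvd ?R"
  proof (rule dvd_sum)
    fix \<rho> assume "\<rho> \<in> PF - {\<pi>}"
    then have "\<pi> dvd cof \<rho>" using dvd_cof assms by blast
    then show "\<pi> dvd const3 (\<gamma> \<rho>) * (cof \<rho> * pderiv3 i \<rho>)" by (intro dvd_mult dvd_mult2)
  qed
  ultimately show ?thesis by simp
qed

text \<open>Contraction with the Euler field. It is zero for every \<open>eta a\<close>, so the
  residues of a syzygy, weighted with the degrees of the components, sum to zero.\<close>

lemma logform_euler: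
  "(\<Sum>i\<in>UNIV. var3 i * logform \<gamma> i) = const3 (\<Sum>\<pi>\<in>PF. \<gamma> \<pi> * of_nat (fdeg \<pi>)) * f"
proof -
  have "(\<Sum>i\<in>UNIV. var3 i * logform \<gamma> i) = (\<Sum>\<pi>\<in>PF. const3 (\<gamma> \<pi>) * (cof \<pi> * (\<Sum>i\<in>UNIV. var3 i * pderiv3 i \<pi>)))"
    unfolding logform_def sum_3 by (simp add: sum_distrib_left sum.distrib[symmetric] algebra_simps)
  also have "\<dots> = (\<Sum>\<pi>\<in>PF. const3 (\<gamma> \<pi> * of_nat (fdeg \<pi>)) * f)"
  proof (rule sum.cong[OF refl])
    fix \<pi> assume p: "\<pi> \<in> PF"
    have "cof \<pi> * (of_nat (fdeg \<pi>) * \<pi>) = of_nat (fdeg \<pi>) * (\<pi> * cof \<pi>)" by (simp only: mult_ac)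
    then have "cof \<pi> * (of_nat (fdeg \<pi>) * \<pi>) = of_nat (fdeg \<pi>) * f" unfolding cof_mult[OF p] .
    then show "const3 (\<gamma> \<pi>) * (cof \<pi> * (\<Sum>i\<in>UNIV. var3 i * pderiv3 i \<pi>)) = const3 (\<gamma> \<pi> * of_nat (fdeg \<pi>)) * f"
      unfolding euler_identity[OF PF_form(1)[OF p]] by (simp add: const3_of_nat mult.assoc)
  qed
  also have "\<dots> = const3 (\<Sum>\<pi>\<in>PF. \<gamma> \<pi> * of_nat (fdeg \<pi>)) * f"
  proof -
    have "const3 (sum g A) = (\<Sum>x\<in>A. const3 (g x))" for g :: "poly3 \<Rightarrow> complex" and A
      by (induction A rule: infinite_finite_induct) simp_all
    then show ?thesis by (simp only: sum_distrib_right)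
  qed
  finally show ?thesis .
qed

lemma logform_zero:
  assumes "\<And>i. logform \<gamma> i = 0" "\<pi> \<in> PF"
  shows "\<gamma> \<pi> = 0"
proof (rule ccontr)
  assume nz: "\<gamma> \<pi> \<noteq> 0"
  have "\<pi> dvd const3 (\<gamma> \<pi>) * F i" for i using logform_cong[OF assms(2), of \<gamma> i] unfolding assms(1) by simp
  then have "\<pi> dvd const3 (\<gamma> \<pi>)" by (rule PF_not_dvd_const_gv[OF assms(2)])
  then have "\<pi> dvd 1" using const3_dvd_1[OF nz] by (rule dvd_trans)
  then show False using PF_irr[OF assms(2)] unfolding irreducible_def by blast
qed

text \<open>A form of degree e < d is determined by its residues along all components, since a
  difference without residues is divisible by \<open>f\<close>.\<close>

lemma syzygy_logform:
  assumes a: "a \<in> AR m" "Suc m = e"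
  obtains \<gamma> where "(\<Sum>\<pi>\<in>PF. \<gamma> \<pi> * of_nat (fdeg \<pi>)) = 0" "\<And>i. eta a i = logform \<gamma> i"
proof -
  have "\<exists>c. \<forall>i. \<pi> dvd eta a i - const3 c * F i" if "\<pi> \<in> PF" for \<pi>
    using residue_constant[OF a that] by blast
  then obtain \<gamma> where g: "\<And>\<pi> i. \<pi> \<in> PF \<Longrightarrow> \<pi> dvd eta a i - const3 (\<gamma> \<pi>) * F i" by metis
  have eq: "eta a i = logform \<gamma> i" for i
  proof -
    have "\<pi> dvd eta a i - logform \<gamma> i" if "\<pi> \<in> PF" for \<pi>
    proof -
      have "\<pi> dvd (eta a i - const3 (\<gamma> \<pi>) * F i) - (logform \<gamma> i - const3 (\<gamma> \<pi>) * F i)"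
        by (rule dvd_diff[OF g[OF that] logform_cong[OF that]])
      then show ?thesis by simp
    qed
    then have "f dvd eta a i - logform \<gamma> i" by (rule f_dvdI)
    moreover have "eta a i - logform \<gamma> i \<in> forms e" using eta_forms[OF a(1)] logform_forms a(2) by (simp add: forms_diff)
    moreover have "e < d" using d_e by simp
    ultimately have "eta a i - logform \<gamma> i = 0" by (rule small_form_zero[rotated 2])
    then show ?thesis by simp
  qed
  have "const3 (\<Sum>\<pi>\<in>PF. \<gamma> \<pi> * of_nat (fdeg \<pi>)) * f = (\<Sum>i\<in>UNIV. var3 i * eta a i)"
    unfolding logform_euler[symmetric] eq ..
  also have "\<dots> = 0" unfolding sum_3 eta_simps by (simp add: algebra_simps)
  finally have "(\<Sum>\<pi>\<in>PF. \<gamma> \<pi> * of_nat (fdeg \<pi>)) = 0" using f0 by simp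
  then show ?thesis using that eq by blast
qed

text \<open>Modulo each prime factor the logarithmic form is a multiple of the gradient, so
  \<open>f\<close> divides their cross product. The quotient divided by -d is the required syzygy,
  as \<open>cross_eta\<close> dictates; the condition on \<gamma> ensures that its cross product
  with x returns the form.\<close>

lemma logform_syzygy:
  assumes g: "(\<Sum>\<pi>\<in>PF. \<gamma> \<pi> * of_nat (fdeg \<pi>)) = 0" and m: "Suc m = e"
  obtains a where "a \<in> AR m" "\<And>i. eta a i = logform \<gamma> i"
proof -
  let ?n = "logform \<gamma>"
  have "f dvd F i * ?n j - F j * ?n i" for i j
  proof (rule f_dvdI)
    fix \<pi> assume p: "\<pi> \<in> PF"
    have "\<pi> dvd F i * (?n j - const3 (\<gamma> \<pi>) * F j) - F j * (?n i - const3 (\<gamma> \<pi>) * F i)"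
      by (intro dvd_diff dvd_mult logform_cong[OF p])
    moreover have "F i * (?n j - const3 (\<gamma> \<pi>) * F j) - F j * (?n i - const3 (\<gamma> \<pi>) * F i) = F i * ?n j - F j * ?n i"
      by (simp add: algebra_simps)
    ultimately show "\<pi> dvd F i * ?n j - F j * ?n i" by (simp only:)
  qed
  then have "\<exists>q. F i * ?n j - F j * ?n i = f * q" for i j unfolding dvd_def by blast
  then obtain q where q: "\<And>i j. F i * ?n j - F j * ?n i = f * q i j" by metis
  have Ff: "F i \<in> forms e" for i using pderiv3_forms[OF f, of i] unfolding e_def .
  have qf: "q i j \<in> forms m" for i j
  proof (cases "q i j = 0")
    case False
    have "f * q i j \<in> forms (e + e)" unfolding q[symmetric] by (intro forms_diff forms_mult Ff logform_forms)
    then have "q i j \<in> forms (e + e - d)" using form_cofactor(2)[OF f f0 False] by blast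
    moreover have "e + e - d = m" using m d_e by simp
    ultimately show ?thesis by simp
  qed simp
  define b where "b = const3 (- 1 / of_nat d)"
  have bd: "of_nat d * b = - 1"
    unfolding b_def const3_of_nat[symmetric] using d2 by (simp flip: const3_simps(4))
  define a where "a i = b * (if i = 1 then q 2 3 else if i = 2 then q 3 1 else q 1 2)" for i :: 3
  have av: "a 1 = b * q 2 3" "a 2 = b * q 3 1" "a 3 = b * q 1 2" by (simp_all add: a_def)
  have "b * q i j \<in> forms m" for i j unfolding b_def by (rule forms_const3_mult[OF qf])
  then have "a i \<in> forms m" for i unfolding a_def by (cases "i = 1"; cases "i = 2") simp_all
  moreover have "(\<Sum>i\<in>UNIV. a i * F i) = 0"
  proof -
    have "f * (\<Sum>i\<in>UNIV. a i * F i) = b * ((f * q 2 3) * F 1 + (f * q 3 1) * F 2 + (f * q 1 2) * F 3)"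
      unfolding sum_3 av by (simp add: algebra_simps)
    also have "\<dots> = 0" unfolding q[symmetric] by (simp add: algebra_simps)
    finally show ?thesis using f0 by simp
  qed
  ultimately have aAR: "a \<in> AR m" unfolding AR_def by blast
  have xn: "var3 1 * ?n 1 + var3 2 * ?n 2 + var3 3 * ?n 3 = 0" using logform_euler[of \<gamma>] unfolding g sum_3 by simp
  have "eta a i = ?n i" for i
  proof -
    have key: "f * (x * (b * q1) - y * (b * q2)) = f * n" if "x * (f * q1) - y * (f * q2) = - (of_nat d * f * n)" for x y q1 q2 n :: poly3
    proof -
      have "f * (x * (b * q1) - y * (b * q2)) = b * (x * (f * q1) - y * (f * q2))" by (simp add: algebra_simps)
      also have "\<dots> = - (of_nat d * b) * (f * n)" unfolding that by (simp add: algebra_simps)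
      finally show ?thesis unfolding bd by simp
    qed
    have e1: "var3 2 * (f * q 1 2) - var3 3 * (f * q 3 1) = - (of_nat d * f * ?n 1)"
    proof -
      have "var3 2 * (f * q 1 2) - var3 3 * (f * q 3 1) = F 1 * (var3 1 * ?n 1 + var3 2 * ?n 2 + var3 3 * ?n 3) - (var3 1 * F 1 + var3 2 * F 2 + var3 3 * F 3) * ?n 1"
        unfolding q[symmetric] by (simp add: algebra_simps)
      then show ?thesis unfolding xn euler_three by simp
    qed
    have e2: "var3 3 * (f * q 2 3) - var3 1 * (f * q 1 2) = - (of_nat d * f * ?n 2)"
    proof -
      have "var3 3 * (f * q 2 3) - var3 1 * (f * q 1 2) = F 2 * (var3 1 * ?n 1 + var3 2 * ?n 2 + var3 3 * ?n 3) - (var3 1 * F 1 + var3 2 * F 2 + var3 3 * F 3) * ?n 2"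
        unfolding q[symmetric] by (simp add: algebra_simps)
      then show ?thesis unfolding xn euler_three by simp
    qed
    have e3: "var3 1 * (f * q 3 1) - var3 2 * (f * q 2 3) = - (of_nat d * f * ?n 3)"
    proof -
      have "var3 1 * (f * q 3 1) - var3 2 * (f * q 2 3) = F 3 * (var3 1 * ?n 1 + var3 2 * ?n 2 + var3 3 * ?n 3) - (var3 1 * F 1 + var3 2 * F 2 + var3 3 * F 3) * ?n 3"
        unfolding q[symmetric] by (simp add: algebra_simps)
      then show ?thesis unfolding xn euler_three by simp
    qed
    have "f * eta a i = f * ?n i"
      using exhaust_3[of i] key[OF e1] key[OF e2] key[OF e3] by (auto simp only: eta_simps av)
    then show ?thesis using f0 by simp
  qed
  then show ?thesis using that aAR by blast
qed

lemma AR_sum: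
  assumes "\<And>x. x \<in> A \<Longrightarrow> a x \<in> AR m"
  shows "(\<lambda>i. \<Sum>x\<in>A. const3 (b x) * a x i) \<in> AR m"
    "eta (\<lambda>i. \<Sum>x\<in>A. const3 (b x) * a x i) k = (\<Sum>x\<in>A. const3 (b x) * eta (a x) k)"
    "lcomp (\<lambda>i. \<Sum>x\<in>A. const3 (b x) * a x i) = (\<Sum>x\<in>A. const3 (b x) * lcomp (a x))"
proof -
  have a: "a x i \<in> forms m" "(\<Sum>i\<in>UNIV. a x i * F i) = 0" if "x \<in> A" for x i using assms[OF that] unfolding AR_def by blast+
  have "(\<Sum>i\<in>UNIV. (\<Sum>x\<in>A. const3 (b x) * a x i) * F i) = (\<Sum>x\<in>A. const3 (b x) * (\<Sum>i\<in>UNIV. a x i * F i))"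
    unfolding sum_3 by (simp add: sum_distrib_right sum_distrib_left sum.distrib[symmetric] algebra_simps)
  also have "\<dots> = 0" using a(2) by simp
  finally show "(\<lambda>i. \<Sum>x\<in>A. const3 (b x) * a x i) \<in> AR m"
    unfolding AR_def using a(1) by (auto intro!: forms_sum forms_const3_mult)
  show "eta (\<lambda>i. \<Sum>x\<in>A. const3 (b x) * a x i) k = (\<Sum>x\<in>A. const3 (b x) * eta (a x) k)"
    using exhaust_3[of k] by (auto simp: eta_simps sum_distrib_left sum_subtractf[symmetric] algebra_simps)
  show "lcomp (\<lambda>i. \<Sum>x\<in>A. const3 (b x) * a x i) = (\<Sum>x\<in>A. const3 (b x) * lcomp (a x))"
    unfolding lcomp_def sum_3 by (simp add: sum_distrib_left sum.distrib[symmetric] algebra_simps)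
qed

lemma logform_sum:
  "(\<Sum>x\<in>A. const3 (b x) * logform (\<gamma> x) k) = logform (\<lambda>\<pi>. \<Sum>x\<in>A. b x * \<gamma> x \<pi>) k"
proof (induction A rule: infinite_finite_induct)
  case (insert x A)
  have "logform (\<lambda>\<pi>. \<Sum>x\<in>insert x A. b x * \<gamma> x \<pi>) k = const3 (b x) * logform (\<gamma> x) k + logform (\<lambda>\<pi>. \<Sum>x\<in>A. b x * \<gamma> x \<pi>) k"
    unfolding logform_def sum.insert[OF insert(1,2)] by (simp add: sum_distrib_left sum.distrib[symmetric] algebra_simps)
  then show ?case using insert by simp
qed (simp_all add: logform_def)

text \<open>The weights orthogonal to the degrees of the factors form a hyperplane, and passing from
  weights to logarithmic forms, to syzygies and to their coefficient of \<open>gw\<close> identifies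
  it with \<open>Hs m\<close>.\<close>

theorem dim_Hs_components:
  assumes m: "Suc m = e"
  shows "Suc (P3.dim (Hs m)) = card PF"
proof -
  have "PF \<noteq> {}"
  proof
    assume "PF = {}"
    then have "f \<in> forms 0" using f_eq forms_const3 by simp
    then show False using forms_unique[OF f _ f0] d2 by fastforce
  qed
  then obtain \<pi>0 where p0: "\<pi>0 \<in> PF" by blast
  define I where "I = PF - {\<pi>0}"
  have I: "finite I" "card PF = Suc (card I)" unfolding I_def using PF_finite card_Suc_Diff1[OF PF_finite p0] by simp_all
  define dg where "dg \<pi> = (of_nat (fdeg \<pi>) :: complex)" for \<pi>
  have dg0: "dg \<pi> \<noteq> 0" if "\<pi> \<in> PF" for \<pi> using PF_form(2)[OF that] unfolding dg_def by simp
  \<comment> \<open>For \<pi> other than \<pi>0 these weights form a basis of the hyperplane: the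
    degree of \<pi>0 placed at \<pi> is balanced by minus the degree of \<pi> placed at
    \<pi>0.\<close>
  define \<Gamma> where "\<Gamma> \<pi> \<rho> = (if \<rho> = \<pi> then dg \<pi>0 else 0) - (if \<rho> = \<pi>0 then dg \<pi> else 0)" for \<pi> \<rho> :: poly3
  have G0: "(\<Sum>\<rho>\<in>PF. \<Gamma> \<pi> \<rho> * of_nat (fdeg \<rho>)) = 0" if "\<pi> \<in> I" for \<pi>
  proof -
    have "(\<Sum>\<rho>\<in>PF. \<Gamma> \<pi> \<rho> * of_nat (fdeg \<rho>)) = (\<Sum>\<rho>\<in>PF. (if \<rho> = \<pi> then dg \<pi>0 * dg \<pi> else 0) - (if \<rho> = \<pi>0 then dg \<pi> * dg \<pi>0 else 0))"
      unfolding \<Gamma>_def dg_def by (rule sum.cong) (auto simp: left_diff_distrib)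
    also have "\<dots> = 0" using that p0 PF_finite unfolding I_def by (simp add: sum_subtractf)
    finally show ?thesis .
  qed
  have "\<exists>a. a \<in> AR m \<and> (\<forall>i. eta a i = logform (\<Gamma> \<pi>) i)" if "\<pi> \<in> I" for \<pi>
    using logform_syzygy[OF G0[OF that] m] by blast
  then obtain a where a: "\<And>\<pi>. \<pi> \<in> I \<Longrightarrow> a \<pi> \<in> AR m" "\<And>\<pi> i. \<pi> \<in> I \<Longrightarrow> eta (a \<pi>) i = logform (\<Gamma> \<pi>) i" by metis
  have me: "m < e" using m by simp
  have etaS: "eta (\<lambda>i. \<Sum>\<pi>\<in>I. const3 (b \<pi>) * a \<pi> i) k = logform (\<lambda>\<rho>. \<Sum>\<pi>\<in>I. b \<pi> * \<Gamma> \<pi> \<rho>) k" for b k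
    unfolding AR_sum(2)[OF a(1), of I "\<lambda>x. x" b k, simplified] logform_sum[symmetric]
    by (rule sum.cong[OF refl]) (simp only: a(2))
  have GS: "(\<Sum>\<pi>\<in>I. b \<pi> * \<Gamma> \<pi> \<rho>) = b \<rho> * dg \<pi>0" if "\<rho> \<in> I" for b \<rho>
  proof -
    have "(\<Sum>\<pi>\<in>I. b \<pi> * \<Gamma> \<pi> \<rho>) = (\<Sum>\<pi>\<in>I. if \<pi> = \<rho> then b \<rho> * dg \<pi>0 else 0)"
      using that unfolding \<Gamma>_def I_def by (intro sum.cong) auto
    then show ?thesis using that I(1) by simp
  qed
  have "P3.dim (Hs m) = card I"
  proof (rule dim_family[OF I(1) Hs_subspace(1), of "\<lambda>\<pi>. lcomp (a \<pi>)"])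
    show "lcomp (a \<pi>) \<in> Hs m" if "\<pi> \<in> I" for \<pi> using lcomp_Hs[OF a(1)[OF that]] .
  next
    fix b \<rho> assume z: "(\<Sum>\<pi>\<in>I. const3 (b \<pi>) * lcomp (a \<pi>)) = 0" and r: "\<rho> \<in> I"
    let ?a = "\<lambda>i. \<Sum>\<pi>\<in>I. const3 (b \<pi>) * a \<pi> i"
    have aA: "?a \<in> AR m" by (rule AR_sum(1)) (rule a(1))
    have "lcomp ?a = (\<Sum>\<pi>\<in>I. const3 (b \<pi>) * lcomp (a \<pi>))" by (rule AR_sum(3)) (rule a(1))
    then have "lcomp ?a = 0" using z by simp
    then have "?a i = 0" for i using lcomp_zero[OF aA me] by blast
    then have "eta ?a k = 0" for k unfolding eta_def by simp
    then have "logform (\<lambda>\<rho>. \<Sum>\<pi>\<in>I. b \<pi> * \<Gamma> \<pi> \<rho>) k = 0" for k unfolding etaS .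
    then have "(\<Sum>\<pi>\<in>I. b \<pi> * \<Gamma> \<pi> \<rho>) = 0" using logform_zero[of "\<lambda>\<rho>. \<Sum>\<pi>\<in>I. b \<pi> * \<Gamma> \<pi> \<rho>" \<rho>] r unfolding I_def by blast
    then show "b \<rho> = 0" unfolding GS[OF r] using dg0[OF p0] by simp
  next
    fix h assume "h \<in> Hs m"
    then obtain a' where a': "a' \<in> AR m" "lcomp a' = h" by (rule Hs_lcomp)
    obtain \<gamma> where g: "(\<Sum>\<pi>\<in>PF. \<gamma> \<pi> * of_nat (fdeg \<pi>)) = 0" "\<And>i. eta a' i = logform \<gamma> i" using syzygy_logform[OF a'(1) m] by blast
    define b where "b \<pi> = \<gamma> \<pi> / dg \<pi>0" for \<pi>
    let ?a = "\<lambda>i. \<Sum>\<pi>\<in>I. const3 (b \<pi>) * a \<pi> i"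
    have aA: "?a \<in> AR m" by (rule AR_sum(1)) (rule a(1))
    have "logform (\<lambda>\<rho>. \<Sum>\<pi>\<in>I. b \<pi> * \<Gamma> \<pi> \<rho>) k = logform \<gamma> k" for k
      unfolding logform_def
    proof (rule sum.cong[OF refl])
      fix \<rho> assume r: "\<rho> \<in> PF"
      have "(\<Sum>\<pi>\<in>I. b \<pi> * \<Gamma> \<pi> \<rho>) = \<gamma> \<rho>"
      proof (cases "\<rho> = \<pi>0")
        case False
        then have "\<rho> \<in> I" using r unfolding I_def by blast
        then show ?thesis unfolding GS[OF \<open>\<rho> \<in> I\<close>] b_def using dg0[OF p0] by simp
      next
        case True
        have "(\<Sum>\<pi>\<in>I. b \<pi> * \<Gamma> \<pi> \<pi>0) = (\<Sum>\<pi>\<in>I. - (\<gamma> \<pi> * dg \<pi>) / dg \<pi>0)"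
          unfolding \<Gamma>_def b_def I_def by (rule sum.cong) auto
        also have "\<dots> = - (\<Sum>\<pi>\<in>I. \<gamma> \<pi> * dg \<pi>) / dg \<pi>0" by (simp add: sum_divide_distrib sum_negf)
        also have "(\<Sum>\<pi>\<in>I. \<gamma> \<pi> * dg \<pi>) = - (\<gamma> \<pi>0 * dg \<pi>0)"
          using g(1) unfolding sum.remove[OF PF_finite p0] dg_def I_def by (simp add: add_eq_0_iff)
        finally show ?thesis unfolding True using dg0[OF p0] by simp
      qed
      then show "const3 (\<Sum>\<pi>\<in>I. b \<pi> * \<Gamma> \<pi> \<rho>) * (cof \<rho> * pderiv3 k \<rho>) = const3 (\<gamma> \<rho>) * (cof \<rho> * pderiv3 k \<rho>)" by simp
    qed
    then have eq: "eta ?a k = eta a' k" for k unfolding etaS g(2) .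
    have "a' i - ?a i = 0" for i
    proof (rule AR_zero_of_eta)
      have "(\<Sum>i\<in>UNIV. (a' i - ?a i) * F i) = (\<Sum>i\<in>UNIV. a' i * F i) - (\<Sum>i\<in>UNIV. ?a i * F i)"
        by (simp only: left_diff_distrib sum_subtractf)
      then show "(\<lambda>i. a' i - ?a i) \<in> AR m" using a'(1) aA unfolding AR_def by (simp add: forms_diff)
      show "eta (\<lambda>i. a' i - ?a i) k = 0" for k
      proof -
        have "eta (\<lambda>i. x i - y i) k = eta x k - eta y k" for x y unfolding eta_def by (simp add: algebra_simps)
        then show ?thesis using eq by simp
      qed
    qed
    then have "a' = ?a" by auto
    then have "h = lcomp ?a" using a'(2) by simp
    also have "\<dots> = (\<Sum>\<pi>\<in>I. const3 (b \<pi>) * lcomp (a \<pi>))" by (rule AR_sum(3)) (rule a(1))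
    finally show "\<exists>b. h = (\<Sum>\<pi>\<in>I. const3 (b \<pi>) * lcomp (a \<pi>))" by (rule exI[of _ b])
  qed
  then show ?thesis using I(2) by simp
qed

text \<open>An irreducible factor of \<open>f\<close> is associated to a member of
  \<open>PF\<close>. Distinct members have distinct loci, because they meet in finitely many points
  while each locus is infinite.\<close>

lemma components_PF: "card (curve_components f) = card PF"
proof -
  have "curve_components f = zero_locus ` PF"
  proof
    show "zero_locus ` PF \<subseteq> curve_components f" unfolding curve_components_def using PF_irr PF_dvd_f by blast
    show "curve_components f \<subseteq> zero_locus ` PF"
    proof
      fix C assume "C \<in> curve_components f"
      then obtain g where g: "C = zero_locus g" "irreducible g" "g dvd f" unfolding curve_components_def by blast
      have pg: "prime_elem g" using irreducible_imp_prime_elem_poly3[OF g(2)] .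
      have "\<not> g dvd const3 c0" using const3_dvd_1[OF c0] g(2) unfolding irreducible_def by (metis dvd_trans)
      then have "g dvd \<Prod>PF" using g(3) prime_elem_dvd_mult_iff[OF pg] unfolding f_eq by blast
      then obtain \<pi> where p: "\<pi> \<in> PF" "g dvd \<pi>" using prime_elem_dvd_Prod[OF PF_finite pg, of "\<lambda>x. x"] by blast
      obtain q where q: "\<pi> = g * q" using p(2) by (auto elim: dvdE)
      have "q dvd 1" using PF_irr[OF p(1)] g(2) q unfolding irreducible_def by metis
      then obtain c where c: "q = const3 c" "c \<noteq> 0" by (rule poly3_unit_const)
      have "poly_at \<pi> x = poly_at g x * c" for x unfolding q c by (simp add: poly_at_simps)
      then have "zero_locus g = zero_locus \<pi>" unfolding zero_locus_def using c(2) by simp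
      then show "C \<in> zero_locus ` PF" using g(1) p(1) by blast
    qed
  qed
  moreover have "inj_on zero_locus PF"
  proof (rule inj_onI, rule ccontr)
    fix \<pi> \<rho> assume p: "\<pi> \<in> PF" "\<rho> \<in> PF" "zero_locus \<pi> = zero_locus \<rho>" "\<pi> \<noteq> \<rho>"
    then have "\<not> \<pi> dvd \<rho>" using PF_dvd by blast
    then have "finite (zero_locus \<pi> \<inter> zero_locus \<rho>)"
      using prime_form_Int_finite[OF PF_prime[OF p(1)] PF_form(1)[OF p(1)] PF_form(1)[OF p(2)]] by blast
    then show False using p(3) irreducible_zero[OF PF_irr[OF p(1)] PF_form(1)[OF p(1)]] by simp
  qed
  ultimately show ?thesis using card_image by metis
qed

text \<open>In this range the coefficients have degree at most e - 2, where there are no syzygies,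
  so three copies of \<open>forms (k - e)\<close> embed. The value depends on d alone, which allows
  \<open>f\<close> to be replaced by the equation of a smooth curve.\<close>

theorem dim_jacobian_piece:
  assumes "k < 2 * e - 1"
  shows "P3.dim (jacobian_ideal f \<inter> forms k) = (if k < e then 0 else 3 * P3.dim (forms (k - e)))"
    "P3.fin_dim (jacobian_ideal f \<inter> forms k)"
proof -
  have sub: "P3.subspace (jacobian_ideal f \<inter> forms k)"
    unfolding J_jacobian_ideal[symmetric] P3.subspace_def scal3_const3
    using J_0 J_add J_mult forms_add forms_const3_mult by auto
  then show "P3.fin_dim (jacobian_ideal f \<inter> forms k)" using fin_dim_forms_subset by blast
  show "P3.dim (jacobian_ideal f \<inter> forms k) = (if k < e then 0 else 3 * P3.dim (forms (k - e)))"
  proof (cases "k < e")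
    case True
    have "p = 0" if p: "p \<in> J" "p \<in> forms k" for p
    proof -
      obtain \<alpha> \<beta> \<gamma> where g: "\<alpha> \<in> graded_piece (int k - int e)" "\<beta> \<in> graded_piece (int k - int e)"
        "\<gamma> \<in> graded_piece (int k - int e)" "p = \<alpha> * gu + \<beta> * gv + \<gamma> * gw" using J_graded[OF p] .
      have "\<alpha> = 0" "\<beta> = 0" "\<gamma> = 0" using graded_nonneg[OF g(1)] graded_nonneg[OF g(2)] graded_nonneg[OF g(3)] True by auto
      then show ?thesis using g(4) by simp
    qed
    then have "jacobian_ideal f \<inter> forms k = {0}" unfolding J_jacobian_ideal[symmetric] using J_0 by auto
    then show ?thesis using True dim_zero_set by simp
  next
    case False
    define m where "m = k - e"
    have m: "int m = int k - int e" "m + 2 \<le> e" "k = m + e" using False assms unfolding m_def by auto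
    have indep: "\<alpha> = 0 \<and> \<beta> = 0 \<and> \<gamma> = 0" if h: "\<alpha> \<in> forms m" "\<beta> \<in> forms m" "\<gamma> \<in> forms m" "\<alpha> * gu + \<beta> * gv + \<gamma> * gw = 0" for \<alpha> \<beta> \<gamma>
    proof -
      have "\<gamma> * gw = (- \<alpha>) * gu + (- \<beta>) * gv" using h(4) by (rule solve_syzygy)
      moreover have "(- \<alpha>) * gu + (- \<beta>) * gv \<in> Qs (int (m + e))" using h(1,2) by (intro QsI) (simp_all add: forms_uminus)
      ultimately have "\<gamma> \<in> Hs m" unfolding Hs_def using h(3) by simp
      then obtain a where a: "a \<in> AR m" "lcomp a = \<gamma>" by (rule Hs_lcomp)
      have "\<gamma> = 0" using no_small_syzygies[OF a(1) m(2)] a(2) unfolding lcomp_def by simp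
      then show ?thesis using syzygy_small[OF h(1,2)] h(4) m(2) by simp
    qed
    have "1 \<in> forms 0" by (rule forms_one)
    obtain z where z: "z \<in> forms m" "z \<noteq> 0"
    proof -
      have "l ^ m \<in> forms m" using forms_power[OF stl(3), of m] by simp
      then show ?thesis using that stl(4) by simp
    qed
    have nz: "gu \<noteq> 0" "gv \<noteq> 0" "gw \<noteq> 0"
      using indep[of z 0 0] indep[of 0 z 0] indep[of 0 0 z] z by auto
    let ?U = "(\<lambda>p. gu * p) ` forms m" and ?V = "(\<lambda>p. gv * p) ` forms m" and ?W = "(\<lambda>p. gw * p) ` forms m"
    note U = dim_mult_forms[OF nz(1) dim_forms(2), of m]
    note V = dim_mult_forms[OF nz(2) dim_forms(2), of m]
    note W = dim_mult_forms[OF nz(3) dim_forms(2), of m]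
    let ?UV = "{x + y |x y. x \<in> ?U \<and> y \<in> ?V}"
    note UV = P3.fin_dim_sum[OF U(1) V(1)]
    have "?U \<inter> ?V = {0}"
    proof -
      have "x = 0" if x: "x \<in> ?U" "x \<in> ?V" for x
      proof -
        obtain a where ab: "a \<in> forms m" "x = gu * a" using x(1) by blast
        obtain b where b: "b \<in> forms m" "x = gv * b" using x(2) by blast
        note ab = ab b
        have "a * gu + (- b) * gv + 0 * gw = gu * a - gv * b" by (simp add: algebra_simps)
        also have "\<dots> = 0" using ab(2,4) by simp
        finally have "a = 0" using indep[of a "- b" 0] ab(1,3) forms_uminus by simp
        then show ?thesis using ab(2) by simp
      qed
      then show ?thesis using P3.subspace_0[OF P3.fin_dim_subspace[OF U(1)]] P3.subspace_0[OF P3.fin_dim_subspace[OF V(1)]] by blast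
    qed
    then have dUV: "P3.dim ?UV = 2 * P3.dim (forms m)" using UV(2) U(2) V(2) dim_zero_set by simp
    have "?UV \<inter> ?W = {0}"
    proof -
      have "x = 0" if x: "x \<in> ?UV" "x \<in> ?W" for x
      proof -
        obtain a b where ab: "a \<in> forms m" "b \<in> forms m" "x = gu * a + gv * b" using x(1) by blast
        obtain c where c: "c \<in> forms m" "x = gw * c" using x(2) by blast
        have "a * gu + b * gv + (- c) * gw = (gu * a + gv * b) - gw * c" by (simp add: algebra_simps)
        also have "\<dots> = 0" using ab(3) c(2) by simp
        finally have "c = 0" using indep[of a b "- c"] ab(1,2) c(1) forms_uminus by simp
        then show ?thesis using c(2) by simp
      qed
      then show ?thesis using P3.subspace_0[OF P3.fin_dim_subspace[OF UV(1)]] P3.subspace_0[OF P3.fin_dim_subspace[OF W(1)]] by blast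
    qed
    then have dUVW: "P3.dim {x + y |x y. x \<in> ?UV \<and> y \<in> ?W} = 3 * P3.dim (forms m)"
      using P3.fin_dim_sum(2)[OF UV(1) W(1)] dUV W(2) dim_zero_set by simp
    have "jacobian_ideal f \<inter> forms k = {x + y |x y. x \<in> ?UV \<and> y \<in> ?W}"
    proof
      show "jacobian_ideal f \<inter> forms k \<subseteq> {x + y |x y. x \<in> ?UV \<and> y \<in> ?W}"
      proof
        fix p assume "p \<in> jacobian_ideal f \<inter> forms k"
        then have p: "p \<in> J" "p \<in> forms k" unfolding J_jacobian_ideal by blast+
        obtain \<alpha> \<beta> \<gamma> where g: "\<alpha> \<in> graded_piece (int k - int e)" "\<beta> \<in> graded_piece (int k - int e)"
          "\<gamma> \<in> graded_piece (int k - int e)" "p = \<alpha> * gu + \<beta> * gv + \<gamma> * gw" using J_graded[OF p] .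
        have gm: "\<alpha> \<in> forms m" "\<beta> \<in> forms m" "\<gamma> \<in> forms m" using g(1-3) unfolding m(1) by blast+
        have "p = (gu * \<alpha> + gv * \<beta>) + gw * \<gamma>" unfolding g(4) by (simp only: mult.commute)
        then show "p \<in> {x + y |x y. x \<in> ?UV \<and> y \<in> ?W}" using gm by blast
      qed
      show "{x + y |x y. x \<in> ?UV \<and> y \<in> ?W} \<subseteq> jacobian_ideal f \<inter> forms k"
      proof
        fix p assume "p \<in> {x + y |x y. x \<in> ?UV \<and> y \<in> ?W}"
        then obtain \<alpha> \<beta> \<gamma> where g: "\<alpha> \<in> forms m" "\<beta> \<in> forms m" "\<gamma> \<in> forms m" "p = (gu * \<alpha> + gv * \<beta>) + gw * \<gamma>" by blast
        have p: "p = \<alpha> * gu + \<beta> * gv + \<gamma> * gw" unfolding g(4) by (simp only: mult.commute)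
        have "p \<in> forms k" unfolding p m(3) by (intro forms_add forms_mult g(1-3) g_forms)
        moreover have "p \<in> J" unfolding p by (rule JI)
        ultimately show "p \<in> jacobian_ideal f \<inter> forms k" unfolding J_jacobian_ideal by blast
      qed
    qed
    then show ?thesis using dUVW False unfolding m_def by simp
  qed
qed

end

section \<open>Rational components\<close>

text \<open>Two applications of the Bezout identity. The final relation guarantees that the
  quotients have no common zero.\<close>

lemma triple_gcd:
  fixes p :: "3 \<Rightarrow> complex poly"
  assumes "p i0 \<noteq> 0"
  obtains D q x where "D \<noteq> 0" "\<And>i. p i = D * q i" "(\<Sum>i\<in>UNIV. x i * q i) = 1"
proof -
  let ?g = "gcd (p 1) (p 2)"
  define D where "D = gcd ?g (p 3)"
  obtain a b where ab: "a * p 1 + b * p 2 = ?g" using bezout_coefficients_fst_snd by blast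
  obtain c e where ce: "c * ?g + e * p 3 = D" unfolding D_def using bezout_coefficients_fst_snd by blast
  have "D dvd p 1" "D dvd p 2" "D dvd p 3"
    unfolding D_def by (meson dvd_trans gcd_dvd1 gcd_dvd2)+
  then have dv: "D dvd p i" for i using exhaust_3[of i] by auto
  then have "\<exists>r. p i = D * r" for i unfolding dvd_def by blast
  then obtain q where q: "\<And>i. p i = D * q i" by metis
  have D0: "D \<noteq> 0" using assms q[of i0] by auto
  define x where "x i = (if i = 1 then c * a else if i = 2 then c * b else e)" for i :: 3
  have xs: "x 1 = c * a" "x 2 = c * b" "x 3 = e" by (simp_all add: x_def)
  have "D * (\<Sum>i\<in>UNIV. x i * q i) = c * (a * (D * q 1) + b * (D * q 2)) + e * (D * q 3)"
    unfolding sum_3 xs by (simp add: algebra_simps)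
  also have "\<dots> = D * 1" unfolding q[symmetric] ab ce by simp
  finally have "(\<Sum>i\<in>UNIV. x i * q i) = 1" using mult_left_cancel[OF D0] by blast
  then show ?thesis using that D0 q by blast
qed

text \<open>The full power of one root is coprime to the remaining factor, so the roots can be
  treated one at a time.\<close>

lemma dvd_of_root_powers:
  fixes G X :: "complex poly"
  assumes "G \<noteq> 0" "\<And>t n. [:- t, 1:] ^ n dvd G \<Longrightarrow> [:- t, 1:] ^ n dvd X"
  shows "G dvd X"
  using assms
proof (induction "degree G" arbitrary: G rule: less_induct)
  case less
  show ?case
  proof (cases "degree G = 0")
    case True
    then have "is_unit G" using less(2) by (simp add: is_unit_iff_degree)
    then show ?thesis by (rule unit_imp_dvd)
  next
    case False
    then have "\<not> constant (poly G)" by (simp add: constant_degree)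
    then obtain z where z: "poly G z = 0" using fundamental_theorem_of_algebra by blast
    let ?N = "order z G"
    obtain G1 where G1: "G = [:- z, 1:] ^ ?N * G1" "\<not> [:- z, 1:] dvd G1" using order_decomp[OF less(2)] by blast
    have N: "?N \<noteq> 0" using z less(2) by (simp add: order_root)
    have G10: "G1 \<noteq> 0" using G1(1) less(2) by auto
    have "degree G = ?N + degree G1"
      using degree_mult_eq[of "[:- z, 1:] ^ ?N" G1] G10 G1(1) by (simp add: degree_power_eq)
    then have lt: "degree G1 < degree G" using N by simp
    have "G1 dvd X"
    proof (rule less(1)[OF lt G10])
      fix t n assume "[:- t, 1:] ^ n dvd G1"
      then have "[:- t, 1:] ^ n dvd G" by (subst G1(1)) (rule dvd_mult)
      then show "[:- t, 1:] ^ n dvd X" by (rule less(3))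
    qed
    moreover have "[:- z, 1:] ^ ?N dvd X" by (rule less(3)[OF order_1])
    moreover have "coprime ([:- z, 1:] ^ ?N) G1"
    proof -
      have "coprime [:- z, 1:] G1"
        by (rule coprime_complex_poly_iff) (use G1(2) in \<open>auto simp: poly_eq_0_iff_dvd\<close>)
      then show ?thesis by simp
    qed
    ultimately have "[:- z, 1:] ^ ?N * G1 dvd X" by (intro divides_mult)
    then show ?thesis using G1(1) by simp
  qed
qed

lemma power_dvd_pderiv:
  fixes q :: "complex poly"
  assumes "[:- t, 1:] ^ Suc n dvd q"
  shows "[:- t, 1:] ^ n dvd pderiv q"
proof -
  obtain r where r: "q = [:- t, 1:] ^ Suc n * r" using assms by (auto elim: dvdE)
  have "pderiv q = [:- t, 1:] ^ Suc n * pderiv r + r * (smult (of_nat (Suc n)) ([:- t, 1:] ^ n) * pderiv [:- t, 1:])"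
    unfolding r pderiv_mult pderiv_power_Suc ..
  moreover have "[:- t, 1:] ^ n dvd [:- t, 1:] ^ Suc n * pderiv r" by (intro dvd_mult2 le_imp_power_dvd) simp
  moreover have "[:- t, 1:] ^ n dvd r * (smult (of_nat (Suc n)) ([:- t, 1:] ^ n) * pderiv [:- t, 1:])"
    by (intro dvd_mult dvd_mult2 dvd_smult dvd_refl)
  ultimately show ?thesis by (metis dvd_add)
qed

text \<open>The quotient q / p has derivative zero and value 0 at 0. In terms of orders at 0:
  differentiation lowers the order of a nonzero \<open>q\<close> by exactly one.\<close>

lemma proportional_derivative:
  fixes p q :: "complex poly"
  assumes "p * pderiv q = pderiv p * q" "poly p 0 \<noteq> 0" "poly q 0 = 0"
  shows "q = 0"
proof (rule ccontr)
  assume q0: "q \<noteq> 0"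
  have dq: "pderiv q \<noteq> 0"
  proof
    assume "pderiv q = 0"
    then have "degree q = 0" by (simp add: pderiv_eq_0_iff)
    then obtain c where "q = [:c:]" by (metis degree_eq_zeroE)
    then show False using assms(3) q0 by simp
  qed
  have p0: "p \<noteq> 0" using assms(2) by auto
  have nz: "p * pderiv q \<noteq> 0" using p0 dq by simp
  have "order 0 p = 0" using assms(2) by (simp add: order_root)
  then have "order 0 (p * pderiv q) = order 0 (pderiv q)" using order_mult[OF nz] by simp
  moreover have "order 0 q = Suc (order 0 (pderiv q))" using order_pderiv[OF q0 assms(3)] .
  moreover have "order 0 (pderiv p * q) = order 0 (pderiv p) + order 0 q" using order_mult[of "pderiv p" q] nz assms(1) by simp
  ultimately show False using assms(1) by simp
qed

lemma poly_zero_of_cofinite_zeros: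
  fixes p :: "complex poly"
  assumes "finite S" "\<And>t. t \<notin> S \<Longrightarrow> poly p t = 0"
  shows "p = 0"
proof (rule ccontr)
  assume "p \<noteq> 0"
  then have "finite (S \<union> {t. poly p t = 0})" using assms(1) poly_roots_finite by blast
  moreover have "UNIV \<subseteq> S \<union> {t. poly p t = 0}" using assms(2) by blast
  ultimately show False using infinite_UNIV_char_0[where 'a = complex] finite_subset by blast
qed

definition cval :: "(3 \<Rightarrow> complex poly) \<Rightarrow> complex \<Rightarrow> complex^3" where
  "cval \<phi> t = (\<chi> i. poly (\<phi> i) t)"

lemma poly_curve_pull_cval: "poly (curve_pull \<phi> p) t = poly_at p (cval \<phi> t)"
  unfolding poly_curve_pull cval_def ..

lemma cval_nth [simp]: "cval \<phi> t $ i = poly (\<phi> i) t"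
  unfolding cval_def by simp

context nodal_transversal_curve
begin

text \<open>The common factor of the coordinates is divided out, so that the map is defined
  everywhere. The inverse A / B makes it injective off a finite set, and by the intersection bound a
  form vanishing on the infinite image is divisible by \<pi>.\<close>

lemma rational_parametrization:
  assumes \<pi>: "\<pi> \<in> PF" and rat: "rational_curve (zero_locus \<pi>)"
  obtains \<phi> where "\<And>t. cval \<phi> t \<noteq> 0" "curve_pull \<phi> \<pi> = 0"
    "\<And>h k. h \<in> forms k \<Longrightarrow> curve_pull \<phi> h = 0 \<Longrightarrow> \<pi> dvd h"
proof -
  obtain \<phi>0 :: "3 \<Rightarrow> complex poly" and A B e' where AB: "A \<in> graded_piece e'" "B \<in> graded_piece e'"
    and fin: "finite {t. \<not> (cval \<phi>0 t \<noteq> 0 \<and> vec.span {cval \<phi>0 t} \<in> zero_locus \<pi> \<and>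
                         poly_at B (cval \<phi>0 t) \<noteq> 0 \<and> poly_at A (cval \<phi>0 t) / poly_at B (cval \<phi>0 t) = t)}" (is "finite ?S")
    using rat unfolding rational_curve_def Let_def cval_def by blast
  have S: "cval \<phi>0 t \<noteq> 0" "vec.span {cval \<phi>0 t} \<in> zero_locus \<pi>" "poly_at B (cval \<phi>0 t) \<noteq> 0"
    "poly_at A (cval \<phi>0 t) / poly_at B (cval \<phi>0 t) = t" if "t \<notin> ?S" for t
    using that by blast+
  obtain t0 where t0: "t0 \<notin> ?S" using ex_new_if_finite[OF infinite_UNIV_char_0[where 'a = complex] fin] by blast
  obtain i0 where "cval \<phi>0 t0 $ i0 \<noteq> 0" using nonvanishing_var[OF S(1)[OF t0]] .
  then have "\<phi>0 i0 \<noteq> 0" by auto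
  then obtain D \<phi> x where D: "D \<noteq> 0" "\<And>i. \<phi>0 i = D * \<phi> i" "(\<Sum>i\<in>UNIV. x i * \<phi> i) = 1" using triple_gcd by blast
  have Dphi: "cval \<phi>0 t = poly D t *s cval \<phi> t" for t by (simp add: vec_eq_iff D(2))
  have nz: "cval \<phi> t \<noteq> 0" for t
  proof
    assume "cval \<phi> t = 0"
    then have "poly (\<phi> i) t = 0" for i by (metis cval_nth zero_index)
    then have "poly (\<Sum>i\<in>UNIV. x i * \<phi> i) t = 0" by (simp add: poly_sum)
    then show False unfolding D(3) by simp
  qed
  have Dt: "poly D t \<noteq> 0" if "t \<notin> ?S" for t using S(1)[OF that] unfolding Dphi by auto
  have span: "vec.span {cval \<phi> t} = vec.span {cval \<phi>0 t}" if "t \<notin> ?S" for t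
  proof -
    have "cval \<phi>0 t = poly D t *s cval \<phi> t" by (rule Dphi)
    then have "vec.span {cval \<phi>0 t} = vec.span {cval \<phi> t}" using vec_span_eq_iff[OF S(1)[OF that]] Dt[OF that] by blast
    then show ?thesis by simp
  qed
  have zero: "poly_at \<pi> (cval \<phi> t) = 0" if t: "t \<notin> ?S" for t
  proof -
    obtain y where y: "vec.span {cval \<phi> t} = vec.span {y}" "poly_at \<pi> y = 0"
      using S(2)[OF t] unfolding span[OF t, symmetric] zero_locus_def by blast
    obtain c where "cval \<phi> t = c *s y" using y(1) vec_span_eq_iff[OF nz] by blast
    then show ?thesis using poly_at_scale[OF PF_form(1)[OF \<pi>], of c y] y(2) by simp
  qed
  have inj: "inj_on (\<lambda>t. vec.span {cval \<phi> t}) (- ?S)"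
  proof (rule inj_onI)
    fix t t' assume t: "t \<in> - ?S" "t' \<in> - ?S" and eq: "vec.span {cval \<phi> t} = vec.span {cval \<phi> t'}"
    have tS: "t \<notin> ?S" "t' \<notin> ?S" using t by auto
    have "vec.span {cval \<phi>0 t} = vec.span {cval \<phi>0 t'}" using eq unfolding span[OF tS(1)] span[OF tS(2)] .
    then obtain c where c: "c \<noteq> 0" "cval \<phi>0 t = c *s cval \<phi>0 t'" using vec_span_eq_iff[OF S(1)[OF tS(1)]] by blast
    have "B \<noteq> 0" using S(3)[OF t0] by (auto simp: poly_at_simps)
    then have "e' \<ge> 0" using graded_nonneg[OF AB(2)] by blast
    then have AB': "A \<in> forms (nat e')" "B \<in> forms (nat e')" using AB by simp_all
    have "t = poly_at A (cval \<phi>0 t) / poly_at B (cval \<phi>0 t)" using S(4)[OF tS(1)] by simp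
    also have "\<dots> = poly_at A (cval \<phi>0 t') / poly_at B (cval \<phi>0 t')"
      unfolding c(2) poly_at_scale[OF AB'(1)] poly_at_scale[OF AB'(2)] using c(1) by simp
    also have "\<dots> = t'" using S(4)[OF tS(2)] .
    finally show "t = t'" .
  qed
  have inf: "infinite (- ?S)" unfolding Compl_eq_Diff_UNIV by (rule Diff_infinite_finite[OF fin infinite_UNIV_char_0])
  show ?thesis
  proof (rule that[of \<phi>])
    show "cval \<phi> t \<noteq> 0" for t by (rule nz)
    show "curve_pull \<phi> \<pi> = 0"
      by (rule poly_zero_of_cofinite_zeros[OF fin]) (unfold poly_curve_pull_cval, rule zero)
    fix h k assume h: "h \<in> forms k" "curve_pull \<phi> h = 0"
    show "\<pi> dvd h"
    proof (rule ccontr)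
      assume "\<not> \<pi> dvd h"
      then have "finite (zero_locus \<pi> \<inter> zero_locus h)"
        using prime_form_Int_finite[OF PF_prime[OF \<pi>] PF_form(1)[OF \<pi>] h(1)] by blast
      moreover have "(\<lambda>t. vec.span {cval \<phi> t}) ` (- ?S) \<subseteq> zero_locus \<pi> \<inter> zero_locus h"
      proof
        fix X assume "X \<in> (\<lambda>t. vec.span {cval \<phi> t}) ` (- ?S)"
        then obtain t where t: "t \<notin> ?S" "X = vec.span {cval \<phi> t}" by auto
        have "poly_at h (cval \<phi> t) = 0" unfolding poly_curve_pull_cval[symmetric] h(2) by simp
        then show "X \<in> zero_locus \<pi> \<inter> zero_locus h" unfolding zero_locus_def t(2) using nz zero[OF t(1)] by blast
      qed
      ultimately have fi: "finite ((\<lambda>t. vec.span {cval \<phi> t}) ` (- ?S))" by (rule finite_subset[rotated])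
      from inf finite_imageD[OF fi inj] show False by contradiction
    qed
  qed
qed

text \<open>The substitution t = t1 + 1 / z moves a point where \<open>gv\<close> does not vanish to
  the parameter infinity. Regularity at infinity then becomes a comparison of degrees.\<close>

lemma rational_parametrization_smooth_infinity:
  assumes \<pi>: "\<pi> \<in> PF" and rat: "rational_curve (zero_locus \<pi>)"
  obtains \<phi> n where "\<And>i. degree (\<phi> i) \<le> n" "\<And>t. cval \<phi> t \<noteq> 0" "curve_pull \<phi> \<pi> = 0"
    "\<And>h k. h \<in> forms k \<Longrightarrow> curve_pull \<phi> h = 0 \<Longrightarrow> \<pi> dvd h" "poly_at gv (\<chi> i. coeff (\<phi> i) n) \<noteq> 0"
proof -
  obtain \<psi> where \<psi>: "\<And>t. cval \<psi> t \<noteq> 0" "curve_pull \<psi> \<pi> = 0"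
    "\<And>h k. h \<in> forms k \<Longrightarrow> curve_pull \<psi> h = 0 \<Longrightarrow> \<pi> dvd h" using rational_parametrization[OF assms] by blast
  have "curve_pull \<psi> gv \<noteq> 0" using \<psi>(3)[OF g_forms(2)] PF_not_dvd_gv[OF \<pi>] by blast
  then obtain t1 where t1: "poly (curve_pull \<psi> gv) t1 \<noteq> 0" using poly_zero_of_cofinite_zeros[of "{}"] by blast
  define n where "n = Max (range (\<lambda>i. degree (\<psi> i)))"
  have dn: "degree (\<psi> i) \<le> n" for i unfolding n_def by (intro Max_ge) auto
  have "n \<in> range (\<lambda>i. degree (\<psi> i))" unfolding n_def by (rule Max_in) auto
  then obtain j where j: "degree (\<psi> j) = n" by (metis imageE)
  define \<sigma> where "\<sigma> i = pcompose (\<psi> i) [:t1, 1:]" for i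
  \<comment> \<open>The substituted coordinates multiplied by \<open>z ^ n\<close>. As
    \<open>n\<close> is the largest degree, they do not all vanish at z = 0, the former
    infinity.\<close>
  define \<phi> where "\<phi> i = (\<Sum>k\<le>n. monom (coeff (\<sigma> i) k) (n - k))" for i
  have ds: "degree (\<sigma> i) = degree (\<psi> i)" for i unfolding \<sigma>_def degree_pcompose by simp
  have val: "poly (\<phi> i) z = z ^ n * poly (\<psi> i) (t1 + inverse z)" if z: "z \<noteq> 0" for i z
  proof -
    have "poly (\<psi> i) (t1 + inverse z) = poly (\<sigma> i) (inverse z)" unfolding \<sigma>_def poly_pcompose by simp
    also have "\<dots> = (\<Sum>k\<le>n. coeff (\<sigma> i) k * inverse z ^ k)"
      unfolding poly_altdef using ds[of i] dn[of i] by (intro sum.mono_neutral_left) (auto simp: coeff_eq_0)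
    finally have e: "poly (\<psi> i) (t1 + inverse z) = (\<Sum>k\<le>n. coeff (\<sigma> i) k * inverse z ^ k)" .
    have "z ^ n * poly (\<psi> i) (t1 + inverse z) = (\<Sum>k\<le>n. coeff (\<sigma> i) k * z ^ (n - k))"
      unfolding e sum_distrib_left
    proof (rule sum.cong[OF refl])
      fix k assume "k \<in> {..n}"
      then have "z ^ n = z ^ (n - k) * z ^ k" by (simp flip: power_add)
      then show "z ^ n * (coeff (\<sigma> i) k * inverse z ^ k) = coeff (\<sigma> i) k * z ^ (n - k)" using z by (simp add: power_inverse)
    qed
    then show ?thesis unfolding \<phi>_def by (simp add: poly_sum poly_monom)
  qed
  have cvalz: "cval \<phi> z = z ^ n *s cval \<psi> (t1 + inverse z)" if "z \<noteq> 0" for z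
    using val[OF that] by (simp add: vec_eq_iff)
  have pull: "poly (curve_pull \<phi> h) z = (z ^ n) ^ k * poly (curve_pull \<psi> h) (t1 + inverse z)" if "h \<in> forms k" "z \<noteq> 0" for h k z
    unfolding poly_curve_pull_cval cvalz[OF that(2)] by (rule poly_at_scale[OF that(1)])
  have cn: "coeff (\<phi> i) n = poly (\<psi> i) t1" for i
  proof -
    have "coeff (\<phi> i) n = (\<Sum>k\<le>n. if k = 0 then coeff (\<sigma> i) 0 else 0)"
      unfolding \<phi>_def coeff_sum coeff_monom by (intro sum.cong) auto
    also have "\<dots> = poly (\<sigma> i) 0" by (simp add: poly_0_coeff_0)
    finally show ?thesis unfolding \<sigma>_def poly_pcompose by simp
  qed
  show ?thesis
  proof (rule that[of \<phi> n])
    show "degree (\<phi> i) \<le> n" for i unfolding \<phi>_def by (intro degree_sum_le) (auto intro: order_trans[OF degree_monom_le])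
    show "cval \<phi> z \<noteq> 0" for z
    proof (cases "z = 0")
      case False
      then show ?thesis unfolding cvalz[OF False] using \<psi>(1) by simp
    next
      case True
      have "poly (\<phi> j) 0 = coeff (\<sigma> j) n"
      proof -
        have "coeff (\<phi> j) 0 = (\<Sum>k\<le>n. if k = n then coeff (\<sigma> j) n else 0)"
          unfolding \<phi>_def coeff_sum coeff_monom by (intro sum.cong) auto
        then show ?thesis by (simp add: poly_0_coeff_0)
      qed
      moreover have "coeff (\<sigma> j) n \<noteq> 0"
      proof -
        have "\<psi> j \<noteq> 0"
        proof
          assume j0: "\<psi> j = 0"
          then have "n = 0" using j by simp
          then have d0: "degree (\<psi> i) = 0" for i using dn[of i] by simp
          define y :: "complex^3" where "y = cval \<psi> 0"
          have c: "cval \<psi> t = y" for t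
          proof -
            have "poly (\<psi> i) t = poly (\<psi> i) 0" for i using d0[of i] by (metis degree_eq_zeroE poly_const_conv)
            then show ?thesis unfolding y_def by (simp add: vec_eq_iff)
          qed
          have "zero_locus \<pi> \<subseteq> {vec.span {y}}"
          proof
            fix X assume "X \<in> zero_locus \<pi>"
            then obtain x where x: "X = vec.span {x}" "x \<noteq> 0" "poly_at \<pi> x = 0" unfolding zero_locus_def by blast
            have "vec.span {x} = vec.span {y}"
            proof (rule ccontr)
              assume ne: "vec.span {x} \<noteq> vec.span {y}"
              have "y \<noteq> 0" using \<psi>(1) unfolding y_def .
              then obtain L where L: "L \<in> forms 1" "poly_at L y = 0" "poly_at L x \<noteq> 0"
                using separating_linear_form[OF x(2) _ ne] by blast
              have "curve_pull \<psi> L = 0"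
                by (rule poly_zero_of_cofinite_zeros[of "{}"]) (simp_all add: poly_curve_pull_cval c L(2))
              then have "\<pi> dvd L" by (rule \<psi>(3)[OF L(1)])
              then obtain q where "L = \<pi> * q" by (auto elim: dvdE)
              then show False using L(3) x(3) by (simp add: poly_at_simps)
            qed
            then show "X \<in> {vec.span {y}}" using x(1) by simp
          qed
          then show False using irreducible_zero[OF PF_irr[OF \<pi>] PF_form(1)[OF \<pi>]] finite_subset by blast
        qed
        then have "\<sigma> j \<noteq> 0" unfolding \<sigma>_def by (simp add: pcompose_eq_0_iff)
        then show ?thesis using ds[of j] j by (metis leading_coeff_0_iff)
      qed
      ultimately have "cval \<phi> 0 $ j \<noteq> 0" by simp
      then show ?thesis unfolding True by (metis zero_index)
    qed
    show "curve_pull \<phi> \<pi> = 0"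
      by (rule poly_zero_of_cofinite_zeros[of "{0}"]) (use pull[OF PF_form(1)[OF \<pi>]] \<psi>(2) in auto)
    show "\<pi> dvd h" if h: "h \<in> forms k" "curve_pull \<phi> h = 0" for h k
    proof (rule \<psi>(3)[OF h(1)], rule poly_zero_of_cofinite_zeros[of "{t1}"])
      fix t assume "t \<notin> {t1}"
      define z where "z = inverse (t - t1)"
      have z: "z \<noteq> 0" "t1 + inverse z = t" using \<open>t \<notin> {t1}\<close> unfolding z_def by simp_all
      show "poly (curve_pull \<psi> h) t = 0" using pull[OF h(1) z(1)] z h(2) by simp
    qed simp
    show "poly_at gv (\<chi> i. coeff (\<phi> i) n) \<noteq> 0" unfolding cn using t1 unfolding poly_curve_pull .
  qed
qed

lemma Ivan_singular:
  assumes "g \<in> Ivan j" "singular_at f x"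
  shows "poly_at g x = 0"
proof -
  define c where "c = 1 / poly_at l x"
  have c: "c \<noteq> 0" using l_nonzero_at_singular[OF assms(2)] unfolding c_def by simp
  have "poly_at l (c *s x) = 1" using poly_at_scale[OF stl(3), of c x] l_nonzero_at_singular[OF assms(2)] unfolding c_def by simp
  moreover have "singular_at f (c *s x)"
    using assms(2) c poly_at_scale[OF f] poly_at_scale[OF pderiv3_forms[OF f]] unfolding singular_at_def by simp
  ultimately have "c *s x \<in> Npts" unfolding Npts_def by blast
  then have "poly_at g (c *s x) = 0" using assms(1) unfolding Ivan_def by blast
  moreover have "g \<in> forms j" using assms(1) unfolding Ivan_def by blast
  ultimately show ?thesis using poly_at_scale[of g j c x] c by simp
qed

text \<open>
  The residue of \<open>g / f\<close> along the component is a holomorphic differential on the projective line, hence zero: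
  with \<open>W\<close> the cross product of \<open>\<phi>\<close> and its derivative, it is \<open>\<Theta> dt\<close> where \<open>W g(\<phi>) = \<Theta> \<nabla>f(\<phi>)\<close>.
  At a parameter mapped to a node, \<open>W\<close> vanishes at most one order less than \<open>\<nabla>f(\<phi>)\<close>, as the Hessian has rank two.
\<close>

lemma adjoint_vanishes_on_rational:
  assumes \<pi>: "\<pi> \<in> PF" and rat: "rational_curve (zero_locus \<pi>)" and g: "g \<in> Ivan j" "j + 3 \<le> d"
  shows "\<pi> dvd g"
proof -
  obtain \<phi> n where \<phi>: "\<And>i. degree (\<phi> i) \<le> n" "\<And>t. cval \<phi> t \<noteq> 0" "curve_pull \<phi> \<pi> = 0"
    "\<And>h k. h \<in> forms k \<Longrightarrow> curve_pull \<phi> h = 0 \<Longrightarrow> \<pi> dvd h" "poly_at gv (\<chi> i. coeff (\<phi> i) n) \<noteq> 0"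
    using rational_parametrization_smooth_infinity[OF \<pi> rat] by blast
  have gf: "g \<in> forms j" using g(1) unfolding Ivan_def by blast
  let ?c = "curve_pull \<phi>"
  define \<gamma> where "\<gamma> = ?c g"
  define a where "a i = ?c (F i)" for i
  define \<phi>' where "\<phi>' i = pderiv (\<phi> i)" for i
  define H where "H i k = ?c (pderiv3 k (F i))" for i k
  have Ff: "F i \<in> forms e" for i using pderiv3_forms[OF f, of i] unfolding e_def .
  have cf: "?c f = 0"
  proof -
    obtain h where "f = \<pi> * h" using PF_dvd_f[OF \<pi>] by (auto elim: dvdE)
    then show ?thesis using \<phi>(3) by (simp add: curve_pull_simps)
  qed
  have a\<phi>: "a 1 * \<phi> 1 + a 2 * \<phi> 2 + a 3 * \<phi> 3 = 0"
  proof -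
    have "?c (var3 1 * F 1 + var3 2 * F 2 + var3 3 * F 3) = ?c (of_nat d * f)" unfolding euler_three ..
    then show ?thesis unfolding curve_pull_simps cf a_def by (simp add: mult.commute)
  qed
  have a\<phi>': "a 1 * \<phi>' 1 + a 2 * \<phi>' 2 + a 3 * \<phi>' 3 = 0"
    using pderiv_curve_pull[of \<phi> f] unfolding cf sum_3 a_def \<phi>'_def by simp
  define W where "W i = (if i = 1 then \<phi> 2 * \<phi>' 3 - \<phi> 3 * \<phi>' 2 else if i = 2 then \<phi> 3 * \<phi>' 1 - \<phi> 1 * \<phi>' 3
     else \<phi> 1 * \<phi>' 2 - \<phi> 2 * \<phi>' 1)" for i :: 3
  have Ws: "W 1 = \<phi> 2 * \<phi>' 3 - \<phi> 3 * \<phi>' 2" "W 2 = \<phi> 3 * \<phi>' 1 - \<phi> 1 * \<phi>' 3" "W 3 = \<phi> 1 * \<phi>' 2 - \<phi> 2 * \<phi>' 1"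
    by (simp_all add: W_def)
  have aW: "a i * W k = a k * W i" for i k
  proof -
    have "a 1 * W 2 - a 2 * W 1 = \<phi> 3 * (a 1 * \<phi>' 1 + a 2 * \<phi>' 2 + a 3 * \<phi>' 3) - \<phi>' 3 * (a 1 * \<phi> 1 + a 2 * \<phi> 2 + a 3 * \<phi> 3)"
      "a 2 * W 3 - a 3 * W 2 = \<phi> 1 * (a 1 * \<phi>' 1 + a 2 * \<phi>' 2 + a 3 * \<phi>' 3) - \<phi>' 1 * (a 1 * \<phi> 1 + a 2 * \<phi> 2 + a 3 * \<phi> 3)"
      "a 3 * W 1 - a 1 * W 3 = \<phi> 2 * (a 1 * \<phi>' 1 + a 2 * \<phi>' 2 + a 3 * \<phi>' 3) - \<phi>' 2 * (a 1 * \<phi> 1 + a 2 * \<phi> 2 + a 3 * \<phi> 3)"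
      unfolding Ws by (simp_all add: algebra_simps)
    then have "a 1 * W 2 = a 2 * W 1" "a 2 * W 3 = a 3 * W 2" "a 3 * W 1 = a 1 * W 3"
      unfolding a\<phi> a\<phi>' by simp_all
    then show ?thesis using exhaust_3[of i] exhaust_3[of k] by auto
  qed
  have cgv: "?c gv = (\<Sum>i\<in>UNIV. smult (v $ i) (a i))"
    unfolding gv_def dir_deriv_def curve_pull_simps a_def by simp
  note dgv = degree_curve_pull[OF g_forms(2), of \<phi>, OF \<phi>(1)]
  have cgv0: "coeff (?c gv) (n * e) \<noteq> 0" using dgv \<phi>(5) by simp
  then have "?c gv \<noteq> 0" by auto
  then obtain i0 where "a i0 \<noteq> 0" unfolding cgv by (metis (no_types, lifting) smult_0_right sum.neutral)
  \<comment> \<open>The zeros of \<open>G\<close> are the parameters mapped to singular points of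
    the curve, and the quotients \<open>b\<close> have no common zero.\<close>
  then obtain G b x where G: "G \<noteq> 0" "\<And>i. a i = G * b i" "(\<Sum>i\<in>UNIV. x i * b i) = 1" using triple_gcd by blast
  \<comment> \<open>\<open>W\<close> is proportional to \<open>b\<close>, hence a polynomial
    multiple of it, and the Bezout coefficients compute the factor \<Psi>. What remains is that
    \<open>G\<close> divides \<Psi> times the pullback of \<open>g\<close>.\<close>
  define \<Psi> where "\<Psi> = (\<Sum>i\<in>UNIV. x i * W i)"
  have bW: "b i * W k = b k * W i" for i k
  proof -
    have "G * (b i * W k) = G * (b k * W i)" using aW[of i k] unfolding G(2) by (simp only: mult.assoc)
    then show ?thesis using mult_left_cancel[OF G(1)] by blast
  qed
  have W\<Psi>: "W k = \<Psi> * b k" for k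
  proof -
    have "\<Psi> * b k = (\<Sum>i\<in>UNIV. x i * (b k * W i))" unfolding \<Psi>_def sum_distrib_right by (simp only: mult_ac)
    also have "\<dots> = (\<Sum>i\<in>UNIV. x i * b i) * W k" unfolding sum_distrib_right bW[of k] by (simp only: mult.assoc)
    finally show ?thesis unfolding G(3) by simp
  qed
  have a': "pderiv (a i) = (\<Sum>k\<in>UNIV. H i k * \<phi>' k)" for i
    unfolding a_def H_def \<phi>'_def by (rule pderiv_curve_pull)
  have H\<phi>: "(\<Sum>k\<in>UNIV. H i k * \<phi> k) = of_nat e * a i" for i
  proof -
    have "?c (\<Sum>k\<in>UNIV. var3 k * pderiv3 k (F i)) = ?c (const3 (of_nat e) * F i)"
      unfolding euler_identity[OF Ff] const3_of_nat ..
    then show ?thesis unfolding curve_pull_simps a_def H_def by (simp add: mult.commute of_nat_poly)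
  qed
  have "G dvd \<Psi> * \<gamma>"
  proof (rule dvd_of_root_powers[OF G(1)])
    fix t0 M assume dv: "[:- t0, 1:] ^ M dvd G"
    let ?\<tau> = "[:- t0, 1:] :: complex poly"
    show "?\<tau> ^ M dvd \<Psi> * \<gamma>"
    proof (cases M)
      case (Suc N)
      have dva: "?\<tau> ^ Suc N dvd a i" for i using dv unfolding G(2) Suc by (intro dvd_mult2)
      define y where "y = cval \<phi> t0"
      have y0: "y \<noteq> 0" unfolding y_def by (rule \<phi>(2))
      have Fy: "poly_at (F i) y = 0" for i
      proof -
        have "?\<tau> dvd a i" using dva[of i] by (metis dvd_mult_left power_Suc)
        then have "poly (a i) t0 = 0" by (simp add: poly_eq_0_iff_dvd)
        then show ?thesis unfolding a_def poly_curve_pull_cval y_def .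
      qed
      have sy: "singular_at f y"
        by (rule singularI[OF y0]) (simp_all add: gu_def gv_def gw_def dir_deriv_def poly_at_simps Fy)
      have "poly \<gamma> t0 = 0" unfolding \<gamma>_def poly_curve_pull_cval y_def[symmetric] by (rule Ivan_singular[OF g(1) sy])
      then have g\<tau>: "?\<tau> dvd \<gamma>" by (simp add: poly_eq_0_iff_dvd)
      obtain i1 where i1: "y $ i1 \<noteq> 0" using nonvanishing_var[OF y0] .
      \<comment> \<open>A multiple of the derivative of \<phi>, corrected by a multiple of \<phi> so
        that coordinate \<open>i1\<close> vanishes. The Hessian maps it to a vector vanishing to
        order N at t0. Its kernel at the node is spanned by \<open>y\<close>, whose coordinate
        \<open>i1\<close> is nonzero, so \<open>w'\<close> itself vanishes to order N.\<close>
      define w' where "w' k = \<phi> i1 * \<phi>' k - \<phi>' i1 * \<phi> k" for k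
      have Hw: "?\<tau> ^ N dvd (\<Sum>k\<in>UNIV. H i k * w' k)" for i
      proof -
        have "(\<Sum>k\<in>UNIV. H i k * w' k) = \<phi> i1 * (\<Sum>k\<in>UNIV. H i k * \<phi>' k) - \<phi>' i1 * (\<Sum>k\<in>UNIV. H i k * \<phi> k)"
          unfolding w'_def sum_3 by (simp add: algebra_simps)
        also have "\<dots> = \<phi> i1 * pderiv (a i) - \<phi>' i1 * (of_nat e * a i)" unfolding a' H\<phi> ..
        finally have eq: "(\<Sum>k\<in>UNIV. H i k * w' k) = \<phi> i1 * pderiv (a i) - \<phi>' i1 * (of_nat e * a i)" .
        have "?\<tau> ^ N dvd ?\<tau> ^ Suc N" by (intro le_imp_power_dvd) simp
        then have "?\<tau> ^ N dvd a i" using dva[of i] by (rule dvd_trans)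
        then show ?thesis unfolding eq using power_dvd_pderiv[OF dva] by (intro dvd_diff dvd_mult)
      qed
      have wN: "m \<le> N \<Longrightarrow> \<forall>k. ?\<tau> ^ m dvd w' k" for m
      proof (induction m)
        case 0
        then show ?case by simp
      next
        case (Suc m)
        then have "\<forall>k. \<exists>r. w' k = ?\<tau> ^ m * r" unfolding dvd_def by simp
        then obtain r where r: "\<And>k. w' k = ?\<tau> ^ m * r k" by metis
        have t0m: "?\<tau> ^ m \<noteq> 0" by simp
        have "?\<tau> dvd (\<Sum>k\<in>UNIV. H i k * r k)" for i
        proof -
          have "?\<tau> ^ Suc m dvd ?\<tau> ^ N" using Suc(2) by (intro le_imp_power_dvd)
          then have "?\<tau> ^ Suc m dvd (\<Sum>k\<in>UNIV. H i k * w' k)" using Hw by (rule dvd_trans)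
          moreover have "(\<Sum>k\<in>UNIV. H i k * w' k) = ?\<tau> ^ m * (\<Sum>k\<in>UNIV. H i k * r k)"
            unfolding r sum_distrib_left by (simp only: mult.left_commute)
          ultimately have "?\<tau> ^ m * ?\<tau> dvd ?\<tau> ^ m * (\<Sum>k\<in>UNIV. H i k * r k)" by (simp only: power_Suc2)
          then show ?thesis using dvd_mult_cancel_left[of "?\<tau> ^ m"] t0m by blast
        qed
        then have Hr: "poly (\<Sum>k\<in>UNIV. H i k * r k) t0 = 0" for i by (simp add: poly_eq_0_iff_dvd)
        define z where "z = cval r t0"
        have "(\<Sum>k\<in>UNIV. poly_at (pderiv3 i (pderiv3 k f)) y * z $ k) = 0" for i
        proof -
          have "(\<Sum>k\<in>UNIV. poly_at (pderiv3 k (F i)) y * z $ k) = 0"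
            using Hr[of i] unfolding poly_sum poly_mult H_def poly_curve_pull_cval y_def z_def by simp
          then show ?thesis by (simp add: pderiv3_commute[of i])
        qed
        then obtain c where c: "z = c *s y" using node_hessian_kernel[OF f nodal[OF sy]] by blast
        have "w' i1 = 0" unfolding w'_def by (simp add: mult.commute)
        then have "r i1 = 0" using r[of i1] t0m by simp
        then have "c * y $ i1 = 0" using c unfolding z_def by (metis cval_nth poly_0 vector_smult_component)
        then have "z = 0" using i1 c by simp
        then have "poly (r k) t0 = 0" for k unfolding z_def by (metis cval_nth zero_index)
        then have "?\<tau> dvd r k" for k by (simp add: poly_eq_0_iff_dvd)
        then have "?\<tau> ^ m * ?\<tau> dvd w' k" for k unfolding r[of k] by (intro mult_dvd_mono dvd_refl)
        then show ?case by (simp only: power_Suc2) blast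
      qed
      have cop: "coprime (?\<tau> ^ N) (\<phi> i1)"
      proof -
        have "coprime ?\<tau> (\<phi> i1)"
        proof (rule coprime_complex_poly_iff)
          fix z assume "poly ?\<tau> z = 0"
          then have "z = t0" by simp
          then show "poly (\<phi> i1) z \<noteq> 0" using i1 unfolding y_def by simp
        qed simp
        then show ?thesis by simp
      qed
      have cross: "?\<tau> ^ N dvd \<phi> p * \<phi>' q - \<phi> q * \<phi>' p" for p q
      proof -
        have "\<phi> i1 * (\<phi> p * \<phi>' q - \<phi> q * \<phi>' p) = \<phi> p * w' q - \<phi> q * w' p"
          unfolding w'_def by (simp add: algebra_simps)
        moreover have "?\<tau> ^ N dvd \<phi> p * w' q - \<phi> q * w' p" using wN[of N] by (intro dvd_diff dvd_mult) blast+
        ultimately have "?\<tau> ^ N dvd \<phi> i1 * (\<phi> p * \<phi>' q - \<phi> q * \<phi>' p)" by (simp only:)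
        then show ?thesis using cop by (simp add: coprime_dvd_mult_right_iff)
      qed
      have "?\<tau> ^ N dvd W i" for i unfolding W_def using cross by simp
      then have "?\<tau> ^ N dvd \<Psi>" unfolding \<Psi>_def by (intro dvd_sum dvd_mult)
      then have "?\<tau> ^ N * ?\<tau> dvd \<Psi> * \<gamma>" using g\<tau> by (rule mult_dvd_mono)
      then show ?thesis unfolding Suc by (simp only: power_Suc2)
    qed simp
  qed
  then obtain \<Theta> where \<Theta>: "\<Psi> * \<gamma> = G * \<Theta>" by (auto elim: dvdE)
  have W\<gamma>: "W k * \<gamma> = a k * \<Theta>" for k
  proof -
    have "W k * \<gamma> = b k * (\<Psi> * \<gamma>)" unfolding W\<Psi>[of k] by (simp only: mult_ac)
    then show ?thesis unfolding \<Theta> G(2) by (simp only: mult_ac)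
  qed
  define Wv where "Wv = (\<Sum>i\<in>UNIV. smult (v $ i) (W i))"
  have Wv\<gamma>: "Wv * \<gamma> = ?c gv * \<Theta>"
    unfolding Wv_def cgv sum_distrib_right by (simp add: W\<gamma>)
  have n0: "n > 0"
  proof (rule ccontr)
    assume "\<not> n > 0"
    then have d0: "degree (\<phi> i) = 0" for i using \<phi>(1)[of i] by simp
    define y where "y = cval \<phi> 0"
    have c: "cval \<phi> t = y" for t
    proof -
      have "poly (\<phi> i) t = poly (\<phi> i) 0" for i using d0[of i] by (metis degree_eq_zeroE poly_const_conv)
      then show ?thesis unfolding y_def by (simp add: vec_eq_iff)
    qed
    have "(\<chi> i. coeff (\<phi> i) n) = y"
      using \<open>\<not> n > 0\<close> unfolding y_def by (simp add: vec_eq_iff poly_0_coeff_0)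
    then have gy: "poly_at gv y \<noteq> 0" using \<phi>(5) by simp
    obtain X where "X \<in> zero_locus \<pi> - {vec.span {y}}"
      using irreducible_zero[OF PF_irr[OF \<pi>] PF_form(1)[OF \<pi>]] by (metis Diff_infinite_finite equals0I finite.emptyI finite_insert)
    then obtain x' where x': "x' \<noteq> 0" "poly_at \<pi> x' = 0" "vec.span {x'} \<noteq> vec.span {y}" unfolding zero_locus_def by blast
    have "y \<noteq> 0" using \<phi>(2) unfolding y_def .
    then obtain L where L: "L \<in> forms 1" "poly_at L y = 0" "poly_at L x' \<noteq> 0" using separating_linear_form[OF x'(1) _ x'(3)] by blast
    have "?c L = 0" by (rule poly_zero_of_cofinite_zeros[of "{}"]) (simp_all add: poly_curve_pull_cval c L(2))
    then have "\<pi> dvd L" by (rule \<phi>(4)[OF L(1)])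
    then obtain q where "L = \<pi> * q" by (auto elim: dvdE)
    then show False using L(3) x'(2) by (simp add: poly_at_simps)
  qed
  \<comment> \<open>Contracted with \<open>v\<close>, the side with \<open>W\<close> has degree at
    most n + (n - 1) + n j. By the choice of the point at infinity the side with the gradient would
    have degree at least n e, and j + 2 \<le> e.\<close>
  have "\<Theta> = 0"
  proof (rule ccontr)
    assume T0: "\<Theta> \<noteq> 0"
    have c0': "?c gv \<noteq> 0" using cgv0 by auto
    have "degree (?c gv) = n * e" using dgv cgv0 le_degree le_antisym by blast
    then have "n * e \<le> degree (Wv * \<gamma>)" unfolding Wv\<gamma> using degree_mult_eq[OF c0' T0] by simp
    also have "\<dots> \<le> degree Wv + degree \<gamma>" by (rule degree_mult_le)
    also have "degree \<gamma> \<le> n * j" unfolding \<gamma>_def using degree_curve_pull[OF gf, of \<phi>, OF \<phi>(1)] by blast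
    also have "degree Wv \<le> n + (n - 1)"
    proof -
      have p: "degree (\<phi> p * \<phi>' q) \<le> n + (n - Suc 0)" for p q
        using degree_mult_le[of "\<phi> p" "\<phi>' q"] \<phi>(1)[of p] \<phi>(1)[of q] unfolding \<phi>'_def degree_pderiv by linarith
      have "degree (W i) \<le> n + (n - 1)" for i
        unfolding W_def by (auto intro!: degree_diff_le p)
      then show ?thesis unfolding Wv_def by (intro degree_sum_le) (auto intro: order_trans[OF degree_smult_le])
    qed
    finally have "n * e \<le> n + (n - 1) + n * j" by simp
    moreover have "n * (j + 2) \<le> n * e" using g(2) d_e by (intro mult_le_mono2) simp
    ultimately show False using n0 by (simp add: algebra_simps)
  qed
  then have W\<gamma>0: "W k * \<gamma> = 0" for k using W\<gamma> by simp
  \<comment> \<open>If \<open>W\<close> vanishes while the pullback of \<open>g\<close> does not,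
    \<phi> is proportional to its derivative and parametrizes a single point, which contradicts the
    infinite locus of \<pi>.\<close>
  show ?thesis
  proof (cases "\<gamma> = 0")
    case True
    then show ?thesis using \<phi>(4)[OF gf] unfolding \<gamma>_def by blast
  next
    case False
    then have W0: "W k = 0" for k using W\<gamma>0[of k] by simp
    have w0: "\<phi> p * \<phi>' q = \<phi>' p * \<phi> q" for p q
    proof -
      have "\<phi> 2 * \<phi>' 3 = \<phi> 3 * \<phi>' 2" "\<phi> 3 * \<phi>' 1 = \<phi> 1 * \<phi>' 3" "\<phi> 1 * \<phi>' 2 = \<phi> 2 * \<phi>' 1"
        using W0[of 1] W0[of 2] W0[of 3] unfolding Ws by simp_all
      then show ?thesis using exhaust_3[of p] exhaust_3[of q] by (auto simp: mult.commute)
    qed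
    define y where "y = cval \<phi> 0"
    have y0: "y \<noteq> 0" unfolding y_def by (rule \<phi>(2))
    obtain i1 where i1: "y $ i1 \<noteq> 0" using nonvanishing_var[OF y0] .
    let ?L = "\<lambda>k. const3 (y $ i1) * var3 k - const3 (y $ k) * var3 i1"
    have "?c (?L k) = 0" for k
    proof (rule proportional_derivative)
      let ?q = "smult (y $ i1) (\<phi> k) - smult (y $ k) (\<phi> i1)"
      have q: "?c (?L k) = ?q" by (simp add: curve_pull_simps)
      have "pderiv ?q = smult (y $ i1) (\<phi>' k) - smult (y $ k) (\<phi>' i1)" unfolding \<phi>'_def by (simp add: pderiv_diff pderiv_smult)
      then show "\<phi> i1 * pderiv (?c (?L k)) = pderiv (\<phi> i1) * ?c (?L k)"
        unfolding q using w0[of i1 k] w0[of i1 i1] unfolding \<phi>'_def[symmetric] by (simp add: right_diff_distrib mult.commute[of "\<phi>' i1" "\<phi> i1"])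
      show "poly (\<phi> i1) 0 \<noteq> 0" using i1 unfolding y_def by simp
      show "poly (?c (?L k)) 0 = 0" unfolding q unfolding y_def by (simp add: mult.commute)
    qed
    then have dL: "\<pi> dvd ?L k" for k by (intro \<phi>(4)[of _ 1] forms_diff forms_const3_mult forms_var3)
    have "zero_locus \<pi> \<subseteq> {vec.span {y}}"
    proof
      fix X assume "X \<in> zero_locus \<pi>"
      then obtain x' where x': "X = vec.span {x'}" "x' \<noteq> 0" "poly_at \<pi> x' = 0" unfolding zero_locus_def by blast
      have e: "y $ i1 * x' $ k = y $ k * x' $ i1" for k
      proof -
        obtain q where "?L k = \<pi> * q" using dL[of k] unfolding dvd_def by blast
        then have "poly_at (?L k) x' = poly_at \<pi> x' * poly_at q x'" by (simp only: poly_at_simps)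
        then show ?thesis using x'(3) by (simp add: poly_at_simps)
      qed
      have "x' = (x' $ i1 / y $ i1) *s y" using e i1 by (simp add: vec_eq_iff field_simps)
      moreover from this have "x' $ i1 / y $ i1 \<noteq> 0" using x'(2) by auto
      ultimately have "vec.span {x'} = vec.span {y}" using vec_span_eq_iff[OF x'(2)] by blast
      then show "X \<in> {vec.span {y}}" using x'(1) by simp
    qed
    then show ?thesis using irreducible_zero[OF PF_irr[OF \<pi>] PF_form(1)[OF \<pi>]] finite_subset by blast
  qed
qed

lemma rational_Ivan:
  assumes "\<And>C. C \<in> curve_components f \<Longrightarrow> rational_curve C" "j + 3 \<le> d" "g \<in> Ivan j"
  shows "g = 0"
proof -
  have "\<pi> dvd g" if p: "\<pi> \<in> PF" for \<pi>
  proof -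
    have "zero_locus \<pi> \<in> curve_components f" unfolding curve_components_def using PF_irr[OF p] PF_dvd_f[OF p] by blast
    then show ?thesis using adjoint_vanishes_on_rational[OF p _ assms(3,2)] assms(1) by blast
  qed
  then have "f dvd g" by (rule f_dvdI)
  moreover have "g \<in> forms j" using assms(3) unfolding Ivan_def by blast
  ultimately show ?thesis using small_form_zero[of g j] assms(2) by simp
qed

lemma jacobian_module_dim_forms:
  "jacobian_module_dim f (int k) = P3.dim (Ivan k) - P3.dim (jacobian_ideal f \<inter> forms k)"
  "jacobian_ideal f \<inter> forms k \<subseteq> Ivan k"
proof -
  show sub: "jacobian_ideal f \<inter> forms k \<subseteq> Ivan k"
    unfolding J_jacobian_ideal[symmetric] Ivan_def using J_vanish by blast
  have "P3.subspace (jacobian_ideal f \<inter> forms k)"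
    unfolding J_jacobian_ideal[symmetric] P3.subspace_def scal3_const3
    using J_0 J_add J_mult forms_add forms_const3_mult by auto
  then show "jacobian_module_dim f (int k) = P3.dim (Ivan k) - P3.dim (jacobian_ideal f \<inter> forms k)"
    unfolding jacobian_module_dim_def saturation_forms using quotient_dim_eq[OF Ivan_subspace(2) _ sub] by blast
qed

end

lemma nodal_curve_transversal:
  assumes "f \<in> forms d" "d \<ge> 2" "nodal_curve f"
  obtains u v w s t l PF c0 where "nodal_transversal_curve f d u v w s t l PF c0"
proof -
  have sq: "squarefree f" and nd: "\<And>x. singular_at f x \<Longrightarrow> node_at f x" using assms(3) unfolding nodal_curve_def by blast+
  have d0: "d > 0" using assms(2) by simp
  obtain u v w s t l where L: "s \<in> forms 1" "t \<in> forms 1" "l \<in> forms 1" "l \<noteq> 0"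
    "\<And>i. var3 i = const3 (u $ i) * s + const3 (v $ i) * t + const3 (w $ i) * l"
    "line_restr u v s = 1" "line_restr u v t = [:0, 1:]" "line_restr u v l = 0"
    "degree (line_restr u v f) = d" "coprime (line_restr u v f) (pderiv (line_restr u v f))"
    by (rule transversal_line[OF sq assms(1) d0]) blast
  obtain PF c0 where P: "finite PF" "\<And>\<pi>. \<pi> \<in> PF \<Longrightarrow> irreducible \<pi>" "\<And>\<pi> \<rho>. \<pi> \<in> PF \<Longrightarrow> \<rho> \<in> PF \<Longrightarrow> \<pi> dvd \<rho> \<Longrightarrow> \<pi> = \<rho>"
    "c0 \<noteq> 0" "f = const3 c0 * \<Prod>PF"
    by (rule squarefree_factorization[OF sq]) blast
  have "nodal_transversal_curve f d u v w s t l PF c0"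
    by unfold_locales (rule assms(1,2) nd L P sq; assumption?)+
  then show ?thesis using that by blast
qed

text \<open>A multiple factor of positive degree would have a zero, and that zero would be a
  singular point. Hence the results on syzygies hold for the smooth curve as well.\<close>

lemma smooth_curve_nodal:
  assumes "f \<in> forms d" "smooth_curve f"
  shows "nodal_curve f"
proof -
  have ns: "\<not> singular_at f x" for x using assms(2) unfolding smooth_curve_def by blast
  have f0: "f \<noteq> 0"
  proof
    assume f: "f = 0"
    have "point3 1 0 0 \<noteq> 0" by (metis point3_simps(1) zero_index zero_neq_one)
    then have "singular_at f (point3 1 0 0)" unfolding singular_at_def f by (simp add: poly_at_simps)
    then show False using ns by blast
  qed
  have "squarefree f"
  proof (rule squarefreeI)
    fix p assume "p ^ 2 dvd f"
    then obtain q where q: "f = p * (p * q)" unfolding power2_eq_square dvd_def mult.assoc by blast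
    have fd: "p * (p * q) \<in> forms d" "p * (p * q) \<noteq> 0" using q assms(1) f0 by simp_all
    obtain k where k: "p \<in> forms k" using form_factor[OF fd] .
    have p0: "p \<noteq> 0" using fd(2) by auto
    have "k = 0"
    proof (rule ccontr)
      assume "k \<noteq> 0"
      then have "infinite (zero_locus p)" using zero_locus_infinite[OF k _ p0] by simp
      then obtain X where "X \<in> zero_locus p" by (metis ex_in_conv finite.emptyI)
      then obtain x where x: "x \<noteq> 0" "poly_at p x = 0" unfolding zero_locus_def by blast
      have "singular_at f x" unfolding singular_at_def q pderiv3_mult using x by (simp add: poly_at_simps)
      then show False using ns by blast
    qed
    then have "p \<in> forms 0" using k by simp
    then obtain c where "p = const3 c" by (rule forms_0_const)
    then show "p dvd 1" using const3_dvd_1 p0 by auto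
  qed
  then show ?thesis unfolding nodal_curve_def using ns by blast
qed

theorem theorem3p2:
  fixes f f\<^sub>s :: poly3 and d :: nat
  assumes "d \<ge> 4"
    and "f \<in> graded_piece (int d)" and "nodal_curve f"
    and "f\<^sub>s \<in> graded_piece (int d)" and "smooth_curve f\<^sub>s"
  shows "(\<forall>k::int. int d - 3 < k \<and> real_of_int k \<le> real_of_int (3 * (int d - 2)) / 2 \<longrightarrow>
            int (jacobian_module_dim f k) = int (milnor_dim f\<^sub>s k) - int (card (nodes f)))
       \<and> int (jacobian_module_dim f (int d - 3))
            = int (milnor_dim f\<^sub>s (int d - 3)) - int (card (nodes f)) + int (card (curve_components f)) - 1
       \<and> ((\<forall>C\<in>curve_components f. rational_curve C) \<longrightarrow>
            (\<forall>k::int. k \<le> int d - 3 \<longrightarrow> jacobian_module_dim f k = 0))"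
proof -
  have d2: "d \<ge> 2" using assms(1) by simp
  obtain u v w s t l PF c0 where "nodal_transversal_curve f d u v w s t l PF c0"
    using nodal_curve_transversal[OF assms(2) d2 assms(3)] .
  then interpret C: nodal_transversal_curve f d u v w s t l PF c0 .
  obtain u' v' w' s' t' l' PF' c0' where "nodal_transversal_curve f\<^sub>s d u' v' w' s' t' l' PF' c0'"
    using nodal_curve_transversal[OF assms(4) d2 smooth_curve_nodal[OF assms(4,5)]] .
  then interpret Cs: nodal_transversal_curve f\<^sub>s d u' v' w' s' t' l' PF' c0' .
  have e: "C.e = d - 1" "Cs.e = d - 1" "C.T = 2 * d - 4"
    unfolding C.T_def C.e_def Cs.e_def by simp_all
  \<comment> \<open>Both curves satisfy \<open>dim_jacobian_piece\<close>, with the same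
    value.\<close>
  have milnor: "int (milnor_dim f\<^sub>s (int k)) = int (P3.dim (forms k)) - int (P3.dim (jacobian_ideal f \<inter> forms k))"
    if k: "k < 2 * (d - 1) - 1" for k
  proof -
    have J: "P3.dim (jacobian_ideal f\<^sub>s \<inter> forms k) = P3.dim (jacobian_ideal f \<inter> forms k)"
      using C.dim_jacobian_piece(1)[of k] Cs.dim_jacobian_piece(1)[of k] k unfolding e by simp
    have fd: "P3.fin_dim (jacobian_ideal f\<^sub>s \<inter> forms k)" using Cs.dim_jacobian_piece(2)[of k] k unfolding e by simp
    have "milnor_dim f\<^sub>s (int k) = P3.dim (forms k) - P3.dim (jacobian_ideal f\<^sub>s \<inter> forms k)"
      unfolding milnor_dim_def using quotient_dim_eq[OF dim_forms(2) P3.fin_dim_subspace[OF fd]] by blast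
    moreover have "P3.dim (jacobian_ideal f\<^sub>s \<inter> forms k) \<le> P3.dim (forms k)"
      using P3.fin_dim_mono[OF dim_forms(2) P3.fin_dim_subspace[OF fd]] by blast
    ultimately show ?thesis unfolding J by simp
  qed
  have module: "int (jacobian_module_dim f (int k)) = int (P3.dim (C.Ivan k)) - int (P3.dim (jacobian_ideal f \<inter> forms k))"
    if k: "k < 2 * (d - 1) - 1" for k
  proof -
    have fd: "P3.fin_dim (jacobian_ideal f \<inter> forms k)" using C.dim_jacobian_piece(2)[of k] k unfolding e by simp
    have "P3.dim (jacobian_ideal f \<inter> forms k) \<le> P3.dim (C.Ivan k)"
      using P3.fin_dim_mono[OF C.Ivan_subspace(2) P3.fin_dim_subspace[OF fd] C.jacobian_module_dim_forms(2)] .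
    then show ?thesis using C.jacobian_module_dim_forms(1)[of k] by simp
  qed
  have part1: "int (jacobian_module_dim f k) = int (milnor_dim f\<^sub>s k) - int (card (nodes f))"
    if k: "int d - 3 < k" "real_of_int k \<le> real_of_int (3 * (int d - 2)) / 2" for k
  proof -
    have k2: "2 * k \<le> 3 * (int d - 2)" using k(2) by linarith
    define n where "n = nat k"
    have n: "k = int n" "d \<le> n + 2" "2 * n + 6 \<le> 3 * d" using k(1) k2 assms(1) unfolding n_def by auto
    define m where "m = C.T - 1 - n"
    \<comment> \<open>The bound 2 n \<le> 3 (d - 2) keeps n below \<open>C.T\<close> = 2 (d - 2), so
      the natural subtraction in \<open>m\<close> is exact. The dual degree is small enough to
      exclude syzygies because d - 2 \<le> n.\<close>
    have m: "Suc (n + m) = C.T" "m + 2 \<le> C.e" using n(2,3) assms(1) unfolding m_def e by auto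
    have "P3.dim (forms n) + P3.dim (C.Hs m) = P3.dim (C.Ivan n) + card C.Npts"
      using C.conditions_duality[OF m(1)] n(2) unfolding e by simp
    then have "P3.dim (forms n) = P3.dim (C.Ivan n) + card (nodes f)"
      unfolding C.dim_Hs_small[OF m(2)] C.card_nodes by simp
    moreover have "n < 2 * (d - 1) - 1" using n(3) assms(1) by auto
    ultimately show ?thesis unfolding n(1) using milnor[of n] module[of n] by simp
  qed
  have part2: "int (jacobian_module_dim f (int d - 3))
            = int (milnor_dim f\<^sub>s (int d - 3)) - int (card (nodes f)) + int (card (curve_components f)) - 1"
  proof -
    define n where "n = d - 3"
    have n: "int d - 3 = int n" "n + 3 = d" using assms(1) unfolding n_def by auto
    \<comment> \<open>For k = d - 3 the dual degree is e - 1, the first in which syzygies can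
      occur.\<close>
    define m where "m = d - 2"
    have m: "Suc (n + m) = C.T" "Suc m = C.e" using n(2) assms(1) unfolding m_def e by auto
    have "P3.dim (forms n) + P3.dim (C.Hs m) = P3.dim (C.Ivan n) + card C.Npts"
      using C.conditions_duality[OF m(1)] n(2) unfolding e by simp
    moreover have "Suc (P3.dim (C.Hs m)) = card (curve_components f)"
      using C.dim_Hs_components[OF m(2)] C.components_PF by simp
    moreover have "n < 2 * (d - 1) - 1" using n(2) by auto
    ultimately show ?thesis unfolding n(1) C.card_nodes using milnor[of n] module[of n] by simp
  qed
  have part3: "jacobian_module_dim f k = 0"
    if rat: "\<forall>C\<in>curve_components f. rational_curve C" and k: "k \<le> int d - 3" for k
  proof (cases "k < 0")
    case False
    define n where "n = nat k"
    have n: "k = int n" "n + 3 \<le> d" using False k unfolding n_def by auto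
    have "C.Ivan n \<subseteq> {0}" using C.rational_Ivan[of n] rat n(2) by blast
    then have "C.Ivan n = {0}" using P3.subspace_0[OF C.Ivan_subspace(1)[of n]] by blast
    then show ?thesis unfolding n(1) C.jacobian_module_dim_forms(1) by (simp add: C.dim_zero_set)
  next
    case True
    then have z: "graded_piece k = {0}" using graded_nonneg[of _ k] by force
    have zero: "(0 :: poly3) \<in> jacobian_ideal f" using C.J_0 unfolding C.J_jacobian_ideal .
    then have "0 \<in> saturation (jacobian_ideal f)" unfolding saturation_def by simp
    then have e: "saturation (jacobian_ideal f) \<inter> graded_piece k = {0}" "jacobian_ideal f \<inter> graded_piece k = {0}"
      using z zero by auto
    have "P3.fin_dim {0}" using P3.fin_dim_span[of "{}"] P3.span_empty by simp
    then show ?thesis unfolding jacobian_module_dim_def e using quotient_dim_eq[OF _ P3.subspace_single_0 subset_refl] by simp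
  qed
  show ?thesis using part1 part2 part3 by blast
qed

end
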